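(* Let $k$ be a field, let $m\ge2$ and $E\in\mathrm{GL}_m(k)$. Let $$\overline X_0(E)=\{F\in\mathrm{GL}_n(k),\ n\ge2\ |\ \mathrm{tr}(E)=\mathrm{tr}(F),\ \mathrm{tr}(E^{-1})=\mathrm{tr}(F^{-1})\}$$ and let $\approx$ be the equivalence relation on $\overline X_0(E)$ defined, for $F\in\mathrm{GL}_n(k)$ and $G\in\mathrm{GL}_p(k)$ in $\overline X_0(E)$, by $F\approx G$ if and only if $n=p$ and there exists $P\in\mathrm{GL}_n(k)$ with $F=PGP^{-1}$. Put $\overline X(E)=\overline X_0(E)/\approx$. Then the map $$\overline X_0(E)\to\mathrm{Gal}(\mathcal H(E)),\quad F\mapsto[\mathcal H(E,F)]$$ induces a bijection $\overline X(E)\simeq\mathrm{Gal}(\mathcal H(E))$.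
   Context: For $E\in\mathrm{GL}_m(k)$ and $F\in\mathrm{GL}_n(k)$, $\mathcal H(E,F)$ is the $k$-algebra presented by generators $u_{ij},v_{ij}$, $1\le i\le m$, $1\le j\le n$, with relations $uv^t=I_m=vFu^tE^{-1}$ and $v^tu=I_n=Fu^tE^{-1}v$, where $u=(u_{ij})$, $v=(v_{ij})$ and $t$ denotes transpose. $\mathcal H(E)=\mathcal H(E,E)$ is a Hopf algebra with $\Delta(u_{ij})=\sum_k u_{ik}\otimes u_{kj}$, $\Delta(v_{ij})=\sum_k v_{ik}\otimes v_{kj}$, $\varepsilon(u_{ij})=\varepsilon(v_{ij})=\delta_{ij}$, $S(u)=v^t$, $S(v)=Eu^tE^{-1}$. $\mathcal H(E,F)$ is a left $\mathcal H(E)$-comodule algebra with coaction $u_{ij}\mapsto\sum_{k=1}^m u_{ik}\otimes u_{kj}$, $v_{ij}\mapsto\sum_{k=1}^m v_{ik}\otimes v_{kj}$, and it is a left $\mathcal H(E)$-Galois object whenever $F\in\overline X_0(E)$. For a Hopf algebra $H$, a left $H$-Galois object is a left $H$-comodule algebra $A\neq(0)$ with coaction $\alpha:A\to H\otimes A$ such that $(1_H\otimes m_A)(\alpha\otimes 1_A):A\otimes A\to H\otimes A$ is bijective ($m_A$ is the multiplication of $A$). $\mathrm{Gal}(\mathcal H(E))$ is the set of isomorphism classes of left $\mathcal H(E)$-Galois objects, isomorphisms being left colinear algebra isomorphisms; $[A]$ is the class of $A$. *)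

theory Defs
  imports
    "HOL-Algebra.QuotRing"
    "HOL-Algebra.Group"
    "Jordan_Normal_Form.Gauss_Jordan_Elimination"
    "Jordan_Normal_Form.VS_Connect"
begin

section \<open>Matrices over the base field\<close>

definition GL :: "nat \<Rightarrow> 'k::field mat set" where
  "GL n = {A \<in> carrier_mat n n. invertible_mat A}"

definition mat_inv :: "'k::field mat \<Rightarrow> 'k mat" where
  "mat_inv A = the (mat_inverse A)"

definition mat_trace :: "'k::field mat \<Rightarrow> 'k" where
  "mat_trace A = (\<Sum>i<dim_row A. A $$ (i, i))"


section \<open>Algebras over a field\<close>

text \<open>The base field is a type of class \<^class>\<open>field\<close>, seen as the HOL-Algebra ring
  \<^term>\<open>class_ring\<close>. Algebras use the \<^type>\<open>module\<close> records of HOL-Algebra, whose fields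
  already include a multiplication and a unit; the locale \<^locale>\<open>algebra\<close> of HOL-Algebra does
  not apply, because it is restricted to commutative algebras.\<close>

definition kalgebra :: "('k::field, 'a, 'z) module_scheme \<Rightarrow> bool" where
  "kalgebra A \<longleftrightarrow> ring A \<and> Module.module class_ring A \<and>
     (\<forall>c. \<forall>x\<in>carrier A. \<forall>y\<in>carrier A.
        (c \<odot>\<^bsub>A\<^esub> x) \<otimes>\<^bsub>A\<^esub> y = c \<odot>\<^bsub>A\<^esub> (x \<otimes>\<^bsub>A\<^esub> y) \<and>
        x \<otimes>\<^bsub>A\<^esub> (c \<odot>\<^bsub>A\<^esub> y) = c \<odot>\<^bsub>A\<^esub> (x \<otimes>\<^bsub>A\<^esub> y))"

definition lin_hom ::
    "('k::field, 'a, 'y) module_scheme \<Rightarrow> ('k, 'b, 'z) module_scheme \<Rightarrow> ('a \<Rightarrow> 'b) set" where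
  "lin_hom A B = {f \<in> carrier A \<rightarrow> carrier B.
     (\<forall>x\<in>carrier A. \<forall>y\<in>carrier A. f (x \<oplus>\<^bsub>A\<^esub> y) = f x \<oplus>\<^bsub>B\<^esub> f y) \<and>
     (\<forall>c. \<forall>x\<in>carrier A. f (c \<odot>\<^bsub>A\<^esub> x) = c \<odot>\<^bsub>B\<^esub> f x)}"

definition alg_hom ::
    "('k::field, 'a, 'y) module_scheme \<Rightarrow> ('k, 'b, 'z) module_scheme \<Rightarrow> ('a \<Rightarrow> 'b) set" where
  "alg_hom A B = Ring.ring_hom A B \<inter> lin_hom A B"

definition base_alg :: "('k::field, 'k) module" where
  "base_alg = \<lparr>carrier = UNIV, mult = (*), one = 1, zero = 0, add = (+), smult = (*)\<rparr>"

definition op_alg :: "('k::field, 'a, 'z) module_scheme \<Rightarrow> ('k, 'a, 'z) module_scheme" where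
  "op_alg A = A\<lparr>mult := (\<lambda>x y. y \<otimes>\<^bsub>A\<^esub> x)\<rparr>"

definition quot_alg :: "('k::field, 'a, 'z) module_scheme \<Rightarrow> 'a set \<Rightarrow> ('k, 'a set) module" where
  "quot_alg A I =
     \<lparr>carrier = carrier (A Quot I), mult = mult (A Quot I), one = one (A Quot I),
      zero = zero (A Quot I), add = add (A Quot I),
      smult = (\<lambda>c X. \<Union>x\<in>X. I +>\<^bsub>A\<^esub> (c \<odot>\<^bsub>A\<^esub> x))\<rparr>"

definition supp :: "('s \<Rightarrow> 'k::field) \<Rightarrow> 's set" where
  "supp f = {s. f s \<noteq> 0}"

definition delta :: "'s \<Rightarrow> 's \<Rightarrow> 'k::field" where
  "delta s = (\<lambda>t. if t = s then 1 else 0)"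

definition monoid_alg :: "('s, 'z) monoid_scheme \<Rightarrow> ('k::field, 's \<Rightarrow> 'k) module" where
  "monoid_alg M =
     \<lparr>carrier = {f. finite (supp f) \<and> supp f \<subseteq> carrier M},
      mult = (\<lambda>f g t. \<Sum>(r, s)\<in>supp f \<times> supp g. if r \<otimes>\<^bsub>M\<^esub> s = t then f r * g s else 0),
      one = delta \<one>\<^bsub>M\<^esub>,
      zero = (\<lambda>t. 0),
      add = (\<lambda>f g t. f t + g t),
      smult = (\<lambda>c f t. c * f t)\<rparr>"

definition lin_ext :: "('k::field, 'a, 'z) module_scheme \<Rightarrow> ('s \<Rightarrow> 'a) \<Rightarrow> ('s \<Rightarrow> 'k) \<Rightarrow> 'a" where
  "lin_ext A b f = (\<Oplus>\<^bsub>A\<^esub>s\<in>supp f. f s \<odot>\<^bsub>A\<^esub> b s)"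

text \<open>The map that \<^term>\<open>lin_ext A b\<close> induces on a quotient. It is meaningful when the relations
  are sent to zero, so that the choice of a representative is irrelevant.\<close>

definition quot_ext ::
    "('k::field, 'a, 'z) module_scheme \<Rightarrow> ('s \<Rightarrow> 'a) \<Rightarrow> ('s \<Rightarrow> 'k) set \<Rightarrow> 'a" where
  "quot_ext A b X = lin_ext A b (SOME f. f \<in> X)"


section \<open>Tensor products\<close>

text \<open>The tensor product of two algebras over \<open>k\<close> is the free vector space on pairs modulo the
  bilinearity relations. The free vector space is taken with its monoid algebra structure for the
  product monoid: the span of the bilinearity relations is then a two-sided ideal, hence is the
  ideal they generate, and the quotient carries
  the product \<open>(a \<otimes> b)(a' \<otimes> b') = aa' \<otimes> bb'\<close>.\<close>

type_synonym ('a, 'b, 'k) tens = "('a \<times> 'b \<Rightarrow> 'k) set"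

definition pair_alg ::
    "('k::field, 'a, 'y) module_scheme \<Rightarrow> ('k, 'b, 'z) module_scheme \<Rightarrow>
     ('k, 'a \<times> 'b \<Rightarrow> 'k) module" where
  "pair_alg A B = monoid_alg (A \<times>\<times> B)"

definition bilin_rels ::
    "('k::field, 'a, 'y) module_scheme \<Rightarrow> ('k, 'b, 'z) module_scheme \<Rightarrow> ('a \<times> 'b \<Rightarrow> 'k) set" where
  "bilin_rels A B = (let P = pair_alg A B in
     {delta (a \<oplus>\<^bsub>A\<^esub> a', b) \<ominus>\<^bsub>P\<^esub> (delta (a, b) \<oplus>\<^bsub>P\<^esub> delta (a', b)) | a a' b.
        a \<in> carrier A \<and> a' \<in> carrier A \<and> b \<in> carrier B} \<union>
     {delta (a, b \<oplus>\<^bsub>B\<^esub> b') \<ominus>\<^bsub>P\<^esub> (delta (a, b) \<oplus>\<^bsub>P\<^esub> delta (a, b')) | a b b'.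
        a \<in> carrier A \<and> b \<in> carrier B \<and> b' \<in> carrier B} \<union>
     {delta (c \<odot>\<^bsub>A\<^esub> a, b) \<ominus>\<^bsub>P\<^esub> (c \<odot>\<^bsub>P\<^esub> delta (a, b)) | c a b.
        a \<in> carrier A \<and> b \<in> carrier B} \<union>
     {delta (a, c \<odot>\<^bsub>B\<^esub> b) \<ominus>\<^bsub>P\<^esub> (c \<odot>\<^bsub>P\<^esub> delta (a, b)) | c a b.
        a \<in> carrier A \<and> b \<in> carrier B})"

definition bilin_ideal ::
    "('k::field, 'a, 'y) module_scheme \<Rightarrow> ('k, 'b, 'z) module_scheme \<Rightarrow> ('a \<times> 'b \<Rightarrow> 'k) set" where
  "bilin_ideal A B = Idl\<^bsub>pair_alg A B\<^esub> (bilin_rels A B)"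

definition tensor ::
    "('k::field, 'a, 'y) module_scheme \<Rightarrow> ('k, 'b, 'z) module_scheme \<Rightarrow>
     ('k, ('a, 'b, 'k) tens) module" where
  "tensor A B = quot_alg (pair_alg A B) (bilin_ideal A B)"

definition pure_tensor ::
    "('k::field, 'a, 'y) module_scheme \<Rightarrow> ('k, 'b, 'z) module_scheme \<Rightarrow> 'a \<Rightarrow> 'b \<Rightarrow>
     ('a, 'b, 'k) tens" where
  "pure_tensor A B a b = bilin_ideal A B +>\<^bsub>pair_alg A B\<^esub> delta (a, b)"

definition tensor_lift ::
    "('k::field, 'c, 'z) module_scheme \<Rightarrow> ('a \<Rightarrow> 'b \<Rightarrow> 'c) \<Rightarrow> ('a, 'b, 'k) tens \<Rightarrow> 'c" where
  "tensor_lift C b = quot_ext C (\<lambda>(x, y). b x y)"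

text \<open>The tensor product \<open>f \<otimes> g\<close> of linear maps with codomains \<open>C\<close> and \<open>D\<close>.\<close>

definition tensor_map ::
    "('k::field, 'c, 'y) module_scheme \<Rightarrow> ('k, 'd, 'z) module_scheme \<Rightarrow>
     ('a \<Rightarrow> 'c) \<Rightarrow> ('b \<Rightarrow> 'd) \<Rightarrow> ('a, 'b, 'k) tens \<Rightarrow> ('c, 'd, 'k) tens" where
  "tensor_map C D f g = tensor_lift (tensor C D) (\<lambda>x y. pure_tensor C D (f x) (g y))"

text \<open>The canonical isomorphism \<open>(A \<otimes> B) \<otimes> C \<rightarrow> A \<otimes> (B \<otimes> C)\<close>.\<close>

definition tensor_assoc ::
    "('k::field, 'a, 'x) module_scheme \<Rightarrow> ('k, 'b, 'y) module_scheme \<Rightarrow> ('k, 'c, 'z) module_scheme \<Rightarrow>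
     (('a, 'b, 'k) tens, 'c, 'k) tens \<Rightarrow> ('a, ('b, 'c, 'k) tens, 'k) tens" where
  "tensor_assoc A B C =
     tensor_lift (tensor A (tensor B C))
       (\<lambda>X z. tensor_lift (tensor A (tensor B C))
          (\<lambda>x y. pure_tensor A (tensor B C) x (pure_tensor B C y z)) X)"


section \<open>Hopf algebras, comodule algebras and Galois objects\<close>

record ('k, 'h) hopf = "('k, 'h) module" +
  comult :: "'h \<Rightarrow> ('h, 'h, 'k) tens"
  counit :: "'h \<Rightarrow> 'k"
  antipode :: "'h \<Rightarrow> 'h"

definition hopf_algebra :: "('k::field, 'h, 'z) hopf_scheme \<Rightarrow> bool" where
  "hopf_algebra H \<longleftrightarrow> kalgebra H \<and>
     comult H \<in> alg_hom H (tensor H H) \<and>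
     counit H \<in> alg_hom H base_alg \<and>
     antipode H \<in> lin_hom H H \<and>
     (\<forall>x\<in>carrier H.
        tensor_assoc H H H (tensor_map (tensor H H) H (comult H) id (comult H x)) =
          tensor_map H (tensor H H) id (comult H) (comult H x) \<and>
        tensor_lift H (\<lambda>y z. counit H y \<odot>\<^bsub>H\<^esub> z) (comult H x) = x \<and>
        tensor_lift H (\<lambda>y z. counit H z \<odot>\<^bsub>H\<^esub> y) (comult H x) = x \<and>
        tensor_lift H (\<lambda>y z. antipode H y \<otimes>\<^bsub>H\<^esub> z) (comult H x) = counit H x \<odot>\<^bsub>H\<^esub> \<one>\<^bsub>H\<^esub> \<and>
        tensor_lift H (\<lambda>y z. y \<otimes>\<^bsub>H\<^esub> antipode H z) (comult H x) = counit H x \<odot>\<^bsub>H\<^esub> \<one>\<^bsub>H\<^esub>)"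

record ('k, 'a, 'h) comod_alg = "('k, 'a) module" +
  coaction :: "'a \<Rightarrow> ('h, 'a, 'k) tens"

definition left_comodule_algebra ::
    "('k::field, 'h, 'y) hopf_scheme \<Rightarrow> ('k, 'a, 'h, 'z) comod_alg_scheme \<Rightarrow> bool" where
  "left_comodule_algebra H A \<longleftrightarrow> kalgebra A \<and>
     coaction A \<in> alg_hom A (tensor H A) \<and>
     (\<forall>x\<in>carrier A.
        tensor_assoc H H A (tensor_map (tensor H H) A (comult H) id (coaction A x)) =
          tensor_map H (tensor H A) id (coaction A) (coaction A x) \<and>
        tensor_lift A (\<lambda>h a. counit H h \<odot>\<^bsub>A\<^esub> a) (coaction A x) = x)"

definition galois_map ::
    "('k::field, 'h, 'y) hopf_scheme \<Rightarrow> ('k, 'a, 'h, 'z) comod_alg_scheme \<Rightarrow>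
     ('a, 'a, 'k) tens \<Rightarrow> ('h, 'a, 'k) tens" where
  "galois_map H A =
     tensor_map H A id (tensor_lift A (\<lambda>a b. a \<otimes>\<^bsub>A\<^esub> b)) \<circ>
     tensor_assoc H A A \<circ>
     tensor_map (tensor H A) A (coaction A) id"

definition galois_object ::
    "('k::field, 'h, 'y) hopf_scheme \<Rightarrow> ('k, 'a, 'h, 'z) comod_alg_scheme \<Rightarrow> bool" where
  "galois_object H A \<longleftrightarrow> hopf_algebra H \<and> left_comodule_algebra H A \<and>
     carrier A \<noteq> {\<zero>\<^bsub>A\<^esub>} \<and>
     bij_betw (galois_map H A) (carrier (tensor A A)) (carrier (tensor H A))"

definition comod_alg_iso ::
    "('k::field, 'h, 'x) hopf_scheme \<Rightarrow> ('k, 'a, 'h, 'y) comod_alg_scheme \<Rightarrow>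
     ('k, 'b, 'h, 'z) comod_alg_scheme \<Rightarrow> bool" where
  "comod_alg_iso H A B \<longleftrightarrow>
     (\<exists>f \<in> alg_hom A B. bij_betw f (carrier A) (carrier B) \<and>
        (\<forall>x\<in>carrier A. coaction B (f x) = tensor_map H B id f (coaction A x)))"

text \<open>Isomorphism classes are formed inside a universe: the Galois objects whose carrier is a set
  of elements of a type \<open>'u\<close>. The representative \<open>A\<close> itself may live on another type, so that
  \<open>[A]\<close> makes sense in any universe with room for a copy of \<open>A\<close> (and is empty otherwise).
  A statement about \<open>Gal\<close> covers all Galois objects when it holds for every sufficiently large
  type \<open>'u\<close>.\<close>

definition gal_class ::
    "('k::field, 'h, 'y) hopf_scheme \<Rightarrow> ('k, 'a, 'h, 'z) comod_alg_scheme \<Rightarrow>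
     ('k, 'u, 'h) comod_alg set" where
  "gal_class H A = {B. galois_object H B \<and> comod_alg_iso H A B}"

definition Gal :: "('k::field, 'h, 'y) hopf_scheme \<Rightarrow> ('k, 'u, 'h) comod_alg set set" where
  "Gal H = {gal_class H A | A :: ('k, 'u, 'h) comod_alg. galois_object H A}"


section \<open>Algebras given by generators and relations\<close>

definition free_monoid :: "'g set \<Rightarrow> 'g list monoid" where
  "free_monoid S = \<lparr>carrier = lists S, mult = (@), one = []\<rparr>"

definition free_alg :: "'g set \<Rightarrow> ('k::field, 'g list \<Rightarrow> 'k) module" where
  "free_alg S = monoid_alg (free_monoid S)"

definition pres_alg ::
    "'g set \<Rightarrow> ('g list \<Rightarrow> 'k::field) set \<Rightarrow> ('k, ('g list \<Rightarrow> 'k) set) module" where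
  "pres_alg S R = quot_alg (free_alg S) (Idl\<^bsub>free_alg S\<^esub> R)"

definition pres_gen ::
    "'g set \<Rightarrow> ('g list \<Rightarrow> 'k::field) set \<Rightarrow> 'g \<Rightarrow> ('g list \<Rightarrow> 'k) set" where
  "pres_gen S R x = (Idl\<^bsub>free_alg S\<^esub> R) +>\<^bsub>free_alg S\<^esub> delta [x]"

text \<open>The algebra map into \<open>B\<close> sending each generator \<open>x\<close> to \<open>g x\<close>.\<close>

definition pres_lift ::
    "('k::field, 'b, 'z) module_scheme \<Rightarrow> ('g \<Rightarrow> 'b) \<Rightarrow> ('g list \<Rightarrow> 'k) set \<Rightarrow> 'b" where
  "pres_lift B g = quot_ext B (\<lambda>w. foldr (\<lambda>x y. g x \<otimes>\<^bsub>B\<^esub> y) w \<one>\<^bsub>B\<^esub>)"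

text \<open>Matrices with entries in an algebra are functions of two indices, counted from \<open>0\<close>; the
  sizes are passed to the operations that need them, \<open>p\<close> below being the inner dimension.\<close>

definition amat_mult ::
    "('k::field, 'a, 'z) module_scheme \<Rightarrow> nat \<Rightarrow> (nat \<Rightarrow> nat \<Rightarrow> 'a) \<Rightarrow> (nat \<Rightarrow> nat \<Rightarrow> 'a) \<Rightarrow>
     nat \<Rightarrow> nat \<Rightarrow> 'a" where
  "amat_mult A p X Y = (\<lambda>i j. \<Oplus>\<^bsub>A\<^esub>l\<in>{..<p}. X i l \<otimes>\<^bsub>A\<^esub> Y l j)"

definition amat_transpose :: "(nat \<Rightarrow> nat \<Rightarrow> 'a) \<Rightarrow> nat \<Rightarrow> nat \<Rightarrow> 'a" where
  "amat_transpose X = (\<lambda>i j. X j i)"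

definition amat_scalar :: "('k::field, 'a, 'z) module_scheme \<Rightarrow> 'k mat \<Rightarrow> nat \<Rightarrow> nat \<Rightarrow> 'a" where
  "amat_scalar A M = (\<lambda>i j. (M $$ (i, j)) \<odot>\<^bsub>A\<^esub> \<one>\<^bsub>A\<^esub>)"

text \<open>The relators expressing that the \<open>n \<times> n\<close> matrix \<open>X\<close> is the identity matrix.\<close>

definition amat_one_rels ::
    "('k::field, 'a, 'z) module_scheme \<Rightarrow> nat \<Rightarrow> (nat \<Rightarrow> nat \<Rightarrow> 'a) \<Rightarrow> 'a set" where
  "amat_one_rels A n X =
     {X i j \<ominus>\<^bsub>A\<^esub> amat_scalar A (1\<^sub>m n) i j | i j. i < n \<and> j < n}"


section \<open>The algebras \<open>H(E,F)\<close>\<close>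

datatype hgen = U nat nat | V nat nat

type_synonym 'k hel = "(hgen list \<Rightarrow> 'k) set"

definition hgens :: "nat \<Rightarrow> nat \<Rightarrow> hgen set" where
  "hgens m n = {U i j | i j. i < m \<and> j < n} \<union> {V i j | i j. i < m \<and> j < n}"

definition hrels :: "'k::field mat \<Rightarrow> 'k mat \<Rightarrow> (hgen list \<Rightarrow> 'k) set" where
  "hrels E F =
    (let m = dim_row E; n = dim_row F; A = free_alg (hgens m n);
         u = (\<lambda>i j. delta [U i j]); v = (\<lambda>i j. delta [V i j]);
         ut = amat_transpose u; vt = amat_transpose v;
         Fm = amat_scalar A F; Ei = amat_scalar A (mat_inv E)
     in amat_one_rels A m (amat_mult A n u vt) \<union>
        amat_one_rels A m (amat_mult A m (amat_mult A n (amat_mult A n v Fm) ut) Ei) \<union>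
        amat_one_rels A n (amat_mult A m vt u) \<union>
        amat_one_rels A n (amat_mult A m (amat_mult A m (amat_mult A n Fm ut) Ei) v))"

definition H_alg :: "'k::field mat \<Rightarrow> 'k mat \<Rightarrow> ('k, 'k hel) module" where
  "H_alg E F = pres_alg (hgens (dim_row E) (dim_row F)) (hrels E F)"

definition H_u :: "'k::field mat \<Rightarrow> 'k mat \<Rightarrow> nat \<Rightarrow> nat \<Rightarrow> 'k hel" where
  "H_u E F i j = pres_gen (hgens (dim_row E) (dim_row F)) (hrels E F) (U i j)"

definition H_v :: "'k::field mat \<Rightarrow> 'k mat \<Rightarrow> nat \<Rightarrow> nat \<Rightarrow> 'k hel" where
  "H_v E F i j = pres_gen (hgens (dim_row E) (dim_row F)) (hrels E F) (V i j)"

text \<open>The algebra map \<open>H(E,F) \<rightarrow> H(E) \<otimes> H(E,F)\<close>; it is the comultiplication when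
  \<open>F = E\<close>.\<close>

definition H_coact :: "'k::field mat \<Rightarrow> 'k mat \<Rightarrow> 'k hel \<Rightarrow> ('k hel, 'k hel, 'k) tens" where
  "H_coact E F =
    (let T = tensor (H_alg E E) (H_alg E F); p = pure_tensor (H_alg E E) (H_alg E F)
     in pres_lift T (\<lambda>x. case x of
          U i j \<Rightarrow> \<Oplus>\<^bsub>T\<^esub>l\<in>{..<dim_row E}. p (H_u E E i l) (H_u E F l j)
        | V i j \<Rightarrow> \<Oplus>\<^bsub>T\<^esub>l\<in>{..<dim_row E}. p (H_v E E i l) (H_v E F l j)))"

definition H_counit :: "'k::field mat \<Rightarrow> 'k hel \<Rightarrow> 'k" where
  "H_counit E = pres_lift base_alg (\<lambda>x. case x of
       U i j \<Rightarrow> (if i = j then 1 else 0)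
     | V i j \<Rightarrow> (if i = j then 1 else 0))"

text \<open>The antipode is an anti-homomorphism, that is, an algebra map into the opposite algebra;
  the product \<open>E u\<^sup>t E\<^sup>-\<^sup>1\<close> is taken in \<open>H(E)\<close> itself.\<close>

definition H_antipode :: "'k::field mat \<Rightarrow> 'k hel \<Rightarrow> 'k hel" where
  "H_antipode E =
    (let A = H_alg E E; m = dim_row E
     in pres_lift (op_alg A) (\<lambda>x. case x of
          U i j \<Rightarrow> amat_transpose (H_v E E) i j
        | V i j \<Rightarrow> amat_mult A m (amat_mult A m (amat_scalar A E) (amat_transpose (H_u E E)))
                     (amat_scalar A (mat_inv E)) i j))"

definition H_hopf :: "'k::field mat \<Rightarrow> ('k, 'k hel) hopf" where
  "H_hopf E = (let A = H_alg E E in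
     \<lparr>carrier = carrier A, mult = mult A, one = one A, zero = zero A, add = add A,
      smult = module.smult A,
      comult = H_coact E E, counit = H_counit E, antipode = H_antipode E\<rparr>)"

definition H_comod_alg :: "'k::field mat \<Rightarrow> 'k mat \<Rightarrow> ('k, 'k hel, 'k hel) comod_alg" where
  "H_comod_alg E F = (let A = H_alg E F in
     \<lparr>carrier = carrier A, mult = mult A, one = one A, zero = zero A, add = add A,
      smult = module.smult A, coaction = H_coact E F\<rparr>)"


section \<open>The parameter set\<close>

definition X0 :: "'k::field mat \<Rightarrow> 'k mat set" where
  "X0 E = {F. \<exists>n\<ge>2. F \<in> GL n \<and> mat_trace E = mat_trace F \<and>
                   mat_trace (mat_inv E) = mat_trace (mat_inv F)}"

definition X0_rel :: "'k::field mat \<Rightarrow> ('k mat \<times> 'k mat) set" where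
  "X0_rel E = {(F, G). F \<in> X0 E \<and> G \<in> X0 E \<and>
     (\<exists>n. F \<in> GL n \<and> G \<in> GL n \<and> (\<exists>P\<in>GL n. F = P * G * mat_inv P))}"

definition X_quot :: "'k::field mat \<Rightarrow> 'k mat set set" where
  "X_quot E = X0 E // X0_rel E"

end

theory Submission
  imports Defs "HOL-Algebra.Algebraic_Closure_Type" "Jordan_Normal_Form.Char_Poly" "HOL-Library.Function_Algebras"
begin

text \<open>
  Two things have to be shown: \<open>H(E,F)\<close> is a Galois object for every \<open>F\<close> in the parameter set, and every
  Galois object is one of these, with \<open>F\<close> unique up to conjugation.

  Algebra maps out of \<open>H(E,F)\<close> are pairs of matrices \<open>(u, v)\<close> satisfying the relations (\<open>hmats\<close>). Such pairs
  can be multiplied: commuting pairs for \<open>(E,G)\<close> and \<open>(G,F)\<close> give one for \<open>(E,F)\<close>. They can also be inverted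
  over the opposite algebra. The coactions, the comultiplication and the antipode are instances of this,
  and so is the translation map \<open>\<kappa> : H(E) \<rightarrow> H(E,F) \<otimes> H(E,F)\<^sup>o\<^sup>p\<close>, from which the inverse of the Galois
  map is built. What remains is \<open>H(E,F) \<noteq> 0\<close> (\<open>H_nonzero\<close>). After extending scalars to the algebraic closure
  and conjugating, the last rows of \<open>E\<^sup>-\<^sup>1\<close> and of \<open>F\<close> vanish off the diagonal. The relations are then
  a rewriting system on words whose overlaps all resolve, so that there is a linear functional on words that
  kills the relations in every context and has the value \<open>1\<close> at the empty word. The trace conditions are what
  makes two of the relators follow from the others.

  For the classification let \<open>A\<close> be a Galois object of \<open>H(E)\<close>. Consider the vectors \<open>w\<close> over \<open>A\<close> with
  \<open>\<alpha>(w\<^sub>i) = \<Sum>\<^sub>k u\<^sub>i\<^sub>k \<otimes> w\<^sub>k\<close>, and likewise those that transform by \<open>v\<close>. Applying functionals to the second leg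
  of the translation map of \<open>A\<close> produces enough of them: there are a matrix \<open>c\<close> with such columns and a matrix
  \<open>y\<close> over \<open>A\<close> with \<open>c y = 1\<close> (\<open>resolution_exists\<close>). Products of a vector of one type with a vector of the
  other type are coinvariant, hence scalars. Comparing the Gram matrices of two resolutions of least size
  shows that both types of vectors have the same dimension \<open>n\<close> and that the Gram matrices are invertible; dual
  bases give \<open>u\<close>, \<open>v\<close> and \<open>F\<close> with the relations of \<open>H(E,F)\<close> (\<open>covariant_representation\<close>). The relations force
  the trace conditions, and \<open>n \<ge> 2\<close>. The resulting colinear algebra map \<open>H(E,F) \<rightarrow> A\<close> is bijective, as is every
  colinear algebra map between Galois objects (\<open>colinear_bij\<close>). Two choices of \<open>(u, v)\<close> in the same \<open>A\<close> differ
  by a scalar base change, which is the conjugacy of the two matrices \<open>F\<close> (\<open>representations_conjugate\<close>).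
\<close>

no_notation fls_nth (infixl "$$" 75)
no_notation var ("X\<index>")
hide_const (open) Polynomial.smult Multiset.mult

text \<open>A structure that is a single letter is written as a plain subscript of its operations.\<close>

syntax "_index" :: "logic \<Rightarrow> index" ("\<^sub>_" [1000])

section \<open>Algebras and linear maps\<close>

locale kalg =
  fixes A :: "('k::field, 'a, 'z) module_scheme" (structure)
  assumes kalgebra: "kalgebra A"

sublocale kalg \<subseteq> ring A
  using kalgebra by (simp add: kalgebra_def)

context kalg
begin

lemma module: "Module.module class_ring A"
  using kalgebra by (simp add: kalgebra_def)

lemma smult_closed [simp]: "x \<in> carrier A \<Longrightarrow> c \<odot> x \<in> carrier A"
  using Module.module.smult_closed[OF module, of c x] by simp

lemma smult_add_left: "x \<in> carrier A \<Longrightarrow> (c + d) \<odot> x = c \<odot> x \<oplus> d \<odot> x"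
  using Module.module.smult_l_distr[OF module, of c d x] by simp

lemma smult_add_right: "x \<in> carrier A \<Longrightarrow> y \<in> carrier A \<Longrightarrow> c \<odot> (x \<oplus> y) = c \<odot> x \<oplus> c \<odot> y"
  using Module.module.smult_r_distr[OF module, of c x y] by simp

lemma smult_smult: "x \<in> carrier A \<Longrightarrow> c \<odot> (d \<odot> x) = (c * d) \<odot> x"
  using Module.module.smult_assoc1[OF module, of c d x] by simp

lemma one_smult [simp]: "x \<in> carrier A \<Longrightarrow> 1 \<odot> x = x"
  using Module.module.smult_one[OF module, of x] by simp

lemma zero_smult [simp]: "x \<in> carrier A \<Longrightarrow> 0 \<odot> x = \<zero>"
proof -
  assume x: "x \<in> carrier A"
  have "0 \<odot> x \<oplus> 0 \<odot> x = 0 \<odot> x" using smult_add_left[OF x, of 0 0] by simp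
  then show ?thesis using x by (metis local.add.l_cancel_one' smult_closed)
qed

lemma smult_zero [simp]: "c \<odot> \<zero> = \<zero>"
  using smult_smult[of \<zero> c 0] by (metis mult_zero_right zero_closed zero_smult)

lemma smult_uminus: "x \<in> carrier A \<Longrightarrow> (-1) \<odot> x = \<ominus> x"
proof -
  assume x: "x \<in> carrier A"
  have "(-1) \<odot> x \<oplus> 1 \<odot> x = \<zero>" using smult_add_left[OF x, of "-1" 1] x by simp
  then show ?thesis using x by (simp add: minus_equality)
qed

lemma mult_smult_left: "x \<in> carrier A \<Longrightarrow> y \<in> carrier A \<Longrightarrow> (c \<odot> x) \<otimes> y = c \<odot> (x \<otimes> y)"
  using kalgebra by (simp add: kalgebra_def)

lemma mult_smult_right: "x \<in> carrier A \<Longrightarrow> y \<in> carrier A \<Longrightarrow> x \<otimes> (c \<odot> y) = c \<odot> (x \<otimes> y)"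
  using kalgebra by (simp add: kalgebra_def)

lemma finsum_smult:
  "g \<in> S \<rightarrow> carrier A \<Longrightarrow> c \<odot> (\<Oplus>i\<in>S. g i) = (\<Oplus>i\<in>S. c \<odot> g i)"
proof (induction S rule: infinite_finite_induct)
  case (insert x F)
  then have "g \<in> F \<rightarrow> carrier A" "g x \<in> carrier A" by auto
  with insert show ?case by (simp add: smult_add_right Pi_def)
qed auto

lemma smult_sum_left:
  "x \<in> carrier A \<Longrightarrow> (\<Sum>i\<in>S. c i) \<odot> x = (\<Oplus>i\<in>S. c i \<odot> x)"
  by (induction S rule: infinite_finite_induct) (auto simp: smult_add_left)

lemma finsum_zero': "(\<And>i. i \<in> S \<Longrightarrow> g i = \<zero>) \<Longrightarrow> (\<Oplus>i\<in>S. g i) = \<zero>"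
  by (rule add.finprod_one_eqI)

lemma finsum_delta:
  assumes "finite S" "i \<in> S" "g i \<in> carrier A" "\<And>j. j \<in> S \<Longrightarrow> j \<noteq> i \<Longrightarrow> g j = \<zero>"
  shows "(\<Oplus>j\<in>S. g j) = g i"
proof -
  have c: "g j \<in> carrier A" if "j \<in> S" for j
    using assms(3) assms(4)[OF that] by (cases "j = i") auto
  have "(\<Oplus>j\<in>S. g j) = (\<Oplus>j\<in>insert i (S - {i}). g j)"
    using assms by (simp add: insert_absorb)
  also have "\<dots> = g i \<oplus> (\<Oplus>j\<in>S - {i}. g j)"
    using assms c by (subst finsum_insert) auto
  also have "(\<Oplus>j\<in>S - {i}. g j) = \<zero>" using assms by (intro finsum_zero') auto
  finally show ?thesis using assms by simp
qed

lemma finsum_swap: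
  assumes "finite S" "finite T" "\<And>i j. i \<in> S \<Longrightarrow> j \<in> T \<Longrightarrow> g i j \<in> carrier A"
  shows "(\<Oplus>i\<in>S. \<Oplus>j\<in>T. g i j) = (\<Oplus>j\<in>T. \<Oplus>i\<in>S. g i j)"
  using assms
proof (induction S rule: finite_induct)
  case empty
  then show ?case by (simp add: finsum_zero')
next
  case (insert x F)
  have "(\<Oplus>i\<in>insert x F. \<Oplus>j\<in>T. g i j) = (\<Oplus>j\<in>T. g x j) \<oplus> (\<Oplus>i\<in>F. \<Oplus>j\<in>T. g i j)"
    using insert by (subst finsum_insert) (auto intro!: finsum_closed)
  also have "\<dots> = (\<Oplus>j\<in>T. g x j) \<oplus> (\<Oplus>j\<in>T. \<Oplus>i\<in>F. g i j)"
    using insert by simp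
  also have "\<dots> = (\<Oplus>j\<in>T. g x j \<oplus> (\<Oplus>i\<in>F. g i j))"
    using insert by (subst finsum_addf) (auto intro!: finsum_closed)
  also have "\<dots> = (\<Oplus>j\<in>T. \<Oplus>i\<in>insert x F. g i j)"
    using insert by (intro finsum_cong') (auto intro!: finsum_closed simp: Pi_def)
  finally show ?case .
qed

end

lemma kalgebraI:
  fixes A (structure)
  assumes "ring A" "\<And>c x. x \<in> carrier A \<Longrightarrow> c \<odot> x \<in> carrier A"
    "\<And>c d x. x \<in> carrier A \<Longrightarrow> (c + d) \<odot> x = c \<odot> x \<oplus> d \<odot> x"
    "\<And>c x y. x \<in> carrier A \<Longrightarrow> y \<in> carrier A \<Longrightarrow> c \<odot> (x \<oplus> y) = c \<odot> x \<oplus> c \<odot> y"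
    "\<And>c d x. x \<in> carrier A \<Longrightarrow> (c * d) \<odot> x = c \<odot> (d \<odot> x)"
    "\<And>x. x \<in> carrier A \<Longrightarrow> 1 \<odot> x = x"
    "\<And>c x y. x \<in> carrier A \<Longrightarrow> y \<in> carrier A \<Longrightarrow> (c \<odot> x) \<otimes> y = c \<odot> (x \<otimes> y)"
    "\<And>c x y. x \<in> carrier A \<Longrightarrow> y \<in> carrier A \<Longrightarrow> x \<otimes> (c \<odot> y) = c \<odot> (x \<otimes> y)"
  shows "kalgebra A"
proof -
  have "abelian_group A" using assms(1) by (simp add: ring_def)
  moreover have "cring (class_ring :: 'b ring)" by (rule class_cring.cring_axioms)
  ultimately show ?thesis
    unfolding kalgebra_def Module.module_def module_axioms_def using assms by auto
qed

lemma lin_homI: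
  assumes "\<And>x. x \<in> carrier A \<Longrightarrow> f x \<in> carrier B"
    "\<And>x y. x \<in> carrier A \<Longrightarrow> y \<in> carrier A \<Longrightarrow> f (x \<oplus>\<^sub>A y) = f x \<oplus>\<^sub>B f y"
    "\<And>c x. x \<in> carrier A \<Longrightarrow> f (c \<odot>\<^sub>A x) = c \<odot>\<^sub>B f x"
  shows "f \<in> lin_hom A B"
  using assms by (auto simp: lin_hom_def)

lemma lin_hom_closed: "f \<in> lin_hom A B \<Longrightarrow> x \<in> carrier A \<Longrightarrow> f x \<in> carrier B"
  by (auto simp: lin_hom_def)

lemma lin_hom_add:
  "f \<in> lin_hom A B \<Longrightarrow> x \<in> carrier A \<Longrightarrow> y \<in> carrier A \<Longrightarrow> f (x \<oplus>\<^sub>A y) = f x \<oplus>\<^sub>B f y"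
  by (auto simp: lin_hom_def)

lemma lin_hom_smult:
  "f \<in> lin_hom A B \<Longrightarrow> x \<in> carrier A \<Longrightarrow> f (c \<odot>\<^sub>A x) = c \<odot>\<^sub>B f x"
  by (auto simp: lin_hom_def)

lemma lin_hom_zero:
  assumes "kalgebra A" "kalgebra B" "f \<in> lin_hom A B"
  shows "f \<zero>\<^sub>A = \<zero>\<^sub>B"
proof -
  interpret A: kalg A by (simp add: kalg_def assms)
  interpret B: kalg B by (simp add: kalg_def assms)
  have "f (0 \<odot>\<^sub>A \<zero>\<^sub>A) = 0 \<odot>\<^sub>B f \<zero>\<^sub>A" using assms(3) by (intro lin_hom_smult) auto
  then show ?thesis using lin_hom_closed[OF assms(3) A.zero_closed] by simp
qed

lemma lin_hom_uminus:
  assumes "kalgebra A" "kalgebra B" "f \<in> lin_hom A B" "x \<in> carrier A"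
  shows "f (\<ominus>\<^sub>A x) = \<ominus>\<^sub>B f x"
proof -
  interpret A: kalg A by (simp add: kalg_def assms)
  interpret B: kalg B by (simp add: kalg_def assms)
  show ?thesis using lin_hom_smult[OF assms(3,4), of "-1"] lin_hom_closed[OF assms(3,4)] assms(4)
    by (simp add: A.smult_uminus B.smult_uminus)
qed

lemma lin_hom_minus:
  assumes "kalgebra A" "kalgebra B" "f \<in> lin_hom A B" "x \<in> carrier A" "y \<in> carrier A"
  shows "f (x \<ominus>\<^sub>A y) = f x \<ominus>\<^sub>B f y"
proof -
  interpret A: kalg A by (simp add: kalg_def assms)
  show ?thesis using assms by (simp add: a_minus_def lin_hom_add lin_hom_uminus)
qed

lemma lin_hom_finsum:
  assumes "kalgebra A" "kalgebra B" "f \<in> lin_hom A B" "\<And>i. i \<in> S \<Longrightarrow> g i \<in> carrier A"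
  shows "f (\<Oplus>\<^sub>A i\<in>S. g i) = (\<Oplus>\<^sub>B i\<in>S. f (g i))"
proof -
  interpret A: kalg A by (simp add: kalg_def assms)
  interpret B: kalg B by (simp add: kalg_def assms)
  show ?thesis using assms(4)
  proof (induction S rule: infinite_finite_induct)
    case (insert x F)
    have "f (\<Oplus>\<^sub>A i\<in>insert x F. g i) = f (g x \<oplus>\<^sub>A (\<Oplus>\<^sub>A i\<in>F. g i))"
      using insert by (subst A.finsum_insert) auto
    also have "\<dots> = f (g x) \<oplus>\<^sub>B (\<Oplus>\<^sub>B i\<in>F. f (g i))"
      using insert by (subst lin_hom_add[OF assms(3)]) (auto intro!: A.finsum_closed)
    also have "\<dots> = (\<Oplus>\<^sub>B i\<in>insert x F. f (g i))"
      using insert lin_hom_closed[OF assms(3)] by (subst B.finsum_insert) auto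
    finally show ?case .
  qed (simp_all add: lin_hom_zero[OF assms(1-3)])
qed

lemma lin_hom_comp: "f \<in> lin_hom A B \<Longrightarrow> g \<in> lin_hom B C \<Longrightarrow> (\<lambda>x. g (f x)) \<in> lin_hom A C"
  by (auto simp: lin_hom_def Pi_iff)

lemma lin_hom_id: "(\<lambda>x. x) \<in> lin_hom A A" "id \<in> lin_hom A A"
  by (auto simp: lin_hom_def)

lemma alg_homI:
  assumes "f \<in> lin_hom A B"
    "\<And>x y. x \<in> carrier A \<Longrightarrow> y \<in> carrier A \<Longrightarrow> f (x \<otimes>\<^sub>A y) = f x \<otimes>\<^sub>B f y"
    "f \<one>\<^sub>A = \<one>\<^sub>B"
  shows "f \<in> alg_hom A B"
  using assms by (auto simp: alg_hom_def Ring.ring_hom_def lin_hom_def)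

lemma alg_hom_lin: "f \<in> alg_hom A B \<Longrightarrow> f \<in> lin_hom A B"
  by (simp add: alg_hom_def)

lemma alg_hom_closed: "f \<in> alg_hom A B \<Longrightarrow> x \<in> carrier A \<Longrightarrow> f x \<in> carrier B"
  by (auto simp: alg_hom_def lin_hom_def)

lemma alg_hom_mult:
  "f \<in> alg_hom A B \<Longrightarrow> x \<in> carrier A \<Longrightarrow> y \<in> carrier A \<Longrightarrow> f (x \<otimes>\<^sub>A y) = f x \<otimes>\<^sub>B f y"
  by (simp add: alg_hom_def Ring.ring_hom_def)

lemma alg_hom_one: "f \<in> alg_hom A B \<Longrightarrow> f \<one>\<^sub>A = \<one>\<^sub>B"
  by (simp add: alg_hom_def Ring.ring_hom_def)

lemma alg_hom_comp: "f \<in> alg_hom A B \<Longrightarrow> g \<in> alg_hom B C \<Longrightarrow> (\<lambda>x. g (f x)) \<in> alg_hom A C"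
  by (auto simp: alg_hom_def lin_hom_def Ring.ring_hom_def Pi_iff)

lemma alg_hom_id: "(\<lambda>x. x) \<in> alg_hom A A"
  by (auto simp: alg_hom_def lin_hom_def Ring.ring_hom_def)

lemma kalgebra_base_alg: "kalgebra (base_alg :: ('k::field, 'k) module)"
proof -
  have r: "ring (base_alg :: ('k::field, 'k) module)"
    by (rule ringI; (rule abelian_groupI monoid.intro)?)
      (auto simp: base_alg_def algebra_simps intro: exI[of _ "- x" for x] ab_left_minus)
  show ?thesis by (rule kalgebraI[OF r]) (auto simp: base_alg_def algebra_simps)
qed

lemma kalgebra_op_alg:
  assumes "kalgebra A" shows "kalgebra (op_alg A)"
proof -
  interpret A: kalg A by (simp add: kalg_def assms)
  have r: "ring (op_alg A)"
    by (rule ringI; (rule abelian_groupI monoid.intro)?)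
      (auto simp: op_alg_def A.l_distr A.r_distr A.m_assoc A.a_ac
         intro: A.add.l_inv_ex)
  show ?thesis
    by (rule kalgebraI[OF r])
      (auto simp: op_alg_def A.smult_add_left A.smult_add_right A.smult_smult
        A.mult_smult_left A.mult_smult_right)
qed

section \<open>Monoid algebras\<close>

lemma supp_delta [simp]: "supp (delta s :: 's \<Rightarrow> 'k::field) = {s}"
  by (auto simp: supp_def delta_def)

lemma delta_same [simp]: "delta s s = 1"
  by (simp add: delta_def)

lemma monoid_alg_simps [simp]:
  "carrier (monoid_alg M) = {f. finite (supp f) \<and> supp f \<subseteq> carrier M}"
  "one (monoid_alg M) = delta \<one>\<^sub>M" "zero (monoid_alg M) = (\<lambda>t. 0)"
  "add (monoid_alg M) = (\<lambda>f g t. f t + g t)"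
  "module.smult (monoid_alg M) = (\<lambda>c f t. c * f t)"
  by (simp_all add: monoid_alg_def)

lemma supp_add: "supp (\<lambda>t. f t + g t) \<subseteq> supp f \<union> supp g"
  by (auto simp: supp_def)

lemma supp_scale: "supp (\<lambda>t. c * f t) \<subseteq> supp f"
  by (auto simp: supp_def)

lemma monoid_alg_mult_eq:
  assumes "finite F" "supp f \<subseteq> F" "finite G" "supp g \<subseteq> G"
  shows "(f \<otimes>\<^bsub>monoid_alg M\<^esub> g) t = (\<Sum>r\<in>F. \<Sum>s\<in>G. f r * g s * (if r \<otimes>\<^sub>M s = t then 1 else 0))"
proof -
  have "(f \<otimes>\<^bsub>monoid_alg M\<^esub> g) t = (\<Sum>(r, s)\<in>supp f \<times> supp g. if r \<otimes>\<^sub>M s = t then f r * g s else 0)"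
    by (simp add: monoid_alg_def)
  also have "\<dots> = (\<Sum>(r, s)\<in>F \<times> G. f r * g s * (if r \<otimes>\<^sub>M s = t then 1 else 0))"
    using assms by (intro sum.mono_neutral_cong_left) (auto simp: supp_def)
  finally show ?thesis by (simp add: sum.cartesian_product)
qed

text \<open>Pairing a product with a function turns the convolution into a double sum; associativity
  follows by applying this twice.\<close>

lemma monoid_alg_pairing:
  assumes "finite F" "supp f \<subseteq> F" "finite G" "supp g \<subseteq> G" "finite P"
    "\<And>r s. r \<in> F \<Longrightarrow> s \<in> G \<Longrightarrow> r \<otimes>\<^sub>M s \<in> P"
  shows "(\<Sum>p\<in>P. (f \<otimes>\<^bsub>monoid_alg M\<^esub> g) p * K p) = (\<Sum>r\<in>F. \<Sum>s\<in>G. f r * g s * K (r \<otimes>\<^sub>M s))"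
proof -
  have "(\<Sum>p\<in>P. (f \<otimes>\<^bsub>monoid_alg M\<^esub> g) p * K p) =
      (\<Sum>p\<in>P. \<Sum>r\<in>F. \<Sum>s\<in>G. f r * g s * (if p = r \<otimes>\<^sub>M s then K p else 0))"
    unfolding monoid_alg_mult_eq[OF assms(1-4)] sum_distrib_right
    by (intro sum.cong) auto
  also have "\<dots> = (\<Sum>r\<in>F. \<Sum>s\<in>G. \<Sum>p\<in>P. f r * g s * (if p = r \<otimes>\<^sub>M s then K p else 0))"
    by (subst sum.swap, rule sum.cong[OF refl], subst sum.swap, rule refl)
  also have "\<dots> = (\<Sum>r\<in>F. \<Sum>s\<in>G. f r * g s * K (r \<otimes>\<^sub>M s))"
    unfolding sum_distrib_left[symmetric] using assms(5,6) by (intro sum.cong) (auto simp: sum.delta')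
  finally show ?thesis .
qed

lemma supp_monoid_alg_mult:
  "supp (f \<otimes>\<^bsub>monoid_alg M\<^esub> g) \<subseteq> (\<lambda>(r, s). r \<otimes>\<^sub>M s) ` (supp f \<times> supp g)"
proof
  fix t assume "t \<in> supp (f \<otimes>\<^bsub>monoid_alg M\<^esub> g)"
  then have "(\<Sum>(r, s)\<in>supp f \<times> supp g. if r \<otimes>\<^sub>M s = t then f r * g s else 0) \<noteq> 0"
    by (simp add: supp_def monoid_alg_def)
  then obtain x where "x \<in> supp f \<times> supp g" "(case x of (r, s) \<Rightarrow> if r \<otimes>\<^sub>M s = t then f r * g s else 0) \<noteq> 0"
    by (rule sum.not_neutral_contains_not_neutral)
  then show "t \<in> (\<lambda>(r, s). r \<otimes>\<^sub>M s) ` (supp f \<times> supp g)"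
    by (auto split: if_splits)
qed

lemma delta_mult: "delta s \<otimes>\<^bsub>monoid_alg M\<^esub> delta t = delta (s \<otimes>\<^sub>M t)"
  by (rule ext, subst monoid_alg_mult_eq[of "{s}" _ "{t}"]) (simp_all, simp add: delta_def)

lemma kalgebra_monoid_alg:
  fixes M :: "('s, 'z) monoid_scheme"
  assumes "monoid M"
  shows "kalgebra (monoid_alg M :: ('k::field, 's \<Rightarrow> 'k) module)"
proof -
  interpret M: monoid M by fact
  let ?A = "monoid_alg M :: ('k::field, 's \<Rightarrow> 'k) module"
  have mcl: "f \<otimes>\<^bsub>?A\<^esub> g \<in> carrier ?A" if "f \<in> carrier ?A" "g \<in> carrier ?A" for f g
  proof -
    have "finite ((\<lambda>(r, s). r \<otimes>\<^sub>M s) ` (supp f \<times> supp g))" using that by auto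
    moreover have "(\<lambda>(r, s). r \<otimes>\<^sub>M s) ` (supp f \<times> supp g) \<subseteq> carrier M" using that by auto
    ultimately show ?thesis using supp_monoid_alg_mult[of M f g]
      by (simp, meson finite_subset subset_trans)
  qed
  have acl: "(\<lambda>t. f t + g t) \<in> carrier ?A" if "f \<in> carrier ?A" "g \<in> carrier ?A" for f g
    using that supp_add[of f g] by (simp, meson finite_UnI finite_subset le_sup_iff subset_trans)
  have scl: "(\<lambda>t. c * f t) \<in> carrier ?A" if "f \<in> carrier ?A" for c f
    using that supp_scale[of c f] by (simp, meson finite_subset subset_trans)
  have assoc: "(f \<otimes>\<^bsub>?A\<^esub> g) \<otimes>\<^bsub>?A\<^esub> h = f \<otimes>\<^bsub>?A\<^esub> (g \<otimes>\<^bsub>?A\<^esub> h)"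
    if c: "f \<in> carrier ?A" "g \<in> carrier ?A" "h \<in> carrier ?A" for f g h
  proof
    fix t
    define P Q where "P = (\<lambda>(r, s). r \<otimes>\<^sub>M s) ` (supp f \<times> supp g)"
      and "Q = (\<lambda>(r, s). r \<otimes>\<^sub>M s) ` (supp g \<times> supp h)"
    have fin: "finite P" "finite Q" "finite (supp f)" "finite (supp g)" "finite (supp h)"
      using c by (auto simp: P_def Q_def)
    have mem: "\<And>r s. r \<in> supp f \<Longrightarrow> s \<in> supp g \<Longrightarrow> r \<otimes>\<^sub>M s \<in> P"
      "\<And>r s. r \<in> supp g \<Longrightarrow> s \<in> supp h \<Longrightarrow> r \<otimes>\<^sub>M s \<in> Q"
      by (auto simp: P_def Q_def)
    have sub: "supp (f \<otimes>\<^bsub>?A\<^esub> g) \<subseteq> P" "supp (g \<otimes>\<^bsub>?A\<^esub> h) \<subseteq> Q"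
      unfolding P_def Q_def by (rule supp_monoid_alg_mult)+
    have "((f \<otimes>\<^bsub>?A\<^esub> g) \<otimes>\<^bsub>?A\<^esub> h) t =
      (\<Sum>p\<in>P. (f \<otimes>\<^bsub>?A\<^esub> g) p * (\<Sum>q\<in>supp h. h q * (if p \<otimes>\<^sub>M q = t then 1 else 0)))"
      by (simp only: monoid_alg_mult_eq[OF fin(1) sub(1) fin(5) subset_refl] sum_distrib_left mult.assoc)
    also have "\<dots> = (\<Sum>r\<in>supp f. \<Sum>s\<in>supp g. f r * g s *
        (\<Sum>q\<in>supp h. h q * (if (r \<otimes>\<^sub>M s) \<otimes>\<^sub>M q = t then 1 else 0)))"
      by (rule monoid_alg_pairing[OF fin(3) subset_refl fin(4) subset_refl fin(1) mem(1)])
    also have "\<dots> = (\<Sum>r\<in>supp f. f r * (\<Sum>s\<in>supp g. \<Sum>q\<in>supp h. g s * h q *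
        (if r \<otimes>\<^sub>M (s \<otimes>\<^sub>M q) = t then 1 else 0)))"
      unfolding sum_distrib_left using c by (intro sum.cong refl) (auto simp: M.m_assoc subset_iff)
    also have "\<dots> = (\<Sum>r\<in>supp f. f r * (\<Sum>p\<in>Q. (g \<otimes>\<^bsub>?A\<^esub> h) p * (if r \<otimes>\<^sub>M p = t then 1 else 0)))"
      by (simp only: monoid_alg_pairing[OF fin(4) subset_refl fin(5) subset_refl fin(2) mem(2)])
    also have "\<dots> = (f \<otimes>\<^bsub>?A\<^esub> (g \<otimes>\<^bsub>?A\<^esub> h)) t"
      by (simp only: monoid_alg_mult_eq[OF fin(3) subset_refl fin(2) sub(2)] sum_distrib_left mult.assoc)
    finally show "((f \<otimes>\<^bsub>?A\<^esub> g) \<otimes>\<^bsub>?A\<^esub> h) t = (f \<otimes>\<^bsub>?A\<^esub> (g \<otimes>\<^bsub>?A\<^esub> h)) t" .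
  qed
  have one_l: "delta \<one>\<^sub>M \<otimes>\<^bsub>?A\<^esub> f = f" if "f \<in> carrier ?A" for f
  proof
    fix t
    have "(\<Sum>s\<in>supp f. f s * (if \<one>\<^sub>M \<otimes>\<^sub>M s = t then 1 else 0)) = (\<Sum>s\<in>supp f. if s = t then f s else 0)"
      using that by (intro sum.cong) (auto simp: subset_iff)
    also have "\<dots> = f t" using that by (auto simp: sum.delta supp_def)
    finally have e: "(\<Sum>s\<in>supp f. f s * (if \<one>\<^sub>M \<otimes>\<^sub>M s = t then 1 else 0)) = f t" .
    show "(delta \<one>\<^sub>M \<otimes>\<^bsub>?A\<^esub> f) t = f t"
      by (subst monoid_alg_mult_eq[of "{\<one>\<^sub>M }" _ "supp f"]) (use that in \<open>simp_all add: e\<close>)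
  qed
  have one_r: "f \<otimes>\<^bsub>?A\<^esub> delta \<one>\<^sub>M = f" if "f \<in> carrier ?A" for f
  proof
    fix t
    have "(\<Sum>s\<in>supp f. f s * (if s \<otimes>\<^sub>M \<one>\<^sub>M = t then 1 else 0)) = (\<Sum>s\<in>supp f. if s = t then f s else 0)"
      using that by (intro sum.cong) (auto simp: subset_iff)
    also have "\<dots> = f t" using that by (auto simp: sum.delta supp_def)
    finally have e: "(\<Sum>s\<in>supp f. f s * (if s \<otimes>\<^sub>M \<one>\<^sub>M = t then 1 else 0)) = f t" .
    show "(f \<otimes>\<^bsub>?A\<^esub> delta \<one>\<^sub>M) t = f t"
      by (subst monoid_alg_mult_eq[of "supp f" _ "{\<one>\<^sub>M }"]) (use that in \<open>simp_all add: e\<close>)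
  qed
  have ldist: "(\<lambda>t. f t + g t) \<otimes>\<^bsub>?A\<^esub> h = (\<lambda>t. (f \<otimes>\<^bsub>?A\<^esub> h) t + (g \<otimes>\<^bsub>?A\<^esub> h) t)"
    if c: "f \<in> carrier ?A" "g \<in> carrier ?A" "h \<in> carrier ?A" for f g h
  proof
    fix t
    have e: "(k \<otimes>\<^bsub>?A\<^esub> h) t = (\<Sum>r\<in>supp f \<union> supp g. \<Sum>s\<in>supp h. k r * h s * (if r \<otimes>\<^sub>M s = t then 1 else 0))"
      if "supp k \<subseteq> supp f \<union> supp g" for k
      using that c by (intro monoid_alg_mult_eq) auto
    show "((\<lambda>t. f t + g t) \<otimes>\<^bsub>?A\<^esub> h) t = (f \<otimes>\<^bsub>?A\<^esub> h) t + (g \<otimes>\<^bsub>?A\<^esub> h) t"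
      by (simp only: e[OF supp_add] e[OF Un_upper1] e[OF Un_upper2] distrib_right sum.distrib)
  qed
  have rdist: "h \<otimes>\<^bsub>?A\<^esub> (\<lambda>t. f t + g t) = (\<lambda>t. (h \<otimes>\<^bsub>?A\<^esub> f) t + (h \<otimes>\<^bsub>?A\<^esub> g) t)"
    if c: "f \<in> carrier ?A" "g \<in> carrier ?A" "h \<in> carrier ?A" for f g h
  proof
    fix t
    have e: "(h \<otimes>\<^bsub>?A\<^esub> k) t = (\<Sum>r\<in>supp h. \<Sum>s\<in>supp f \<union> supp g. h r * k s * (if r \<otimes>\<^sub>M s = t then 1 else 0))"
      if "supp k \<subseteq> supp f \<union> supp g" for k
      using that c by (intro monoid_alg_mult_eq) auto
    show "(h \<otimes>\<^bsub>?A\<^esub> (\<lambda>t. f t + g t)) t = (h \<otimes>\<^bsub>?A\<^esub> f) t + (h \<otimes>\<^bsub>?A\<^esub> g) t"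
      by (simp only: e[OF supp_add] e[OF Un_upper1] e[OF Un_upper2] distrib_right distrib_left sum.distrib)
  qed
  have sl: "(\<lambda>t. c * f t) \<otimes>\<^bsub>?A\<^esub> h = (\<lambda>t. c * (f \<otimes>\<^bsub>?A\<^esub> h) t)"
    if c: "f \<in> carrier ?A" "h \<in> carrier ?A" for f c h
  proof
    fix t
    have e: "(k \<otimes>\<^bsub>?A\<^esub> h) t = (\<Sum>r\<in>supp f. \<Sum>s\<in>supp h. k r * h s * (if r \<otimes>\<^sub>M s = t then 1 else 0))"
      if "supp k \<subseteq> supp f" for k
      using that c by (intro monoid_alg_mult_eq) auto
    show "((\<lambda>t. c * f t) \<otimes>\<^bsub>?A\<^esub> h) t = c * (f \<otimes>\<^bsub>?A\<^esub> h) t"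
      by (simp only: e[OF supp_scale] e[OF subset_refl] sum_distrib_left mult.assoc)
  qed
  have sr: "h \<otimes>\<^bsub>?A\<^esub> (\<lambda>t. c * f t) = (\<lambda>t. c * (h \<otimes>\<^bsub>?A\<^esub> f) t)"
    if c: "f \<in> carrier ?A" "h \<in> carrier ?A" for f c h
  proof
    fix t
    have e: "(h \<otimes>\<^bsub>?A\<^esub> k) t = (\<Sum>r\<in>supp h. \<Sum>s\<in>supp f. h r * k s * (if r \<otimes>\<^sub>M s = t then 1 else 0))"
      if "supp k \<subseteq> supp f" for k
      using that c by (intro monoid_alg_mult_eq) auto
    show "(h \<otimes>\<^bsub>?A\<^esub> (\<lambda>t. c * f t)) t = c * (h \<otimes>\<^bsub>?A\<^esub> f) t"
      by (simp only: e[OF supp_scale] e[OF subset_refl] sum_distrib_left mult.assoc mult.left_commute)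
  qed
  have r: "ring ?A"
  proof (rule ringI)
    show "abelian_group ?A"
    proof (rule abelian_groupI)
      fix x assume "x \<in> carrier ?A"
      then show "\<exists>y\<in>carrier ?A. y \<oplus>\<^bsub>?A\<^esub> x = \<zero>\<^bsub>?A\<^esub>"
        using scl[of x "-1"] by (intro bexI[of _ "\<lambda>t. -1 * x t"]) auto
    qed (use acl in \<open>auto simp: algebra_simps supp_def\<close>)
    show "monoid ?A"
      by (rule monoid.intro) (use mcl assoc one_l one_r in auto)
  qed (use ldist rdist in auto)
  show ?thesis
    by (rule kalgebraI[OF r]) (use scl sl sr in \<open>auto simp: algebra_simps\<close>)
qed

declare monoid_alg_simps [simp del]

lemma (in kalg) minus_eq_zero_iff:
  assumes "x \<in> carrier A" "y \<in> carrier A"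
  shows "x \<ominus> y = \<zero> \<longleftrightarrow> x = y"
proof
  assume "x \<ominus> y = \<zero>"
  then have "x \<oplus> \<ominus> y = \<zero>" by (simp add: a_minus_def)
  then have "\<ominus> (\<ominus> y) = x" using assms by (intro minus_equality) auto
  then show "x = y" using assms by simp
qed (use assms in \<open>simp add: a_minus_def r_neg\<close>)

section \<open>Linear maps out of monoid algebras and their quotients\<close>

lemma delta_closed [simp]: "s \<in> carrier M \<Longrightarrow> delta s \<in> carrier (monoid_alg M)"
  by (simp add: monoid_alg_simps)

lemma monoid_alg_induct [consumes 2, case_names zero step]:
  fixes M :: "('s, 'z) monoid_scheme" and f :: "'s \<Rightarrow> 'k::field"
  defines "A \<equiv> monoid_alg M :: ('k, 's \<Rightarrow> 'k) module"
  assumes M: "monoid M" and f: "f \<in> carrier A"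
    and zero: "P \<zero>\<^sub>A"
    and step: "\<And>c s f. s \<in> carrier M \<Longrightarrow> f \<in> carrier A \<Longrightarrow> P f \<Longrightarrow> P (c \<odot>\<^sub>A delta s \<oplus>\<^sub>A f)"
  shows "P f"
proof -
  have "supp g \<subseteq> S \<Longrightarrow> S \<subseteq> carrier M \<Longrightarrow> P g" if "finite S" for S g
    using that
  proof (induction S arbitrary: g rule: finite_induct)
    case empty
    then have "g = \<zero>\<^sub>A" by (auto simp: supp_def A_def monoid_alg_simps)
    then show ?case using zero by simp
  next
    case (insert x F)
    let ?g = "g(x := 0)"
    have sub: "supp ?g \<subseteq> F" using insert by (auto simp: supp_def split: if_splits)
    then have "P ?g" using insert by auto
    moreover have "?g \<in> carrier A"
      using sub insert by (auto simp: A_def monoid_alg_simps intro: finite_subset)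
    moreover have "g = g x \<odot>\<^sub>A delta x \<oplus>\<^sub>A ?g"
      by (auto simp: A_def monoid_alg_simps delta_def)
    ultimately show ?case using step[of x ?g "g x"] insert by auto
  qed
  then show ?thesis using f by (auto simp: A_def monoid_alg_simps)
qed

lemma lin_hom_monoid_alg_eq:
  fixes M :: "('s, 'z) monoid_scheme" and f :: "'s \<Rightarrow> 'k::field"
  assumes M: "monoid M" and C: "kalgebra C"
    and "F \<in> lin_hom (monoid_alg M) C" "G \<in> lin_hom (monoid_alg M) C"
    "\<And>s. s \<in> carrier M \<Longrightarrow> F (delta s) = G (delta s)"
    "f \<in> carrier (monoid_alg M)"
  shows "F f = G f"
proof -
  interpret A: kalg "monoid_alg M :: ('k, 's \<Rightarrow> 'k) module"
    by (simp add: kalg_def kalgebra_monoid_alg M)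
  show ?thesis
    using M assms(6)
  proof (induction rule: monoid_alg_induct)
    case zero
    show ?case using lin_hom_zero[OF A.kalgebra C] assms by metis
  next
    case (step c s f)
    then show ?case using assms(3-5) by (simp add: lin_hom_add lin_hom_smult)
  qed
qed

lemma lin_ext_superset:
  assumes "kalgebra C" "finite F" "supp f \<subseteq> F" "\<And>s. s \<in> F \<Longrightarrow> b s \<in> carrier C"
  shows "lin_ext C b f = (\<Oplus>\<^sub>C s\<in>F. f s \<odot>\<^sub>C b s)"
proof -
  interpret C: kalg C by (simp add: kalg_def assms)
  show ?thesis unfolding lin_ext_def
    by (rule C.add.finprod_mono_neutral_cong_left) (use assms in \<open>auto simp: supp_def\<close>)
qed

lemma lin_ext_lin_hom:
  fixes M :: "('s, 'z) monoid_scheme"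
  assumes C: "kalgebra (C :: ('k::field, 'c, 'y) module_scheme)" and b: "\<And>s. s \<in> carrier M \<Longrightarrow> b s \<in> carrier C"
  shows "lin_ext C b \<in> lin_hom (monoid_alg M) C"
proof (rule lin_homI)
  interpret C: kalg C by (simp add: kalg_def assms)
  fix f g :: "'s \<Rightarrow> 'k" and c :: 'k assume f: "f \<in> carrier (monoid_alg M)"
  then have F: "finite (supp f)" "supp f \<subseteq> carrier M" by (simp_all add: monoid_alg_simps)
  have eF: "lin_ext C b k = (\<Oplus>\<^sub>C s\<in>supp f. k s \<odot>\<^sub>C b s)" if "supp k \<subseteq> supp f" for k
    by (rule lin_ext_superset[OF C]) (use that F b in auto)
  show "lin_ext C b f \<in> carrier C"
    unfolding eF[OF subset_refl] using F b by (intro C.finsum_closed) auto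
  have "lin_ext C b (\<lambda>t. c * f t) = (\<Oplus>\<^sub>C s\<in>supp f. c \<odot>\<^sub>C (f s \<odot>\<^sub>C b s))"
    unfolding eF[OF supp_scale] using F b by (intro C.finsum_cong') (auto simp: C.smult_smult)
  also have "\<dots> = c \<odot>\<^sub>C lin_ext C b f"
    unfolding eF[OF subset_refl] using F b by (intro C.finsum_smult[symmetric]) auto
  finally show "lin_ext C b (c \<odot>\<^bsub>monoid_alg M\<^esub> f) = c \<odot>\<^sub>C lin_ext C b f"
    by (simp add: monoid_alg_simps)
  assume g: "g \<in> carrier (monoid_alg M)"
  then have G: "finite (supp g)" "supp g \<subseteq> carrier M" by (simp_all add: monoid_alg_simps)
  have eFG: "lin_ext C b k = (\<Oplus>\<^sub>C s\<in>supp f \<union> supp g. k s \<odot>\<^sub>C b s)" if "supp k \<subseteq> supp f \<union> supp g" for k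
    by (rule lin_ext_superset[OF C]) (use that F G b in auto)
  have "lin_ext C b (\<lambda>t. f t + g t) = (\<Oplus>\<^sub>C s\<in>supp f \<union> supp g. f s \<odot>\<^sub>C b s \<oplus>\<^sub>C g s \<odot>\<^sub>C b s)"
    unfolding eFG[OF supp_add] using F G b by (intro C.finsum_cong') (auto simp: C.smult_add_left)
  also have "\<dots> = lin_ext C b f \<oplus>\<^sub>C lin_ext C b g"
    unfolding eFG[OF Un_upper1] eFG[OF Un_upper2] using F G b by (intro C.finsum_addf) auto
  finally show "lin_ext C b (f \<oplus>\<^bsub>monoid_alg M\<^esub> g) = lin_ext C b f \<oplus>\<^sub>C lin_ext C b g"
    by (simp add: monoid_alg_simps)
qed

lemma lin_ext_delta:
  assumes "kalgebra C" "b s \<in> carrier C"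
  shows "lin_ext C b (delta s) = b s"
proof -
  interpret C: kalg C by (simp add: kalg_def assms)
  show ?thesis using assms by (simp add: lin_ext_def)
qed

text \<open>The two-sided ideal generated by \<open>R\<close> is spanned by the products \<open>s r t\<close> with \<open>r\<close> in \<open>R\<close> and
  \<open>s\<close>, \<open>t\<close> in the monoid. The map need not be
  multiplicative, so this serves for tensor products and presented algebras alike.\<close>

lemma lin_ext_ideal_zero:
  fixes M :: "('s, 'z) monoid_scheme" and C :: "('k::field, 'c, 'y) module_scheme"
  assumes M: "monoid M" and C: "kalgebra C"
    and b: "\<And>s. s \<in> carrier M \<Longrightarrow> b s \<in> carrier C"
    and R: "R \<subseteq> carrier (monoid_alg M)"
    and kill: "\<And>r s t. r \<in> R \<Longrightarrow> s \<in> carrier M \<Longrightarrow> t \<in> carrier M \<Longrightarrow>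
      lin_ext C (\<lambda>x. b (s \<otimes>\<^sub>M x \<otimes>\<^sub>M t)) r = \<zero>\<^sub>C"
    and f: "f \<in> Idl\<^bsub>monoid_alg M\<^esub> R"
  shows "lin_ext C b f = \<zero>\<^sub>C"
proof -
  let ?A = "monoid_alg M :: ('k, 's \<Rightarrow> 'k) module"
  interpret M: monoid M by fact
  interpret A: kalg ?A by (simp add: kalg_def kalgebra_monoid_alg M)
  interpret C: kalg C by (simp add: kalg_def C)
  define L where "L s t = lin_ext C (\<lambda>x. b (s \<otimes>\<^sub>M x \<otimes>\<^sub>M t))" for s t
  have Lh: "L s t \<in> lin_hom ?A C" if "s \<in> carrier M" "t \<in> carrier M" for s t
    unfolding L_def using that b by (intro lin_ext_lin_hom C) auto
  have Ld: "L s t (delta x) = b (s \<otimes>\<^sub>M x \<otimes>\<^sub>M t)"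
    if "s \<in> carrier M" "t \<in> carrier M" "x \<in> carrier M" for s t x
    unfolding L_def using that b by (intro lin_ext_delta C) auto
  have Ll: "L s t (delta p \<otimes>\<^bsub>?A\<^esub> g) = L (s \<otimes>\<^sub>M p) t g"
    if m: "s \<in> carrier M" "t \<in> carrier M" "p \<in> carrier M" "g \<in> carrier ?A" for s t p g
  proof (rule lin_hom_monoid_alg_eq[OF M C _ Lh _ m(4)])
    show "(\<lambda>g. L s t (delta p \<otimes>\<^bsub>?A\<^esub> g)) \<in> lin_hom ?A C"
      by (rule lin_hom_comp[OF _ Lh], rule lin_homI)
        (use m in \<open>auto simp: A.r_distr A.mult_smult_right\<close>)
  qed (use m Ld in \<open>auto simp: delta_mult M.m_assoc\<close>)
  have Lr: "L s t (g \<otimes>\<^bsub>?A\<^esub> delta p) = L s (p \<otimes>\<^sub>M t) g"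
    if m: "s \<in> carrier M" "t \<in> carrier M" "p \<in> carrier M" "g \<in> carrier ?A" for s t p g
  proof (rule lin_hom_monoid_alg_eq[OF M C _ Lh _ m(4)])
    show "(\<lambda>g. L s t (g \<otimes>\<^bsub>?A\<^esub> delta p)) \<in> lin_hom ?A C"
      by (rule lin_hom_comp[OF _ Lh], rule lin_homI)
        (use m in \<open>auto simp: A.l_distr A.mult_smult_left\<close>)
  qed (use m Ld in \<open>auto simp: delta_mult M.m_assoc\<close>)
  define J where "J = {g \<in> carrier ?A. \<forall>s\<in>carrier M. \<forall>t\<in>carrier M. L s t g = \<zero>\<^sub>C }"
  have "ideal J ?A"
  proof (rule idealI[OF A.ring_axioms])
    show "subgroup J (add_monoid ?A)"
    proof (rule A.add.subgroupI)
      have "\<zero>\<^bsub>?A\<^esub> \<in> J" using lin_hom_zero[OF A.kalgebra C Lh] by (simp add: J_def)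
      then show "J \<noteq> {}" by blast
    qed (auto simp: J_def lin_hom_add[OF Lh] lin_hom_uminus[OF A.kalgebra C Lh] simp flip: a_inv_def)
  next
    fix a x assume a: "a \<in> J" and x: "x \<in> carrier ?A"
    then have ac: "a \<in> carrier ?A" by (simp add: J_def)
    have "x \<otimes>\<^bsub>?A\<^esub> a \<in> J \<and> a \<otimes>\<^bsub>?A\<^esub> x \<in> J"
      using M x
    proof (induction rule: monoid_alg_induct)
      case zero
      then show ?case using ac lin_hom_zero[OF A.kalgebra C Lh] by (simp add: J_def)
    next
      case (step c s f)
      have "L p q ((c \<odot>\<^bsub>?A\<^esub> delta s \<oplus>\<^bsub>?A\<^esub> f) \<otimes>\<^bsub>?A\<^esub> a) = \<zero>\<^sub>C"
        "L p q (a \<otimes>\<^bsub>?A\<^esub> (c \<odot>\<^bsub>?A\<^esub> delta s \<oplus>\<^bsub>?A\<^esub> f)) = \<zero>\<^sub>C"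
        if "p \<in> carrier M" "q \<in> carrier M" for p q
        using that step a ac
        by (simp_all add: A.l_distr A.r_distr A.mult_smult_left A.mult_smult_right
          lin_hom_add[OF Lh] lin_hom_smult[OF Lh] Ll Lr J_def)
      then show ?case using step ac by (simp add: J_def)
    qed
    then show "x \<otimes>\<^bsub>?A\<^esub> a \<in> J" "a \<otimes>\<^bsub>?A\<^esub> x \<in> J" by auto
  qed
  moreover have "R \<subseteq> J" using R kill by (auto simp: J_def L_def)
  ultimately have "f \<in> J" using A.genideal_minimal[of J R] f by auto
  then have fA: "f \<in> carrier ?A" and f0: "L \<one>\<^sub>M \<one>\<^sub>M f = \<zero>\<^sub>C" by (auto simp: J_def)
  have "lin_ext C b f = L \<one>\<^sub>M \<one>\<^sub>M f"
    by (rule lin_hom_monoid_alg_eq[OF M C lin_ext_lin_hom[OF C b] Lh _ fA])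
      (auto simp: lin_ext_delta C b Ld)
  then show ?thesis using f0 by simp
qed

lemma ring_same_operations:
  assumes "ring R" "carrier S = carrier R" "mult S = mult R" "one S = one R" "zero S = zero R" "add S = add R"
  shows "ring S"
proof -
  interpret R: ring R by fact
  show ?thesis
    by (rule ringI; (rule abelian_groupI monoid.intro)?)
      (auto simp: assms(2-) R.l_distr R.r_distr R.m_assoc R.a_ac intro: R.add.l_inv_ex)
qed

lemma quot_alg_hom:
  assumes "kalgebra A" "ideal I A"
  shows "kalgebra (quot_alg A I)" "(\<lambda>x. I +>\<^sub>A x) \<in> alg_hom A (quot_alg A I)"
    "carrier (quot_alg A I) = (\<lambda>x. I +>\<^sub>A x) ` carrier A"
proof -
  interpret A: kalg A by (simp add: kalg_def assms)
  interpret I: ideal I A by fact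
  let ?Q = "quot_alg A I"
  show car: "carrier ?Q = (\<lambda>x. I +>\<^sub>A x) ` carrier A"
    by (auto simp: quot_alg_def FactRing_def A_RCOSETS_def RCOSETS_def a_r_coset_def)
  have hom: "(+>\<^sub>A) I \<in> Ring.ring_hom A ?Q"
    using I.rcos_ring_hom by (simp add: Ring.ring_hom_def quot_alg_def)
  have r: "ring ?Q"
    by (rule ring_same_operations[OF I.quotient_is_ring]) (simp_all add: quot_alg_def)
  have sm: "c \<odot>\<^bsub>?Q\<^esub> (I +>\<^sub>A x) = I +>\<^sub>A (c \<odot>\<^sub>A x)" if x: "x \<in> carrier A" for c x
  proof -
    have "I +>\<^sub>A (c \<odot>\<^sub>A y) = I +>\<^sub>A (c \<odot>\<^sub>A x)" if y: "y \<in> I +>\<^sub>A x" for y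
    proof -
      obtain i where i: "i \<in> I" "y = i \<oplus>\<^sub>A x" using y by (auto simp: a_r_coset_def')
      have ic: "i \<in> carrier A" using i I.a_subset by auto
      have "c \<odot>\<^sub>A i = (c \<odot>\<^sub>A \<one>\<^sub>A) \<otimes>\<^sub>A i" using ic by (simp add: A.mult_smult_left)
      then have "c \<odot>\<^sub>A i \<in> I" using i by (simp add: I.I_l_closed)
      moreover have "c \<odot>\<^sub>A y = c \<odot>\<^sub>A i \<oplus>\<^sub>A c \<odot>\<^sub>A x" using i ic x by (simp add: A.smult_add_right)
      ultimately have "c \<odot>\<^sub>A y \<in> I +>\<^sub>A (c \<odot>\<^sub>A x)" by (auto simp: a_r_coset_def')
      then show ?thesis
        using A.a_repr_independence[OF _ _ I.a_subgroup, of "c \<odot>\<^sub>A y" "c \<odot>\<^sub>A x"] x by simp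
    qed
    then have "(\<Union>y\<in>I +>\<^sub>A x. I +>\<^sub>A (c \<odot>\<^sub>A y)) = I +>\<^sub>A (c \<odot>\<^sub>A x)"
      using I.a_rcos_self[OF x] by (intro SUP_eq_const) blast+
    then show ?thesis unfolding quot_alg_def by simp
  qed
  have ad: "(I +>\<^sub>A x) \<oplus>\<^bsub>?Q\<^esub> (I +>\<^sub>A y) = I +>\<^sub>A (x \<oplus>\<^sub>A y)"
    "(I +>\<^sub>A x) \<otimes>\<^bsub>?Q\<^esub> (I +>\<^sub>A y) = I +>\<^sub>A (x \<otimes>\<^sub>A y)"
    if "x \<in> carrier A" "y \<in> carrier A" for x y
    using hom that by (auto simp: Ring.ring_hom_def)
  show "kalgebra ?Q"
    by (rule kalgebraI[OF r]; clarsimp simp: car)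
      (auto simp: sm ad A.smult_add_left A.smult_add_right A.smult_smult A.mult_smult_left A.mult_smult_right)
  show "(\<lambda>x. I +>\<^sub>A x) \<in> alg_hom A ?Q"
    using hom by (auto simp: alg_hom_def lin_hom_def sm ad car)
qed

lemma quot_alg_zero:
  assumes "kalgebra A" "ideal I A" "x \<in> I"
  shows "I +>\<^sub>A x = \<zero>\<^bsub>quot_alg A I\<^esub>"
proof -
  interpret I: ideal I A by fact
  show ?thesis using assms(3) by (simp add: quot_alg_def FactRing_def I.a_rcos_const)
qed

text \<open>The presented objects of this development are all quotients of a monoid algebra by the ideal
  generated by some relators; these are their common properties.\<close>

locale monoid_quot =
  fixes M :: "('s, 'z) monoid_scheme" and R :: "('s \<Rightarrow> 'k::field) set"
  assumes M: "monoid M" and R: "R \<subseteq> carrier (monoid_alg M)"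
begin

abbreviation P where "P \<equiv> monoid_alg M :: ('k, 's \<Rightarrow> 'k) module"
abbreviation I where "I \<equiv> Idl\<^bsub>P\<^esub> R"
abbreviation Q where "Q \<equiv> quot_alg P I"

lemma P: "kalgebra P" by (rule kalgebra_monoid_alg[OF M])

lemma ideal_I: "ideal I P"
proof -
  interpret P: kalg P by (simp add: kalg_def P)
  show ?thesis by (rule P.genideal_ideal[OF R])
qed

lemma Q: "kalgebra Q" by (rule quot_alg_hom(1)[OF P ideal_I])

lemma proj: "(\<lambda>x. I +>\<^sub>P x) \<in> alg_hom P Q" by (rule quot_alg_hom(2)[OF P ideal_I])

lemma carrier_Q: "carrier Q = (\<lambda>x. I +>\<^sub>P x) ` carrier P" by (rule quot_alg_hom(3)[OF P ideal_I])

lemma proj_rel: "r \<in> R \<Longrightarrow> I +>\<^sub>P r = \<zero>\<^bsub>Q\<^esub>"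
proof -
  assume r: "r \<in> R"
  interpret P: kalg P by (simp add: kalg_def P)
  show ?thesis using P.genideal_self[OF R] r by (intro quot_alg_zero[OF P ideal_I]) auto
qed

lemma quot_ext_proj:
  assumes C: "kalgebra C" and b: "\<And>s. s \<in> carrier M \<Longrightarrow> b s \<in> carrier C"
    and kill: "\<And>r s t. r \<in> R \<Longrightarrow> s \<in> carrier M \<Longrightarrow> t \<in> carrier M \<Longrightarrow>
      lin_ext C (\<lambda>x. b (s \<otimes>\<^sub>M x \<otimes>\<^sub>M t)) r = \<zero>\<^sub>C"
    and f: "f \<in> carrier P"
  shows "quot_ext C b (I +>\<^sub>P f) = lin_ext C b f"
proof -
  interpret P: kalg P by (simp add: kalg_def P)
  interpret C: kalg C by (simp add: kalg_def C)
  interpret I: ideal I P by (rule ideal_I)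
  have L: "lin_ext C b \<in> lin_hom P C" by (rule lin_ext_lin_hom[OF C b])
  let ?g = "SOME g. g \<in> I +>\<^sub>P f"
  have "?g \<in> I +>\<^sub>P f" using I.a_rcos_self[OF f] by (rule someI[of "\<lambda>g. g \<in> I +>\<^sub>P f"])
  then obtain i where i: "i \<in> I" "?g = i \<oplus>\<^sub>P f" by (auto simp: a_r_coset_def')
  have "i \<in> carrier P" using i I.a_subset by auto
  then have "lin_ext C b ?g = lin_ext C b i \<oplus>\<^sub>C lin_ext C b f"
    using i f by (simp add: lin_hom_add[OF L])
  also have "lin_ext C b i = \<zero>\<^sub>C" using lin_ext_ideal_zero[OF M C b R kill i(1)] by blast
  finally show ?thesis using lin_hom_closed[OF L f] by (simp add: quot_ext_def)
qed

lemma quot_ext_lin_hom: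
  assumes C: "kalgebra C" and b: "\<And>s. s \<in> carrier M \<Longrightarrow> b s \<in> carrier C"
    and kill: "\<And>r s t. r \<in> R \<Longrightarrow> s \<in> carrier M \<Longrightarrow> t \<in> carrier M \<Longrightarrow>
      lin_ext C (\<lambda>x. b (s \<otimes>\<^sub>M x \<otimes>\<^sub>M t)) r = \<zero>\<^sub>C"
  shows "quot_ext C b \<in> lin_hom Q C"
proof -
  interpret P: kalg P by (simp add: kalg_def P)
  have L: "lin_ext C b \<in> lin_hom P C" by (rule lin_ext_lin_hom[OF C b])
  note e = quot_ext_proj[OF C b kill]
  note ph = lin_hom_add[OF alg_hom_lin[OF proj], symmetric] lin_hom_smult[OF alg_hom_lin[OF proj], symmetric]
  show ?thesis
    by (rule lin_homI; clarsimp simp: carrier_Q)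
      (auto simp: e ph lin_hom_add[OF L] lin_hom_smult[OF L] lin_hom_closed[OF L])
qed

lemma quot_ext_delta:
  assumes C: "kalgebra C" and b: "\<And>s. s \<in> carrier M \<Longrightarrow> b s \<in> carrier C"
    and kill: "\<And>r s t. r \<in> R \<Longrightarrow> s \<in> carrier M \<Longrightarrow> t \<in> carrier M \<Longrightarrow>
      lin_ext C (\<lambda>x. b (s \<otimes>\<^sub>M x \<otimes>\<^sub>M t)) r = \<zero>\<^sub>C"
    and s: "s \<in> carrier M"
  shows "quot_ext C b (I +>\<^sub>P delta s) = b s"
  using quot_ext_proj[OF C b kill] s by (simp add: lin_ext_delta C b)

lemma quot_induct [consumes 1, case_names zero step]:
  assumes "X \<in> carrier Q" "H \<zero>\<^bsub>Q\<^esub>"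
    "\<And>c s X. s \<in> carrier M \<Longrightarrow> X \<in> carrier Q \<Longrightarrow> H X \<Longrightarrow> H (c \<odot>\<^bsub>Q\<^esub> (I +>\<^sub>P delta s) \<oplus>\<^bsub>Q\<^esub> X)"
  shows "H X"
proof -
  interpret P: kalg P by (simp add: kalg_def P)
  note pl = alg_hom_lin[OF proj]
  obtain f where f: "f \<in> carrier P" "X = I +>\<^sub>P f" using assms(1) by (auto simp: carrier_Q)
  have "H (I +>\<^sub>P f)"
    using M f(1)
  proof (induction rule: monoid_alg_induct)
    case zero
    then show ?case using lin_hom_zero[OF P Q pl] assms(2) by simp
  next
    case (step c s f)
    then show ?case using assms(3)[of s "I +>\<^sub>P f" c] lin_hom_closed[OF pl]
      by (simp add: lin_hom_add[OF pl] lin_hom_smult[OF pl])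
  qed
  then show ?thesis using f by simp
qed

end

section \<open>Tensor products\<close>

definition bilin ::
    "('k::field, 'a, 'x) module_scheme \<Rightarrow> ('k, 'b, 'y) module_scheme \<Rightarrow> ('k, 'c, 'z) module_scheme \<Rightarrow>
     ('a \<Rightarrow> 'b \<Rightarrow> 'c) \<Rightarrow> bool" where
  "bilin A B C \<beta> \<longleftrightarrow> (\<forall>b\<in>carrier B. (\<lambda>a. \<beta> a b) \<in> lin_hom A C) \<and> (\<forall>a\<in>carrier A. \<beta> a \<in> lin_hom B C)"

lemma bilinI:
  assumes "\<And>b. b \<in> carrier B \<Longrightarrow> (\<lambda>a. \<beta> a b) \<in> lin_hom A C" "\<And>a. a \<in> carrier A \<Longrightarrow> \<beta> a \<in> lin_hom B C"
  shows "bilin A B C \<beta>"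
  using assms by (simp add: bilin_def)

lemma bilin_closed: "bilin A B C \<beta> \<Longrightarrow> a \<in> carrier A \<Longrightarrow> b \<in> carrier B \<Longrightarrow> \<beta> a b \<in> carrier C"
  by (auto simp: bilin_def intro: lin_hom_closed)

lemma bilin_left: "bilin A B C \<beta> \<Longrightarrow> b \<in> carrier B \<Longrightarrow> (\<lambda>a. \<beta> a b) \<in> lin_hom A C"
  by (auto simp: bilin_def)

lemma bilin_right: "bilin A B C \<beta> \<Longrightarrow> a \<in> carrier A \<Longrightarrow> \<beta> a \<in> lin_hom B C"
  by (auto simp: bilin_def)

text \<open>The monoid algebra of the product monoid serves as the free vector space on pairs, so that the tensor
  product is a quotient of the kind treated above.\<close>

locale tensor_construction =
  A: kalg A + B: kalg B
  for A :: "('k::field, 'a, 'x) module_scheme" and B :: "('k, 'b, 'y) module_scheme"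
begin

abbreviation "T \<equiv> tensor A B"
abbreviation "pt \<equiv> pure_tensor A B"

lemma bilin_rels_carrier: "bilin_rels A B \<subseteq> carrier (monoid_alg (A \<times>\<times> B))"
proof -
  interpret P: kalg "monoid_alg (A \<times>\<times> B) :: ('k, 'a \<times> 'b \<Rightarrow> 'k) module"
    by (simp add: kalg_def kalgebra_monoid_alg DirProd_monoid A.monoid_axioms B.monoid_axioms)
  show ?thesis
    by (auto simp: bilin_rels_def pair_alg_def Let_def intro!: P.minus_closed P.add.m_closed)
qed

sublocale MQ: monoid_quot "A \<times>\<times> B" "bilin_rels A B"
  by (rule monoid_quot.intro) (simp_all add: DirProd_monoid A.monoid_axioms B.monoid_axioms bilin_rels_carrier)

lemma T_eq: "T = MQ.Q"
  by (simp add: tensor_def pair_alg_def bilin_ideal_def)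

lemma pt_eq: "pt a b = MQ.I +>\<^bsub>MQ.P\<^esub> delta (a, b)"
  by (simp add: pure_tensor_def pair_alg_def bilin_ideal_def)

sublocale PP: kalg "MQ.P" by (simp add: kalg_def MQ.P)
sublocale T: kalg T by (simp add: kalg_def T_eq MQ.Q)

lemma kalgebra_T: "kalgebra T" by (rule T.kalgebra)

lemma pt_closed [simp]: "a \<in> carrier A \<Longrightarrow> b \<in> carrier B \<Longrightarrow> pt a b \<in> carrier T"
  unfolding T_eq pt_eq by (intro alg_hom_closed[OF MQ.proj]) simp

lemma proj_eqI:
  assumes "x \<in> carrier MQ.P" "y \<in> carrier MQ.P" "x \<ominus>\<^bsub>MQ.P\<^esub> y \<in> bilin_rels A B"
  shows "MQ.I +>\<^bsub>MQ.P\<^esub> x = MQ.I +>\<^bsub>MQ.P\<^esub> y"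
proof -
  note pl = alg_hom_lin[OF MQ.proj]
  have "(MQ.I +>\<^bsub>MQ.P\<^esub> x) \<ominus>\<^sub>T (MQ.I +>\<^bsub>MQ.P\<^esub> y) = \<zero>\<^sub>T"
    using lin_hom_minus[OF MQ.P MQ.Q pl assms(1,2)] MQ.proj_rel[OF assms(3)] by (simp add: T_eq)
  then show ?thesis using lin_hom_closed[OF pl] assms by (simp add: T_eq[symmetric] T.minus_eq_zero_iff)
qed

lemma bilin_relsI:
  assumes "a \<in> carrier A" "b \<in> carrier B"
  shows "a' \<in> carrier A \<Longrightarrow> delta (a \<oplus>\<^sub>A a', b) \<ominus>\<^bsub>MQ.P\<^esub> (delta (a, b) \<oplus>\<^bsub>MQ.P\<^esub> delta (a', b)) \<in> bilin_rels A B"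
    "b' \<in> carrier B \<Longrightarrow> delta (a, b \<oplus>\<^sub>B b') \<ominus>\<^bsub>MQ.P\<^esub> (delta (a, b) \<oplus>\<^bsub>MQ.P\<^esub> delta (a, b')) \<in> bilin_rels A B"
    "delta (c \<odot>\<^sub>A a, b) \<ominus>\<^bsub>MQ.P\<^esub> (c \<odot>\<^bsub>MQ.P\<^esub> delta (a, b)) \<in> bilin_rels A B"
    "delta (a, c \<odot>\<^sub>B b) \<ominus>\<^bsub>MQ.P\<^esub> (c \<odot>\<^bsub>MQ.P\<^esub> delta (a, b)) \<in> bilin_rels A B"
  using assms unfolding bilin_rels_def pair_alg_def Let_def by blast+

lemma pt_bilin: "bilin A B T pt"
proof (rule bilinI; rule lin_homI)
  note pl = alg_hom_lin[OF MQ.proj]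
  note ph = lin_hom_add[OF pl, symmetric] lin_hom_smult[OF pl, symmetric]
  fix a a' b b' c
  assume a: "a \<in> carrier A" and b: "b \<in> carrier B"
  show "pt (c \<odot>\<^sub>A a) b = c \<odot>\<^sub>T pt a b" "pt a (c \<odot>\<^sub>B b) = c \<odot>\<^sub>T pt a b"
    unfolding T_eq pt_eq using a b
    by (simp_all add: ph proj_eqI bilin_relsI)
  { assume a': "a' \<in> carrier A"
    show "pt (a \<oplus>\<^sub>A a') b = pt a b \<oplus>\<^sub>T pt a' b"
      unfolding T_eq pt_eq using a b a'
      by (simp add: ph proj_eqI bilin_relsI) }
  { assume b': "b' \<in> carrier B"
    show "pt a (b \<oplus>\<^sub>B b') = pt a b \<oplus>\<^sub>T pt a b'"
      unfolding T_eq pt_eq using a b b'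
      by (simp add: ph proj_eqI bilin_relsI) }
qed auto

lemmas pt_left = bilin_left[OF pt_bilin] and pt_right = bilin_right[OF pt_bilin]

lemma pt_add_left: "a \<in> carrier A \<Longrightarrow> a' \<in> carrier A \<Longrightarrow> b \<in> carrier B \<Longrightarrow>
    pt (a \<oplus>\<^sub>A a') b = pt a b \<oplus>\<^sub>T pt a' b"
  by (rule lin_hom_add[OF pt_left])

lemma pt_add_right: "a \<in> carrier A \<Longrightarrow> b \<in> carrier B \<Longrightarrow> b' \<in> carrier B \<Longrightarrow>
    pt a (b \<oplus>\<^sub>B b') = pt a b \<oplus>\<^sub>T pt a b'"
  by (rule lin_hom_add[OF pt_right])

lemma pt_smult_left: "a \<in> carrier A \<Longrightarrow> b \<in> carrier B \<Longrightarrow> pt (c \<odot>\<^sub>A a) b = c \<odot>\<^sub>T pt a b"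
  by (rule lin_hom_smult[OF pt_left])

lemma pt_smult_right: "a \<in> carrier A \<Longrightarrow> b \<in> carrier B \<Longrightarrow> pt a (c \<odot>\<^sub>B b) = c \<odot>\<^sub>T pt a b"
  by (rule lin_hom_smult[OF pt_right])

lemma pt_zero_left: "b \<in> carrier B \<Longrightarrow> pt \<zero>\<^sub>A b = \<zero>\<^sub>T"
  by (rule lin_hom_zero[OF A.kalgebra T.kalgebra pt_left])

lemma pt_zero_right: "a \<in> carrier A \<Longrightarrow> pt a \<zero>\<^sub>B = \<zero>\<^sub>T"
  by (rule lin_hom_zero[OF B.kalgebra T.kalgebra pt_right])

lemma pt_finsum_left: "b \<in> carrier B \<Longrightarrow> (\<And>i. i \<in> S \<Longrightarrow> g i \<in> carrier A) \<Longrightarrow>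
    pt (\<Oplus>\<^sub>A i\<in>S. g i) b = (\<Oplus>\<^sub>T i\<in>S. pt (g i) b)"
  by (rule lin_hom_finsum[OF A.kalgebra T.kalgebra pt_left])

lemma pt_finsum_right: "a \<in> carrier A \<Longrightarrow> (\<And>i. i \<in> S \<Longrightarrow> g i \<in> carrier B) \<Longrightarrow>
    pt a (\<Oplus>\<^sub>B i\<in>S. g i) = (\<Oplus>\<^sub>T i\<in>S. pt a (g i))"
  by (rule lin_hom_finsum[OF B.kalgebra T.kalgebra pt_right])

lemma pt_mult: "a \<in> carrier A \<Longrightarrow> a' \<in> carrier A \<Longrightarrow> b \<in> carrier B \<Longrightarrow> b' \<in> carrier B \<Longrightarrow>
    pt a b \<otimes>\<^sub>T pt a' b' = pt (a \<otimes>\<^sub>A a') (b \<otimes>\<^sub>B b')"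
  unfolding T_eq pt_eq by (subst alg_hom_mult[OF MQ.proj, symmetric]) (simp_all add: delta_mult)

lemma T_one: "\<one>\<^sub>T = pt \<one>\<^sub>A \<one>\<^sub>B"
  unfolding T_eq pt_eq using alg_hom_one[OF MQ.proj] by (simp add: monoid_alg_simps)

lemma tensor_induct [consumes 1, case_names pure add]:
  assumes X: "X \<in> carrier T"
    and pure: "\<And>a b. a \<in> carrier A \<Longrightarrow> b \<in> carrier B \<Longrightarrow> H (pt a b)"
    and add: "\<And>X Y. X \<in> carrier T \<Longrightarrow> Y \<in> carrier T \<Longrightarrow> H X \<Longrightarrow> H Y \<Longrightarrow> H (X \<oplus>\<^sub>T Y)"
  shows "H X"
  using X unfolding T_eq
proof (induction rule: MQ.quot_induct)
  case zero
  show ?case using pure[OF A.zero_closed B.zero_closed] by (simp add: pt_zero_left T_eq)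
next
  case (step c s X)
  then show ?case
    using add[OF pt_closed[of "c \<odot>\<^sub>A fst s" "snd s"], of X] pure[of "c \<odot>\<^sub>A fst s" "snd s"]
      pt_smult_left[of "fst s" "snd s" c]
    by (auto simp: T_eq pt_eq)
qed

lemma lin_hom_tensor_eq:
  assumes "f \<in> lin_hom T C" "g \<in> lin_hom T C"
    "\<And>a b. a \<in> carrier A \<Longrightarrow> b \<in> carrier B \<Longrightarrow> f (pt a b) = g (pt a b)" "X \<in> carrier T"
  shows "f X = g X"
  using assms(4)
  by (induction rule: tensor_induct) (simp_all add: assms(3) lin_hom_add[OF assms(1)] lin_hom_add[OF assms(2)])

text \<open>The universal property. A bilinearity relator multiplied on both sides by pairs is again such a
  relator, so a bilinear map, extended linearly, kills the ideal that the relators generate.\<close>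

lemma tensor_lift:
  assumes C: "kalgebra C" and \<beta>: "bilin A B C \<beta>"
  shows "tensor_lift C \<beta> \<in> lin_hom T C"
    and "\<And>a b. a \<in> carrier A \<Longrightarrow> b \<in> carrier B \<Longrightarrow> tensor_lift C \<beta> (pt a b) = \<beta> a b"
proof -
  let ?b = "\<lambda>(x, y). \<beta> x y"
  interpret C: kalg C by (simp add: kalg_def C)
  have b: "\<And>s. s \<in> carrier (A \<times>\<times> B) \<Longrightarrow> ?b s \<in> carrier C"
    by (auto intro: bilin_closed[OF \<beta>])
  have kill: "lin_ext C (\<lambda>x. ?b (s \<otimes>\<^bsub>A \<times>\<times> B\<^esub> x \<otimes>\<^bsub>A \<times>\<times> B\<^esub> t)) r = \<zero>\<^sub>C"
    if r: "r \<in> bilin_rels A B" and s: "s \<in> carrier (A \<times>\<times> B)" and t: "t \<in> carrier (A \<times>\<times> B)" for r s t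
  proof -
    obtain s1 s2 t1 t2 where st: "s = (s1, s2)" "t = (t1, t2)"
      "s1 \<in> carrier A" "s2 \<in> carrier B" "t1 \<in> carrier A" "t2 \<in> carrier B"
      using s t by auto
    define L where "L = lin_ext C (\<lambda>x. ?b (s \<otimes>\<^bsub>A \<times>\<times> B\<^esub> x \<otimes>\<^bsub>A \<times>\<times> B\<^esub> t))"
    interpret AB: monoid "A \<times>\<times> B" by (rule MQ.M)
    have Lh: "L \<in> lin_hom MQ.P C" unfolding L_def
      by (intro lin_ext_lin_hom C b AB.m_closed s t)
    have Ld: "L (delta (x, y)) = \<beta> (s1 \<otimes>\<^sub>A x \<otimes>\<^sub>A t1) (s2 \<otimes>\<^sub>B y \<otimes>\<^sub>B t2)"
      if "x \<in> carrier A" "y \<in> carrier B" for x y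
      unfolding L_def using that st by (subst lin_ext_delta[OF C]) (auto intro: bilin_closed[OF \<beta>])
    have "L r = \<zero>\<^sub>C"
      using r st unfolding bilin_rels_def pair_alg_def Let_def
      by (auto simp: lin_hom_minus[OF MQ.P C Lh] lin_hom_add[OF Lh] lin_hom_smult[OF Lh] Ld
          A.l_distr A.r_distr B.l_distr B.r_distr A.mult_smult_left A.mult_smult_right
          B.mult_smult_left B.mult_smult_right C.minus_eq_zero_iff
          lin_hom_add[OF bilin_left[OF \<beta>]] lin_hom_add[OF bilin_right[OF \<beta>]]
          lin_hom_smult[OF bilin_left[OF \<beta>]] lin_hom_smult[OF bilin_right[OF \<beta>]]
          bilin_closed[OF \<beta>])
    then show ?thesis by (simp add: L_def)
  qed
  show "tensor_lift C \<beta> \<in> lin_hom T C"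
    unfolding tensor_lift_def T_eq by (rule MQ.quot_ext_lin_hom[OF C b kill])
  fix a b assume "a \<in> carrier A" "b \<in> carrier B"
  then show "tensor_lift C \<beta> (pt a b) = \<beta> a b"
    unfolding tensor_lift_def pt_eq using MQ.quot_ext_delta[OF C b kill, of "(a, b)"] by simp
qed

lemma lin_hom_tensor_alg_hom:
  assumes C: "kalgebra C" and f: "f \<in> lin_hom T C"
    and m: "\<And>a b a' b'. a \<in> carrier A \<Longrightarrow> b \<in> carrier B \<Longrightarrow> a' \<in> carrier A \<Longrightarrow> b' \<in> carrier B \<Longrightarrow>
      f (pt (a \<otimes>\<^sub>A a') (b \<otimes>\<^sub>B b')) = f (pt a b) \<otimes>\<^sub>C f (pt a' b')"
    and one: "f (pt \<one>\<^sub>A \<one>\<^sub>B) = \<one>\<^sub>C"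
  shows "f \<in> alg_hom T C"
proof (rule alg_homI[OF f])
  interpret C: kalg C by (simp add: kalg_def C)
  note fc = lin_hom_closed[OF f] and fa = lin_hom_add[OF f]
  fix X Y assume X: "X \<in> carrier T" and Y: "Y \<in> carrier T"
  show "f (X \<otimes>\<^sub>T Y) = f X \<otimes>\<^sub>C f Y"
    using X
  proof (induction rule: tensor_induct)
    case (pure a b)
    from Y show ?case
    proof (induction rule: tensor_induct)
      case (pure a' b')
      then show ?case using m \<open>a \<in> carrier A\<close> \<open>b \<in> carrier B\<close> by (simp add: pt_mult)
    next
      case (add X Y)
      then show ?case using pure by (simp add: T.r_distr C.r_distr fa fc)
    qed
  next
    case (add X Y')
    then show ?case using Y by (simp add: T.l_distr C.l_distr fa fc)
  qed
qed (simp add: T_one one)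

end

text \<open>The interface of the tensor product, without the free vector space that it is a quotient of.\<close>

locale two_algs =
  A: kalg A + B: kalg B
  for A :: "('k::field, 'a, 'x) module_scheme" and B :: "('k, 'b, 'y) module_scheme"
begin

abbreviation "T \<equiv> tensor A B"
abbreviation "pt \<equiv> pure_tensor A B"

lemma construction: "tensor_construction A B"
  by (rule tensor_construction.intro[OF A.kalg_axioms B.kalg_axioms])

sublocale T: kalg T by (rule kalg.intro[OF tensor_construction.kalgebra_T[OF construction]])

lemmas pt_closed [simp] = tensor_construction.pt_closed[OF construction]
  and tensor_induct [consumes 1, case_names pure add] = tensor_construction.tensor_induct[OF construction]
  and pt_left = tensor_construction.pt_left[OF construction]
  and pt_right = tensor_construction.pt_right[OF construction]
  and pt_add_left = tensor_construction.pt_add_left[OF construction]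
  and pt_add_right = tensor_construction.pt_add_right[OF construction]
  and pt_smult_left = tensor_construction.pt_smult_left[OF construction]
  and pt_smult_right = tensor_construction.pt_smult_right[OF construction]
  and pt_zero_left = tensor_construction.pt_zero_left[OF construction]
  and pt_zero_right = tensor_construction.pt_zero_right[OF construction]
  and pt_finsum_left = tensor_construction.pt_finsum_left[OF construction]
  and pt_finsum_right = tensor_construction.pt_finsum_right[OF construction]
  and pt_mult = tensor_construction.pt_mult[OF construction]
  and T_one = tensor_construction.T_one[OF construction]
  and lin_hom_tensor_eq = tensor_construction.lin_hom_tensor_eq[OF construction]
  and tensor_lift = tensor_construction.tensor_lift[OF construction]
  and lin_hom_tensor_alg_hom = tensor_construction.lin_hom_tensor_alg_hom[OF construction]

end

lemma two_algsI: "kalgebra A \<Longrightarrow> kalgebra B \<Longrightarrow> two_algs A B"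
  by (simp add: two_algs_def kalg_def)

lemma kalgebra_tensor: "kalgebra A \<Longrightarrow> kalgebra B \<Longrightarrow> kalgebra (tensor A B)"
  using tensor_construction.kalgebra_T[OF tensor_construction.intro] by (simp add: kalg_def)

lemma lin_hom_sum:
  assumes "kalgebra B" "f \<in> lin_hom A B" "g \<in> lin_hom A B"
  shows "(\<lambda>x. f x \<oplus>\<^sub>B g x) \<in> lin_hom A B"
proof -
  interpret B: kalg B by (simp add: kalg_def assms)
  show ?thesis using lin_hom_closed[OF assms(2)] lin_hom_closed[OF assms(3)]
    by (intro lin_homI)
      (auto simp: lin_hom_add[OF assms(2)] lin_hom_add[OF assms(3)] lin_hom_smult[OF assms(2)]
        lin_hom_smult[OF assms(3)] B.smult_add_right B.a_ac)
qed

lemma lin_hom_scale: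
  assumes "kalgebra B" "f \<in> lin_hom A B"
  shows "(\<lambda>x. c \<odot>\<^sub>B f x) \<in> lin_hom A B"
proof -
  interpret B: kalg B by (simp add: kalg_def assms)
  show ?thesis using lin_hom_closed[OF assms(2)]
    by (intro lin_homI)
      (auto simp: lin_hom_add[OF assms(2)] lin_hom_smult[OF assms(2)] B.smult_add_right B.smult_smult mult.commute)
qed

lemma lin_hom_mult_left:
  assumes "kalgebra A" "y \<in> carrier A"
  shows "(\<lambda>x. y \<otimes>\<^sub>A x) \<in> lin_hom A A"
proof -
  interpret A: kalg A by (simp add: kalg_def assms)
  show ?thesis using assms by (intro lin_homI) (auto simp: A.r_distr A.mult_smult_right)
qed

lemma lin_hom_mult_right:
  assumes "kalgebra A" "y \<in> carrier A"
  shows "(\<lambda>x. x \<otimes>\<^sub>A y) \<in> lin_hom A A"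
proof -
  interpret A: kalg A by (simp add: kalg_def assms)
  show ?thesis using assms by (intro lin_homI) (auto simp: A.l_distr A.mult_smult_left)
qed

lemma lin_hom_inv_into:
  assumes "kalgebra A" "kalgebra B" "f \<in> lin_hom A B" "bij_betw f (carrier A) (carrier B)"
  shows "inv_into (carrier A) f \<in> lin_hom B A"
proof (rule lin_homI)
  interpret A: kalg A by (simp add: kalg_def assms)
  interpret B: kalg B by (simp add: kalg_def assms)
  let ?g = "inv_into (carrier A) f"
  have im: "f ` carrier A = carrier B" and inj: "inj_on f (carrier A)"
    using assms(4) by (auto simp: bij_betw_def)
  have g: "?g y \<in> carrier A" "f (?g y) = y" if "y \<in> carrier B" for y
    using that im by (auto intro: inv_into_into f_inv_into_f)
  have eq: "?g z = x" if "x \<in> carrier A" "f x = z" for x z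
    using inv_into_f_f[OF inj that(1)] that(2) by simp
  fix x y c assume x: "x \<in> carrier B"
  show "?g x \<in> carrier A" using g x by simp
  show "?g (c \<odot>\<^sub>B x) = c \<odot>\<^sub>A ?g x" using g x by (intro eq) (auto simp: lin_hom_smult[OF assms(3)])
  assume "y \<in> carrier B"
  then show "?g (x \<oplus>\<^sub>B y) = ?g x \<oplus>\<^sub>A ?g y"
    using g x by (intro eq) (auto simp: lin_hom_add[OF assms(3)])
qed

lemma alg_hom_inv_into:
  assumes "kalgebra A" "kalgebra B" "f \<in> alg_hom A B" "bij_betw f (carrier A) (carrier B)"
  shows "inv_into (carrier A) f \<in> alg_hom B A"
proof (rule alg_homI)
  interpret A: kalg A by (simp add: kalg_def assms)
  interpret B: kalg B by (simp add: kalg_def assms)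
  let ?g = "inv_into (carrier A) f"
  have im: "f ` carrier A = carrier B" and inj: "inj_on f (carrier A)"
    using assms(4) by (auto simp: bij_betw_def)
  have g: "?g y \<in> carrier A" "f (?g y) = y" if "y \<in> carrier B" for y
    using that im by (auto intro: inv_into_into f_inv_into_f)
  have eq: "?g z = x" if "x \<in> carrier A" "f x = z" for x z
    using inv_into_f_f[OF inj that(1)] that(2) by simp
  show "?g \<in> lin_hom B A" by (rule lin_hom_inv_into[OF assms(1,2) alg_hom_lin[OF assms(3)] assms(4)])
  show "?g \<one>\<^sub>B = \<one>\<^sub>A" by (rule eq) (auto simp: alg_hom_one[OF assms(3)])
  fix x y assume "x \<in> carrier B" "y \<in> carrier B"
  then show "?g (x \<otimes>\<^sub>B y) = ?g x \<otimes>\<^sub>A ?g y"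
    using g by (intro eq) (auto simp: alg_hom_mult[OF assms(3)])
qed

lemma tensor_map:
  assumes "kalgebra A" "kalgebra B" "kalgebra C" "kalgebra D" "f \<in> lin_hom A C" "g \<in> lin_hom B D"
  shows "tensor_map C D f g \<in> lin_hom (tensor A B) (tensor C D)"
    and "\<And>a b. a \<in> carrier A \<Longrightarrow> b \<in> carrier B \<Longrightarrow>
      tensor_map C D f g (pure_tensor A B a b) = pure_tensor C D (f a) (g b)"
proof -
  interpret AB: two_algs A B by (rule two_algsI[OF assms(1,2)])
  interpret CD: two_algs C D by (rule two_algsI[OF assms(3,4)])
  have b: "bilin A B CD.T (\<lambda>x y. CD.pt (f x) (g y))"
    using lin_hom_closed[OF assms(5)] lin_hom_closed[OF assms(6)]
    by (intro bilinI lin_hom_comp[OF assms(5) CD.pt_left] lin_hom_comp[OF assms(6) CD.pt_right])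
  note tl = AB.tensor_lift[OF CD.T.kalgebra b]
  show "tensor_map C D f g \<in> lin_hom (tensor A B) (tensor C D)"
    unfolding tensor_map_def by (rule tl(1))
  show "\<And>a b. a \<in> carrier A \<Longrightarrow> b \<in> carrier B \<Longrightarrow>
      tensor_map C D f g (pure_tensor A B a b) = pure_tensor C D (f a) (g b)"
    unfolding tensor_map_def by (rule tl(2))
qed

lemma tensor_map_alg_hom:
  assumes "kalgebra A" "kalgebra B" "kalgebra C" "kalgebra D" "f \<in> alg_hom A C" "g \<in> alg_hom B D"
  shows "tensor_map C D f g \<in> alg_hom (tensor A B) (tensor C D)"
proof -
  interpret AB: two_algs A B by (rule two_algsI[OF assms(1,2)])
  interpret CD: two_algs C D by (rule two_algsI[OF assms(3,4)])
  note tm = tensor_map[OF assms(1-4) alg_hom_lin[OF assms(5)] alg_hom_lin[OF assms(6)]]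
  show ?thesis
    by (rule AB.lin_hom_tensor_alg_hom[OF CD.T.kalgebra tm(1)])
      (simp_all add: tm(2) alg_hom_mult[OF assms(5)] alg_hom_mult[OF assms(6)] CD.pt_mult
        alg_hom_closed[OF assms(5)] alg_hom_closed[OF assms(6)] alg_hom_one[OF assms(5)]
        alg_hom_one[OF assms(6)] CD.T_one)
qed

lemma tensor_assoc:
  assumes "kalgebra A" "kalgebra B" "kalgebra C"
  shows "tensor_assoc A B C \<in> alg_hom (tensor (tensor A B) C) (tensor A (tensor B C))"
    and "\<And>a b c. a \<in> carrier A \<Longrightarrow> b \<in> carrier B \<Longrightarrow> c \<in> carrier C \<Longrightarrow>
      tensor_assoc A B C (pure_tensor (tensor A B) C (pure_tensor A B a b) c) =
      pure_tensor A (tensor B C) a (pure_tensor B C b c)"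
proof -
  interpret AB: two_algs A B by (rule two_algsI[OF assms(1,2)])
  interpret BC: two_algs B C by (rule two_algsI[OF assms(2,3)])
  interpret L: two_algs "tensor A B" C by (rule two_algsI[OF AB.T.kalgebra assms(3)])
  interpret R: two_algs A "tensor B C" by (rule two_algsI[OF assms(1) BC.T.kalgebra])
  define \<beta> where "\<beta> c = tensor_lift R.T (\<lambda>a b. R.pt a (BC.pt b c))" for c
  have bil: "bilin A B R.T (\<lambda>a b. R.pt a (BC.pt b c))" if "c \<in> carrier C" for c
    using that by (intro bilinI R.pt_left lin_hom_comp[OF BC.pt_left R.pt_right]) auto
  have h: "\<beta> c \<in> lin_hom AB.T R.T" if "c \<in> carrier C" for c
    unfolding \<beta>_def by (rule AB.tensor_lift(1)[OF R.T.kalgebra bil[OF that]])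
  have p: "\<beta> c (AB.pt a b) = R.pt a (BC.pt b c)" if "a \<in> carrier A" "b \<in> carrier B" "c \<in> carrier C" for a b c
    unfolding \<beta>_def by (rule AB.tensor_lift(2)[OF R.T.kalgebra bil[OF that(3)] that(1,2)])
  have bil2: "bilin AB.T C R.T (\<lambda>X c. \<beta> c X)"
  proof (rule bilinI)
    fix X assume X: "X \<in> carrier AB.T"
    show "(\<lambda>c. \<beta> c X) \<in> lin_hom C R.T"
    proof (rule lin_homI)
      fix c d s assume c: "c \<in> carrier C"
      show "\<beta> c X \<in> carrier R.T" using lin_hom_closed[OF h] c X by simp
      show "\<beta> (s \<odot>\<^sub>C c) X = s \<odot>\<^bsub>R.T\<^esub> \<beta> c X"
        by (rule AB.lin_hom_tensor_eq[OF h lin_hom_scale[OF R.T.kalgebra h] _ X])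
          (use c in \<open>simp_all add: p BC.pt_smult_right R.pt_smult_right\<close>)
      assume d: "d \<in> carrier C"
      show "\<beta> (c \<oplus>\<^sub>C d) X = \<beta> c X \<oplus>\<^bsub>R.T\<^esub> \<beta> d X"
        by (rule AB.lin_hom_tensor_eq[OF h lin_hom_sum[OF R.T.kalgebra h h] _ X])
          (use c d in \<open>simp_all add: p BC.pt_add_right R.pt_add_right\<close>)
    qed
  qed (rule h)
  have d: "tensor_assoc A B C = tensor_lift R.T (\<lambda>X c. \<beta> c X)"
    by (simp add: tensor_assoc_def \<beta>_def)
  note tl = L.tensor_lift[OF R.T.kalgebra bil2, folded d]
  show val: "\<And>a b c. a \<in> carrier A \<Longrightarrow> b \<in> carrier B \<Longrightarrow> c \<in> carrier C \<Longrightarrow>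
      tensor_assoc A B C (L.pt (AB.pt a b) c) = R.pt a (BC.pt b c)"
    by (simp add: tl(2) p)
  have bm: "\<beta> (c \<otimes>\<^sub>C c') (X \<otimes>\<^bsub>AB.T\<^esub> X') = \<beta> c X \<otimes>\<^bsub>R.T\<^esub> \<beta> c' X'"
    if X: "X \<in> carrier AB.T" and X': "X' \<in> carrier AB.T" and c: "c \<in> carrier C" "c' \<in> carrier C" for X X' c c'
    using X
  proof (induction rule: AB.tensor_induct)
    case (pure a b)
    from X' show ?case
      by (induction rule: AB.tensor_induct)
        (use pure c in \<open>simp_all add: p AB.pt_mult R.pt_mult BC.pt_mult AB.T.r_distr R.T.r_distr
          lin_hom_add[OF h] lin_hom_closed[OF h]\<close>)
  next
    case (add X Y)
    then show ?case using X' c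
      by (simp add: AB.T.l_distr R.T.l_distr lin_hom_add[OF h] lin_hom_closed[OF h])
  qed
  show "tensor_assoc A B C \<in> alg_hom L.T R.T"
  proof (rule L.lin_hom_tensor_alg_hom[OF R.T.kalgebra tl(1)])
    show "tensor_assoc A B C (L.pt \<one>\<^bsub>AB.T\<^esub> \<one>\<^sub>C) = \<one>\<^bsub>R.T\<^esub>"
      by (simp add: AB.T_one val R.T_one BC.T_one)
  qed (simp add: tl(2) bm)
qed

lemma tensor_lift_alg_hom:
  assumes "kalgebra A" "kalgebra B" and C: "kalgebra C" and b: "bilin A B C \<beta>"
    and "\<And>a b a' b'. a \<in> carrier A \<Longrightarrow> b \<in> carrier B \<Longrightarrow> a' \<in> carrier A \<Longrightarrow> b' \<in> carrier B \<Longrightarrow>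
      \<beta> (a \<otimes>\<^sub>A a') (b \<otimes>\<^sub>B b') = \<beta> a b \<otimes>\<^sub>C \<beta> a' b'"
    and "\<beta> \<one>\<^sub>A \<one>\<^sub>B = \<one>\<^sub>C"
  shows "tensor_lift C \<beta> \<in> alg_hom (tensor A B) C"
proof -
  interpret AB: two_algs A B by (rule two_algsI[OF assms(1,2)])
  note tl = AB.tensor_lift[OF C b]
  show ?thesis
    by (rule AB.lin_hom_tensor_alg_hom[OF C tl(1)]) (simp_all add: tl(2) assms(5,6))
qed

text \<open>Hopf algebras and comodule algebras are extended records; this passes to the underlying algebras.\<close>

lemma tensor_cong:
  assumes "carrier A = carrier A'" "mult A = mult A'" "one A = one A'" "zero A = zero A'" "add A = add A'"
    "module.smult A = module.smult A'"
    "carrier B = carrier B'" "mult B = mult B'" "one B = one B'" "zero B = zero B'" "add B = add B'"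
    "module.smult B = module.smult B'"
  shows "tensor A B = tensor A' B'" "pure_tensor A B = pure_tensor A' B'"
proof -
  have p: "pair_alg A B = pair_alg A' B'"
    by (simp add: pair_alg_def DirProd_def assms)
  have i: "bilin_ideal A B = bilin_ideal A' B'"
    unfolding bilin_ideal_def bilin_rels_def by (simp add: p assms)
  show "tensor A B = tensor A' B'" "pure_tensor A B = pure_tensor A' B'"
    by (simp_all add: tensor_def pure_tensor_def p i fun_eq_iff)
qed

lemma finsum_cong_algebra:
  assumes "carrier A = carrier A'" "zero A = zero A'" "add A = add A'"
  shows "finsum A f S = finsum A' f S"
proof -
  have "carrier (add_monoid A) = carrier (add_monoid A')" "one (add_monoid A) = one (add_monoid A')"
    "mult (add_monoid A) = mult (add_monoid A')" by (simp_all add: assms)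
  then show ?thesis by (simp add: finsum_def finprod_def)
qed

section \<open>Presented algebras\<close>

abbreviation word_prod where
  "word_prod B g w \<equiv> foldr (\<lambda>x y. g x \<otimes>\<^sub>B y) w \<one>\<^sub>B"

lemma monoid_free_monoid: "monoid (free_monoid S)"
  by (rule monoid.intro) (auto simp: free_monoid_def)

lemma free_monoid_simps [simp]:
  "carrier (free_monoid S) = lists S" "mult (free_monoid S) = (@)" "one (free_monoid S) = []"
  by (simp_all add: free_monoid_def)

locale presentation =
  fixes S :: "'g set" and R :: "('g list \<Rightarrow> 'k::field) set"
  assumes R: "R \<subseteq> carrier (free_alg S)"
begin

sublocale MQ: monoid_quot "free_monoid S" R
  by (rule monoid_quot.intro) (use R monoid_free_monoid in \<open>auto simp: free_alg_def\<close>)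

abbreviation "A \<equiv> pres_alg S R :: ('k, ('g list \<Rightarrow> 'k) set) module"

lemma A_eq: "A = MQ.Q" by (simp add: pres_alg_def free_alg_def)

sublocale A: kalg A by (simp add: kalg_def A_eq MQ.Q)

lemma gen_eq: "pres_gen S R x = MQ.I +>\<^bsub>MQ.P\<^esub> delta [x]" by (simp add: pres_gen_def free_alg_def)

lemma proj: "(\<lambda>x. MQ.I +>\<^bsub>MQ.P\<^esub> x) \<in> alg_hom (free_alg S) A"
  using MQ.proj by (simp add: A_eq free_alg_def)

lemma proj_rel: "r \<in> R \<Longrightarrow> MQ.I +>\<^bsub>MQ.P\<^esub> r = \<zero>\<^sub>A"
  using MQ.proj_rel by (simp add: A_eq)

lemma gen_closed [simp]: "x \<in> S \<Longrightarrow> pres_gen S R x \<in> carrier A"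
  unfolding A_eq gen_eq by (intro alg_hom_closed[OF MQ.proj]) simp

lemma delta_word: "w \<in> lists S \<Longrightarrow> MQ.I +>\<^bsub>MQ.P\<^esub> delta w = word_prod A (pres_gen S R) w"
proof (induction w)
  case Nil
  then show ?case using alg_hom_one[OF MQ.proj] by (simp add: A_eq monoid_alg_simps)
next
  case (Cons x w)
  have "MQ.I +>\<^bsub>MQ.P\<^esub> delta (x # w) = (MQ.I +>\<^bsub>MQ.P\<^esub> delta [x]) \<otimes>\<^sub>A (MQ.I +>\<^bsub>MQ.P\<^esub> delta w)"
    using Cons by (subst alg_hom_mult[OF MQ.proj, folded A_eq, symmetric]) (auto simp: delta_mult)
  then show ?case using Cons by (simp add: gen_eq)
qed

lemma pres_induct [consumes 1, case_names one gen add scale]: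
  assumes X: "X \<in> carrier A" and one: "H \<one>\<^sub>A"
    and gen: "\<And>x Y. x \<in> S \<Longrightarrow> Y \<in> carrier A \<Longrightarrow> H Y \<Longrightarrow> H (pres_gen S R x \<otimes>\<^sub>A Y)"
    and add: "\<And>X Y. X \<in> carrier A \<Longrightarrow> Y \<in> carrier A \<Longrightarrow> H X \<Longrightarrow> H Y \<Longrightarrow> H (X \<oplus>\<^sub>A Y)"
    and scale: "\<And>c X. X \<in> carrier A \<Longrightarrow> H X \<Longrightarrow> H (c \<odot>\<^sub>A X)"
  shows "H X"
proof -
  have w: "word_prod A (pres_gen S R) w \<in> carrier A \<and> H (word_prod A (pres_gen S R) w)" if "w \<in> lists S" for w
    using that by (induction w) (auto intro: one gen)
  show ?thesis
    using X unfolding A_eq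
  proof (induction rule: MQ.quot_induct)
    case zero
    show ?case using scale[OF A.one_closed one, of 0] A.zero_smult[OF A.one_closed] by (simp add: A_eq)
  next
    case (step c s X)
    then have s: "s \<in> lists S" by simp
    show ?case using step w[OF s] delta_word[OF s] add scale A.smult_closed by (simp add: A_eq)
  qed
qed

lemma alg_hom_pres_eq:
  assumes "f \<in> alg_hom A C" "g \<in> alg_hom A C"
    "\<And>x. x \<in> S \<Longrightarrow> f (pres_gen S R x) = g (pres_gen S R x)" "X \<in> carrier A"
  shows "f X = g X"
  using assms(4)
  by (induction rule: pres_induct)
    (simp_all add: assms(3) alg_hom_one[OF assms(1)] alg_hom_one[OF assms(2)] alg_hom_mult[OF assms(1)]
      alg_hom_mult[OF assms(2)] lin_hom_add[OF alg_hom_lin[OF assms(1)]] lin_hom_add[OF alg_hom_lin[OF assms(2)]]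
      lin_hom_smult[OF alg_hom_lin[OF assms(1)]] lin_hom_smult[OF alg_hom_lin[OF assms(2)]])

end

lemma word_prod_closed:
  assumes "kalgebra C" "\<And>x. x \<in> S \<Longrightarrow> g x \<in> carrier C" "w \<in> lists S"
  shows "word_prod C g w \<in> carrier C"
proof -
  interpret C: kalg C by (simp add: kalg_def assms)
  show ?thesis using assms(3,2) by (induction w) auto
qed

lemma word_prod_append:
  assumes "kalgebra C" "\<And>x. x \<in> S \<Longrightarrow> g x \<in> carrier C" "v \<in> lists S" "w \<in> lists S"
  shows "word_prod C g (v @ w) = word_prod C g v \<otimes>\<^sub>C word_prod C g w"
proof -
  interpret C: kalg C by (simp add: kalg_def assms)
  have cl: "word_prod C g w \<in> carrier C" if "w \<in> lists S" for w
    using word_prod_closed[of C S g w] assms(1,2) that by blast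
  show ?thesis using assms(3)
  proof (induction v)
    case Nil
    then show ?case using cl[OF assms(4)] by simp
  next
    case (Cons x v)
    then show ?case using cl[OF assms(4)] cl[of v] assms(2)[of x] by (simp add: C.m_assoc)
  qed
qed

lemma free_alg_hom:
  fixes C :: "('k::field, 'c, 'z) module_scheme"
  assumes C: "kalgebra C" and g: "\<And>x. x \<in> S \<Longrightarrow> g x \<in> carrier C"
  shows "lin_ext C (word_prod C g) \<in> alg_hom (free_alg S) C"
    and "\<And>x. x \<in> S \<Longrightarrow> lin_ext C (word_prod C g) (delta [x]) = g x"
proof -
  let ?L = "lin_ext C (word_prod C g)" and ?P = "monoid_alg (free_monoid S) :: ('k, 'a list \<Rightarrow> 'k) module"
  interpret C: kalg C by (simp add: kalg_def C)
  interpret P: kalg ?P by (simp add: kalg_def kalgebra_monoid_alg monoid_free_monoid)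
  have cl: "word_prod C g w \<in> carrier C" if "w \<in> lists S" for w
    using word_prod_closed[of C S g w] C g that by blast
  have ap: "word_prod C g (v @ w) = word_prod C g v \<otimes>\<^sub>C word_prod C g w"
    if "v \<in> lists S" "w \<in> lists S" for v w
    using word_prod_append[of C S g v w] C g that by blast
  have L: "?L \<in> lin_hom ?P C" by (rule lin_ext_lin_hom[OF C]) (use cl in auto)
  have d: "?L (delta w) = word_prod C g w" if "w \<in> lists S" for w
    using that cl by (intro lin_ext_delta[OF C]) auto
  have m1: "?L (delta w \<otimes>\<^bsub>?P\<^esub> f) = word_prod C g w \<otimes>\<^sub>C ?L f" if w: "w \<in> lists S" and f: "f \<in> carrier ?P" for w f
  proof (rule lin_hom_monoid_alg_eq[OF monoid_free_monoid C _ _ _ f])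
    show "(\<lambda>f. ?L (delta w \<otimes>\<^bsub>?P\<^esub> f)) \<in> lin_hom ?P C"
      using w by (intro lin_hom_comp[OF lin_hom_mult_left L] P.kalgebra) simp
    show "(\<lambda>f. word_prod C g w \<otimes>\<^sub>C ?L f) \<in> lin_hom ?P C"
      using w by (intro lin_hom_comp[OF L lin_hom_mult_left] C cl)
    show "\<And>s. s \<in> carrier (free_monoid S) \<Longrightarrow> ?L (delta w \<otimes>\<^bsub>?P\<^esub> delta s) = word_prod C g w \<otimes>\<^sub>C ?L (delta s)"
      using w ap by (simp add: delta_mult d del: foldr_append)
  qed
  have "?L \<in> alg_hom ?P C"
  proof (rule alg_homI[OF L])
    fix f h assume f: "f \<in> carrier ?P" and h: "h \<in> carrier ?P"
    show "?L (f \<otimes>\<^bsub>?P\<^esub> h) = ?L f \<otimes>\<^sub>C ?L h"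
    proof (rule lin_hom_monoid_alg_eq[OF monoid_free_monoid C _ _ _ f])
      show "(\<lambda>f. ?L (f \<otimes>\<^bsub>?P\<^esub> h)) \<in> lin_hom ?P C"
        using h by (intro lin_hom_comp[OF lin_hom_mult_right L] P.kalgebra)
      show "(\<lambda>f. ?L f \<otimes>\<^sub>C ?L h) \<in> lin_hom ?P C"
        using h by (intro lin_hom_comp[OF L lin_hom_mult_right] C lin_hom_closed[OF L])
    qed (use h in \<open>simp add: m1 d\<close>)
  next
    show "?L \<one>\<^bsub>?P\<^esub> = \<one>\<^sub>C" using d[of "[]"] by (simp add: monoid_alg_simps)
  qed
  then show "?L \<in> alg_hom (free_alg S) C" by (simp add: free_alg_def)
  show "\<And>x. x \<in> S \<Longrightarrow> ?L (delta [x]) = g x" using d g by simp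
qed

lemma (in presentation) pres_lift:
  fixes C :: "('k, 'c, 'z) module_scheme"
  assumes C: "kalgebra C" and g: "\<And>x. x \<in> S \<Longrightarrow> g x \<in> carrier C"
    and rel: "\<And>r. r \<in> R \<Longrightarrow> lin_ext C (word_prod C g) r = \<zero>\<^sub>C"
  shows "pres_lift C g \<in> alg_hom A C" and "\<And>x. x \<in> S \<Longrightarrow> pres_lift C g (pres_gen S R x) = g x"
proof -
  interpret C: kalg C by (simp add: kalg_def C)
  interpret P: kalg MQ.P by (simp add: kalg_def MQ.P)
  let ?L = "lin_ext C (word_prod C g)"
  have cl: "word_prod C g w \<in> carrier C" if "w \<in> lists S" for w
    using word_prod_closed[of C S g w] C g that by blast
  have ap: "word_prod C g (v @ w) = word_prod C g v \<otimes>\<^sub>C word_prod C g w"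
    if "v \<in> lists S" "w \<in> lists S" for v w
    using word_prod_append[of C S g v w] C g that by blast
  have hom: "?L \<in> alg_hom MQ.P C" using free_alg_hom(1)[OF C g] by (simp add: free_alg_def)
  note L = alg_hom_lin[OF hom]
  have b: "\<And>s. s \<in> carrier (free_monoid S) \<Longrightarrow> word_prod C g s \<in> carrier C" using cl by simp
  have kill: "lin_ext C (\<lambda>x. word_prod C g (s \<otimes>\<^bsub>free_monoid S\<^esub> x \<otimes>\<^bsub>free_monoid S\<^esub> t)) r = \<zero>\<^sub>C"
    if r: "r \<in> R" and s: "s \<in> carrier (free_monoid S)" and t: "t \<in> carrier (free_monoid S)" for r s t
  proof -
    have rc: "r \<in> carrier MQ.P" using r MQ.R by auto
    have "lin_ext C (\<lambda>x. word_prod C g (s \<otimes>\<^bsub>free_monoid S\<^esub> x \<otimes>\<^bsub>free_monoid S\<^esub> t)) r =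
      word_prod C g s \<otimes>\<^sub>C ?L r \<otimes>\<^sub>C word_prod C g t"
    proof (rule lin_hom_monoid_alg_eq[OF MQ.M C lin_ext_lin_hom[OF C] _ _ rc])
      show "(\<lambda>r. word_prod C g s \<otimes>\<^sub>C ?L r \<otimes>\<^sub>C word_prod C g t) \<in> lin_hom MQ.P C"
        using s t b by (intro lin_hom_comp[OF lin_hom_comp[OF L lin_hom_mult_left] lin_hom_mult_right] C)
      show "lin_ext C (\<lambda>x. word_prod C g (s \<otimes>\<^bsub>free_monoid S\<^esub> x \<otimes>\<^bsub>free_monoid S\<^esub> t)) (delta x) =
        word_prod C g s \<otimes>\<^sub>C ?L (delta x) \<otimes>\<^sub>C word_prod C g t" if x: "x \<in> carrier (free_monoid S)" for x
        using that s t cl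
        by (subst (1 2) lin_ext_delta[OF C]) (auto simp: ap C.m_assoc simp del: foldr_append)
    qed (use s t cl in \<open>auto simp del: foldr_append\<close>)
    then show ?thesis using rel[OF r] s t cl by simp
  qed
  have e: "quot_ext C (word_prod C g) (MQ.I +>\<^bsub>MQ.P\<^esub> f) = ?L f" if "f \<in> carrier MQ.P" for f
    by (rule MQ.quot_ext_proj[OF C], erule b, rule kill) (use that in simp_all)
  have lift: "pres_lift C g = quot_ext C (word_prod C g)" by (simp add: pres_lift_def)
  note pr = MQ.proj[folded A_eq]
  show "pres_lift C g \<in> alg_hom A C"
  proof (rule alg_homI)
    show "pres_lift C g \<in> lin_hom A C" unfolding lift A_eq by (rule MQ.quot_ext_lin_hom[OF C b kill])
    show "pres_lift C g \<one>\<^sub>A = \<one>\<^sub>C"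
      using e[OF P.one_closed] alg_hom_one[OF hom] alg_hom_one[OF pr] by (simp add: lift)
    fix x y assume "x \<in> carrier A" "y \<in> carrier A"
    then obtain p q where "p \<in> carrier MQ.P" "q \<in> carrier MQ.P" "x = MQ.I +>\<^bsub>MQ.P\<^esub> p" "y = MQ.I +>\<^bsub>MQ.P\<^esub> q"
      unfolding A_eq MQ.carrier_Q by auto
    then show "pres_lift C g (x \<otimes>\<^sub>A y) = pres_lift C g x \<otimes>\<^sub>C pres_lift C g y"
      using e alg_hom_mult[OF hom] alg_hom_mult[OF pr, symmetric] by (simp add: lift)
  qed
  show "\<And>x. x \<in> S \<Longrightarrow> pres_lift C g (pres_gen S R x) = g x"
    unfolding lift gen_eq by (subst MQ.quot_ext_delta[OF C b kill]) (use g in auto)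
qed

section \<open>Matrices with entries in an algebra\<close>

definition amul :: "('k::field, 'a, 'z) module_scheme \<Rightarrow> 'a mat \<Rightarrow> 'a mat \<Rightarrow> 'a mat" (infixl "\<star>\<index>" 70)
  where "X \<star>\<^sub>A Y = mat (dim_row X) (dim_col Y) (\<lambda>(i, j). \<Oplus>\<^sub>A l\<in>{..<dim_row Y}. X $$ (i, l) \<otimes>\<^sub>A Y $$ (l, j))"

definition scal :: "('k::field, 'a, 'z) module_scheme \<Rightarrow> 'k mat \<Rightarrow> 'a mat" where
  "scal A M = map_mat (\<lambda>c. c \<odot>\<^sub>A \<one>\<^sub>A) M"

definition entries :: "('k::field, 'a, 'z) module_scheme \<Rightarrow> 'a mat \<Rightarrow> bool" where
  "entries A X \<longleftrightarrow> (\<forall>i<dim_row X. \<forall>j<dim_col X. X $$ (i, j) \<in> carrier A)"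

lemma amul_dims [simp]: "dim_row (X \<star>\<^sub>A Y) = dim_row X" "dim_col (X \<star>\<^sub>A Y) = dim_col Y"
  by (simp_all add: amul_def)

lemma scal_dims [simp]: "dim_row (scal A M) = dim_row M" "dim_col (scal A M) = dim_col M"
  by (simp_all add: scal_def)

lemma scal_index [simp]: "i < dim_row M \<Longrightarrow> j < dim_col M \<Longrightarrow> scal A M $$ (i, j) = M $$ (i, j) \<odot>\<^sub>A \<one>\<^sub>A"
  by (simp add: scal_def)

lemma entriesD: "entries A X \<Longrightarrow> i < dim_row X \<Longrightarrow> j < dim_col X \<Longrightarrow> X $$ (i, j) \<in> carrier A"
  by (simp add: entries_def)

lemma entries_transpose [simp]: "entries A X\<^sup>T = entries A X"
  by (auto simp: entries_def)

lemma transpose_scal [simp]: "(scal A M)\<^sup>T = scal A M\<^sup>T"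
  by (rule eq_matI) auto

context kalg
begin

lemma amul_index:
  "i < dim_row X \<Longrightarrow> j < dim_col Y \<Longrightarrow> (X \<star> Y) $$ (i, j) = (\<Oplus>l\<in>{..<dim_row Y}. X $$ (i, l) \<otimes> Y $$ (l, j))"
  by (simp add: amul_def)

lemma entries_scal [simp]: "entries A (scal A M)"
  by (simp add: entries_def)

lemma entries_amul [simp]: "dim_col X = dim_row Y \<Longrightarrow> entries A X \<Longrightarrow> entries A Y \<Longrightarrow> entries A (X \<star> Y)"
  by (auto simp: entries_def amul_index intro!: finsum_closed)

lemma amul_assoc:
  assumes "dim_col X = dim_row Y" "dim_col Y = dim_row Z" "entries A X" "entries A Y" "entries A Z"
  shows "X \<star> Y \<star> Z = X \<star> (Y \<star> Z)"
proof (rule eq_matI)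
  fix i j assume "i < dim_row (X \<star> (Y \<star> Z))" "j < dim_col (X \<star> (Y \<star> Z))"
  then have ij: "i < dim_row X" "j < dim_col Z" by auto
  note [simp] = entriesD[OF assms(3)] entriesD[OF assms(4)] entriesD[OF assms(5)] assms(1,2)
  have "(X \<star> Y \<star> Z) $$ (i, j) = (\<Oplus>k\<in>{..<dim_row Z}. \<Oplus>l\<in>{..<dim_row Y}. X $$ (i, l) \<otimes> Y $$ (l, k) \<otimes> Z $$ (k, j))"
    using ij by (subst amul_index) (auto intro!: finsum_cong' finsum_closed simp: amul_index finsum_ldistr Pi_def)
  also have "\<dots> = (\<Oplus>l\<in>{..<dim_row Y}. \<Oplus>k\<in>{..<dim_row Z}. X $$ (i, l) \<otimes> Y $$ (l, k) \<otimes> Z $$ (k, j))"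
    using ij by (intro finsum_swap) auto
  also have "\<dots> = (\<Oplus>l\<in>{..<dim_row Y}. X $$ (i, l) \<otimes> (\<Oplus>k\<in>{..<dim_row Z}. Y $$ (l, k) \<otimes> Z $$ (k, j)))"
    using ij by (auto intro!: finsum_cong' finsum_closed simp: finsum_rdistr m_assoc Pi_def)
  also have "\<dots> = (X \<star> (Y \<star> Z)) $$ (i, j)"
    using ij by (subst amul_index) (auto intro!: finsum_cong' finsum_closed simp: amul_index Pi_def)
  finally show "(X \<star> Y \<star> Z) $$ (i, j) = (X \<star> (Y \<star> Z)) $$ (i, j)" .
qed auto

lemma amul_one_left [simp]: "dim_row X = n \<Longrightarrow> entries A X \<Longrightarrow> scal A (1\<^sub>m n) \<star> X = X"
proof (rule eq_matI)
  fix i j assume X: "dim_row X = n" "entries A X" and ij: "i < dim_row X" "j < dim_col X"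
  show "(scal A (1\<^sub>m n) \<star> X) $$ (i, j) = X $$ (i, j)"
    using X ij entriesD[OF X(2)]
    by (subst amul_index) (auto intro!: finsum_delta[of _ i, THEN trans])
qed auto

lemma amul_one_right [simp]: "dim_col X = n \<Longrightarrow> entries A X \<Longrightarrow> X \<star> scal A (1\<^sub>m n) = X"
proof (rule eq_matI)
  fix i j assume X: "dim_col X = n" "entries A X" and ij: "i < dim_row X" "j < dim_col X"
  show "(X \<star> scal A (1\<^sub>m n)) $$ (i, j) = X $$ (i, j)"
    using X ij entriesD[OF X(2)]
    by (subst amul_index) (auto intro!: finsum_delta[of _ j, THEN trans])
qed auto

lemma scal_mult: "dim_col M = dim_row N \<Longrightarrow> scal A (M * N) = scal A M \<star> scal A N"
  by (rule eq_matI)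
    (auto simp: amul_index scalar_prod_def smult_sum_left mult_smult_left smult_smult lessThan_atLeast0
      intro!: finsum_cong')

text \<open>Scalars are central, so multiplying by a scalar matrix does not see the order of the product.\<close>

lemma amul_scal_index:
  "i < dim_row X \<Longrightarrow> j < dim_col M \<Longrightarrow> dim_col X = dim_row M \<Longrightarrow> entries A X \<Longrightarrow>
    (X \<star> scal A M) $$ (i, j) = (\<Oplus>l\<in>{..<dim_row M}. M $$ (l, j) \<odot> X $$ (i, l))"
  by (auto simp: amul_index mult_smult_right entriesD intro!: finsum_cong')

lemma scal_amul_index:
  "i < dim_row M \<Longrightarrow> j < dim_col X \<Longrightarrow> dim_col M = dim_row X \<Longrightarrow> entries A X \<Longrightarrow>
    (scal A M \<star> X) $$ (i, j) = (\<Oplus>l\<in>{..<dim_row X}. M $$ (i, l) \<odot> X $$ (l, j))"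
  by (auto simp: amul_index mult_smult_left entriesD intro!: finsum_cong')

lemma transpose_amul_scal:
  "dim_col X = dim_row M \<Longrightarrow> entries A X \<Longrightarrow>
    (X \<star> scal A M)\<^sup>T = scal A M\<^sup>T \<star> X\<^sup>T"
  by (rule eq_matI) (auto simp: amul_scal_index scal_amul_index entriesD intro!: finsum_cong')

lemma transpose_scal_amul:
  "dim_col M = dim_row X \<Longrightarrow> entries A X \<Longrightarrow>
    (scal A M \<star> X)\<^sup>T = X\<^sup>T \<star> scal A M\<^sup>T"
  by (rule eq_matI) (auto simp: amul_scal_index scal_amul_index entriesD intro!: finsum_cong')

lemma transpose_amul_commuting:
  assumes "dim_col X = dim_row Y" "entries A X" "entries A Y"
    "\<And>i j k l. i < dim_row X \<Longrightarrow> j < dim_col X \<Longrightarrow> k < dim_row Y \<Longrightarrow> l < dim_col Y \<Longrightarrow>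
      X $$ (i, j) \<otimes> Y $$ (k, l) = Y $$ (k, l) \<otimes> X $$ (i, j)"
  shows "(X \<star> Y)\<^sup>T = Y\<^sup>T \<star> X\<^sup>T"
  by (rule eq_matI)
    (use assms in \<open>auto simp: amul_index entriesD intro!: finsum_cong'\<close>)

end

lemma op_alg_simps [simp]:
  "carrier (op_alg A) = carrier A" "mult (op_alg A) = (\<lambda>x y. y \<otimes>\<^sub>A x)" "one (op_alg A) = one A"
  "zero (op_alg A) = zero A" "add (op_alg A) = add A" "module.smult (op_alg A) = module.smult A"
  by (simp_all add: op_alg_def)

lemma finsum_op_alg [simp]: "finsum (op_alg A) f S = finsum A f S"
  by (rule finsum_cong_algebra) simp_all

lemma (in kalg) amul_op_alg:
  "dim_col X = dim_row Y \<Longrightarrow> entries A X \<Longrightarrow> entries A Y \<Longrightarrow>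
    X \<star>\<^bsub>op_alg A\<^esub> Y = (Y\<^sup>T \<star> X\<^sup>T)\<^sup>T"
  by (rule eq_matI) (auto simp: amul_def entriesD intro!: finsum_cong')

lemma scal_op_alg [simp]: "scal (op_alg A) M = scal A M"
  by (simp add: scal_def)

lemma entries_op_alg [simp]: "entries (op_alg A) X = entries A X"
  by (simp add: entries_def)

lemma entries_map_mat: "f \<in> lin_hom A B \<Longrightarrow> entries A X \<Longrightarrow> entries B (map_mat f X)"
  by (auto simp: entries_def intro: lin_hom_closed)

lemma map_mat_amul:
  assumes "kalgebra A" "kalgebra B" "f \<in> alg_hom A B" "dim_col X = dim_row Y" "entries A X" "entries A Y"
  shows "map_mat f (X \<star>\<^sub>A Y) = map_mat f X \<star>\<^sub>B map_mat f Y"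
proof (rule eq_matI)
  interpret A: kalg A by (simp add: kalg_def assms)
  interpret B: kalg B by (simp add: kalg_def assms)
  fix i j assume "i < dim_row (map_mat f X \<star>\<^sub>B map_mat f Y)" "j < dim_col (map_mat f X \<star>\<^sub>B map_mat f Y)"
  then have ij: "i < dim_row X" "j < dim_col Y" by auto
  note [simp] = assms(4) entriesD[OF assms(5)] entriesD[OF assms(6)] alg_hom_mult[OF assms(3)] alg_hom_closed[OF assms(3)]
  have "map_mat f (X \<star>\<^sub>A Y) $$ (i, j) = f (\<Oplus>\<^sub>A l\<in>{..<dim_row Y}. X $$ (i, l) \<otimes>\<^sub>A Y $$ (l, j))"
    using ij by (simp add: A.amul_index)
  also have "\<dots> = (\<Oplus>\<^sub>B l\<in>{..<dim_row Y}. f (X $$ (i, l) \<otimes>\<^sub>A Y $$ (l, j)))"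
    using ij by (intro lin_hom_finsum[OF assms(1,2) alg_hom_lin[OF assms(3)]]) auto
  also have "\<dots> = (map_mat f X \<star>\<^sub>B map_mat f Y) $$ (i, j)"
    using ij by (subst B.amul_index) (auto intro!: B.finsum_cong')
  finally show "map_mat f (X \<star>\<^sub>A Y) $$ (i, j) = (map_mat f X \<star>\<^sub>B map_mat f Y) $$ (i, j)" .
qed auto

lemma map_mat_scal:
  assumes "kalgebra A" "f \<in> alg_hom A B"
  shows "map_mat f (scal A M) = scal B M"
proof -
  interpret A: kalg A by (simp add: kalg_def assms)
  show ?thesis
    by (rule eq_matI) (auto simp: lin_hom_smult[OF alg_hom_lin[OF assms(2)]] alg_hom_one[OF assms(2)])
qed

section \<open>Invertible matrices over the base field\<close>

lemma GL_inv:
  assumes "M \<in> GL n"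
  shows "M \<in> carrier_mat n n" "mat_inv M \<in> carrier_mat n n" "M * mat_inv M = 1\<^sub>m n" "mat_inv M * M = 1\<^sub>m n"
proof -
  show M: "M \<in> carrier_mat n n" using assms by (simp add: GL_def)
  obtain B where B: "inverts_mat M B" "inverts_mat B M" using assms by (auto simp: GL_def invertible_mat_def)
  then have "M * B = 1\<^sub>m n" "B * M = 1\<^sub>m (dim_row B)" using M by (auto simp: inverts_mat_def)
  moreover from this have "B \<in> carrier_mat n n"
    by (metis M carrier_matD(2) carrier_matI index_mult_mat(2,3) index_one_mat(2,3))
  ultimately have "M \<in> Units (ring_mat TYPE('a) n ())"
    using M by (auto simp: Units_def ring_mat_def)
  then obtain C where C: "mat_inverse M = Some C" using mat_inverse(1)[OF M, where b = "()"] by (cases "mat_inverse M") auto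
  from mat_inverse(2)[OF M C] show "mat_inv M \<in> carrier_mat n n" "M * mat_inv M = 1\<^sub>m n" "mat_inv M * M = 1\<^sub>m n"
    by (simp_all add: mat_inv_def C)
qed

lemma GL_I:
  assumes "M \<in> carrier_mat n n" "N \<in> carrier_mat n n" "M * N = 1\<^sub>m n" "N * M = 1\<^sub>m n"
  shows "M \<in> GL n" "mat_inv M = N"
proof -
  show M: "M \<in> GL n"
    using assms by (auto simp: GL_def invertible_mat_def inverts_mat_def intro!: exI[of _ N])
  have "mat_inv M = mat_inv M * (M * N)" using GL_inv[OF M] assms by simp
  also have "\<dots> = N" using GL_inv[OF M] assms by (subst assoc_mult_mat[symmetric]) auto
  finally show "mat_inv M = N" .
qed

lemma GL_dims: "M \<in> GL n \<Longrightarrow> dim_row M = n" "M \<in> GL n \<Longrightarrow> dim_col M = n"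
  "M \<in> GL n \<Longrightarrow> dim_row (mat_inv M) = n" "M \<in> GL n \<Longrightarrow> dim_col (mat_inv M) = n"
  using GL_inv(1)[of M n] GL_inv(2)[of M n] by auto

section \<open>Representations of the relations of \<open>H(E,F)\<close>\<close>

text \<open>Pairs of matrices over an algebra that satisfy the defining relations; these are the algebra
  maps out of \<open>H(E,F)\<close>.\<close>

definition hmats ::
    "'k::field mat \<Rightarrow> 'k mat \<Rightarrow> ('k, 'a, 'z) module_scheme \<Rightarrow> 'a mat \<Rightarrow> 'a mat \<Rightarrow> bool" where
  "hmats E F A u v \<longleftrightarrow>
     u \<in> carrier_mat (dim_row E) (dim_row F) \<and> v \<in> carrier_mat (dim_row E) (dim_row F) \<and>
     entries A u \<and> entries A v \<and>
     u \<star>\<^sub>A v\<^sup>T = scal A (1\<^sub>m (dim_row E)) \<and>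
     v \<star>\<^sub>A scal A F \<star>\<^sub>A u\<^sup>T \<star>\<^sub>A scal A (mat_inv E) = scal A (1\<^sub>m (dim_row E)) \<and>
     v\<^sup>T \<star>\<^sub>A u = scal A (1\<^sub>m (dim_row F)) \<and>
     scal A F \<star>\<^sub>A u\<^sup>T \<star>\<^sub>A scal A (mat_inv E) \<star>\<^sub>A v = scal A (1\<^sub>m (dim_row F))"

locale hrep = kalg A
  for A :: "('k::field, 'a, 'z) module_scheme" (structure) +
  fixes E F :: "'k mat" and u v :: "'a mat" and m n :: nat
  assumes E: "E \<in> GL m" and F: "F \<in> GL n" and rep: "hmats E F A u v"
begin

lemmas dimE [simp] = GL_dims[OF E] and dimF [simp] = GL_dims[OF F]

lemma uv_dims [simp]: "dim_row u = m" "dim_col u = n" "dim_row v = m" "dim_col v = n"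
  using rep by (auto simp: hmats_def)

lemma uv_entries [simp]: "entries A u" "entries A v"
  using rep by (auto simp: hmats_def)

lemma rel1: "u \<star> v\<^sup>T = scal A (1\<^sub>m m)" and rel3: "v\<^sup>T \<star> u = scal A (1\<^sub>m n)"
  using rep by (simp_all add: hmats_def)

lemma rel2: "v \<star> (scal A F \<star> (u\<^sup>T \<star> scal A (mat_inv E))) = scal A (1\<^sub>m m)"
  using rep by (simp add: hmats_def amul_assoc)

lemma rel4: "scal A F \<star> (u\<^sup>T \<star> (scal A (mat_inv E) \<star> v)) = scal A (1\<^sub>m n)"
  using rep by (simp add: hmats_def amul_assoc)

lemma scal_inv:
  "scal A E \<star> scal A (mat_inv E) = scal A (1\<^sub>m m)" "scal A (mat_inv E) \<star> scal A E = scal A (1\<^sub>m m)"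
  "scal A F \<star> scal A (mat_inv F) = scal A (1\<^sub>m n)" "scal A (mat_inv F) \<star> scal A F = scal A (1\<^sub>m n)"
  using GL_inv[OF E] GL_inv[OF F] by (simp_all add: scal_mult[symmetric])

lemma rel2': "v \<star> (scal A F \<star> u\<^sup>T) = scal A E"
proof -
  have "v \<star> (scal A F \<star> u\<^sup>T) =
      v \<star> (scal A F \<star> (u\<^sup>T \<star> (scal A (mat_inv E) \<star> scal A E)))"
    by (simp add: scal_inv)
  also have "\<dots> = v \<star> (scal A F \<star> (u\<^sup>T \<star> scal A (mat_inv E))) \<star> scal A E"
    by (simp add: amul_assoc)
  finally show ?thesis by (simp add: rel2)
qed

lemma rel4': "u\<^sup>T \<star> (scal A (mat_inv E) \<star> v) = scal A (mat_inv F)"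
proof -
  have "u\<^sup>T \<star> (scal A (mat_inv E) \<star> v) =
      (scal A (mat_inv F) \<star> scal A F) \<star> (u\<^sup>T \<star> (scal A (mat_inv E) \<star> v))"
    by (simp add: scal_inv)
  also have "\<dots> = scal A (mat_inv F) \<star> (scal A F \<star> (u\<^sup>T \<star> (scal A (mat_inv E) \<star> v)))"
    by (simp add: amul_assoc)
  finally show ?thesis by (simp add: rel4)
qed

end

lemma hrepI:
  assumes "kalgebra A" "E \<in> GL m" "F \<in> GL n" "hmats E F A u v"
  shows "hrep A E F u v m n"
  using assms by (simp add: hrep_def kalg_def hrep_axioms_def)

text \<open>The form of the relations used throughout: the second and fourth of them are freed of one inverse,
  so that \<open>v F u\<^sup>t = E\<close> and \<open>u\<^sup>t E\<^sup>-\<^sup>1 v = F\<^sup>-\<^sup>1\<close>.\<close>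

lemma hmatsI:
  assumes "kalgebra A" "E \<in> GL m" "F \<in> GL n"
    "u \<in> carrier_mat m n" "v \<in> carrier_mat m n" "entries A u" "entries A v"
    "u \<star>\<^sub>A v\<^sup>T = scal A (1\<^sub>m m)" "v\<^sup>T \<star>\<^sub>A u = scal A (1\<^sub>m n)"
    "v \<star>\<^sub>A (scal A F \<star>\<^sub>A u\<^sup>T) = scal A E"
    "u\<^sup>T \<star>\<^sub>A (scal A (mat_inv E) \<star>\<^sub>A v) = scal A (mat_inv F)"
  shows "hmats E F A u v"
proof -
  interpret A: kalg A by (simp add: kalg_def assms)
  note d [simp] = GL_dims[OF assms(2)] GL_dims[OF assms(3)]
  have s: "scal A E \<star>\<^sub>A scal A (mat_inv E) = scal A (1\<^sub>m m)" "scal A F \<star>\<^sub>A scal A (mat_inv F) = scal A (1\<^sub>m n)"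
    using GL_inv[OF assms(2)] GL_inv[OF assms(3)] by (simp_all add: A.scal_mult[symmetric])
  have uv [simp]: "dim_row u = m" "dim_col u = n" "dim_row v = m" "dim_col v = n" using assms(4,5) by auto
  have "v \<star>\<^sub>A scal A F \<star>\<^sub>A u\<^sup>T \<star>\<^sub>A scal A (mat_inv E) =
      v \<star>\<^sub>A (scal A F \<star>\<^sub>A u\<^sup>T) \<star>\<^sub>A scal A (mat_inv E)"
    "scal A F \<star>\<^sub>A u\<^sup>T \<star>\<^sub>A scal A (mat_inv E) \<star>\<^sub>A v =
      scal A F \<star>\<^sub>A (u\<^sup>T \<star>\<^sub>A (scal A (mat_inv E) \<star>\<^sub>A v))"
    using assms(6,7) by (simp_all add: A.amul_assoc)
  then show ?thesis using assms by (simp add: hmats_def s)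
qed

lemma hmats_map:
  assumes "kalgebra A" "kalgebra B" "f \<in> alg_hom A B" "E \<in> GL m" "F \<in> GL n" "hmats E F A u v"
  shows "hmats E F B (map_mat f u) (map_mat f v)"
proof -
  interpret hrep A E F u v m n by (rule hrepI) fact+
  note mm = map_mat_amul[OF assms(1-3), symmetric] and ms = map_mat_scal[OF assms(1,3), symmetric]
  have t: "(map_mat f X)\<^sup>T = map_mat f X\<^sup>T" for X by (rule eq_matI) auto
  note en = entries_map_mat[OF alg_hom_lin[OF assms(3)]]
  show ?thesis
  proof (rule hmatsI[OF assms(2,4,5)])
    show "map_mat f u \<star>\<^sub>B (map_mat f v)\<^sup>T = scal B (1\<^sub>m m)"
      by (simp add: t mm rel1 map_mat_scal[OF assms(1,3)])
    show "(map_mat f v)\<^sup>T \<star>\<^sub>B map_mat f u = scal B (1\<^sub>m n)"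
      by (simp add: t mm rel3 map_mat_scal[OF assms(1,3)])
    show "map_mat f v \<star>\<^sub>B (scal B F \<star>\<^sub>B (map_mat f u)\<^sup>T) = scal B E"
      by (simp add: t ms mm rel2')
    show "(map_mat f u)\<^sup>T \<star>\<^sub>B (scal B (mat_inv E) \<star>\<^sub>B map_mat f v) = scal B (mat_inv F)"
      by (simp add: t ms mm rel4')
  qed (use en in \<open>auto intro!: carrier_matI\<close>)
qed

text \<open>Composition: commuting representations for \<open>(E,G)\<close> and \<open>(G,F)\<close> multiply to one for \<open>(E,F)\<close>.
  This one computation gives the comultiplication, the coaction and the inverse of the Galois map.\<close>

lemma hmats_comp:
  assumes A: "kalgebra A" and E: "E \<in> GL m" and G: "G \<in> GL p" and F: "F \<in> GL n"
    and h1: "hmats E G A u v" and h2: "hmats G F A u' v'"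
    and comm: "\<And>x y i j k l. x \<in> {u, v} \<Longrightarrow> y \<in> {u', v'} \<Longrightarrow> i < m \<Longrightarrow> j < p \<Longrightarrow> k < p \<Longrightarrow> l < n \<Longrightarrow>
      x $$ (i, j) \<otimes>\<^sub>A y $$ (k, l) = y $$ (k, l) \<otimes>\<^sub>A x $$ (i, j)"
  shows "hmats E F A (u \<star>\<^sub>A u') (v \<star>\<^sub>A v')"
proof -
  interpret X: hrep A E G u v m p by (rule hrepI) fact+
  interpret Y: hrep A G F u' v' p n by (rule hrepI) fact+
  have tu: "(u \<star>\<^sub>A u')\<^sup>T = u'\<^sup>T \<star>\<^sub>A u\<^sup>T"
    by (rule X.transpose_amul_commuting) (auto intro: comm)
  have tv: "(v \<star>\<^sub>A v')\<^sup>T = v'\<^sup>T \<star>\<^sub>A v\<^sup>T"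
    by (rule X.transpose_amul_commuting) (auto intro: comm)
  show ?thesis
  proof (rule hmatsI[OF A E F])
    have "u \<star>\<^sub>A u' \<star>\<^sub>A (v'\<^sup>T \<star>\<^sub>A v\<^sup>T) =
        u \<star>\<^sub>A ((u' \<star>\<^sub>A v'\<^sup>T) \<star>\<^sub>A v\<^sup>T)"
      by (simp add: X.amul_assoc)
    then show "u \<star>\<^sub>A u' \<star>\<^sub>A (v \<star>\<^sub>A v')\<^sup>T = scal A (1\<^sub>m m)"
      by (simp add: tv X.rel1 Y.rel1)
    have "(v'\<^sup>T \<star>\<^sub>A v\<^sup>T) \<star>\<^sub>A (u \<star>\<^sub>A u') =
        v'\<^sup>T \<star>\<^sub>A ((v\<^sup>T \<star>\<^sub>A u) \<star>\<^sub>A u')"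
      by (simp add: X.amul_assoc)
    then show "(v \<star>\<^sub>A v')\<^sup>T \<star>\<^sub>A (u \<star>\<^sub>A u') = scal A (1\<^sub>m n)"
      by (simp add: tv X.rel3 Y.rel3)
    have "v \<star>\<^sub>A v' \<star>\<^sub>A (scal A F \<star>\<^sub>A (u'\<^sup>T \<star>\<^sub>A u\<^sup>T)) =
        v \<star>\<^sub>A ((v' \<star>\<^sub>A (scal A F \<star>\<^sub>A u'\<^sup>T)) \<star>\<^sub>A u\<^sup>T)"
      by (simp add: X.amul_assoc)
    then show "v \<star>\<^sub>A v' \<star>\<^sub>A (scal A F \<star>\<^sub>A (u \<star>\<^sub>A u')\<^sup>T) = scal A E"
      by (simp add: tu X.rel2' Y.rel2')
    have "u'\<^sup>T \<star>\<^sub>A u\<^sup>T \<star>\<^sub>A (scal A (mat_inv E) \<star>\<^sub>A (v \<star>\<^sub>A v')) =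
        u'\<^sup>T \<star>\<^sub>A ((u\<^sup>T \<star>\<^sub>A (scal A (mat_inv E) \<star>\<^sub>A v)) \<star>\<^sub>A v')"
      by (simp add: X.amul_assoc)
    then show "(u \<star>\<^sub>A u')\<^sup>T \<star>\<^sub>A (scal A (mat_inv E) \<star>\<^sub>A (v \<star>\<^sub>A v')) = scal A (mat_inv F)"
      by (simp add: tu X.rel4' Y.rel4')
  qed (auto intro!: carrier_matI)
qed

text \<open>Inversion: over the opposite algebra, \<open>(v\<^sup>t, F u\<^sup>t E\<^sup>-\<^sup>1)\<close> represents the relations
  of \<open>(F,E)\<close>. For \<open>F = E\<close> this is the antipode.\<close>

lemma hmats_op:
  assumes A: "kalgebra A" and E: "E \<in> GL m" and F: "F \<in> GL n" and h: "hmats E F A u v"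
  shows "hmats F E (op_alg A) v\<^sup>T (scal A F \<star>\<^sub>A u\<^sup>T \<star>\<^sub>A scal A (mat_inv E))"
proof -
  interpret hrep A E F u v m n by (rule hrepI) fact+
  let ?w = "scal A F \<star>\<^sub>A u\<^sup>T \<star>\<^sub>A scal A (mat_inv E)"
  have tw: "?w\<^sup>T = scal A ((mat_inv E)\<^sup>T) \<star>\<^sub>A (u \<star>\<^sub>A scal A F\<^sup>T)"
    by (simp add: transpose_amul_scal transpose_scal_amul)
  have one: "(scal A (1\<^sub>m k))\<^sup>T = scal A (1\<^sub>m k)" for k by simp
  have tEE: "scal A ((mat_inv E)\<^sup>T) \<star>\<^sub>A scal A E\<^sup>T = scal A (1\<^sub>m m)"
    using GL_inv[OF E] by (simp add: scal_mult[symmetric] transpose_mult[symmetric, where nr = m and n = m and nc = m])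
  have tFF: "scal A F\<^sup>T \<star>\<^sub>A scal A ((mat_inv F)\<^sup>T) = scal A (1\<^sub>m n)"
    using GL_inv[OF F] by (simp add: scal_mult[symmetric] transpose_mult[symmetric, where nr = n and n = n and nc = n])
  show ?thesis
  proof (rule hmatsI[OF kalgebra_op_alg[OF A] F E])
    have "?w \<star>\<^sub>A v = scal A (1\<^sub>m n)" by (simp add: amul_assoc rel4)
    then show "v\<^sup>T \<star>\<^bsub>op_alg A\<^esub> ?w\<^sup>T = scal (op_alg A) (1\<^sub>m n)"
      by (subst amul_op_alg) (simp_all add: one)
    have "v \<star>\<^sub>A ?w = scal A (1\<^sub>m m)" by (simp add: amul_assoc rel2)
    then show "?w\<^sup>T \<star>\<^bsub>op_alg A\<^esub> v\<^sup>T = scal (op_alg A) (1\<^sub>m m)"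
      by (subst amul_op_alg) (simp_all add: one)
    have "v \<star>\<^sub>A scal A E\<^sup>T = v \<star>\<^sub>A scal A E\<^sup>T" ..
    have a: "scal A E \<star>\<^bsub>op_alg A\<^esub> v\<^sup>T\<^sup>T = (v\<^sup>T \<star>\<^sub>A scal A E\<^sup>T)\<^sup>T"
      by (subst amul_op_alg) auto
    have "?w \<star>\<^bsub>op_alg A\<^esub> (scal A E \<star>\<^bsub>op_alg A\<^esub> v\<^sup>T\<^sup>T) =
        (v\<^sup>T \<star>\<^sub>A scal A E\<^sup>T \<star>\<^sub>A ?w\<^sup>T)\<^sup>T"
      unfolding a by (subst amul_op_alg) auto
    also have "v\<^sup>T \<star>\<^sub>A scal A E\<^sup>T \<star>\<^sub>A ?w\<^sup>T =
        v\<^sup>T \<star>\<^sub>A ((scal A E\<^sup>T \<star>\<^sub>A scal A ((mat_inv E)\<^sup>T)) \<star>\<^sub>A (u \<star>\<^sub>A scal A F\<^sup>T))"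
      unfolding tw by (simp add: amul_assoc)
    also have "\<dots> = (v\<^sup>T \<star>\<^sub>A u) \<star>\<^sub>A scal A F\<^sup>T"
      using GL_inv[OF E]
      by (simp add: scal_mult[symmetric] transpose_mult[symmetric, where nr = m and n = m and nc = m] amul_assoc)
    finally show "?w \<star>\<^bsub>op_alg A\<^esub> (scal (op_alg A) E \<star>\<^bsub>op_alg A\<^esub> v\<^sup>T\<^sup>T) = scal (op_alg A) F"
      by (simp add: rel3)
    have b: "scal A (mat_inv F) \<star>\<^bsub>op_alg A\<^esub> ?w = (?w\<^sup>T \<star>\<^sub>A scal A ((mat_inv F)\<^sup>T))\<^sup>T"
      by (subst amul_op_alg) auto
    have "(v\<^sup>T)\<^sup>T \<star>\<^bsub>op_alg A\<^esub> (scal A (mat_inv F) \<star>\<^bsub>op_alg A\<^esub> ?w) =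
        (?w\<^sup>T \<star>\<^sub>A scal A ((mat_inv F)\<^sup>T) \<star>\<^sub>A v\<^sup>T)\<^sup>T"
      unfolding b by (subst amul_op_alg) auto
    also have "?w\<^sup>T \<star>\<^sub>A scal A ((mat_inv F)\<^sup>T) \<star>\<^sub>A v\<^sup>T =
        scal A ((mat_inv E)\<^sup>T) \<star>\<^sub>A (u \<star>\<^sub>A ((scal A F\<^sup>T \<star>\<^sub>A scal A ((mat_inv F)\<^sup>T)) \<star>\<^sub>A v\<^sup>T))"
      unfolding tw by (simp add: amul_assoc)
    also have "\<dots> = scal A ((mat_inv E)\<^sup>T)" by (simp add: tFF rel1)
    finally show "(v\<^sup>T)\<^sup>T \<star>\<^bsub>op_alg A\<^esub> (scal (op_alg A) (mat_inv F) \<star>\<^bsub>op_alg A\<^esub> ?w) = scal (op_alg A) (mat_inv E)"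
      by simp
  qed (auto intro!: carrier_matI)
qed

section \<open>The presentation of \<open>H(E,F)\<close>\<close>

definition Um :: "nat \<Rightarrow> nat \<Rightarrow> (hgen \<Rightarrow> 'a) \<Rightarrow> 'a mat" where
  "Um m n g = mat m n (\<lambda>(i, j). g (U i j))"

definition Vm :: "nat \<Rightarrow> nat \<Rightarrow> (hgen \<Rightarrow> 'a) \<Rightarrow> 'a mat" where
  "Vm m n g = mat m n (\<lambda>(i, j). g (V i j))"

lemma UVm_dims [simp]: "dim_row (Um m n g) = m" "dim_col (Um m n g) = n"
  "dim_row (Vm m n g) = m" "dim_col (Vm m n g) = n"
  by (simp_all add: Um_def Vm_def)

lemma UVm_index [simp]: "i < m \<Longrightarrow> j < n \<Longrightarrow> Um m n g $$ (i, j) = g (U i j)"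
  "i < m \<Longrightarrow> j < n \<Longrightarrow> Vm m n g $$ (i, j) = g (V i j)"
  by (simp_all add: Um_def Vm_def)

lemma hgens_iff [simp]: "U i j \<in> hgens m n \<longleftrightarrow> i < m \<and> j < n" "V i j \<in> hgens m n \<longleftrightarrow> i < m \<and> j < n"
  by (auto simp: hgens_def)

lemma (in kalg) amat_mult_index:
  assumes "i < dim_row X" "j < dim_col Y" "dim_col X = p" "dim_row Y = p" "entries A X" "entries A Y"
    "\<And>l. l < p \<Longrightarrow> f i l = X $$ (i, l)" "\<And>l. l < p \<Longrightarrow> g l j = Y $$ (l, j)"
  shows "amat_mult A p f g i j = (X \<star> Y) $$ (i, j)"
  using assms entriesD[OF assms(5)] entriesD[OF assms(6)]
  by (auto simp: amat_mult_def amul_index intro!: finsum_cong')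

definition diff_rels :: "('k::field, 'a, 'z) module_scheme \<Rightarrow> nat \<Rightarrow> 'a mat \<Rightarrow> 'a set" where
  "diff_rels A n X = {X $$ (i, j) \<ominus>\<^sub>A scal A (1\<^sub>m n) $$ (i, j) | i j. i < n \<and> j < n}"

lemma amat_one_rels_eq:
  assumes "\<And>i j. i < n \<Longrightarrow> j < n \<Longrightarrow> f i j = X $$ (i, j)"
  shows "amat_one_rels A n f = diff_rels A n X"
proof -
  have "f i j \<ominus>\<^sub>A amat_scalar A (1\<^sub>m n) i j = X $$ (i, j) \<ominus>\<^sub>A scal A (1\<^sub>m n) $$ (i, j)" if "i < n" "j < n" for i j
    using that assms by (simp add: amat_scalar_def)
  then show ?thesis unfolding amat_one_rels_def diff_rels_def by (intro Collect_cong) metis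
qed

context
  fixes E F :: "'k::field mat" and m n :: nat
  assumes E: "E \<in> GL m" and F: "F \<in> GL n"
begin

abbreviation (input) "FA \<equiv> free_alg (hgens m n) :: ('k, hgen list \<Rightarrow> 'k) module"
abbreviation (input) "fu \<equiv> Um m n (\<lambda>x. delta [x]) :: (hgen list \<Rightarrow> 'k) mat"
abbreviation (input) "fv \<equiv> Vm m n (\<lambda>x. delta [x]) :: (hgen list \<Rightarrow> 'k) mat"

lemma kalgebra_free_alg: "kalgebra (free_alg S :: ('k, 'g list \<Rightarrow> 'k) module)"
  by (simp add: free_alg_def kalgebra_monoid_alg monoid_free_monoid)

lemma delta_gen_closed: "x \<in> S \<Longrightarrow> delta [x] \<in> carrier (free_alg S)"
  by (simp add: free_alg_def)

lemma hrels_eq: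
  "hrels E F = diff_rels FA m (fu \<star>\<^bsub>FA\<^esub> fv\<^sup>T) \<union>
     diff_rels FA m (fv \<star>\<^bsub>FA\<^esub> scal FA F \<star>\<^bsub>FA\<^esub> fu\<^sup>T \<star>\<^bsub>FA\<^esub> scal FA (mat_inv E)) \<union>
     diff_rels FA n (fv\<^sup>T \<star>\<^bsub>FA\<^esub> fu) \<union>
     diff_rels FA n (scal FA F \<star>\<^bsub>FA\<^esub> fu\<^sup>T \<star>\<^bsub>FA\<^esub> scal FA (mat_inv E) \<star>\<^bsub>FA\<^esub> fv)"
proof -
  interpret FA: kalg FA by (simp add: kalg_def kalgebra_free_alg)
  note d [simp] = GL_dims[OF E] GL_dims[OF F]
  have en [simp]: "entries FA fu" "entries FA fv" by (auto simp: entries_def intro: delta_gen_closed)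
  let ?u = "\<lambda>i j. delta [U i j] :: hgen list \<Rightarrow> 'k" and ?v = "\<lambda>i j. delta [V i j] :: hgen list \<Rightarrow> 'k"
  have 1: "amat_one_rels FA m (amat_mult FA n ?u (amat_transpose ?v)) = diff_rels FA m (fu \<star>\<^bsub>FA\<^esub> fv\<^sup>T)"
    by (intro amat_one_rels_eq FA.amat_mult_index) (auto simp: amat_transpose_def)
  have 2: "amat_one_rels FA m (amat_mult FA m (amat_mult FA n (amat_mult FA n ?v (amat_scalar FA F)) (amat_transpose ?u)) (amat_scalar FA (mat_inv E)))
    = diff_rels FA m (fv \<star>\<^bsub>FA\<^esub> scal FA F \<star>\<^bsub>FA\<^esub> fu\<^sup>T \<star>\<^bsub>FA\<^esub> scal FA (mat_inv E))"
    by (intro amat_one_rels_eq FA.amat_mult_index) (auto simp: amat_transpose_def amat_scalar_def intro!: FA.amat_mult_index)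
  have 3: "amat_one_rels FA n (amat_mult FA m (amat_transpose ?v) ?u) = diff_rels FA n (fv\<^sup>T \<star>\<^bsub>FA\<^esub> fu)"
    by (intro amat_one_rels_eq FA.amat_mult_index) (auto simp: amat_transpose_def)
  have 4: "amat_one_rels FA n (amat_mult FA m (amat_mult FA m (amat_mult FA n (amat_scalar FA F) (amat_transpose ?u)) (amat_scalar FA (mat_inv E))) ?v)
    = diff_rels FA n (scal FA F \<star>\<^bsub>FA\<^esub> fu\<^sup>T \<star>\<^bsub>FA\<^esub> scal FA (mat_inv E) \<star>\<^bsub>FA\<^esub> fv)"
    by (intro amat_one_rels_eq FA.amat_mult_index) (auto simp: amat_transpose_def amat_scalar_def intro!: FA.amat_mult_index)
  show ?thesis unfolding hrels_def Let_def d by (simp only: 1 2 3 4)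
qed

lemma diff_rels_closed:
  assumes "kalgebra A" "dim_row X = k" "dim_col X = k" "entries A X"
  shows "diff_rels A k X \<subseteq> carrier A"
proof -
  interpret A: kalg A by (simp add: kalg_def assms)
  show ?thesis using assms by (auto simp: diff_rels_def entriesD intro!: A.minus_closed)
qed

lemma diff_rels_map:
  assumes "kalgebra A" "kalgebra B" "f \<in> alg_hom A B" "dim_row X = k" "dim_col X = k" "entries A X"
  shows "(\<forall>r\<in>diff_rels A k X. f r = \<zero>\<^sub>B) \<longleftrightarrow> map_mat f X = scal B (1\<^sub>m k)"
proof -
  interpret A: kalg A by (simp add: kalg_def assms)
  interpret B: kalg B by (simp add: kalg_def assms)
  have "f (X $$ (i, j) \<ominus>\<^sub>A scal A (1\<^sub>m k) $$ (i, j)) = \<zero>\<^sub>B \<longleftrightarrow> map_mat f X $$ (i, j) = scal B (1\<^sub>m k) $$ (i, j)"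
    if "i < k" "j < k" for i j
  proof -
    have c: "X $$ (i, j) \<in> carrier A" "scal A (1\<^sub>m k) $$ (i, j) \<in> carrier A"
      using that assms by (auto simp: entriesD)
    have "f (scal A (1\<^sub>m k) $$ (i, j)) = scal B (1\<^sub>m k) $$ (i, j)"
      using that arg_cong[OF map_mat_scal[OF assms(1,3), of "1\<^sub>m k"], of "\<lambda>M. M $$ (i, j)"] by (simp del: scal_index)
    then show ?thesis
      using that c assms lin_hom_minus[OF assms(1,2) alg_hom_lin[OF assms(3)] c] alg_hom_closed[OF assms(3)]
      by (simp add: B.minus_eq_zero_iff del: scal_index) (metis B.minus_eq_zero_iff)
  qed
  then have "(\<forall>r\<in>diff_rels A k X. f r = \<zero>\<^sub>B) \<longleftrightarrow> (\<forall>i<k. \<forall>j<k. map_mat f X $$ (i, j) = scal B (1\<^sub>m k) $$ (i, j))"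
    unfolding diff_rels_def by blast
  also have "\<dots> \<longleftrightarrow> map_mat f X = scal B (1\<^sub>m k)" using assms(4,5) by (auto simp: mat_eq_iff)
  finally show ?thesis .
qed

text \<open>The relators of the presentation are the entries of the matrix equations in \<open>hmats\<close>.\<close>

lemma hrels_map:
  fixes C :: "('k, 'c, 'z) module_scheme"
  assumes C: "kalgebra C" and f: "f \<in> alg_hom FA C"
  shows "(\<forall>r\<in>hrels E F. f r = \<zero>\<^sub>C) \<longleftrightarrow> hmats E F C (map_mat f fu) (map_mat f fv)"
proof -
  interpret FA: kalg FA by (simp add: kalg_def kalgebra_free_alg)
  note d [simp] = GL_dims[OF E] GL_dims[OF F]
  have en [simp]: "entries FA fu" "entries FA fv" by (auto simp: entries_def intro: delta_gen_closed)
  have t: "map_mat f X\<^sup>T = (map_mat f X)\<^sup>T" for X by (rule eq_matI) auto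
  note dm = diff_rels_map[OF FA.kalgebra C f]
  show ?thesis unfolding hrels_eq ball_Un hmats_def
    by (simp add: dm map_mat_amul[OF FA.kalgebra C f] map_mat_scal[OF FA.kalgebra f] t
        entries_map_mat[OF alg_hom_lin[OF f]] carrier_matI conj_ac)
qed

lemma hrels_closed: "hrels E F \<subseteq> carrier FA"
proof -
  interpret FA: kalg FA by (simp add: kalg_def kalgebra_free_alg)
  note d [simp] = GL_dims[OF E] GL_dims[OF F]
  have en [simp]: "entries FA fu" "entries FA fv" by (auto simp: entries_def intro: delta_gen_closed)
  show ?thesis unfolding hrels_eq by (intro Un_least diff_rels_closed FA.kalgebra) auto
qed

interpretation HP: presentation "hgens m n" "hrels E F"
  by (rule presentation.intro) (rule hrels_closed)

lemma H_alg_eq: "H_alg E F = HP.A"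
  by (simp add: H_alg_def GL_dims[OF E] GL_dims[OF F])

lemma kalgebra_H: "kalgebra (H_alg E F)" by (simp add: H_alg_eq HP.A.kalgebra)

lemma H_gens: "H_u E F i j = pres_gen (hgens m n) (hrels E F) (U i j)"
  "H_v E F i j = pres_gen (hgens m n) (hrels E F) (V i j)"
  by (simp_all add: H_u_def H_v_def GL_dims[OF E] GL_dims[OF F])

lemma H_gens_closed [simp]: "i < m \<Longrightarrow> j < n \<Longrightarrow> H_u E F i j \<in> carrier (H_alg E F)"
  "i < m \<Longrightarrow> j < n \<Longrightarrow> H_v E F i j \<in> carrier (H_alg E F)"
  by (simp_all add: H_gens H_alg_eq)

lemma hmats_H: "hmats E F (H_alg E F) (mat m n (\<lambda>(i, j). H_u E F i j)) (mat m n (\<lambda>(i, j). H_v E F i j))"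
proof -
  let ?p = "\<lambda>x. HP.MQ.I +>\<^bsub>HP.MQ.P\<^esub> x"
  have "map_mat ?p fu = mat m n (\<lambda>(i, j). H_u E F i j)" "map_mat ?p fv = mat m n (\<lambda>(i, j). H_v E F i j)"
    by (auto intro!: eq_matI simp: H_gens HP.gen_eq)
  moreover have "hmats E F HP.A (map_mat ?p fu) (map_mat ?p fv)"
    using hrels_map[OF HP.A.kalgebra HP.proj] HP.proj_rel by auto
  ultimately show ?thesis by (simp add: H_alg_eq)
qed

lemma H_lift:
  fixes C :: "('k, 'c, 'z) module_scheme"
  assumes C: "kalgebra C" and h: "hmats E F C (Um m n g) (Vm m n g)"
  shows "pres_lift C g \<in> alg_hom (H_alg E F) C"
    and "\<And>i j. i < m \<Longrightarrow> j < n \<Longrightarrow> pres_lift C g (H_u E F i j) = g (U i j)"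
    and "\<And>i j. i < m \<Longrightarrow> j < n \<Longrightarrow> pres_lift C g (H_v E F i j) = g (V i j)"
proof -
  have g: "g x \<in> carrier C" if "x \<in> hgens m n" for x
    using h that by (auto simp: hgens_def hmats_def entries_def)
  note L = free_alg_hom[where S = "hgens m n" and g = g, OF C g]
  let ?L = "lin_ext C (word_prod C g)"
  have "map_mat ?L fu = Um m n g" "map_mat ?L fv = Vm m n g"
    by (auto intro!: eq_matI simp: L(2))
  then have rel: "\<And>r. r \<in> hrels E F \<Longrightarrow> ?L r = \<zero>\<^sub>C"
    using hrels_map[OF C L(1)] h by auto
  note pl = HP.pres_lift[of C g, OF C g rel]
  show "pres_lift C g \<in> alg_hom (H_alg E F) C" using pl(1) by (simp add: H_alg_eq)
  show "\<And>i j. i < m \<Longrightarrow> j < n \<Longrightarrow> pres_lift C g (H_u E F i j) = g (U i j)"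
    "\<And>i j. i < m \<Longrightarrow> j < n \<Longrightarrow> pres_lift C g (H_v E F i j) = g (V i j)"
    using pl(2) by (simp_all add: H_gens)
qed

lemma alg_hom_H_eq:
  fixes C :: "('k, 'c, 'z) module_scheme"
  assumes "f \<in> alg_hom (H_alg E F) C" "g \<in> alg_hom (H_alg E F) C"
    "\<And>i j. i < m \<Longrightarrow> j < n \<Longrightarrow> f (H_u E F i j) = g (H_u E F i j)"
    "\<And>i j. i < m \<Longrightarrow> j < n \<Longrightarrow> f (H_v E F i j) = g (H_v E F i j)"
    "x \<in> carrier (H_alg E F)"
  shows "f x = g x"
  by (rule HP.alg_hom_pres_eq[of f C g])
    (use assms in \<open>auto simp: H_alg_eq H_gens hgens_def\<close>)

lemma H_induct [consumes 1, case_names one u v add scale]: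
  assumes "X \<in> carrier (H_alg E F)" "P \<one>\<^bsub>H_alg E F\<^esub>"
    "\<And>i j Y. i < m \<Longrightarrow> j < n \<Longrightarrow> Y \<in> carrier (H_alg E F) \<Longrightarrow> P Y \<Longrightarrow> P (H_u E F i j \<otimes>\<^bsub>H_alg E F\<^esub> Y)"
    "\<And>i j Y. i < m \<Longrightarrow> j < n \<Longrightarrow> Y \<in> carrier (H_alg E F) \<Longrightarrow> P Y \<Longrightarrow> P (H_v E F i j \<otimes>\<^bsub>H_alg E F\<^esub> Y)"
    "\<And>X Y. X \<in> carrier (H_alg E F) \<Longrightarrow> Y \<in> carrier (H_alg E F) \<Longrightarrow> P X \<Longrightarrow> P Y \<Longrightarrow> P (X \<oplus>\<^bsub>H_alg E F\<^esub> Y)"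
    "\<And>c X. X \<in> carrier (H_alg E F) \<Longrightarrow> P X \<Longrightarrow> P (c \<odot>\<^bsub>H_alg E F\<^esub> X)"
  shows "P X"
  using assms(1) unfolding H_alg_eq
proof (induction rule: HP.pres_induct)
  case (gen x Y)
  then show ?case using assms(3,4) by (auto simp: hgens_def H_gens H_alg_eq)
qed (use assms(2,5,6) in \<open>auto simp: H_alg_eq\<close>)

end

section \<open>A functional on words: the diamond lemma\<close>

text \<open>Rewriting of two-letter factors in words. A rule replaces \<open>x y\<close> by the combination of the words
  \<open>t x y i\<close>, \<open>i \<in> I x y\<close>, with coefficients \<open>c x y i\<close>. To see that the rules do not collapse the free
  algebra, a linear functional on words suffices: it is defined by reducing one arbitrarily chosen
  factor, and confluence says that the choice does not matter.\<close>

locale word_rewriting =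
  fixes L :: "('g \<times> 'g) set" and I :: "'g \<Rightarrow> 'g \<Rightarrow> 'i set" and c :: "'g \<Rightarrow> 'g \<Rightarrow> 'i \<Rightarrow> 'k::field"
    and t :: "'g \<Rightarrow> 'g \<Rightarrow> 'i \<Rightarrow> 'g list" and r :: "('g list \<times> 'g list) set"
  assumes wf: "wf r" and trans: "trans r" and fin: "\<And>x y. finite (I x y)"
    and dec: "\<And>x y i p q. (x, y) \<in> L \<Longrightarrow> i \<in> I x y \<Longrightarrow> c x y i \<noteq> 0 \<Longrightarrow> (p @ t x y i @ q, p @ [x, y] @ q) \<in> r"
begin

definition step :: "('g list \<Rightarrow> 'k) \<Rightarrow> 'g list \<Rightarrow> 'g \<Rightarrow> 'g \<Rightarrow> 'g list \<Rightarrow> 'k" where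
  "step \<phi> p x y q = (\<Sum>i\<in>I x y. c x y i * \<phi> (p @ t x y i @ q))"

definition redex :: "'g list \<Rightarrow> 'g list \<times> 'g \<times> 'g \<times> 'g list \<Rightarrow> bool" where
  "redex w = (\<lambda>(p, x, y, q). w = p @ [x, y] @ q \<and> (x, y) \<in> L)"

definition phi :: "'g list \<Rightarrow> 'k" where
  "phi = wfrec r (\<lambda>\<phi> w. if Ex (redex w) then (case Eps (redex w) of (p, x, y, q) \<Rightarrow> step \<phi> p x y q)
     else if w = [] then 1 else 0)"

lemma step_cut:
  assumes "(x, y) \<in> L" "w = p @ [x, y] @ q"
  shows "step (cut \<phi> r w) p x y q = step \<phi> p x y q"
  unfolding step_def using dec[OF assms(1)] assms(2)
  by (intro sum.cong) (auto simp: cut_def)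

lemma phi_redex:
  assumes "Ex (redex w)"
  shows "\<exists>p x y q. redex w (p, x, y, q) \<and> phi w = step phi p x y q"
proof -
  obtain p x y q where e: "Eps (redex w) = (p, x, y, q)" by (metis prod_cases4)
  have "redex w (p, x, y, q)" using someI_ex[OF assms] e by simp
  moreover from this have "phi w = step phi p x y q"
    using def_wfrec[OF phi_def[THEN eq_reflection] wf, of w] assms e
    by (simp add: step_cut redex_def)
  ultimately show ?thesis by blast
qed

lemma phi_Nil: "phi [] = 1"
  using def_wfrec[OF phi_def[THEN eq_reflection] wf, of "[]"] by (simp add: redex_def)

definition holds :: "'g list \<Rightarrow> 'g \<Rightarrow> 'g \<Rightarrow> 'g list \<Rightarrow> bool" where
  "holds p x y q \<longleftrightarrow> phi (p @ [x, y] @ q) = step phi p x y q"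

definition below :: "'g list \<Rightarrow> bool" where
  "below w \<longleftrightarrow> (\<forall>p x y q. (x, y) \<in> L \<longrightarrow> (p @ [x, y] @ q, w) \<in> r \<longrightarrow> holds p x y q)"

lemma step_disjoint:
  assumes "below (p @ [x, y] @ s @ [x', y'] @ q)" "(x, y) \<in> L" "(x', y') \<in> L"
  shows "step phi p x y (s @ [x', y'] @ q) = step phi (p @ [x, y] @ s) x' y' q"
proof -
  have 1: "c x y i * phi (p @ t x y i @ s @ [x', y'] @ q) =
      (\<Sum>j\<in>I x' y'. c x y i * (c x' y' j * phi (p @ t x y i @ s @ t x' y' j @ q)))"
    if i: "i \<in> I x y" for i
  proof (cases "c x y i = 0")
    case False
    have "((p @ t x y i @ s) @ [x', y'] @ q, p @ [x, y] @ s @ [x', y'] @ q) \<in> r"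
      using dec[OF assms(2) i False, of p "s @ [x', y'] @ q"] by simp
    then have "phi ((p @ t x y i @ s) @ [x', y'] @ q) = step phi (p @ t x y i @ s) x' y' q"
      using assms(1,3) unfolding below_def holds_def by blast
    then show ?thesis by (simp add: step_def sum_distrib_left)
  qed simp
  have 2: "c x' y' j * phi (p @ [x, y] @ s @ t x' y' j @ q) =
      (\<Sum>i\<in>I x y. c x y i * (c x' y' j * phi (p @ t x y i @ s @ t x' y' j @ q)))"
    if j: "j \<in> I x' y'" for j
  proof (cases "c x' y' j = 0")
    case False
    have "(p @ [x, y] @ s @ t x' y' j @ q, p @ [x, y] @ s @ [x', y'] @ q) \<in> r"
      using dec[OF assms(3) j False, of "p @ [x, y] @ s" q] by simp
    then have "phi (p @ [x, y] @ (s @ t x' y' j @ q)) = step phi p x y (s @ t x' y' j @ q)"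
      using assms(1,2) unfolding below_def holds_def by blast
    then show ?thesis by (simp add: step_def sum_distrib_left mult.left_commute)
  qed simp
  have "step phi p x y (s @ [x', y'] @ q) =
      (\<Sum>i\<in>I x y. \<Sum>j\<in>I x' y'. c x y i * (c x' y' j * phi (p @ t x y i @ s @ t x' y' j @ q)))"
    unfolding step_def[of _ p] by (intro sum.cong refl 1)
  also have "\<dots> = (\<Sum>j\<in>I x' y'. \<Sum>i\<in>I x y. c x y i * (c x' y' j * phi (p @ t x y i @ s @ t x' y' j @ q)))"
    by (rule sum.swap)
  also have "\<dots> = step phi (p @ [x, y] @ s) x' y' q"
    unfolding step_def[of _ "p @ [x, y] @ s"] by (intro sum.cong refl) (use 2 in simp)
  finally show ?thesis .
qed

theorem diamond:
  assumes overlap: "\<And>p x y z q. (x, y) \<in> L \<Longrightarrow> (y, z) \<in> L \<Longrightarrow> below (p @ [x, y, z] @ q) \<Longrightarrow>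
    step phi p x y (z # q) = step phi (p @ [x]) y z q"
    and "(x, y) \<in> L"
  shows "holds p x y q"
proof -
  have "\<forall>p x y q. w = p @ [x, y] @ q \<longrightarrow> (x, y) \<in> L \<longrightarrow> holds p x y q" for w
    using wf
  proof (induction w rule: wf_induct_rule)
    case (less w)
    then have bw: "below w" unfolding below_def by blast
    have eq: "step phi p x y q = step phi p' x' y' q'"
      if "w = p @ [x, y] @ q" "w = p' @ [x', y'] @ q'" "(x, y) \<in> L" "(x', y') \<in> L" "length p \<le> length p'"
      for p x y q p' x' y' q'
    proof -
      have eq0: "p @ [x, y] @ q = p' @ [x', y'] @ q'" using that by simp
      then have "p = take (length p) p'" using that(5)
        by (metis append_eq_append_conv_if append_eq_conv_conj)
      then obtain d where d: "p' = p @ d" by (metis append_take_drop_id)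
      then have "[x, y] @ q = d @ [x', y'] @ q'" using eq0 by simp
      then consider "d = []" "x' = x" "y' = y" "q' = q" | "d = [x]" "x' = y" "q = y' # q'"
        | s where "d = [x, y] @ s" "q = s @ [x', y'] @ q'"
        by (cases d; cases "tl d") auto
      then show ?thesis
      proof cases
        case 1
        then show ?thesis using d by simp
      next
        case 2
        then show ?thesis using overlap[of x y y' p q'] bw that d by simp
      next
        case 3
        then show ?thesis using step_disjoint[of p x y s x' y' q'] bw that d by simp
      qed
    qed
    show ?case
    proof (intro allI impI)
      fix p x y q assume w: "w = p @ [x, y] @ q" "(x, y) \<in> L"
      then have "redex w (p, x, y, q)" by (simp add: redex_def)
      then obtain p' x' y' q' where "redex w (p', x', y', q')" and ph: "phi w = step phi p' x' y' q'"
        using phi_redex[of w] by blast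
      then have w': "w = p' @ [x', y'] @ q'" "(x', y') \<in> L" by (simp_all add: redex_def)
      have "step phi p x y q = step phi p' x' y' q'"
        using eq[OF w(1) w'(1) w(2) w'(2)] eq[OF w'(1) w(1) w'(2) w(2)]
        by (cases "length p \<le> length p'") auto
      then show "holds p x y q" using ph w by (simp add: holds_def)
    qed
  qed
  then show ?thesis using assms(2) by blast
qed

end

text \<open>All overlaps below resolve by evaluating a double sum in two ways.\<close>

lemma double_sum_exchange:
  fixes g :: "'a \<Rightarrow> 'b \<Rightarrow> 'k::field"
  assumes "finite K" "finite B" "k0 \<in> K" "b0 \<in> B"
    "\<And>k. k \<in> K - {k0} \<Longrightarrow> (\<Sum>b\<in>B. g k b) = \<alpha> k" "\<And>b. b \<in> B - {b0} \<Longrightarrow> (\<Sum>k\<in>K. g k b) = \<beta> b"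
  shows "(\<Sum>k\<in>K - {k0}. g k b0) - (\<Sum>b\<in>B - {b0}. g k0 b) = (\<Sum>k\<in>K - {k0}. \<alpha> k) - (\<Sum>b\<in>B - {b0}. \<beta> b)"
proof -
  have "(\<Sum>k\<in>K - {k0}. \<alpha> k) = (\<Sum>k\<in>K - {k0}. g k b0) + (\<Sum>k\<in>K - {k0}. \<Sum>b\<in>B - {b0}. g k b)"
    using assms by (simp add: sum.remove[of B b0] sum.distrib flip: assms(5))
  moreover have "(\<Sum>b\<in>B - {b0}. \<beta> b) = (\<Sum>b\<in>B - {b0}. g k0 b) + (\<Sum>b\<in>B - {b0}. \<Sum>k\<in>K - {k0}. g k b)"
    using assms by (simp add: sum.remove[of K k0] sum.distrib flip: assms(6))
  ultimately show ?thesis using sum.swap[of g "B - {b0}" "K - {k0}"] by simp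
qed

lemma cancel_two_factors:
  fixes x y :: "'k::field"
  assumes "x \<noteq> 0" "y \<noteq> 0" "x * (y * s) = P - \<sigma>" "y * (x * s') = Q - \<sigma>'" "\<sigma> - \<sigma>' = P - Q"
  shows "s = s'"
proof -
  have "x * (y * (s - s')) = (P - \<sigma>) - (Q - \<sigma>')"
    unfolding assms(3,4)[symmetric] by (simp add: algebra_simps)
  also have "\<dots> = 0" using assms(5) by (simp add: algebra_simps)
  finally show ?thesis using assms(1,2) by simp
qed

section \<open>The rewriting system for triangular parameters\<close>

text \<open>The parameters after conjugation: \<open>e\<close>, \<open>e'\<close> are the entries of \<open>E\<close> and its inverse, \<open>f\<close>, \<open>f'\<close> those of
  \<open>F\<close>. Only the last rows of \<open>e'\<close> and \<open>f\<close> are normalized.\<close>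

locale reduced_pair =
  fixes m n :: nat and e e' f f' :: "nat \<Rightarrow> nat \<Rightarrow> 'k::field"
  assumes m: "2 \<le> m" and n: "2 \<le> n"
    and e'e: "\<And>i j. i < m \<Longrightarrow> j < m \<Longrightarrow> (\<Sum>k<m. e' i k * e k j) = (if i = j then 1 else 0)"
    and ee': "\<And>i j. i < m \<Longrightarrow> j < m \<Longrightarrow> (\<Sum>k<m. e i k * e' k j) = (if i = j then 1 else 0)"
    and f'f: "\<And>i j. i < n \<Longrightarrow> j < n \<Longrightarrow> (\<Sum>k<n. f' i k * f k j) = (if i = j then 1 else 0)"
    and ff': "\<And>i j. i < n \<Longrightarrow> j < n \<Longrightarrow> (\<Sum>k<n. f i k * f' k j) = (if i = j then 1 else 0)"
    and tr: "(\<Sum>i<m. e i i) = (\<Sum>a<n. f a a)" and tr': "(\<Sum>i<m. e' i i) = (\<Sum>a<n. f' a a)"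
    and e'_row: "\<And>j. j < m - 1 \<Longrightarrow> e' (m - 1) j = 0" and f_row: "\<And>b. b < n - 1 \<Longrightarrow> f (n - 1) b = 0"
begin

abbreviation "x0 \<equiv> m - 1"
abbreviation "z0 \<equiv> n - 1"

lemma x0: "x0 < m" "x0 \<noteq> 0" "0 < m" and z0: "z0 < n" "z0 \<noteq> 0" "0 < n"
  using m n by auto

lemma e'_row': "j < m \<Longrightarrow> e' x0 j \<noteq> 0 \<Longrightarrow> j = x0"
  using e'_row[of j] by (cases "j < x0") auto

lemma f_row': "b < n \<Longrightarrow> f z0 b \<noteq> 0 \<Longrightarrow> b = z0"
  using f_row[of b] by (cases "b < z0") auto

lemma lam: "e' x0 x0 \<noteq> 0"
proof
  assume a: "e' x0 x0 = 0"
  have "e' x0 k * e k x0 = 0" if "k < m" for k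
    using that a e'_row[of k] x0 by (cases "k = x0") auto
  then have "(\<Sum>k<m. e' x0 k * e k x0) = 0" by (intro sum.neutral) auto
  then show False using e'e[OF x0(1) x0(1)] by simp
qed

lemma mu: "f z0 z0 \<noteq> 0"
proof
  assume a: "f z0 z0 = 0"
  have "f z0 k * f' k z0 = 0" if "k < n" for k
    using that a f_row[of k] z0 by (cases "k = z0") auto
  then have "(\<Sum>k<n. f z0 k * f' k z0) = 0" by (intro sum.neutral) auto
  then show False using ff'[OF z0(1) z0(1)] by simp
qed

text \<open>The words \<open>u\<^sub>i\<^sub>0 v\<^sub>j\<^sub>0\<close> and \<open>v\<^sub>0\<^sub>a u\<^sub>0\<^sub>b\<close> are solved for by the first and third relations, the words with both row
  indices (for \<open>u v\<close>) or both column indices (for \<open>v u\<close>) maximal by the other two. The right-hand side of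
  the rule for a leading word consists of a constant, indexed by \<open>None\<close>, and of two-letter words.\<close>

fun lead :: "hgen \<Rightarrow> hgen \<Rightarrow> bool" where
  "lead (U i a) (V j b) \<longleftrightarrow> i < m \<and> j < m \<and> a < n \<and> b < n \<and> (a = 0 \<and> b = 0 \<or> i = x0 \<and> j = x0)"
| "lead (V i a) (U j b) \<longleftrightarrow> i < m \<and> j < m \<and> a < n \<and> b < n \<and> (i = 0 \<and> j = 0 \<or> a = z0 \<and> b = z0)"
| "lead (U i a) (U j b) \<longleftrightarrow> False"
| "lead (V i a) (V j b) \<longleftrightarrow> False"

fun idx :: "hgen \<Rightarrow> hgen \<Rightarrow> (nat \<times> nat) option set" where
  "idx (U i a) (V j b) = insert None (Some ` (if a = 0 \<and> b = 0 then (\<lambda>d. (d, d)) ` ({..<n} - {0})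
     else {..<m} \<times> {..<m} - {(x0, x0)}))"
| "idx (V i a) (U j b) = insert None (Some ` (if i = 0 \<and> j = 0 then (\<lambda>k. (k, k)) ` ({..<m} - {0})
     else {..<n} \<times> {..<n} - {(z0, z0)}))"
| "idx (U i a) (U j b) = {}"
| "idx (V i a) (V j b) = {}"

fun coef :: "hgen \<Rightarrow> hgen \<Rightarrow> (nat \<times> nat) option \<Rightarrow> 'k" where
  "coef (U i a) (V j b) None = (if a = 0 \<and> b = 0 then (if i = j then 1 else 0) else f' a b / e' x0 x0)"
| "coef (U i a) (V j b) (Some (k, l)) = (if a = 0 \<and> b = 0 then -1 else - e' k l / e' x0 x0)"
| "coef (V i a) (U j b) None = (if i = 0 \<and> j = 0 then (if a = b then 1 else 0) else e i j / f z0 z0)"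
| "coef (V i a) (U j b) (Some (k, l)) = (if i = 0 \<and> j = 0 then -1 else - f k l / f z0 z0)"
| "coef (U i a) (U j b) _ = 0"
| "coef (V i a) (V j b) _ = 0"

fun tail :: "hgen \<Rightarrow> hgen \<Rightarrow> (nat \<times> nat) option \<Rightarrow> hgen list" where
  "tail (U i a) (V j b) (Some (k, l)) = (if a = 0 \<and> b = 0 then [U i k, V j l] else [U k a, V l b])"
| "tail (V i a) (U j b) (Some (k, l)) = (if i = 0 \<and> j = 0 then [V k a, U l b] else [V i k, U j l])"
| "tail _ _ _ = []"

text \<open>Words are compared by length and then at the first difference; since a rule replaces two letters by
  two letters, it is enough that the first letter of every replacement is smaller. The second rule of each kind
  lowers the first component, because the last row of \<open>e'\<close> (of \<open>f\<close>) has only one nonzero entry.\<close>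

fun rank :: "hgen \<Rightarrow> nat \<times> nat" where
  "rank (U i a) = (i, n - a)"
| "rank (V i a) = (a, m - i)"

definition ord :: "(hgen list \<times> hgen list) set" where
  "ord = lenlex (inv_image (less_than <*lex*> less_than) rank)"

lemma ord_len: "length v < length w \<Longrightarrow> (v, w) \<in> ord"
  by (simp add: ord_def lenlex_conv)

lemma ord_first:
  "(rank x', rank x) \<in> less_than <*lex*> less_than \<Longrightarrow> length v = length w \<Longrightarrow> (p @ x' # v, p @ x # w) \<in> ord"
  by (auto simp: ord_def lenlex_conv intro!: lex_append_leftI)

sublocale W: word_rewriting "{(x, y). lead x y}" idx coef tail ord
proof
  show "wf ord" by (auto simp: ord_def intro!: wf_lenlex)
  show "trans ord" by (auto simp: ord_def intro!: lenlex_transI trans_inv_image trans_lex_prod)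
  show "finite (idx x y)" for x y by (cases x; cases y) auto
  fix x y i p q assume "(x, y) \<in> {(x, y). lead x y}" and i: "i \<in> idx x y" and c: "coef x y i \<noteq> 0"
  then have L: "lead x y" by simp
  show "(p @ tail x y i @ q, p @ [x, y] @ q) \<in> ord"
  proof (cases i)
    case None
    have "tail x y None = []" by (cases x; cases y) auto
    then show ?thesis using None by (intro ord_len) simp
  next
    case (Some kl)
    obtain k l where kl: "kl = (k, l)" by (cases kl)
    show ?thesis
    proof (cases x; cases y)
      fix i' a j b assume xy: "x = U i' a" "y = V j b"
      show ?thesis
      proof (cases "a = 0 \<and> b = 0")
        case True
        then show ?thesis using i xy L Some kl by (auto intro!: ord_first)
      next
        case False
        then have "(k, l) \<in> {..<m} \<times> {..<m} - {(x0, x0)}" "e' k l \<noteq> 0" using i c xy Some kl by auto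
        then have "k < x0" using e'_row'[of l] by (cases "k = x0") auto
        then show ?thesis using False xy L Some kl by (auto intro!: ord_first)
      qed
    next
      fix i' a j b assume xy: "x = V i' a" "y = U j b"
      show ?thesis
      proof (cases "i' = 0 \<and> j = 0")
        case True
        then show ?thesis using i xy L Some kl by (auto intro!: ord_first)
      next
        case False
        then have "(k, l) \<in> {..<n} \<times> {..<n} - {(z0, z0)}" "f k l \<noteq> 0" using i c xy Some kl by auto
        then have "k < z0" using f_row'[of l] by (cases "k = z0") auto
        then show ?thesis using False xy L Some kl by (auto intro!: ord_first)
      qed
    qed (use L in auto)
  qed
qed

abbreviation "\<phi> \<equiv> W.phi"

abbreviation "ite P \<equiv> (if P then 1 else 0 :: 'k)"

text \<open>The four families of relators, evaluated in the context \<open>p _ q\<close>.\<close>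

definition R1 where "R1 p i j q \<longleftrightarrow> (\<Sum>a<n. \<phi> (p @ [U i a, V j a] @ q)) = ite (i = j) * \<phi> (p @ q)"
definition R2 where "R2 p a b q \<longleftrightarrow> (\<Sum>i<m. \<phi> (p @ [V i a, U i b] @ q)) = ite (a = b) * \<phi> (p @ q)"
definition R3 where
  "R3 p i j q \<longleftrightarrow> (\<Sum>(a, b)\<in>{..<n} \<times> {..<n}. f a b * \<phi> (p @ [V i a, U j b] @ q)) = e i j * \<phi> (p @ q)"
definition R4 where
  "R4 p a b q \<longleftrightarrow> (\<Sum>(i, j)\<in>{..<m} \<times> {..<m}. e' i j * \<phi> (p @ [U i a, V j b] @ q)) = f' a b * \<phi> (p @ q)"

lemma sum_insert_None:
  fixes g :: "'b option \<Rightarrow> 'k"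
  shows "finite D \<Longrightarrow> (\<Sum>i\<in>insert None (Some ` D). g i) = g None + (\<Sum>d\<in>D. g (Some d))"
  by (subst sum.insert) (auto simp: sum.reindex)

lemma step1: "W.step \<phi> p (U i 0) (V j 0) q =
    ite (i = j) * \<phi> (p @ q) - (\<Sum>a\<in>{..<n} - {0}. \<phi> (p @ [U i a, V j a] @ q))"
  unfolding W.step_def
  by (simp add: sum_insert_None sum.reindex inj_on_def sum_negf)

lemma step2: "W.step \<phi> p (V 0 a) (U 0 b) q =
    ite (a = b) * \<phi> (p @ q) - (\<Sum>i\<in>{..<m} - {0}. \<phi> (p @ [V i a, U i b] @ q))"
  unfolding W.step_def
  by (simp add: sum_insert_None sum.reindex inj_on_def sum_negf)

lemma step3:
  assumes "(i, j) \<noteq> (0, 0)"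
  shows "f z0 z0 * W.step \<phi> p (V i z0) (U j z0) q =
    e i j * \<phi> (p @ q) - (\<Sum>(a, b)\<in>{..<n} \<times> {..<n} - {(z0, z0)}. f a b * \<phi> (p @ [V i a, U j b] @ q))"
proof -
  have nz: "\<not> (i = 0 \<and> j = 0)" using assms by simp
  have "W.step \<phi> p (V i z0) (U j z0) q = e i j / f z0 z0 * \<phi> (p @ q) +
      (\<Sum>d\<in>{..<n} \<times> {..<n} - {(z0, z0)}. coef (V i z0) (U j z0) (Some d) * \<phi> (p @ tail (V i z0) (U j z0) (Some d) @ q))"
    unfolding W.step_def idx.simps if_not_P[OF nz] by (subst sum_insert_None) (simp_all add: nz)
  moreover have "f z0 z0 * (\<Sum>d\<in>{..<n} \<times> {..<n} - {(z0, z0)}. coef (V i z0) (U j z0) (Some d) * \<phi> (p @ tail (V i z0) (U j z0) (Some d) @ q))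
      = - (\<Sum>(a, b)\<in>{..<n} \<times> {..<n} - {(z0, z0)}. f a b * \<phi> (p @ [V i a, U j b] @ q))"
    unfolding sum_distrib_left sum_negf[symmetric] by (intro sum.cong refl) (use nz mu in auto)
  ultimately show ?thesis using mu by (simp add: distrib_left)
qed

lemma step4:
  assumes "(a, b) \<noteq> (0, 0)"
  shows "e' x0 x0 * W.step \<phi> p (U x0 a) (V x0 b) q =
    f' a b * \<phi> (p @ q) - (\<Sum>(i, j)\<in>{..<m} \<times> {..<m} - {(x0, x0)}. e' i j * \<phi> (p @ [U i a, V j b] @ q))"
proof -
  have nz: "\<not> (a = 0 \<and> b = 0)" using assms by simp
  have "W.step \<phi> p (U x0 a) (V x0 b) q = f' a b / e' x0 x0 * \<phi> (p @ q) +
      (\<Sum>d\<in>{..<m} \<times> {..<m} - {(x0, x0)}. coef (U x0 a) (V x0 b) (Some d) * \<phi> (p @ tail (U x0 a) (V x0 b) (Some d) @ q))"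
    unfolding W.step_def idx.simps if_not_P[OF nz] by (subst sum_insert_None) (simp_all add: nz)
  moreover have "e' x0 x0 * (\<Sum>d\<in>{..<m} \<times> {..<m} - {(x0, x0)}. coef (U x0 a) (V x0 b) (Some d) * \<phi> (p @ tail (U x0 a) (V x0 b) (Some d) @ q))
      = - (\<Sum>(i, j)\<in>{..<m} \<times> {..<m} - {(x0, x0)}. e' i j * \<phi> (p @ [U i a, V j b] @ q))"
    unfolding sum_distrib_left sum_negf[symmetric] by (intro sum.cong refl) (use nz lam in auto)
  ultimately show ?thesis using lam by (simp add: distrib_left)
qed

lemma R1_holds: "W.holds p (U i 0) (V j 0) q \<Longrightarrow> R1 p i j q"
  unfolding W.holds_def step1 R1_def using z0 by (subst sum.remove[of _ 0]) auto

lemma R2_holds: "W.holds p (V 0 a) (U 0 b) q \<Longrightarrow> R2 p a b q"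
  unfolding W.holds_def step2 R2_def using x0 by (subst sum.remove[of _ 0]) auto

lemma R3_holds: "(i, j) \<noteq> (0, 0) \<Longrightarrow> W.holds p (V i z0) (U j z0) q \<Longrightarrow> R3 p i j q"
proof -
  assume ij: "(i, j) \<noteq> (0, 0)" and h: "W.holds p (V i z0) (U j z0) q"
  have "f z0 z0 * \<phi> (p @ [V i z0, U j z0] @ q) =
    e i j * \<phi> (p @ q) - (\<Sum>(a, b)\<in>{..<n} \<times> {..<n} - {(z0, z0)}. f a b * \<phi> (p @ [V i a, U j b] @ q))"
    using h step3[OF ij] by (simp only: W.holds_def)
  then show ?thesis unfolding R3_def using z0 by (subst sum.remove[of _ "(z0, z0)"]) auto
qed

lemma R4_holds: "(a, b) \<noteq> (0, 0) \<Longrightarrow> W.holds p (U x0 a) (V x0 b) q \<Longrightarrow> R4 p a b q"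
proof -
  assume ab: "(a, b) \<noteq> (0, 0)" and h: "W.holds p (U x0 a) (V x0 b) q"
  have "e' x0 x0 * \<phi> (p @ [U x0 a, V x0 b] @ q) =
    f' a b * \<phi> (p @ q) - (\<Sum>(i, j)\<in>{..<m} \<times> {..<m} - {(x0, x0)}. e' i j * \<phi> (p @ [U i a, V j b] @ q))"
    using h step4[OF ab] by (simp only: W.holds_def)
  then show ?thesis unfolding R4_def using x0 by (subst sum.remove[of _ "(x0, x0)"]) auto
qed

text \<open>There are \<open>m\<^sup>2 + n\<^sup>2\<close> relators on the words \<open>u v\<close> but only \<open>m\<^sup>2 + n\<^sup>2 - 1\<close> leading words. The equality
  of traces makes the remaining relator a combination of the others; the same holds for \<open>v u\<close>.\<close>

lemma R4_00:
  assumes 1: "\<And>i j. i < m \<Longrightarrow> j < m \<Longrightarrow> e' i j \<noteq> 0 \<Longrightarrow> R1 p i j q" and 4: "\<And>a. 0 < a \<Longrightarrow> a < n \<Longrightarrow> R4 p a a q"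
  shows "R4 p 0 0 q"
proof -
  let ?M = "{..<m} \<times> {..<m}" and ?g = "\<lambda>i j a. \<phi> (p @ [U i a, V j a] @ q)"
  have "(\<Sum>a<n. \<Sum>(i, j)\<in>?M. e' i j * ?g i j a) = (\<Sum>(i, j)\<in>?M. e' i j * (\<Sum>a<n. ?g i j a))"
    by (subst sum.swap) (simp add: sum_distrib_left case_prod_unfold)
  also have "\<dots> = (\<Sum>(i, j)\<in>?M. e' i j * (ite (i = j) * \<phi> (p @ q)))"
  proof (intro sum.cong refl)
    fix k assume k: "k \<in> ?M"
    show "(case k of (i, j) \<Rightarrow> e' i j * (\<Sum>a<n. ?g i j a)) = (case k of (i, j) \<Rightarrow> e' i j * (ite (i = j) * \<phi> (p @ q)))"
      using 1[of "fst k" "snd k"] k by (cases "e' (fst k) (snd k) = 0") (auto simp: R1_def)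
  qed
  also have "\<dots> = (\<Sum>i<m. e' i i) * \<phi> (p @ q)"
    by (simp add: sum.cartesian_product[symmetric] sum_distrib_right if_distrib[of "\<lambda>x. _ * (x * _)"] sum.delta cong: if_cong)
  finally have "(\<Sum>(i, j)\<in>?M. e' i j * ?g i j 0) + (\<Sum>a\<in>{..<n} - {0}. \<Sum>(i, j)\<in>?M. e' i j * ?g i j a) =
      (\<Sum>a<n. f' a a) * \<phi> (p @ q)"
    using z0 by (simp add: tr' sum.remove[of "{..<n}" 0])
  moreover have "(\<Sum>a\<in>{..<n} - {0}. \<Sum>(i, j)\<in>?M. e' i j * ?g i j a) = (\<Sum>a\<in>{..<n} - {0}. f' a a * \<phi> (p @ q))"
    using 4 by (intro sum.cong refl) (auto simp: R4_def)
  moreover have "(\<Sum>a<n. f' a a) * \<phi> (p @ q) = f' 0 0 * \<phi> (p @ q) + (\<Sum>a\<in>{..<n} - {0}. f' a a * \<phi> (p @ q))"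
    using z0 by (simp add: sum_distrib_right distrib_right sum.remove[of "{..<n}" 0])
  ultimately show ?thesis by (simp add: R4_def)
qed

lemma R3_00:
  assumes 2: "\<And>a b. a < n \<Longrightarrow> b < n \<Longrightarrow> f a b \<noteq> 0 \<Longrightarrow> R2 p a b q" and 3: "\<And>i. 0 < i \<Longrightarrow> i < m \<Longrightarrow> R3 p i i q"
  shows "R3 p 0 0 q"
proof -
  let ?M = "{..<n} \<times> {..<n}" and ?g = "\<lambda>a b i. \<phi> (p @ [V i a, U i b] @ q)"
  have "(\<Sum>i<m. \<Sum>(a, b)\<in>?M. f a b * ?g a b i) = (\<Sum>(a, b)\<in>?M. f a b * (\<Sum>i<m. ?g a b i))"
    by (subst sum.swap) (simp add: sum_distrib_left case_prod_unfold)
  also have "\<dots> = (\<Sum>(a, b)\<in>?M. f a b * (ite (a = b) * \<phi> (p @ q)))"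
  proof (intro sum.cong refl)
    fix k assume k: "k \<in> ?M"
    show "(case k of (a, b) \<Rightarrow> f a b * (\<Sum>i<m. ?g a b i)) = (case k of (a, b) \<Rightarrow> f a b * (ite (a = b) * \<phi> (p @ q)))"
      using 2[of "fst k" "snd k"] k by (cases "f (fst k) (snd k) = 0") (auto simp: R2_def)
  qed
  also have "\<dots> = (\<Sum>a<n. f a a) * \<phi> (p @ q)"
    by (simp add: sum.cartesian_product[symmetric] sum_distrib_right if_distrib[of "\<lambda>x. _ * (x * _)"] sum.delta cong: if_cong)
  finally have "(\<Sum>(a, b)\<in>?M. f a b * ?g a b 0) + (\<Sum>i\<in>{..<m} - {0}. \<Sum>(a, b)\<in>?M. f a b * ?g a b i) =
      (\<Sum>i<m. e i i) * \<phi> (p @ q)"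
    using x0 by (simp add: tr sum.remove[of "{..<m}" 0])
  moreover have "(\<Sum>i\<in>{..<m} - {0}. \<Sum>(a, b)\<in>?M. f a b * ?g a b i) = (\<Sum>i\<in>{..<m} - {0}. e i i * \<phi> (p @ q))"
    using 3 by (intro sum.cong refl) (auto simp: R3_def)
  moreover have "(\<Sum>i<m. e i i) * \<phi> (p @ q) = e 0 0 * \<phi> (p @ q) + (\<Sum>i\<in>{..<m} - {0}. e i i * \<phi> (p @ q))"
    using x0 by (simp add: sum_distrib_right distrib_right sum.remove[of "{..<m}" 0])
  ultimately show ?thesis by (simp add: R3_def)
qed

lemma R1_below:
  assumes "W.below w" "i < m" "j < m" "(p @ [U i 0, V j 0] @ q, w) \<in> ord"
  shows "R1 p i j q"
  by (rule R1_holds) (use assms z0 in \<open>auto simp: W.below_def\<close>)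

lemma R2_below:
  assumes "W.below w" "a < n" "b < n" "(p @ [V 0 a, U 0 b] @ q, w) \<in> ord"
  shows "R2 p a b q"
  by (rule R2_holds) (use assms x0 in \<open>auto simp: W.below_def\<close>)

lemma ord_trans: "(u, v) \<in> ord \<Longrightarrow> (v, w) \<in> ord \<Longrightarrow> (u, w) \<in> ord"
  using W.trans by (auto dest: transD)

lemma R4_below:
  assumes b: "W.below w" and ab: "a < n" "b < n" and o: "(p @ [U x0 a, V x0 b] @ q, w) \<in> ord"
  shows "R4 p a b q"
proof (cases "(a, b) = (0, 0)")
  case False
  then show ?thesis by (intro R4_holds) (use assms x0 in \<open>auto simp: W.below_def\<close>)
next
  case True
  show ?thesis unfolding True[unfolded prod.inject, THEN conjunct1] True[unfolded prod.inject, THEN conjunct2]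
  proof (rule R4_00)
    fix i j assume ij: "i < m" "j < m" "e' i j \<noteq> 0"
    have "i < x0 \<or> i = x0 \<and> j = x0" using ij e'_row'[of j] by (cases "i = x0") auto
    then have "(p @ [U i 0, V j 0] @ q, w) \<in> ord"
    proof
      assume "i < x0"
      then have "(p @ [U i 0, V j 0] @ q, p @ [U x0 a, V x0 b] @ q) \<in> ord"
        using True by (auto intro!: ord_first)
      then show ?thesis using o by (rule ord_trans)
    qed (use o True in auto)
    then show "R1 p i j q" using ij b by (intro R1_below) auto
  next
    fix d assume d: "0 < d" "d < n"
    have "(p @ [U x0 d, V x0 d] @ q, p @ [U x0 a, V x0 b] @ q) \<in> ord"
      using d True by (auto intro!: ord_first)
    then have "(p @ [U x0 d, V x0 d] @ q, w) \<in> ord" using o by (rule ord_trans)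
    then show "R4 p d d q" by (intro R4_holds) (use d b x0 in \<open>auto simp: W.below_def\<close>)
  qed
qed

lemma R3_below:
  assumes b: "W.below w" and ij: "i < m" "j < m" and o: "(p @ [V i z0, U j z0] @ q, w) \<in> ord"
  shows "R3 p i j q"
proof (cases "(i, j) = (0, 0)")
  case False
  then show ?thesis by (intro R3_holds) (use assms z0 in \<open>auto simp: W.below_def\<close>)
next
  case True
  show ?thesis unfolding True[unfolded prod.inject, THEN conjunct1] True[unfolded prod.inject, THEN conjunct2]
  proof (rule R3_00)
    fix a b assume ab: "a < n" "b < n" "f a b \<noteq> 0"
    have "a < z0 \<or> a = z0 \<and> b = z0" using ab f_row'[of b] by (cases "a = z0") auto
    then have "(p @ [V 0 a, U 0 b] @ q, w) \<in> ord"
    proof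
      assume "a < z0"
      then have "(p @ [V 0 a, U 0 b] @ q, p @ [V i z0, U j z0] @ q) \<in> ord"
        using True by (auto intro!: ord_first)
      then show ?thesis using o by (rule ord_trans)
    qed (use o True in auto)
    then show "R2 p a b q" using ab assms(1) by (intro R2_below) auto
  next
    fix d assume d: "0 < d" "d < m"
    have "(p @ [V d z0, U d z0] @ q, p @ [V i z0, U j z0] @ q) \<in> ord"
      using d True by (auto intro!: ord_first)
    then have "(p @ [V d z0, U d z0] @ q, w) \<in> ord" using o by (rule ord_trans)
    then show "R3 p d d q" by (intro R3_holds) (use d b z0 in \<open>auto simp: W.below_def\<close>)
  qed
qed

lemma sum_ite: "finite D \<Longrightarrow> (\<Sum>k\<in>D. ite (j = k) * g k) = ite (j \<in> D) * g j"
  by (simp add: if_distrib[of "\<lambda>x. x * _"] cong: if_cong)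

text \<open>The four overlaps. Each expresses that the two ways of contracting \<open>u v\<^sup>t u\<close>,
  \<open>v\<^sup>t u v\<^sup>t\<close>, \<open>u\<^sup>t E\<^sup>-\<^sup>1 v F u\<^sup>t\<close> and \<open>v F u\<^sup>t E\<^sup>-\<^sup>1 v\<close> agree.\<close>

lemma overlap12:
  assumes b: "W.below (p @ [U i 0, V 0 0, U 0 c] @ q)" and i: "i < m" and c: "c < n"
  shows "W.step \<phi> p (U i 0) (V 0 0) (U 0 c # q) = W.step \<phi> (p @ [U i 0]) (V 0 0) (U 0 c) q"
proof -
  let ?H = "\<phi> (p @ [U i c] @ q)"
  define g where "g k a = \<phi> (p @ [U i a, V k a, U k c] @ q)" for k a
  have "(\<Sum>k\<in>{..<m} - {0}. g k 0) - (\<Sum>a\<in>{..<n} - {0}. g 0 a) =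
      (\<Sum>k\<in>{..<m} - {0}. ite (i = k) * \<phi> (p @ [U k c] @ q)) - (\<Sum>a\<in>{..<n} - {0}. ite (c = a) * \<phi> (p @ [U i a] @ q))"
  proof (rule double_sum_exchange)
    fix k assume k: "k \<in> {..<m} - {0}"
    have "R1 p i k ([U k c] @ q)"
    proof (rule R1_below[OF b])
      show "(p @ [U i 0, V k 0] @ [U k c] @ q, p @ [U i 0, V 0 0, U 0 c] @ q) \<in> ord"
        using k by (auto intro!: ord_first[of _ _ _ _ "p @ [U i 0]", simplified])
    qed (use i k in auto)
    then show "(\<Sum>a<n. g k a) = ite (i = k) * \<phi> (p @ [U k c] @ q)" by (simp add: R1_def g_def)
  next
    fix a assume a: "a \<in> {..<n} - {0}"
    have "R2 (p @ [U i a]) a c q"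
    proof (rule R2_below[OF b])
      show "((p @ [U i a]) @ [V 0 a, U 0 c] @ q, p @ [U i 0, V 0 0, U 0 c] @ q) \<in> ord"
        using a by (auto intro!: ord_first)
    qed (use a c in auto)
    then show "(\<Sum>k<m. g k a) = ite (c = a) * \<phi> (p @ [U i a] @ q)" by (auto simp: R2_def g_def)
  qed (use x0 z0 in auto)
  also have "\<dots> = (ite (i \<noteq> 0) - ite (c \<noteq> 0)) * ?H"
    using i c by (simp add: sum_ite left_diff_distrib)
  finally show ?thesis unfolding step1 step2
    by (simp add: g_def algebra_simps split: if_splits)
qed

lemma overlap21:
  assumes b: "W.below (p @ [V 0 a, U 0 0, V j 0] @ q)" and j: "j < m" and a: "a < n"
  shows "W.step \<phi> p (V 0 a) (U 0 0) (V j 0 # q) = W.step \<phi> (p @ [V 0 a]) (U 0 0) (V j 0) q"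
proof -
  let ?H = "\<phi> (p @ [V j a] @ q)"
  define g where "g c k = \<phi> (p @ [V k a, U k c, V j c] @ q)" for c k
  have "(\<Sum>c\<in>{..<n} - {0}. g c 0) - (\<Sum>k\<in>{..<m} - {0}. g 0 k) =
      (\<Sum>c\<in>{..<n} - {0}. ite (a = c) * \<phi> (p @ [V j c] @ q)) - (\<Sum>k\<in>{..<m} - {0}. ite (j = k) * \<phi> (p @ [V k a] @ q))"
  proof (rule double_sum_exchange)
    fix c assume c: "c \<in> {..<n} - {0}"
    have "R2 p a c ([V j c] @ q)"
    proof (rule R2_below[OF b])
      show "(p @ [V 0 a, U 0 c] @ [V j c] @ q, p @ [V 0 a, U 0 0, V j 0] @ q) \<in> ord"
        using c by (auto intro!: ord_first[of _ _ _ _ "p @ [V 0 a]", simplified])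
    qed (use a c in auto)
    then show "(\<Sum>k<m. g c k) = ite (a = c) * \<phi> (p @ [V j c] @ q)" by (simp add: R2_def g_def)
  next
    fix k assume k: "k \<in> {..<m} - {0}"
    have "R1 (p @ [V k a]) k j q"
    proof (rule R1_below[OF b])
      show "((p @ [V k a]) @ [U k 0, V j 0] @ q, p @ [V 0 a, U 0 0, V j 0] @ q) \<in> ord"
        using k by (auto intro!: ord_first)
    qed (use k j in auto)
    then show "(\<Sum>c<n. g c k) = ite (j = k) * \<phi> (p @ [V k a] @ q)" by (auto simp: R1_def g_def)
  qed (use x0 z0 in auto)
  also have "\<dots> = (ite (a \<noteq> 0) - ite (j \<noteq> 0)) * ?H"
    using j a by (simp add: sum_ite left_diff_distrib)
  finally show ?thesis unfolding step1 step2
    by (simp add: g_def algebra_simps split: if_splits)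
qed

lemma overlap43:
  assumes b: "W.below (p @ [U x0 a, V x0 z0, U j z0] @ q)" and j: "j < m" and a: "a < n"
  shows "W.step \<phi> p (U x0 a) (V x0 z0) (U j z0 # q) = W.step \<phi> (p @ [U x0 a]) (V x0 z0) (U j z0) q"
proof -
  let ?M = "{..<m} \<times> {..<m}" and ?N = "{..<n} \<times> {..<n}"
  define h where "h c = \<phi> (p @ [U j c] @ q)" for c
  define h' where "h' i = \<phi> (p @ [U i a] @ q)" for i
  define g where "g ik bc = e' (fst ik) (snd ik) * f (fst bc) (snd bc) * \<phi> (p @ [U (fst ik) a, V (snd ik) (fst bc), U j (snd bc)] @ q)" for ik bc
  have F: "(\<Sum>bc\<in>?N. f' a (fst bc) * f (fst bc) (snd bc) * h (snd bc)) = h a"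
  proof -
    have "(\<Sum>bc\<in>?N. f' a (fst bc) * f (fst bc) (snd bc) * h (snd bc)) = (\<Sum>c<n. \<Sum>b<n. f' a b * f b c * h c)"
      by (subst sum.swap) (simp add: sum.cartesian_product case_prod_unfold)
    also have "\<dots> = (\<Sum>c<n. ite (a = c) * h c)"
      using a by (intro sum.cong refl) (simp add: f'f sum_distrib_right[symmetric])
    also have "\<dots> = h a" using a by (subst sum_ite) auto
    finally show ?thesis .
  qed
  have E: "(\<Sum>ik\<in>?M. e' (fst ik) (snd ik) * e (snd ik) j * h' (fst ik)) = h' j"
  proof -
    have "(\<Sum>ik\<in>?M. e' (fst ik) (snd ik) * e (snd ik) j * h' (fst ik)) = (\<Sum>i<m. \<Sum>k<m. e' i k * e k j * h' i)"
      by (simp add: sum.cartesian_product case_prod_unfold)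
    also have "\<dots> = (\<Sum>i<m. ite (j = i) * h' i)"
      using j by (intro sum.cong refl) (auto simp: e'e sum_distrib_right[symmetric])
    also have "\<dots> = h' j" using j by (subst sum_ite) auto
    finally show ?thesis .
  qed
  have "(\<Sum>ik\<in>?M - {(x0, x0)}. g ik (z0, z0)) - (\<Sum>bc\<in>?N - {(z0, z0)}. g (x0, x0) bc) =
      (\<Sum>ik\<in>?M - {(x0, x0)}. e' (fst ik) (snd ik) * e (snd ik) j * h' (fst ik)) -
      (\<Sum>bc\<in>?N - {(z0, z0)}. f' a (fst bc) * f (fst bc) (snd bc) * h (snd bc))"
  proof (rule double_sum_exchange)
    fix ik assume "ik \<in> ?M - {(x0, x0)}"
    then obtain i k where ik: "ik = (i, k)" "i < m" "k < m" "(i, k) \<noteq> (x0, x0)" by auto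
    show "(\<Sum>bc\<in>?N. g ik bc) = e' (fst ik) (snd ik) * e (snd ik) j * h' (fst ik)"
    proof (cases "e' i k = 0")
      case False
      then have i: "i < x0" using ik e'_row'[of k] by (cases "i = x0") auto
      have "R3 (p @ [U i a]) k j q"
      proof (rule R3_below[OF b])
        show "((p @ [U i a]) @ [V k z0, U j z0] @ q, p @ [U x0 a, V x0 z0, U j z0] @ q) \<in> ord"
          using i by (auto intro!: ord_first)
      qed (use ik j in auto)
      then have "(\<Sum>(b, c)\<in>?N. f b c * \<phi> (p @ [U i a, V k b, U j c] @ q)) = e k j * h' i"
        by (simp add: R3_def h'_def)
      then have "e' i k * (\<Sum>(b, c)\<in>?N. f b c * \<phi> (p @ [U i a, V k b, U j c] @ q)) = e' i k * (e k j * h' i)"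
        by simp
      then show ?thesis using ik by (simp add: g_def sum_distrib_left case_prod_unfold mult.assoc)
    qed (simp add: g_def ik)
  next
    fix bc assume "bc \<in> ?N - {(z0, z0)}"
    then obtain b' c where bc: "bc = (b', c)" "b' < n" "c < n" "(b', c) \<noteq> (z0, z0)" by auto
    show "(\<Sum>ik\<in>?M. g ik bc) = f' a (fst bc) * f (fst bc) (snd bc) * h (snd bc)"
    proof (cases "f b' c = 0")
      case False
      then have b': "b' < z0" using bc f_row'[of c] by (cases "b' = z0") auto
      have "R4 p a b' ([U j c] @ q)"
      proof (rule R4_below[OF b])
        show "(p @ [U x0 a, V x0 b'] @ [U j c] @ q, p @ [U x0 a, V x0 z0, U j z0] @ q) \<in> ord"
          using b' by (auto intro!: ord_first[of _ _ _ _ "p @ [U x0 a]", simplified])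
      qed (use bc a in auto)
      then have "(\<Sum>(i, k)\<in>?M. e' i k * \<phi> (p @ [U i a, V k b', U j c] @ q)) = f' a b' * h c"
        by (simp add: R4_def h_def)
      then have "f b' c * (\<Sum>(i, k)\<in>?M. e' i k * \<phi> (p @ [U i a, V k b', U j c] @ q)) = f b' c * (f' a b' * h c)"
        by simp
      then show ?thesis using bc by (simp add: g_def sum_distrib_left case_prod_unfold mult_ac)
    qed (simp add: g_def bc)
  qed (use x0 z0 in auto)
  also have "\<dots> = (h' j - e' x0 x0 * e x0 j * h' x0) - (h a - f' a z0 * f z0 z0 * h z0)"
    unfolding E[symmetric] F[symmetric] using x0 z0 by (simp add: sum.remove[of ?M "(x0, x0)"] sum.remove[of ?N "(z0, z0)"])
  also have "h' j = h a" by (simp add: h_def h'_def)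
  finally have main: "(\<Sum>ik\<in>?M - {(x0, x0)}. g ik (z0, z0)) - (\<Sum>bc\<in>?N - {(z0, z0)}. g (x0, x0) bc) =
      f' a z0 * f z0 z0 * h z0 - e' x0 x0 * e x0 j * h' x0" by simp
  have 1: "f z0 z0 * (e' x0 x0 * W.step \<phi> p (U x0 a) (V x0 z0) (U j z0 # q)) =
      f z0 z0 * (f' a z0 * h z0) - (\<Sum>ik\<in>?M - {(x0, x0)}. g ik (z0, z0))"
    using z0 by (subst step4) (simp_all add: right_diff_distrib sum_distrib_left g_def h_def case_prod_unfold mult_ac)
  have 2: "e' x0 x0 * (f z0 z0 * W.step \<phi> (p @ [U x0 a]) (V x0 z0) (U j z0) q) =
      e' x0 x0 * (e x0 j * h' x0) - (\<Sum>bc\<in>?N - {(z0, z0)}. g (x0, x0) bc)"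
    using x0 by (subst step3) (simp_all add: right_diff_distrib sum_distrib_left g_def h'_def case_prod_unfold mult_ac)
  show ?thesis
    by (rule cancel_two_factors[OF mu lam 1 2]) (use main in \<open>simp only: mult_ac\<close>)
qed

lemma overlap34:
  assumes b: "W.below (p @ [V i z0, U x0 z0, V x0 b0] @ q)" and i: "i < m" and b0: "b0 < n"
  shows "W.step \<phi> p (V i z0) (U x0 z0) (V x0 b0 # q) = W.step \<phi> (p @ [V i z0]) (U x0 z0) (V x0 b0) q"
proof -
  let ?M = "{..<m} \<times> {..<m}" and ?N = "{..<n} \<times> {..<n}"
  define h where "h k = \<phi> (p @ [V k b0] @ q)" for k
  define h' where "h' a = \<phi> (p @ [V i a] @ q)" for a
  define g where "g ab jk = f (fst ab) (snd ab) * e' (fst jk) (snd jk) * \<phi> (p @ [V i (fst ab), U (fst jk) (snd ab), V (snd jk) b0] @ q)" for ab jk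
  have E: "(\<Sum>jk\<in>?M. e i (fst jk) * e' (fst jk) (snd jk) * h (snd jk)) = h i"
  proof -
    have "(\<Sum>jk\<in>?M. e i (fst jk) * e' (fst jk) (snd jk) * h (snd jk)) = (\<Sum>k<m. \<Sum>j<m. e i j * e' j k * h k)"
      by (subst sum.swap) (simp add: sum.cartesian_product case_prod_unfold)
    also have "\<dots> = (\<Sum>k<m. ite (i = k) * h k)"
      using i by (intro sum.cong refl) (simp add: ee' sum_distrib_right[symmetric])
    also have "\<dots> = h i" using i by (subst sum_ite) auto
    finally show ?thesis .
  qed
  have F: "(\<Sum>ab\<in>?N. f (fst ab) (snd ab) * f' (snd ab) b0 * h' (fst ab)) = h' b0"
  proof -
    have "(\<Sum>ab\<in>?N. f (fst ab) (snd ab) * f' (snd ab) b0 * h' (fst ab)) = (\<Sum>a<n. \<Sum>b<n. f a b * f' b b0 * h' a)"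
      by (simp add: sum.cartesian_product case_prod_unfold)
    also have "\<dots> = (\<Sum>a<n. ite (b0 = a) * h' a)"
      using b0 by (intro sum.cong refl) (auto simp: ff' sum_distrib_right[symmetric])
    also have "\<dots> = h' b0" using b0 by (subst sum_ite) auto
    finally show ?thesis .
  qed
  have "(\<Sum>ab\<in>?N - {(z0, z0)}. g ab (x0, x0)) - (\<Sum>jk\<in>?M - {(x0, x0)}. g (z0, z0) jk) =
      (\<Sum>ab\<in>?N - {(z0, z0)}. f (fst ab) (snd ab) * f' (snd ab) b0 * h' (fst ab)) -
      (\<Sum>jk\<in>?M - {(x0, x0)}. e i (fst jk) * e' (fst jk) (snd jk) * h (snd jk))"
  proof (rule double_sum_exchange)
    fix ab assume "ab \<in> ?N - {(z0, z0)}"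
    then obtain a b' where ab: "ab = (a, b')" "a < n" "b' < n" "(a, b') \<noteq> (z0, z0)" by auto
    show "(\<Sum>jk\<in>?M. g ab jk) = f (fst ab) (snd ab) * f' (snd ab) b0 * h' (fst ab)"
    proof (cases "f a b' = 0")
      case False
      then have a: "a < z0" using ab f_row'[of b'] by (cases "a = z0") auto
      have "R4 (p @ [V i a]) b' b0 q"
      proof (rule R4_below[OF b])
        show "((p @ [V i a]) @ [U x0 b', V x0 b0] @ q, p @ [V i z0, U x0 z0, V x0 b0] @ q) \<in> ord"
          using a by (auto intro!: ord_first)
      qed (use ab b0 in auto)
      then have "(\<Sum>(j, k)\<in>?M. e' j k * \<phi> (p @ [V i a, U j b', V k b0] @ q)) = f' b' b0 * h' a"
        by (simp add: R4_def h'_def)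
      then have "f a b' * (\<Sum>(j, k)\<in>?M. e' j k * \<phi> (p @ [V i a, U j b', V k b0] @ q)) = f a b' * (f' b' b0 * h' a)"
        by simp
      then show ?thesis using ab by (simp add: g_def sum_distrib_left case_prod_unfold mult.assoc)
    qed (simp add: g_def ab)
  next
    fix jk assume "jk \<in> ?M - {(x0, x0)}"
    then obtain j k where jk: "jk = (j, k)" "j < m" "k < m" "(j, k) \<noteq> (x0, x0)" by auto
    show "(\<Sum>ab\<in>?N. g ab jk) = e i (fst jk) * e' (fst jk) (snd jk) * h (snd jk)"
    proof (cases "e' j k = 0")
      case False
      then have j: "j < x0" using jk e'_row'[of k] by (cases "j = x0") auto
      have "R3 p i j ([V k b0] @ q)"
      proof (rule R3_below[OF b])
        show "(p @ [V i z0, U j z0] @ [V k b0] @ q, p @ [V i z0, U x0 z0, V x0 b0] @ q) \<in> ord"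
          using j by (auto intro!: ord_first[of _ _ _ _ "p @ [V i z0]", simplified])
      qed (use jk i in auto)
      then have "(\<Sum>(a, b')\<in>?N. f a b' * \<phi> (p @ [V i a, U j b', V k b0] @ q)) = e i j * h k"
        by (simp add: R3_def h_def)
      then have "e' j k * (\<Sum>(a, b')\<in>?N. f a b' * \<phi> (p @ [V i a, U j b', V k b0] @ q)) = e' j k * (e i j * h k)"
        by simp
      then show ?thesis using jk by (simp add: g_def sum_distrib_left case_prod_unfold mult_ac)
    qed (simp add: g_def jk)
  qed (use x0 z0 in auto)
  also have "\<dots> = (h' b0 - f z0 z0 * f' z0 b0 * h' z0) - (h i - e i x0 * e' x0 x0 * h x0)"
    unfolding E[symmetric] F[symmetric] using x0 z0 by (simp add: sum.remove[of ?M "(x0, x0)"] sum.remove[of ?N "(z0, z0)"])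
  also have "h' b0 = h i" by (simp add: h_def h'_def)
  finally have main: "(\<Sum>ab\<in>?N - {(z0, z0)}. g ab (x0, x0)) - (\<Sum>jk\<in>?M - {(x0, x0)}. g (z0, z0) jk) =
      e i x0 * e' x0 x0 * h x0 - f z0 z0 * f' z0 b0 * h' z0" by simp
  have 1: "e' x0 x0 * (f z0 z0 * W.step \<phi> p (V i z0) (U x0 z0) (V x0 b0 # q)) =
      e' x0 x0 * (e i x0 * h x0) - (\<Sum>ab\<in>?N - {(z0, z0)}. g ab (x0, x0))"
    using x0 by (subst step3) (simp_all add: right_diff_distrib sum_distrib_left g_def h_def case_prod_unfold mult_ac)
  have 2: "f z0 z0 * (e' x0 x0 * W.step \<phi> (p @ [V i z0]) (U x0 z0) (V x0 b0) q) =
      f z0 z0 * (f' z0 b0 * h' z0) - (\<Sum>jk\<in>?M - {(x0, x0)}. g (z0, z0) jk)"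
    using z0 by (subst step4) (simp_all add: right_diff_distrib sum_distrib_left g_def h'_def case_prod_unfold mult_ac)
  show ?thesis
    by (rule cancel_two_factors[OF lam mu 1 2]) (use main in \<open>simp only: mult_ac\<close>)
qed

lemma all_hold: "lead x y \<Longrightarrow> W.holds p x y q"
proof (rule W.diamond)
  fix p x y z q
  assume "(x, y) \<in> {(x, y). lead x y}" "(y, z) \<in> {(x, y). lead x y}" and b: "W.below (p @ [x, y, z] @ q)"
  then have l: "lead x y" "lead y z" by auto
  show "W.step \<phi> p x y (z # q) = W.step \<phi> (p @ [x]) y z q"
  proof (cases x; cases y; cases z)
    fix i a j b' k d assume e: "x = U i a" "y = V j b'" "z = U k d"
    then consider "a = 0" "b' = 0" "j = 0" "k = 0" | "i = x0" "j = x0" "b' = z0" "d = z0"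
      using l x0 z0 by auto
    then show ?thesis using overlap12[of p i d q] overlap43[of p a k q] l e b by cases auto
  next
    fix i a j b' k d assume e: "x = V i a" "y = U j b'" "z = V k d"
    then consider "i = 0" "j = 0" "b' = 0" "d = 0" | "a = z0" "b' = z0" "j = x0" "k = x0"
      using l x0 z0 by auto
    then show ?thesis using overlap21[of p a k q] overlap34[of p i d q] l e b by cases auto
  qed (use l in auto)
qed simp

lemma below_all: "W.below w" using all_hold by (auto simp: W.below_def)

lemma relations:
  "i < m \<Longrightarrow> j < m \<Longrightarrow> R1 p i j q" "a < n \<Longrightarrow> b < n \<Longrightarrow> R2 p a b q"
  "i < m \<Longrightarrow> j < m \<Longrightarrow> R3 p i j q" "a < n \<Longrightarrow> b < n \<Longrightarrow> R4 p a b q"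
proof -
  have big: "\<exists>w'. (w, w') \<in> ord" for w :: "hgen list"
    by (rule exI[of _ "U 0 0 # w"]) (simp add: ord_len)
  show "i < m \<Longrightarrow> j < m \<Longrightarrow> R1 p i j q" using big R1_below[OF below_all] by blast
  show "a < n \<Longrightarrow> b < n \<Longrightarrow> R2 p a b q" using big R2_below[OF below_all] by blast
  show "i < m \<Longrightarrow> j < m \<Longrightarrow> R3 p i j q" using big R3_below[OF below_all] by blast
  show "a < n \<Longrightarrow> b < n \<Longrightarrow> R4 p a b q" using big R4_below[OF below_all] by blast
qed

end

section \<open>\<open>H(E,F)\<close> does not vanish\<close>

lemma finsum_base_alg: "finsum base_alg f S = sum f S"
proof -
  interpret B: kalg "base_alg :: ('a, 'a) module" by (simp add: kalg_def kalgebra_base_alg)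
  have c [simp]: "x \<in> carrier base_alg" for x :: 'a by (simp add: base_alg_def)
  have z: "\<zero>\<^bsub>base_alg\<^esub> = (0 :: 'a)" and ad: "x \<oplus>\<^bsub>base_alg\<^esub> y = x + y" for x y :: 'a
    by (simp_all add: base_alg_def)
  show ?thesis
    by (induction S rule: infinite_finite_induct) (simp_all add: z ad)
qed

definition matrix_rels :: "('k::field, 'a, 'z) module_scheme \<Rightarrow> 'a mat \<Rightarrow> 'a mat \<Rightarrow> 'a set" where
  "matrix_rels A X Y = {X $$ (i, j) \<ominus>\<^sub>A Y $$ (i, j) | i j. i < dim_row X \<and> j < dim_col X}"

lemma matrix_rels_closed:
  assumes "kalgebra A" "dim_row X = dim_row Y" "dim_col X = dim_col Y" "entries A X" "entries A Y"
  shows "matrix_rels A X Y \<subseteq> carrier A"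
proof -
  interpret A: kalg A by (simp add: kalg_def assms)
  show ?thesis using assms by (auto simp: matrix_rels_def entriesD intro!: A.minus_closed)
qed

lemma matrix_rels_map:
  assumes "kalgebra A" "kalgebra B" "f \<in> lin_hom A B" "dim_row X = dim_row Y" "dim_col X = dim_col Y"
    "entries A X" "entries A Y" "\<And>r. r \<in> matrix_rels A X Y \<Longrightarrow> f r = \<zero>\<^sub>B"
  shows "map_mat f X = map_mat f Y"
proof (rule eq_matI)
  interpret B: kalg B by (simp add: kalg_def assms)
  fix i j assume "i < dim_row (map_mat f Y)" "j < dim_col (map_mat f Y)"
  then have ij: "i < dim_row X" "j < dim_col X" using assms(4,5) by auto
  then have c: "X $$ (i, j) \<in> carrier A" "Y $$ (i, j) \<in> carrier A" using assms by (auto simp: entriesD)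
  have "f (X $$ (i, j) \<ominus>\<^sub>A Y $$ (i, j)) = \<zero>\<^sub>B" using ij by (intro assms(8)) (auto simp: matrix_rels_def)
  then show "map_mat f X $$ (i, j) = map_mat f Y $$ (i, j)"
    using ij c assms(4,5) by (simp add: lin_hom_minus[OF assms(1-3) c] B.minus_eq_zero_iff lin_hom_closed[OF assms(3)])
qed (use assms in auto)

text \<open>The functional on words vanishes on the ideal of relations, because it kills every relator in every
  context, and not on \<open>1\<close>. So the free algebra modulo these relations is a nonzero representation.\<close>

lemma triangular_nonzero_rep:
  fixes E F :: "'k::field mat"
  assumes m: "2 \<le> m" and n: "2 \<le> n" and E: "E \<in> GL m" and F: "F \<in> GL n"
    and tr: "mat_trace E = mat_trace F" "mat_trace (mat_inv E) = mat_trace (mat_inv F)"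
    and rows: "\<And>j. j < m - 1 \<Longrightarrow> mat_inv E $$ (m - 1, j) = 0" "\<And>b. b < n - 1 \<Longrightarrow> F $$ (n - 1, b) = 0"
  shows "\<exists>(B :: ('k, (hgen list \<Rightarrow> 'k) set) module) u v. kalgebra B \<and> \<one>\<^sub>B \<noteq> \<zero>\<^sub>B \<and> hmats E F B u v"
proof -
  note dims [simp] = GL_dims[OF E] GL_dims[OF F]
  note iE = GL_inv[OF E] and iF = GL_inv[OF F]
  have inv_index: "(\<Sum>k<d. M $$ (i, k) * N $$ (k, j)) = (if i = j then 1 else 0)"
    if "M * N = 1\<^sub>m d" "M \<in> carrier_mat d d" "N \<in> carrier_mat d d" "i < d" "j < d" for M N :: "'k mat" and d i j
  proof -
    have "(M * N) $$ (i, j) = (\<Sum>k<d. M $$ (i, k) * N $$ (k, j))"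
      using that(2-5) by (auto simp: scalar_prod_def lessThan_atLeast0)
    then show ?thesis using that by simp
  qed
  interpret X: reduced_pair m n "\<lambda>i j. E $$ (i, j)" "\<lambda>i j. mat_inv E $$ (i, j)"
    "\<lambda>i j. F $$ (i, j)" "\<lambda>i j. mat_inv F $$ (i, j)"
    by unfold_locales (use m n tr rows iE iF in \<open>auto simp: mat_trace_def intro!: inv_index[THEN trans]\<close>)
  define P where "P = (free_alg (hgens m n) :: ('k, hgen list \<Rightarrow> 'k) module)"
  have kP: "kalgebra P" by (simp add: P_def free_alg_def kalgebra_monoid_alg monoid_free_monoid)
  interpret P: kalg P by (simp add: kalg_def kP)
  define u v where "u = Um m n (\<lambda>x. delta [x] :: hgen list \<Rightarrow> 'k)" and "v = Vm m n (\<lambda>x. delta [x] :: hgen list \<Rightarrow> 'k)"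
  have d [simp]: "dim_row u = m" "dim_col u = n" "dim_row v = m" "dim_col v = n" by (simp_all add: u_def v_def)
  have dw: "delta w \<in> carrier P" if "w \<in> lists (hgens m n)" for w using that by (simp add: P_def free_alg_def)
  have en [simp]: "entries P u" "entries P v" by (auto simp: entries_def u_def v_def intro!: dw)
  define R where "R = matrix_rels P (u \<star>\<^sub>P v\<^sup>T) (scal P (1\<^sub>m m)) \<union>
    matrix_rels P (v\<^sup>T \<star>\<^sub>P u) (scal P (1\<^sub>m n)) \<union>
    matrix_rels P (v \<star>\<^sub>P (scal P F \<star>\<^sub>P u\<^sup>T)) (scal P E) \<union>
    matrix_rels P (u\<^sup>T \<star>\<^sub>P (scal P (mat_inv E) \<star>\<^sub>P v)) (scal P (mat_inv F))"
  have "R \<subseteq> carrier P" unfolding R_def by (intro Un_least matrix_rels_closed kP) auto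
  then interpret B: presentation "hgens m n" R by unfold_locales (simp add: P_def)
  let ?p = "\<lambda>x. B.MQ.I +>\<^bsub>B.MQ.P\<^esub> x"
  have p: "?p \<in> alg_hom P B.A" using B.proj by (simp add: P_def)
  note rel = matrix_rels_map[OF kP B.A.kalgebra alg_hom_lin[OF p]]
  note mm = map_mat_amul[OF kP B.A.kalgebra p, symmetric] and ms = map_mat_scal[OF kP p, symmetric]
  have t: "(map_mat ?p X)\<^sup>T = map_mat ?p X\<^sup>T" for X by (rule eq_matI) auto
  have pr: "?p r = \<zero>\<^bsub>B.A\<^esub>" if "r \<in> R" for r using B.proj_rel[OF that] .
  have h: "hmats E F B.A (map_mat ?p u) (map_mat ?p v)"
  proof (rule hmatsI[OF B.A.kalgebra E F])
    show "map_mat ?p u \<star>\<^bsub>B.A\<^esub> (map_mat ?p v)\<^sup>T = scal B.A (1\<^sub>m m)"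
      unfolding t ms by (subst mm) (simp_all, intro rel pr, auto simp: R_def)
    show "(map_mat ?p v)\<^sup>T \<star>\<^bsub>B.A\<^esub> map_mat ?p u = scal B.A (1\<^sub>m n)"
      unfolding t ms by (subst mm) (simp_all, intro rel pr, auto simp: R_def)
    show "map_mat ?p v \<star>\<^bsub>B.A\<^esub> (scal B.A F \<star>\<^bsub>B.A\<^esub> (map_mat ?p u)\<^sup>T) = scal B.A E"
      unfolding t ms by (subst mm, simp_all, subst mm, simp_all) (intro rel pr, auto simp: R_def)
    show "(map_mat ?p u)\<^sup>T \<star>\<^bsub>B.A\<^esub> (scal B.A (mat_inv E) \<star>\<^bsub>B.A\<^esub> map_mat ?p v) = scal B.A (mat_inv F)"
      unfolding t ms by (subst mm, simp_all, subst mm, simp_all) (intro rel pr, auto simp: R_def)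
  qed (auto intro!: carrier_matI entries_map_mat[OF alg_hom_lin[OF p]])
  interpret K: kalg "base_alg :: ('k, 'k) module" by (simp add: kalg_def kalgebra_base_alg)
  have bc: "x \<in> carrier base_alg" for x :: 'k by (simp add: base_alg_def)
  have bs: "c \<odot>\<^bsub>base_alg\<^esub> x = c * x" for c x :: 'k by (simp add: base_alg_def)
  have kill: "lin_ext base_alg (\<lambda>x. X.W.phi (s \<otimes>\<^bsub>free_monoid (hgens m n)\<^esub> x \<otimes>\<^bsub>free_monoid (hgens m n)\<^esub> t)) r = \<zero>\<^bsub>base_alg\<^esub>"
    if r: "r \<in> R" for r s t
  proof -
    define \<Lambda> where "\<Lambda> = lin_ext base_alg (\<lambda>x. X.W.phi (s @ x @ t))"
    have L: "\<Lambda> \<in> lin_hom P base_alg" unfolding \<Lambda>_def P_def free_alg_def by (intro lin_ext_lin_hom kalgebra_base_alg bc)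
    have Ld: "\<Lambda> (delta w) = X.W.phi (s @ w @ t)" for w
      unfolding \<Lambda>_def by (rule lin_ext_delta[OF kalgebra_base_alg bc])
    have L1: "\<Lambda> (c \<odot>\<^sub>P \<one>\<^sub>P) = c * X.W.phi (s @ t)" for c
      using Ld[of "[]"] lin_hom_smult[OF L P.one_closed] by (simp add: bs P_def free_alg_def monoid_alg_simps)
    note Lsum = lin_hom_finsum[OF kP kalgebra_base_alg L, unfolded finsum_base_alg]
    have dm: "delta [x] \<otimes>\<^sub>P delta [y] = delta [x, y]" for x y by (simp add: P_def free_alg_def delta_mult)
    have Lm: "\<Lambda> (X $$ (i, j) \<ominus>\<^sub>P Y $$ (i, j)) = \<zero>\<^bsub>base_alg\<^esub>"
      if "\<Lambda> (X $$ (i, j)) = \<Lambda> (Y $$ (i, j))" "X $$ (i, j) \<in> carrier P" "Y $$ (i, j) \<in> carrier P" for X Y i j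
      using that by (simp add: lin_hom_minus[OF kP kalgebra_base_alg L] K.minus_eq_zero_iff bc)
    have e1: "\<Lambda> ((u \<star>\<^sub>P v\<^sup>T) $$ (i, j)) = \<Lambda> (scal P (1\<^sub>m m) $$ (i, j))" if "i < m" "j < m" for i j
    proof -
      have "(u \<star>\<^sub>P v\<^sup>T) $$ (i, j) = (\<Oplus>\<^sub>P a\<in>{..<n}. delta [U i a, V j a])"
        using that by (subst P.amul_index) (auto simp: u_def v_def dm dw intro!: P.finsum_cong')
      then have "\<Lambda> ((u \<star>\<^sub>P v\<^sup>T) $$ (i, j)) = (\<Sum>a<n. X.W.phi (s @ [U i a, V j a] @ t))"
        using that by (simp only:, subst Lsum) (auto simp: dw Ld)
      also have "\<dots> = (if i = j then 1 else 0) * X.W.phi (s @ t)" using X.relations(1)[OF that] by (simp add: X.R1_def)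
      finally show ?thesis using that L1[of 0] L1[of 1] by simp
    qed
    have e2: "\<Lambda> ((v\<^sup>T \<star>\<^sub>P u) $$ (i, j)) = \<Lambda> (scal P (1\<^sub>m n) $$ (i, j))" if "i < n" "j < n" for i j
    proof -
      have "(v\<^sup>T \<star>\<^sub>P u) $$ (i, j) = (\<Oplus>\<^sub>P a\<in>{..<m}. delta [V a i, U a j])"
        using that by (subst P.amul_index) (auto simp: u_def v_def dm dw intro!: P.finsum_cong')
      then have "\<Lambda> ((v\<^sup>T \<star>\<^sub>P u) $$ (i, j)) = (\<Sum>a<m. X.W.phi (s @ [V a i, U a j] @ t))"
        using that by (simp only:, subst Lsum) (auto simp: dw Ld)
      also have "\<dots> = (if i = j then 1 else 0) * X.W.phi (s @ t)" using X.relations(2)[OF that] by (simp add: X.R2_def)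
      finally show ?thesis using that L1[of 0] L1[of 1] by simp
    qed
    have e3: "\<Lambda> ((v \<star>\<^sub>P (scal P F \<star>\<^sub>P u\<^sup>T)) $$ (i, j)) = \<Lambda> (scal P E $$ (i, j))" if ij: "i < m" "j < m" for i j
    proof -
      have tu: "u\<^sup>T $$ (b, j) \<in> carrier P" if "b < n" "j < m" for b j
        using that by (simp add: entriesD)
      have "(v \<star>\<^sub>P (scal P F \<star>\<^sub>P u\<^sup>T)) $$ (i, j) =
          (\<Oplus>\<^sub>P a\<in>{..<n}. v $$ (i, a) \<otimes>\<^sub>P (\<Oplus>\<^sub>P b\<in>{..<n}. F $$ (a, b) \<odot>\<^sub>P u\<^sup>T $$ (b, j)))"
        using ij by (subst P.amul_index)
          (auto intro!: P.finsum_cong' P.finsum_closed P.m_closed simp: P.scal_amul_index entriesD[OF en(2)] tu simp del: index_transpose_mat(1))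
      also have "\<dots> = (\<Oplus>\<^sub>P a\<in>{..<n}. \<Oplus>\<^sub>P b\<in>{..<n}. F $$ (a, b) \<odot>\<^sub>P delta [V i a, U j b])"
        using ij by (intro P.finsum_cong') (auto simp: u_def v_def P.finsum_rdistr P.mult_smult_right dm dw Pi_def intro!: P.finsum_cong' P.finsum_closed)
      finally have eq: "(v \<star>\<^sub>P (scal P F \<star>\<^sub>P u\<^sup>T)) $$ (i, j) =
          (\<Oplus>\<^sub>P a\<in>{..<n}. \<Oplus>\<^sub>P b\<in>{..<n}. F $$ (a, b) \<odot>\<^sub>P delta [V i a, U j b])" .
      have "\<Lambda> ((v \<star>\<^sub>P (scal P F \<star>\<^sub>P u\<^sup>T)) $$ (i, j)) = (\<Sum>a<n. \<Lambda> (\<Oplus>\<^sub>P b\<in>{..<n}. F $$ (a, b) \<odot>\<^sub>P delta [V i a, U j b]))"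
        unfolding eq using ij by (intro Lsum) (auto intro!: P.finsum_closed P.smult_closed dw)
      also have "\<dots> = (\<Sum>a<n. \<Sum>b<n. F $$ (a, b) * X.W.phi (s @ [V i a, U j b] @ t))"
      proof (rule sum.cong[OF refl])
        fix a assume a: "a \<in> {..<n}"
        have "\<Lambda> (\<Oplus>\<^sub>P b\<in>{..<n}. F $$ (a, b) \<odot>\<^sub>P delta [V i a, U j b]) = (\<Sum>b<n. \<Lambda> (F $$ (a, b) \<odot>\<^sub>P delta [V i a, U j b]))"
          using ij a by (intro Lsum) (auto intro!: P.smult_closed dw)
        also have "\<dots> = (\<Sum>b<n. F $$ (a, b) * X.W.phi (s @ [V i a, U j b] @ t))"
          using ij a by (intro sum.cong refl) (subst lin_hom_smult[OF L]; auto simp: dw Ld bs)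
        finally show "\<Lambda> (\<Oplus>\<^sub>P b\<in>{..<n}. F $$ (a, b) \<odot>\<^sub>P delta [V i a, U j b]) = (\<Sum>b<n. F $$ (a, b) * X.W.phi (s @ [V i a, U j b] @ t))" .
      qed
      also have "\<dots> = E $$ (i, j) * X.W.phi (s @ t)"
        using X.relations(3)[OF ij] by (simp add: X.R3_def sum.cartesian_product)
      finally show ?thesis using ij by (simp add: L1)
    qed
    have e4: "\<Lambda> ((u\<^sup>T \<star>\<^sub>P (scal P (mat_inv E) \<star>\<^sub>P v)) $$ (a, b)) = \<Lambda> (scal P (mat_inv F) $$ (a, b))" if ab: "a < n" "b < n" for a b
    proof -
      have "(u\<^sup>T \<star>\<^sub>P (scal P (mat_inv E) \<star>\<^sub>P v)) $$ (a, b) =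
          (\<Oplus>\<^sub>P i\<in>{..<m}. u\<^sup>T $$ (a, i) \<otimes>\<^sub>P (\<Oplus>\<^sub>P j\<in>{..<m}. mat_inv E $$ (i, j) \<odot>\<^sub>P v $$ (j, b)))"
        using ab by (subst P.amul_index)
          (auto intro!: P.finsum_cong' P.finsum_closed P.m_closed simp: P.scal_amul_index entriesD[OF en(2)] entriesD[OF en(1)])
      also have "\<dots> = (\<Oplus>\<^sub>P i\<in>{..<m}. \<Oplus>\<^sub>P j\<in>{..<m}. mat_inv E $$ (i, j) \<odot>\<^sub>P delta [U i a, V j b])"
        using ab by (intro P.finsum_cong') (auto simp: u_def v_def P.finsum_rdistr P.mult_smult_right dm dw Pi_def intro!: P.finsum_cong' P.finsum_closed)
      finally have eq: "(u\<^sup>T \<star>\<^sub>P (scal P (mat_inv E) \<star>\<^sub>P v)) $$ (a, b) =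
          (\<Oplus>\<^sub>P i\<in>{..<m}. \<Oplus>\<^sub>P j\<in>{..<m}. mat_inv E $$ (i, j) \<odot>\<^sub>P delta [U i a, V j b])" .
      have "\<Lambda> ((u\<^sup>T \<star>\<^sub>P (scal P (mat_inv E) \<star>\<^sub>P v)) $$ (a, b)) = (\<Sum>i<m. \<Lambda> (\<Oplus>\<^sub>P j\<in>{..<m}. mat_inv E $$ (i, j) \<odot>\<^sub>P delta [U i a, V j b]))"
        unfolding eq using ab by (intro Lsum) (auto intro!: P.finsum_closed P.smult_closed dw)
      also have "\<dots> = (\<Sum>i<m. \<Sum>j<m. mat_inv E $$ (i, j) * X.W.phi (s @ [U i a, V j b] @ t))"
      proof (rule sum.cong[OF refl])
        fix i assume i: "i \<in> {..<m}"
        have "\<Lambda> (\<Oplus>\<^sub>P j\<in>{..<m}. mat_inv E $$ (i, j) \<odot>\<^sub>P delta [U i a, V j b]) = (\<Sum>j<m. \<Lambda> (mat_inv E $$ (i, j) \<odot>\<^sub>P delta [U i a, V j b]))"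
          using ab i by (intro Lsum) (auto intro!: P.smult_closed dw)
        also have "\<dots> = (\<Sum>j<m. mat_inv E $$ (i, j) * X.W.phi (s @ [U i a, V j b] @ t))"
          using ab i by (intro sum.cong refl) (subst lin_hom_smult[OF L]; auto simp: dw Ld bs)
        finally show "\<Lambda> (\<Oplus>\<^sub>P j\<in>{..<m}. mat_inv E $$ (i, j) \<odot>\<^sub>P delta [U i a, V j b]) = (\<Sum>j<m. mat_inv E $$ (i, j) * X.W.phi (s @ [U i a, V j b] @ t))" .
      qed
      also have "\<dots> = mat_inv F $$ (a, b) * X.W.phi (s @ t)"
        using X.relations(4)[OF ab] by (simp add: X.R4_def sum.cartesian_product)
      finally show ?thesis using ab by (simp add: L1)
    qed
    have "\<Lambda> r = \<zero>\<^bsub>base_alg\<^esub>"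
      using r unfolding R_def matrix_rels_def
      by (elim UnE CollectE exE conjE; hypsubst; intro Lm e1 e2 e3 e4 entriesD; simp)
    then show ?thesis by (simp add: \<Lambda>_def)
  qed
  have "\<one>\<^bsub>B.A\<^esub> \<noteq> \<zero>\<^bsub>B.A\<^esub>"
  proof
    let ?q = "quot_ext base_alg X.W.phi"
    assume z: "\<one>\<^bsub>B.A\<^esub> = \<zero>\<^bsub>B.A\<^esub>"
    have "?q \<in> lin_hom B.A base_alg"
      unfolding B.A_eq by (rule B.MQ.quot_ext_lin_hom[OF kalgebra_base_alg bc kill])
    then have "?q \<zero>\<^bsub>B.A\<^esub> = \<zero>\<^bsub>base_alg\<^esub>" by (rule lin_hom_zero[OF B.A.kalgebra kalgebra_base_alg])
    moreover have "?q (?p (delta [])) = X.W.phi []"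
      by (rule B.MQ.quot_ext_delta[OF kalgebra_base_alg bc kill]) simp_all
    moreover have "?p (delta []) = \<one>\<^bsub>B.A\<^esub>"
      using alg_hom_one[OF p] by (simp add: P_def free_alg_def monoid_alg_simps)
    ultimately show False using z by (simp add: X.W.phi_Nil) (simp add: base_alg_def)
  qed
  then show ?thesis using h B.A.kalgebra by blast
qed

subsection \<open>Change of basis\<close>

lemma mat_cancel:
  fixes A B Z :: "'a::semiring_1 mat"
  assumes "A \<in> carrier_mat n n" "B \<in> carrier_mat n n" "Z \<in> carrier_mat n n" "A * B = 1\<^sub>m n"
  shows "A * (B * Z) = Z"
  using assms left_mult_one_mat[of Z n n] by (simp add: assoc_mult_mat[symmetric, of _ n n _ n _ n])

lemma GL_mult: "P \<in> GL n \<Longrightarrow> Q \<in> GL n \<Longrightarrow> P * Q \<in> GL n \<and> mat_inv (P * Q) = mat_inv Q * mat_inv P"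
proof -
  assume P: "P \<in> GL n" and Q: "Q \<in> GL n"
  note iP = GL_inv[OF P] and iQ = GL_inv[OF Q]
  have a: "P * Q * (mat_inv Q * mat_inv P) = P * (Q * mat_inv Q) * mat_inv P"
    using iP iQ by (simp add: assoc_mult_mat[of _ n n _ n _ n] mat_cancel[of _ n])
  have b: "mat_inv Q * mat_inv P * (P * Q) = mat_inv Q * (mat_inv P * P) * Q"
    using iP iQ by (simp add: assoc_mult_mat[of _ n n _ n _ n] mat_cancel[of _ n])
  show ?thesis using GL_I[of "P * Q" n "mat_inv Q * mat_inv P"] iP iQ a b by simp
qed

lemma GL_mat_inv: "P \<in> GL n \<Longrightarrow> mat_inv P \<in> GL n \<and> mat_inv (mat_inv P) = P"
  using GL_inv[of P n] GL_I[of "mat_inv P" n P] by simp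

lemma GL_conj:
  assumes "P \<in> GL n" "M \<in> GL n"
  shows "P * M * mat_inv P \<in> GL n" "mat_inv (P * M * mat_inv P) = P * mat_inv M * mat_inv P"
proof -
  note iP = GL_inv[OF assms(1)] and iM = GL_inv[OF assms(2)]
  note m1 = GL_mult[OF assms]
  note m2 = GL_mult[OF m1[THEN conjunct1] GL_mat_inv[OF assms(1), THEN conjunct1]]
  show "P * M * mat_inv P \<in> GL n" using m2 by simp
  show "mat_inv (P * M * mat_inv P) = P * mat_inv M * mat_inv P"
    using m2 m1 GL_mat_inv[OF assms(1)] iP iM by (simp add: assoc_mult_mat[of _ n n _ n _ n] mat_cancel[of _ n])
qed

lemma mat_trace_mult_commute:
  assumes "A \<in> carrier_mat n n" "B \<in> carrier_mat n n"
  shows "mat_trace (A * B) = mat_trace (B * A)"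
proof -
  have "mat_trace (A * B) = (\<Sum>i<n. \<Sum>k<n. A $$ (i, k) * B $$ (k, i))"
    using assms by (auto simp: mat_trace_def scalar_prod_def lessThan_atLeast0)
  also have "\<dots> = (\<Sum>k<n. \<Sum>i<n. A $$ (i, k) * B $$ (k, i))" by (rule sum.swap)
  also have "\<dots> = mat_trace (B * A)"
    using assms by (auto simp: mat_trace_def scalar_prod_def lessThan_atLeast0 mult.commute)
  finally show ?thesis .
qed

lemma mat_trace_conj:
  assumes "P \<in> GL n" "M \<in> carrier_mat n n"
  shows "mat_trace (P * M * mat_inv P) = mat_trace M"
proof -
  note iP = GL_inv[OF assms(1)]
  have "mat_trace (P * M * mat_inv P) = mat_trace (mat_inv P * (P * M))"
    using iP assms by (intro mat_trace_mult_commute[of _ n]) auto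
  also have "mat_inv P * (P * M) = (mat_inv P * P) * M" using iP assms by (simp add: assoc_mult_mat[of _ n n _ n _ n] mat_cancel[of _ n])
  finally show ?thesis using iP assms by simp
qed

text \<open>A change of basis \<open>P\<close> is a representation of the relations by scalar matrices.\<close>

lemma hmats_scalar:
  assumes A: "kalgebra A" and P: "P \<in> GL n" and M: "M \<in> GL n"
  shows "hmats (P * M * mat_inv P) M A (scal A ((mat_inv P)\<^sup>T)) (scal A P)"
proof -
  interpret A: kalg A by (simp add: kalg_def A)
  note iP = GL_inv[OF P] and iM = GL_inv[OF M]
  have t: "(mat_inv P)\<^sup>T * P\<^sup>T = 1\<^sub>m n" "P\<^sup>T * (mat_inv P)\<^sup>T = 1\<^sub>m n"
    using iP by (simp_all add: transpose_mult[symmetric, of _ n n _ n])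
  have x: "mat_inv P * (P * mat_inv M * mat_inv P * P) = mat_inv M"
  proof -
    have "mat_inv P * (P * mat_inv M * mat_inv P * P) = (mat_inv P * P) * mat_inv M * (mat_inv P * P)"
      using iP iM by (simp add: assoc_mult_mat[of _ n n _ n _ n] mat_cancel[of _ n])
    then show ?thesis using iP iM by simp
  qed
  show ?thesis
  proof (rule hmatsI[OF A GL_conj(1)[OF P M] M])
    show "scal A P \<star>\<^sub>A (scal A M \<star>\<^sub>A (scal A ((mat_inv P)\<^sup>T))\<^sup>T) = scal A (P * M * mat_inv P)"
      using iP iM by (simp add: A.scal_mult[symmetric] assoc_mult_mat[of _ n n _ n _ n])
    show "(scal A ((mat_inv P)\<^sup>T))\<^sup>T \<star>\<^sub>A (scal A (mat_inv (P * M * mat_inv P)) \<star>\<^sub>A scal A P) = scal A (mat_inv M)"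
      unfolding GL_conj(2)[OF P M] using iP iM x by (simp add: A.scal_mult[symmetric])
  qed (use iP iM t in \<open>auto simp: A.scal_mult[symmetric]\<close>)
qed

lemma hmats_conj:
  assumes A: "kalgebra A" and E: "E \<in> GL m" and F: "F \<in> GL n" and P: "P \<in> GL m" and Q: "Q \<in> GL n"
    and h: "hmats (P * E * mat_inv P) (Q * F * mat_inv Q) A u v"
  shows "\<exists>u v. hmats E F A u v"
proof -
  interpret A: kalg A by (simp add: kalg_def A)
  let ?E = "P * E * mat_inv P" and ?F = "Q * F * mat_inv Q"
  note iP = GL_inv[OF P] and iQ = GL_inv[OF Q]
  have E': "?E \<in> GL m" and F': "?F \<in> GL n" by (rule GL_conj[OF P E], rule GL_conj[OF Q F])
  interpret h: hrep A ?E ?F u v m n by (rule hrepI) fact+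
  have P': "mat_inv P \<in> GL m" "mat_inv (mat_inv P) = P" using GL_mat_inv[OF P] by auto
  have "mat_inv P * ?E * mat_inv (mat_inv P) = (mat_inv P * P) * E * (mat_inv P * P)"
    using iP GL_inv[OF E] P' by (simp add: assoc_mult_mat[of _ m m _ m _ m] mat_cancel[of _ m])
  then have "mat_inv P * ?E * mat_inv (mat_inv P) = E" using iP GL_inv[OF E] by simp
  with hmats_scalar[OF A P'(1) E'] have 1: "hmats E ?E A (scal A P\<^sup>T) (scal A (mat_inv P))"
    by (simp add: P')
  have c: "scal A M $$ (i, j) \<otimes>\<^sub>A x = x \<otimes>\<^sub>A scal A M $$ (i, j)"
    if "i < dim_row M" "j < dim_col M" "x \<in> carrier A" for M i j x
    using that by (simp add: A.mult_smult_left A.mult_smult_right)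
  have 2: "hmats E ?F A (scal A P\<^sup>T \<star>\<^sub>A u) (scal A (mat_inv P) \<star>\<^sub>A v)"
    by (rule hmats_comp[OF A E E' F' 1 h])
      (use iP in \<open>auto simp del: scal_index intro!: c entriesD\<close>)
  interpret h2: hrep A E ?F "scal A P\<^sup>T \<star>\<^sub>A u" "scal A (mat_inv P) \<star>\<^sub>A v" m n
    by (rule hrepI[OF A E F' 2])
  have "hmats E F A (scal A P\<^sup>T \<star>\<^sub>A u \<star>\<^sub>A scal A ((mat_inv Q)\<^sup>T)) (scal A (mat_inv P) \<star>\<^sub>A v \<star>\<^sub>A scal A Q)"
    by (rule hmats_comp[OF A E F' F 2 hmats_scalar[OF A Q F]])
      (use iQ h2.uv_entries h2.uv_dims in \<open>auto simp del: scal_index amul_dims intro!: c[symmetric] entriesD\<close>)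
  then show ?thesis by blast
qed

lemma GL_with_last_row:
  fixes w :: "'k::field vec"
  assumes w: "w \<in> carrier_vec n" "w \<noteq> 0\<^sub>v n"
  shows "\<exists>P\<in>GL n. \<forall>j<n. P $$ (n - 1, j) = w $ j"
proof -
  obtain k where k: "k < n" "w $ k \<noteq> 0" using w by (metis carrier_vecD eq_vecI index_zero_vec(1,2))
  define \<tau> where "\<tau> i = (if i = k then n - 1 else if i = n - 1 then k else i)" for i
  have \<tau>: "\<tau> i < n" "\<tau> (\<tau> i) = i" if "i < n" for i using that k by (auto simp: \<tau>_def)
  have \<tau>eq: "\<tau> i = \<tau> j \<longleftrightarrow> i = j" if "i < n" "j < n" for i j using \<tau>(2) that by metis
  define D where "D i j = (if i = k then w $ j else if i = j then 1 else 0)" for i j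
  define D' where "D' i j = (if i = k then (if j = k then 1 / w $ k else - w $ j / w $ k) else if i = j then 1 else 0)" for i j
  have DD: "(\<Sum>l<n. D a l * D' l b) = (if a = b then 1 else 0)" if ab: "a < n" "b < n" for a b
  proof (cases "a = k")
    case True
    have "(\<Sum>l<n. D a l * D' l b) = w $ k * D' k b + (\<Sum>l\<in>{..<n} - {k}. if b = l then w $ l else 0)"
    proof -
      have "(\<Sum>l\<in>{..<n} - {k}. D a l * D' l b) = (\<Sum>l\<in>{..<n} - {k}. if b = l then w $ l else 0)"
        by (rule sum.cong) (auto simp: D_def D'_def True)
      moreover have "(\<Sum>l<n. D a l * D' l b) = D a k * D' k b + (\<Sum>l\<in>{..<n} - {k}. D a l * D' l b)"
        using k by (intro sum.remove) auto
      ultimately show ?thesis by (simp add: D_def True)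
    qed
    also have "(\<Sum>l\<in>{..<n} - {k}. if b = l then w $ l else 0) = (if b = k then 0 else w $ b)"
      using ab by (subst sum.delta') auto
    also have "w $ k * D' k b + (if b = k then 0 else w $ b) = (if a = b then 1 else 0)"
      using k True by (cases "b = k") (simp_all add: D'_def)
    finally show ?thesis .
  next
    case False
    then have "(\<Sum>l<n. D a l * D' l b) = (\<Sum>l<n. if a = l then D' l b else 0)" by (intro sum.cong) (auto simp: D_def)
    then show ?thesis using False ab by (auto simp: D'_def)
  qed
  define P where "P = mat n n (\<lambda>(i, j). D (\<tau> i) j)"
  define P' where "P' = mat n n (\<lambda>(i, j). D' i (\<tau> j))"
  have c: "P \<in> carrier_mat n n" "P' \<in> carrier_mat n n" by (auto simp: P_def P'_def)
  have 1: "P * P' = 1\<^sub>m n"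
  proof (rule eq_matI)
    fix i j assume "i < dim_row (1\<^sub>m n :: 'k mat)" "j < dim_col (1\<^sub>m n :: 'k mat)"
    then have ij: "i < n" "j < n" by auto
    then have "(P * P') $$ (i, j) = (\<Sum>l<n. D (\<tau> i) l * D' l (\<tau> j))"
      by (simp add: P_def P'_def scalar_prod_def lessThan_atLeast0)
    then show "(P * P') $$ (i, j) = 1\<^sub>m n $$ (i, j)" using ij by (simp add: DD \<tau> \<tau>eq)
  qed (use c in auto)
  then have "P \<in> GL n" using GL_I[OF c 1 mat_mult_left_right_inverse[OF c 1]] by simp
  moreover have "P $$ (n - 1, j) = w $ j" if "j < n" for j
    using that k by (auto simp: P_def D_def \<tau>_def)
  ultimately show ?thesis by blast
qed

text \<open>Over an algebraically closed field a matrix has a left eigenvector, hence is conjugate to one whose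
  last row vanishes off the diagonal.\<close>

lemma conj_last_row:
  fixes M :: "'k::alg_closed_field mat"
  assumes M: "M \<in> GL n" and n: "n > 0"
  shows "\<exists>P\<in>GL n. \<forall>j<n - 1. (P * M * mat_inv P) $$ (n - 1, j) = 0"
proof -
  note iM = GL_inv[OF M]
  have tM: "M\<^sup>T \<in> carrier_mat n n" using iM by simp
  have "Polynomial.degree (char_poly M\<^sup>T) > 0" using degree_monic_char_poly[OF tM] n by simp
  then obtain l where "poly (char_poly M\<^sup>T) l = 0" using alg_closed_imp_poly_has_root by blast
  then have "eigenvalue M\<^sup>T l" using eigenvalue_root_char_poly[OF tM] by simp
  then obtain w where w: "w \<in> carrier_vec n" "w \<noteq> 0\<^sub>v n" "M\<^sup>T *\<^sub>v w = l \<cdot>\<^sub>v w"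
    using tM by (auto simp: eigenvalue_def eigenvector_def)
  then obtain P where P: "P \<in> GL n" "\<forall>j<n. P $$ (n - 1, j) = w $ j" using GL_with_last_row by blast
  note iP = GL_inv[OF P(1)]
  have row: "(P * M) $$ (n - 1, i) = l * P $$ (n - 1, i)" if i: "i < n" for i
  proof -
    have "(\<Sum>j<n. M $$ (j, i) * w $ j) = (M\<^sup>T *\<^sub>v w) $ i"
      using i iM w(1) by (simp add: scalar_prod_def lessThan_atLeast0)
    also have "\<dots> = l * w $ i" using w i by simp
    finally have "(\<Sum>j<n. M $$ (j, i) * w $ j) = l * w $ i" .
    then show ?thesis using P(2) i iM iP n
      by (auto simp: scalar_prod_def lessThan_atLeast0[symmetric] mult.commute)
  qed
  have "(P * M * mat_inv P) $$ (n - 1, j) = 0" if j: "j < n - 1" for j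
  proof -
    define N where "N = P * M"
    have N: "N \<in> carrier_mat n n" using iP iM by (simp add: N_def)
    have "(N * mat_inv P) $$ (n - 1, j) = (\<Sum>i<n. N $$ (n - 1, i) * mat_inv P $$ (i, j))"
      using N iP j n by (auto simp: scalar_prod_def lessThan_atLeast0)
    then have "(P * M * mat_inv P) $$ (n - 1, j) = (\<Sum>i<n. (P * M) $$ (n - 1, i) * mat_inv P $$ (i, j))"
      by (simp only: N_def)
    also have "\<dots> = l * (\<Sum>i<n. P $$ (n - 1, i) * mat_inv P $$ (i, j))"
      unfolding sum_distrib_left by (intro sum.cong refl) (subst row, simp, simp add: mult.assoc)
    also have "(\<Sum>i<n. P $$ (n - 1, i) * mat_inv P $$ (i, j)) = (P * mat_inv P) $$ (n - 1, j)"
      using iP(1,2) j n by (auto simp: scalar_prod_def lessThan_atLeast0)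
    also have "(P * mat_inv P) $$ (n - 1, j) = 0" unfolding iP(3) using j n by simp
    finally show ?thesis by simp
  qed
  then show ?thesis using P by blast
qed

subsection \<open>Descent from the algebraic closure\<close>

text \<open>An algebra over the algebraic closure, seen over the base field.\<close>

definition restrict_scalars :: "('k::field alg_closure, 'a) module \<Rightarrow> ('k, 'a) module" where
  "restrict_scalars B = \<lparr>carrier = carrier B, mult = mult B, one = one B, zero = zero B, add = add B,
     smult = (\<lambda>c. module.smult B (to_ac c))\<rparr>"

lemma restrict_scalars_simps [simp]:
  "carrier (restrict_scalars B) = carrier B" "mult (restrict_scalars B) = mult B"
  "one (restrict_scalars B) = one B" "zero (restrict_scalars B) = zero B" "add (restrict_scalars B) = add B"
  "module.smult (restrict_scalars B) = (\<lambda>c. module.smult B (to_ac c))"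
  by (simp_all add: restrict_scalars_def)

lemma kalgebra_restrict_scalars:
  assumes "kalgebra B" shows "kalgebra (restrict_scalars B)"
proof -
  interpret B: kalg B by (simp add: kalg_def assms)
  have "ring (restrict_scalars B)" by (rule ring_same_operations[OF B.ring_axioms]) simp_all
  then show ?thesis
    by (rule kalgebraI) (auto simp: B.smult_add_left B.smult_add_right B.smult_smult B.mult_smult_left B.mult_smult_right)
qed

lemma map_to_ac_mult: "dim_col M = dim_row N \<Longrightarrow> map_mat to_ac (M * N) = map_mat to_ac M * map_mat to_ac N"
  by (rule eq_matI) (auto simp: scalar_prod_def to_ac_sum)

lemma map_to_ac_one: "map_mat to_ac (1\<^sub>m n) = 1\<^sub>m n"
  by (rule eq_matI) auto

lemma GL_to_ac:
  assumes "M \<in> GL n"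
  shows "map_mat to_ac M \<in> GL n" "mat_inv (map_mat to_ac M) = map_mat to_ac (mat_inv M)"
proof -
  note i = GL_inv[OF assms]
  have "map_mat to_ac M * map_mat to_ac (mat_inv M) = 1\<^sub>m n" "map_mat to_ac (mat_inv M) * map_mat to_ac M = 1\<^sub>m n"
    using i by (simp_all add: map_to_ac_mult[symmetric] map_to_ac_one)
  then show "map_mat to_ac M \<in> GL n" "mat_inv (map_mat to_ac M) = map_mat to_ac (mat_inv M)"
    using GL_I[of "map_mat to_ac M" n "map_mat to_ac (mat_inv M)"] i by auto
qed

lemma mat_trace_to_ac: "M \<in> carrier_mat n n \<Longrightarrow> mat_trace (map_mat to_ac M) = to_ac (mat_trace M)"
  by (auto simp: mat_trace_def to_ac_sum)

lemma hmats_restrict_scalars: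
  assumes "kalgebra B" and E: "E \<in> GL m" and F: "F \<in> GL n" and h: "hmats (map_mat to_ac E) (map_mat to_ac F) B u v"
  shows "hmats E F (restrict_scalars B) u v"
proof -
  have mul: "X \<star>\<^bsub>restrict_scalars B\<^esub> Y = X \<star>\<^sub>B Y" for X Y
    unfolding amul_def by (simp add: finsum_cong_algebra[of "restrict_scalars B" B])
  have sc: "scal (restrict_scalars B) M = scal B (map_mat to_ac M)" for M
    by (rule eq_matI) auto
  have en: "entries (restrict_scalars B) X = entries B X" for X by (simp add: entries_def)
  show ?thesis using h by (simp add: hmats_def mul sc en map_to_ac_one GL_to_ac[OF E])
qed

text \<open>Both matrices are conjugated over the algebraic closure to the reduced form, once for \<open>E\<^sup>-\<^sup>1\<close> and once
  for \<open>F\<close>. Conjugating the parameters and restricting scalars preserve the existence of a nonzero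
  representation, and a nonzero representation is an algebra map from \<open>H(E,F)\<close> with \<open>1\<close> not sent to \<open>0\<close>.\<close>

theorem H_nonzero:
  fixes E F :: "'k::field mat"
  assumes m: "2 \<le> m" and n: "2 \<le> n" and E: "E \<in> GL m" and F: "F \<in> GL n"
    and tr: "mat_trace E = mat_trace F" "mat_trace (mat_inv E) = mat_trace (mat_inv F)"
  shows "\<one>\<^bsub>H_alg E F\<^esub> \<noteq> \<zero>\<^bsub>H_alg E F\<^esub>"
proof -
  let ?E = "map_mat to_ac E" and ?F = "map_mat to_ac F"
  note aE = GL_to_ac[OF E] and aF = GL_to_ac[OF F]
  have "mat_inv ?E \<in> GL m" using GL_mat_inv[OF aE(1)] by simp
  then obtain P where P: "P \<in> GL m" "\<forall>j<m - 1. (P * mat_inv ?E * mat_inv P) $$ (m - 1, j) = 0"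
    using conj_last_row[of "mat_inv ?E" m] m by auto
  obtain Q where Q: "Q \<in> GL n" "\<forall>j<n - 1. (Q * ?F * mat_inv Q) $$ (n - 1, j) = 0"
    using conj_last_row[OF aF(1)] n by auto
  note cE = GL_conj[OF P(1) aE(1)] and cF = GL_conj[OF Q(1) aF(1)]
  note iE = GL_inv[OF E] and iF = GL_inv[OF F]
  have "\<exists>(B :: ('k alg_closure, (hgen list \<Rightarrow> 'k alg_closure) set) module) u v. kalgebra B \<and> \<one>\<^sub>B \<noteq> \<zero>\<^sub>B \<and>
      hmats (P * ?E * mat_inv P) (Q * ?F * mat_inv Q) B u v"
  proof (rule triangular_nonzero_rep[OF m n cE(1) cF(1)])
    show "mat_trace (P * ?E * mat_inv P) = mat_trace (Q * ?F * mat_inv Q)"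
      using mat_trace_conj[OF P(1), of ?E] mat_trace_conj[OF Q(1), of ?F] tr iE iF by (simp add: mat_trace_to_ac)
    show "mat_trace (mat_inv (P * ?E * mat_inv P)) = mat_trace (mat_inv (Q * ?F * mat_inv Q))"
      unfolding cE(2) cF(2) aE(2) aF(2)
      using mat_trace_conj[OF P(1), of "map_mat to_ac (mat_inv E)"] mat_trace_conj[OF Q(1), of "map_mat to_ac (mat_inv F)"] tr iE iF
      by (simp add: mat_trace_to_ac)
  qed (use P(2) Q(2) cE(2) in auto)
  then obtain B :: "('k alg_closure, (hgen list \<Rightarrow> 'k alg_closure) set) module" and u v
    where B: "kalgebra B" "\<one>\<^sub>B \<noteq> \<zero>\<^sub>B" "hmats (P * ?E * mat_inv P) (Q * ?F * mat_inv Q) B u v" by blast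
  obtain u' v' where h: "hmats ?E ?F B u' v'" using hmats_conj[OF B(1) aE(1) aF(1) P(1) Q(1) B(3)] by blast
  let ?B = "restrict_scalars B"
  have kB: "kalgebra ?B" by (rule kalgebra_restrict_scalars[OF B(1)])
  have h': "hmats E F ?B u' v'" by (rule hmats_restrict_scalars[OF B(1) E F h])
  define g where "g x = (case x of U i j \<Rightarrow> u' $$ (i, j) | V i j \<Rightarrow> v' $$ (i, j))" for x
  have "u' = Um m n g" "v' = Vm m n g"
    using h' GL_dims[OF E] GL_dims[OF F] by (auto intro!: eq_matI simp: hmats_def g_def)
  then have hg: "hmats E F ?B (Um m n g) (Vm m n g)" using h' by simp
  note l = H_lift(1)[OF E F kB hg]
  show ?thesis
  proof
    assume "\<one>\<^bsub>H_alg E F\<^esub> = \<zero>\<^bsub>H_alg E F\<^esub>"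
    then have "\<one>\<^bsub>?B\<^esub> = \<zero>\<^bsub>?B\<^esub>"
      using alg_hom_one[OF l] lin_hom_zero[OF kalgebra_H[OF E F] kB alg_hom_lin[OF l]] by simp
    then show False using B by simp
  qed
qed

lemma (in kalg) finsum_eqI:
  "(\<And>i. i \<in> S \<Longrightarrow> f i = g i) \<Longrightarrow> (\<And>i. i \<in> S \<Longrightarrow> g i \<in> carrier A) \<Longrightarrow> finsum A f S = finsum A g S"
  by (rule finsum_cong') (simp_all add: Pi_iff)

lemma (in kalg) finsum_in_carrier [simp]: "(\<And>i. i \<in> S \<Longrightarrow> g i \<in> carrier A) \<Longrightarrow> finsum A g S \<in> carrier A"
  by (rule finsum_closed) (simp add: Pi_iff)

lemma lin_hom_finsum_eq:
  assumes "kalgebra A" "kalgebra B" "f \<in> lin_hom A B"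
    "\<And>i. i \<in> S \<Longrightarrow> g i \<in> carrier A" "\<And>i. i \<in> S \<Longrightarrow> f (g i) = h i"
  shows "f (\<Oplus>\<^sub>A i\<in>S. g i) = (\<Oplus>\<^sub>B i\<in>S. h i)"
proof -
  interpret B: kalg B by (simp add: kalg_def assms)
  have h: "h i \<in> carrier B" if "i \<in> S" for i
    using lin_hom_closed[OF assms(3) assms(4)[OF that]] assms(5)[OF that] by simp
  have "f (\<Oplus>\<^sub>A i\<in>S. g i) = (\<Oplus>\<^sub>B i\<in>S. f (g i))"
    by (rule lin_hom_finsum[OF assms(1-3)]) (rule assms(4))
  also have "\<dots> = (\<Oplus>\<^sub>B i\<in>S. h i)" by (rule B.finsum_eqI) (simp_all add: assms(5) h)
  finally show ?thesis .
qed

section \<open>The Hopf algebra \<open>H(E)\<close> and its comodule algebras\<close>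

text \<open>The same algebra occurs in records with different further fields: as \<open>H(E,E)\<close> it is a Hopf algebra,
  as \<open>H(E,F)\<close> a comodule algebra. Tensor constructions do not see the difference.\<close>

definition same_alg :: "('k::field, 'a, 'y) module_scheme \<Rightarrow> ('k, 'a, 'z) module_scheme \<Rightarrow> bool" where
  "same_alg A B \<longleftrightarrow> carrier A = carrier B \<and> mult A = mult B \<and> one A = one B \<and> zero A = zero B \<and>
     add A = add B \<and> module.smult A = module.smult B"

lemma same_alg_refl [simp]: "same_alg A A" by (simp add: same_alg_def)

lemma same_alg_tensor:
  assumes "same_alg A A'" "same_alg B B'"
  shows "tensor A B = tensor A' B'" "pure_tensor A B = pure_tensor A' B'"
proof -
  show "tensor A B = tensor A' B'"
    by (rule tensor_cong(1)) (use assms in \<open>auto simp: same_alg_def\<close>)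
  show "pure_tensor A B = pure_tensor A' B'"
    by (rule tensor_cong(2)) (use assms in \<open>auto simp: same_alg_def\<close>)
qed

lemma same_alg_lift:
  assumes "same_alg C C'"
  shows "tensor_lift C = tensor_lift C'"
proof -
  have "finsum C f S = finsum C' f S" for f S
    by (rule finsum_cong_algebra) (use assms in \<open>auto simp: same_alg_def\<close>)
  then show ?thesis using assms
    by (intro ext) (simp add: tensor_lift_def quot_ext_def lin_ext_def same_alg_def)
qed

lemma same_alg_maps:
  assumes "same_alg A A'" "same_alg B B'" "same_alg C C'"
  shows "tensor_map A B = tensor_map A' B'" "tensor_assoc A B C = tensor_assoc A' B' C'"
proof -
  show "tensor_map A B = tensor_map A' B'"
    using same_alg_tensor[OF assms(1,2)] by (intro ext) (simp add: tensor_map_def)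
  have "tensor A (tensor B C) = tensor A' (tensor B' C')" "pure_tensor A (tensor B C) = pure_tensor A' (tensor B' C')"
    using same_alg_tensor[OF assms(2,3)] same_alg_tensor[OF assms(1), of "tensor B' C'" "tensor B' C'"] by simp_all
  then show "tensor_assoc A B C = tensor_assoc A' B' C'"
    using same_alg_tensor[OF assms(2,3)] by (intro ext) (simp add: tensor_assoc_def)
qed

lemma same_alg_kalgebra:
  assumes "same_alg A B" "kalgebra B"
  shows "kalgebra A"
proof -
  interpret B: kalg B by (simp add: kalg_def assms)
  note s = assms(1)[unfolded same_alg_def]
  have "ring A" by (rule ring_same_operations[OF B.ring_axioms]) (use s in auto)
  then show ?thesis
    by (rule kalgebraI) (use s in \<open>auto simp: B.smult_add_left B.smult_add_right B.smult_smult B.mult_smult_left B.mult_smult_right\<close>)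
qed

lemma same_alg_hom:
  assumes "same_alg A A'" "same_alg B B'"
  shows "lin_hom A B = lin_hom A' B'" "alg_hom A B = alg_hom A' B'"
  using assms by (simp_all add: same_alg_def lin_hom_def alg_hom_def Ring.ring_hom_def)

lemma H_hopf_simps [simp]:
  "carrier (H_hopf E) = carrier (H_alg E E)" "mult (H_hopf E) = mult (H_alg E E)" "one (H_hopf E) = one (H_alg E E)"
  "zero (H_hopf E) = zero (H_alg E E)" "add (H_hopf E) = add (H_alg E E)"
  "module.smult (H_hopf E) = module.smult (H_alg E E)"
  "comult (H_hopf E) = H_coact E E" "counit (H_hopf E) = H_counit E" "antipode (H_hopf E) = H_antipode E"
  by (simp_all add: H_hopf_def Let_def)

lemma H_comod_simps [simp]:
  "carrier (H_comod_alg E F) = carrier (H_alg E F)" "mult (H_comod_alg E F) = mult (H_alg E F)"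
  "one (H_comod_alg E F) = one (H_alg E F)" "zero (H_comod_alg E F) = zero (H_alg E F)"
  "add (H_comod_alg E F) = add (H_alg E F)"
  "module.smult (H_comod_alg E F) = module.smult (H_alg E F)" "coaction (H_comod_alg E F) = H_coact E F"
  by (simp_all add: H_comod_alg_def Let_def)

lemma same_alg_H: "same_alg (H_hopf E) (H_alg E E)" "same_alg (H_comod_alg E F) (H_alg E F)"
  by (simp_all add: same_alg_def)

context two_algs
begin

lemma incl_left: "(\<lambda>a. pt a \<one>\<^sub>B) \<in> alg_hom A T"
  by (rule alg_homI[OF pt_left]) (simp_all add: pt_mult T_one)

lemma incl_right: "pt \<one>\<^sub>A \<in> alg_hom B T"
  by (rule alg_homI[OF pt_right]) (simp_all add: pt_mult T_one)

text \<open>The two tensor factors commute, so \<open>hmats_comp\<close> applies to any two representations.\<close>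

lemma hmats_tensor:
  assumes E: "E \<in> GL m" and G: "G \<in> GL p" and F: "F \<in> GL n" and h: "hmats E G A u v" "hmats G F B u' v'"
  shows "hmats E F T (mat m n (\<lambda>(i, j). \<Oplus>\<^sub>T l\<in>{..<p}. pt (u $$ (i, l)) (u' $$ (l, j))))
    (mat m n (\<lambda>(i, j). \<Oplus>\<^sub>T l\<in>{..<p}. pt (v $$ (i, l)) (v' $$ (l, j))))"
proof -
  interpret h1: hrep A E G u v m p by (rule hrepI[OF A.kalgebra E G h(1)])
  interpret h2: hrep B G F u' v' p n by (rule hrepI[OF B.kalgebra G F h(2)])
  let ?l = "map_mat (\<lambda>a. pt a \<one>\<^sub>B)" and ?r = "map_mat (pt \<one>\<^sub>A)"
  have "hmats E F T (?l u \<star>\<^sub>T ?r u') (?l v \<star>\<^sub>T ?r v')"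
    by (rule hmats_comp[OF T.kalgebra E G F hmats_map[OF A.kalgebra T.kalgebra incl_left E G h(1)]
          hmats_map[OF B.kalgebra T.kalgebra incl_right G F h(2)]])
      (auto simp: pt_mult entriesD[OF h1.uv_entries(1)] entriesD[OF h1.uv_entries(2)]
        entriesD[OF h2.uv_entries(1)] entriesD[OF h2.uv_entries(2)])
  moreover have "?l x \<star>\<^sub>T ?r y = mat m n (\<lambda>(i, j). \<Oplus>\<^sub>T l\<in>{..<p}. pt (x $$ (i, l)) (y $$ (l, j)))"
    if "x \<in> carrier_mat m p" "y \<in> carrier_mat p n" "entries A x" "entries B y" for x y
  proof (rule eq_matI)
    fix i j assume "i < dim_row (mat m n (\<lambda>(i, j). \<Oplus>\<^sub>T l\<in>{..<p}. pt (x $$ (i, l)) (y $$ (l, j))))"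
      "j < dim_col (mat m n (\<lambda>(i, j). \<Oplus>\<^sub>T l\<in>{..<p}. pt (x $$ (i, l)) (y $$ (l, j))))"
    then have ij: "i < m" "j < n" by simp_all
    have d: "dim_row x = m" "dim_col x = p" "dim_row y = p" "dim_col y = n" using that by auto
    have "(?l x \<star>\<^sub>T ?r y) $$ (i, j) = (\<Oplus>\<^sub>T l\<in>{..<p}. ?l x $$ (i, l) \<otimes>\<^sub>T ?r y $$ (l, j))"
      using ij d by (subst T.amul_index) simp_all
    also have "\<dots> = (\<Oplus>\<^sub>T l\<in>{..<p}. pt (x $$ (i, l)) (y $$ (l, j)))"
      using ij d entriesD[OF that(3)] entriesD[OF that(4)]
      by (intro T.finsum_eqI) (simp_all add: pt_mult)
    finally show "(?l x \<star>\<^sub>T ?r y) $$ (i, j) = mat m n (\<lambda>(i, j). \<Oplus>\<^sub>T l\<in>{..<p}. pt (x $$ (i, l)) (y $$ (l, j))) $$ (i, j)"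
      using ij by simp
  qed (use that in auto)
  moreover have "u \<in> carrier_mat m p" "v \<in> carrier_mat m p" "u' \<in> carrier_mat p n" "v' \<in> carrier_mat p n"
    by (intro carrier_matI; simp)+
  ultimately show ?thesis using h1.uv_entries h2.uv_entries by simp
qed

end

text \<open>The three steps in the definition of the Galois map amount to \<open>x \<otimes> y \<mapsto> \<alpha>(x)(1 \<otimes> y)\<close>.\<close>

lemma galois_map:
  fixes H :: "('k::field, 'h, 'y) hopf_scheme" and A :: "('k, 'a, 'h, 'z) comod_alg_scheme"
  assumes H: "kalgebra H" and A: "kalgebra A" and \<alpha>: "coaction A \<in> lin_hom A (tensor H A)"
  shows "galois_map H A \<in> lin_hom (tensor A A) (tensor H A)"
    and "\<And>x y. x \<in> carrier A \<Longrightarrow> y \<in> carrier A \<Longrightarrow>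
      galois_map H A (pure_tensor A A x y) = coaction A x \<otimes>\<^bsub>tensor H A\<^esub> pure_tensor H A \<one>\<^sub>H y"
proof -
  interpret HA: two_algs H A by (rule two_algsI[OF H A])
  interpret AA: two_algs A A by (rule two_algsI[OF A A])
  interpret HAA: two_algs "tensor H A" A by (rule two_algsI[OF HA.T.kalgebra A])
  interpret HAA': two_algs H "tensor A A" by (rule two_algsI[OF H AA.T.kalgebra])
  have m: "bilin A A A (\<lambda>a b. a \<otimes>\<^sub>A b)"
    using lin_hom_mult_left[OF A] lin_hom_mult_right[OF A] by (intro bilinI) auto
  note ml = AA.tensor_lift[OF A m]
  note t1 = tensor_map[OF A A HA.T.kalgebra A \<alpha> lin_hom_id(1)]
  note t2 = tensor_assoc[OF H A A]
  note t3 = tensor_map[OF H AA.T.kalgebra H A lin_hom_id(1) ml(1)]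
  show "galois_map H A \<in> lin_hom (tensor A A) (tensor H A)"
    unfolding galois_map_def comp_def id_def
    by (rule lin_hom_comp[OF lin_hom_comp[OF t1(1) alg_hom_lin[OF t2(1)]] t3(1)])
  fix x y assume x: "x \<in> carrier A" and y: "y \<in> carrier A"
  have "tensor_map H A (\<lambda>x. x) (tensor_lift A (\<lambda>a b. a \<otimes>\<^sub>A b)) (tensor_assoc H A A (HAA.pt Z y)) =
      Z \<otimes>\<^bsub>HA.T\<^esub> HA.pt \<one>\<^sub>H y" if "Z \<in> carrier HA.T" for Z
    using that
  proof (induction rule: HA.tensor_induct)
    case (pure h a)
    then show ?case using y by (simp add: t2(2) t3(2) ml(2) HA.pt_mult)
  next
    case (add X Y)
    then show ?case using y
      by (simp add: HAA.pt_add_left lin_hom_add[OF alg_hom_lin[OF t2(1)]] alg_hom_closed[OF t2(1)]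
          lin_hom_add[OF t3(1)] HA.T.l_distr)
  qed
  then show "galois_map H A (AA.pt x y) = coaction A x \<otimes>\<^bsub>HA.T\<^esub> HA.pt \<one>\<^sub>H y"
    using x y lin_hom_closed[OF \<alpha>] by (simp add: galois_map_def id_def t1(2))
qed

locale h_pair =
  fixes E F :: "'k::field mat" and m n :: nat
  assumes E: "E \<in> GL m" and F: "F \<in> GL n"
begin

abbreviation "H \<equiv> H_alg E E"
abbreviation "A \<equiv> H_alg E F"
abbreviation "Hu \<equiv> H_u E E"
abbreviation "Hv \<equiv> H_v E E"
abbreviation "u \<equiv> H_u E F"
abbreviation "v \<equiv> H_v E F"

sublocale HA: two_algs H A by (rule two_algsI[OF kalgebra_H[OF E E] kalgebra_H[OF E F]])
sublocale AA: two_algs A A by (rule two_algsI[OF kalgebra_H[OF E F] kalgebra_H[OF E F]])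
sublocale HH: two_algs H H by (rule two_algsI[OF kalgebra_H[OF E E] kalgebra_H[OF E E]])
sublocale AO: two_algs A "op_alg A" by (rule two_algsI[OF kalgebra_H[OF E F] kalgebra_op_alg[OF kalgebra_H[OF E F]]])
sublocale rep: hrep A E F "mat m n (\<lambda>(i, j). u i j)" "mat m n (\<lambda>(i, j). v i j)" m n
  by (rule hrepI[OF kalgebra_H[OF E F] E F hmats_H[OF E F]])

abbreviation "HAT \<equiv> tensor H A"
abbreviation "AAT \<equiv> tensor A A"
abbreviation "AOT \<equiv> tensor A (op_alg A)"

definition w :: "nat \<Rightarrow> nat \<Rightarrow> 'k hel" where
  "w a j = (scal A F \<star>\<^sub>A (mat m n (\<lambda>(i, j). u i j))\<^sup>T \<star>\<^sub>A scal A (mat_inv E)) $$ (a, j)"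

lemma gens_closed [simp]: "i < m \<Longrightarrow> j < n \<Longrightarrow> u i j \<in> carrier A" "i < m \<Longrightarrow> j < n \<Longrightarrow> v i j \<in> carrier A"
  "i < m \<Longrightarrow> j < m \<Longrightarrow> Hu i j \<in> carrier H" "i < m \<Longrightarrow> j < m \<Longrightarrow> Hv i j \<in> carrier H"
  using H_gens_closed[OF E F] H_gens_closed[OF E E] by auto

lemma w_closed [simp]: "a < n \<Longrightarrow> j < m \<Longrightarrow> w a j \<in> carrier A"
  unfolding w_def by (rule entriesD) simp_all

lemma rels:
  "i < m \<Longrightarrow> j < m \<Longrightarrow> (\<Oplus>\<^sub>A a\<in>{..<n}. u i a \<otimes>\<^sub>A v j a) = (if i = j then \<one>\<^sub>A else \<zero>\<^sub>A)"
  "a < n \<Longrightarrow> b < n \<Longrightarrow> (\<Oplus>\<^sub>A i\<in>{..<m}. v i a \<otimes>\<^sub>A u i b) = (if a = b then \<one>\<^sub>A else \<zero>\<^sub>A)"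
  "i < m \<Longrightarrow> j < m \<Longrightarrow> (\<Oplus>\<^sub>A a\<in>{..<n}. v i a \<otimes>\<^sub>A w a j) = (if i = j then \<one>\<^sub>A else \<zero>\<^sub>A)"
  "a < n \<Longrightarrow> b < n \<Longrightarrow> (\<Oplus>\<^sub>A i\<in>{..<m}. w a i \<otimes>\<^sub>A v i b) = (if a = b then \<one>\<^sub>A else \<zero>\<^sub>A)"
proof -
  let ?u = "mat m n (\<lambda>(i, j). u i j)" and ?v = "mat m n (\<lambda>(i, j). v i j)"
  let ?w = "scal A F \<star>\<^sub>A ?u\<^sup>T \<star>\<^sub>A scal A (mat_inv E)"
  have wd: "dim_row ?w = n" "dim_col ?w = m" by simp_all
  { assume ij: "i < m" "j < m"
    have "(?u \<star>\<^sub>A ?v\<^sup>T) $$ (i, j) = (\<Oplus>\<^sub>A a\<in>{..<n}. u i a \<otimes>\<^sub>A v j a)"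
      using ij by (subst HA.B.amul_index) (simp_all, intro HA.B.finsum_eqI, simp_all)
    then have e: "(\<Oplus>\<^sub>A a\<in>{..<n}. u i a \<otimes>\<^sub>A v j a) = scal A (1\<^sub>m m) $$ (i, j)"
      unfolding rep.rel1 by (rule sym)
    show "(\<Oplus>\<^sub>A a\<in>{..<n}. u i a \<otimes>\<^sub>A v j a) = (if i = j then \<one>\<^sub>A else \<zero>\<^sub>A)"
      unfolding e using ij by simp
    have one: "?v \<star>\<^sub>A ?w = scal A (1\<^sub>m m)" using rep.rel2 by (simp add: HA.B.amul_assoc)
    have "(?v \<star>\<^sub>A ?w) $$ (i, j) = (\<Oplus>\<^sub>A a\<in>{..<n}. ?v $$ (i, a) \<otimes>\<^sub>A ?w $$ (a, j))"
      using ij by (subst HA.B.amul_index) simp_all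
    also have "\<dots> = (\<Oplus>\<^sub>A a\<in>{..<n}. v i a \<otimes>\<^sub>A w a j)"
      using ij by (intro HA.B.finsum_eqI) (simp_all add: w_def[symmetric])
    finally have e: "(\<Oplus>\<^sub>A a\<in>{..<n}. v i a \<otimes>\<^sub>A w a j) = scal A (1\<^sub>m m) $$ (i, j)" unfolding one by (rule sym)
    show "(\<Oplus>\<^sub>A a\<in>{..<n}. v i a \<otimes>\<^sub>A w a j) = (if i = j then \<one>\<^sub>A else \<zero>\<^sub>A)"
      unfolding e using ij by simp }
  { assume ab: "a < n" "b < n"
    have "(?v\<^sup>T \<star>\<^sub>A ?u) $$ (a, b) = (\<Oplus>\<^sub>A i\<in>{..<m}. v i a \<otimes>\<^sub>A u i b)"
      using ab by (subst HA.B.amul_index) (simp_all, intro HA.B.finsum_eqI, simp_all)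
    then have e: "(\<Oplus>\<^sub>A i\<in>{..<m}. v i a \<otimes>\<^sub>A u i b) = scal A (1\<^sub>m n) $$ (a, b)"
      unfolding rep.rel3 by (rule sym)
    show "(\<Oplus>\<^sub>A i\<in>{..<m}. v i a \<otimes>\<^sub>A u i b) = (if a = b then \<one>\<^sub>A else \<zero>\<^sub>A)"
      unfolding e using ab by simp
    have one: "?w \<star>\<^sub>A ?v = scal A (1\<^sub>m n)" using rep.rel4 by (simp add: HA.B.amul_assoc)
    have "(?w \<star>\<^sub>A ?v) $$ (a, b) = (\<Oplus>\<^sub>A i\<in>{..<m}. ?w $$ (a, i) \<otimes>\<^sub>A ?v $$ (i, b))"
      using ab by (subst HA.B.amul_index) simp_all
    also have "\<dots> = (\<Oplus>\<^sub>A i\<in>{..<m}. w a i \<otimes>\<^sub>A v i b)"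
      using ab by (intro HA.B.finsum_eqI) (simp_all add: w_def[symmetric])
    finally have e: "(\<Oplus>\<^sub>A i\<in>{..<m}. w a i \<otimes>\<^sub>A v i b) = scal A (1\<^sub>m n) $$ (a, b)" unfolding one by (rule sym)
    show "(\<Oplus>\<^sub>A i\<in>{..<m}. w a i \<otimes>\<^sub>A v i b) = (if a = b then \<one>\<^sub>A else \<zero>\<^sub>A)"
      unfolding e using ab by simp }
qed

lemma coact:
  shows coact_hom: "H_coact E F \<in> alg_hom A HAT"
    and coact_u: "\<And>i j. i < m \<Longrightarrow> j < n \<Longrightarrow> H_coact E F (u i j) = (\<Oplus>\<^bsub>HAT\<^esub>l\<in>{..<m}. HA.pt (Hu i l) (u l j))"
    and coact_v: "\<And>i j. i < m \<Longrightarrow> j < n \<Longrightarrow> H_coact E F (v i j) = (\<Oplus>\<^bsub>HAT\<^esub>l\<in>{..<m}. HA.pt (Hv i l) (v l j))"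
proof -
  let ?g = "\<lambda>x. case x of U i j \<Rightarrow> \<Oplus>\<^bsub>HAT\<^esub>l\<in>{..<dim_row E}. HA.pt (Hu i l) (u l j)
    | V i j \<Rightarrow> \<Oplus>\<^bsub>HAT\<^esub>l\<in>{..<dim_row E}. HA.pt (Hv i l) (v l j)"
  have c: "H_coact E F = pres_lift HAT ?g" by (simp only: H_coact_def Let_def)
  have dE: "dim_row E = m" using GL_dims[OF E] by simp
  have eq: "Um m n ?g = mat m n (\<lambda>(i, j). \<Oplus>\<^bsub>HAT\<^esub>l\<in>{..<m}. HA.pt (mat m m (\<lambda>(i, j). Hu i j) $$ (i, l)) (mat m n (\<lambda>(i, j). u i j) $$ (l, j)))"
    "Vm m n ?g = mat m n (\<lambda>(i, j). \<Oplus>\<^bsub>HAT\<^esub>l\<in>{..<m}. HA.pt (mat m m (\<lambda>(i, j). Hv i j) $$ (i, l)) (mat m n (\<lambda>(i, j). v i j) $$ (l, j)))"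
    by (intro eq_matI; simp; intro HA.T.finsum_eqI; simp)+
  have h: "hmats E F HAT (Um m n ?g) (Vm m n ?g)"
    unfolding eq by (rule HA.hmats_tensor[OF E E F hmats_H[OF E E] hmats_H[OF E F]])
  note l = H_lift[OF E F HA.T.kalgebra h, folded c]
  show "H_coact E F \<in> alg_hom A HAT" by (rule l(1))
  show "\<And>i j. i < m \<Longrightarrow> j < n \<Longrightarrow> H_coact E F (u i j) = (\<Oplus>\<^bsub>HAT\<^esub>l\<in>{..<m}. HA.pt (Hu i l) (u l j))"
    "\<And>i j. i < m \<Longrightarrow> j < n \<Longrightarrow> H_coact E F (v i j) = (\<Oplus>\<^bsub>HAT\<^esub>l\<in>{..<m}. HA.pt (Hv i l) (v l j))"
    using l(2,3) by (simp_all add: dE)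
qed

text \<open>The translation map: the product of the generic representation for \<open>(E,F)\<close> with its inverse over
  the opposite algebra is a representation for \<open>(E,E)\<close>.\<close>

lemma kappa_exists:
  "\<exists>\<kappa>\<in>alg_hom H AOT. (\<forall>i<m. \<forall>j<m. \<kappa> (Hu i j) = (\<Oplus>\<^bsub>AOT\<^esub>a\<in>{..<n}. AO.pt (u i a) (v j a))) \<and>
     (\<forall>i<m. \<forall>j<m. \<kappa> (Hv i j) = (\<Oplus>\<^bsub>AOT\<^esub>a\<in>{..<n}. AO.pt (v i a) (w a j)))"
proof -
  let ?u = "mat m n (\<lambda>(i, j). u i j)" and ?v = "mat m n (\<lambda>(i, j). v i j)"
  let ?w = "scal A F \<star>\<^sub>A ?u\<^sup>T \<star>\<^sub>A scal A (mat_inv E)"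
  let ?g = "\<lambda>x. case x of U i j \<Rightarrow> \<Oplus>\<^bsub>AOT\<^esub>a\<in>{..<n}. AO.pt (u i a) (v j a)
    | V i j \<Rightarrow> \<Oplus>\<^bsub>AOT\<^esub>a\<in>{..<n}. AO.pt (v i a) (w a j)"
  have eq: "Um m m ?g = mat m m (\<lambda>(i, j). \<Oplus>\<^bsub>AOT\<^esub>l\<in>{..<n}. AO.pt (?u $$ (i, l)) (?v\<^sup>T $$ (l, j)))"
    "Vm m m ?g = mat m m (\<lambda>(i, j). \<Oplus>\<^bsub>AOT\<^esub>l\<in>{..<n}. AO.pt (?v $$ (i, l)) (?w $$ (l, j)))"
    by (intro eq_matI; simp; intro AO.T.finsum_eqI; simp add: w_def[symmetric])+
  have h: "hmats E E AOT (Um m m ?g) (Vm m m ?g)"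
    unfolding eq by (rule AO.hmats_tensor[OF E F E hmats_H[OF E F] hmats_op[OF HA.B.kalgebra E F hmats_H[OF E F]]])
  note l = H_lift[OF E E AO.T.kalgebra h]
  show ?thesis
    by (rule bexI[OF _ l(1)]) (use l(2,3) in auto)
qed

lemma counit: "H_counit E \<in> alg_hom H base_alg"
  "i < m \<Longrightarrow> j < m \<Longrightarrow> H_counit E (Hu i j) = (if i = j then 1 else 0)"
  "i < m \<Longrightarrow> j < m \<Longrightarrow> H_counit E (Hv i j) = (if i = j then 1 else 0)"
proof -
  let ?g = "\<lambda>x. case x of U i j \<Rightarrow> (if i = j then 1 else 0 :: 'k) | V i j \<Rightarrow> (if i = j then 1 else 0)"
  interpret K: kalg "base_alg :: ('k, 'k) module" by (simp add: kalg_def kalgebra_base_alg)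
  have I: "(1\<^sub>m m :: 'k mat) \<in> GL m" "mat_inv (1\<^sub>m m :: 'k mat) = 1\<^sub>m m"
    using GL_I[of "1\<^sub>m m :: 'k mat" m "1\<^sub>m m"] by auto
  have eq: "Um m m ?g = scal base_alg (1\<^sub>m m)" "Vm m m ?g = scal base_alg (1\<^sub>m m)"
    by (intro eq_matI; auto simp: base_alg_def)+
  have h: "hmats E E base_alg (Um m m ?g) (Vm m m ?g)"
    using hmats_scalar[OF K.kalgebra I(1) E] I GL_inv[OF E] by (simp add: eq)
  note l = H_lift[OF E E K.kalgebra h]
  show "H_counit E \<in> alg_hom H base_alg"
    "i < m \<Longrightarrow> j < m \<Longrightarrow> H_counit E (Hu i j) = (if i = j then 1 else 0)"
    "i < m \<Longrightarrow> j < m \<Longrightarrow> H_counit E (Hv i j) = (if i = j then 1 else 0)"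
    using l by (simp_all add: H_counit_def)
qed

lemma comodule_counit:
  assumes "x \<in> carrier A"
  shows "tensor_lift A (\<lambda>h a. H_counit E h \<odot>\<^sub>A a) (H_coact E F x) = x"
proof -
  note e = counit(1)
  have b: "bilin H A A (\<lambda>h a. H_counit E h \<odot>\<^sub>A a)"
    by (intro bilinI lin_homI)
      (auto simp: lin_hom_add[OF alg_hom_lin[OF e]] lin_hom_smult[OF alg_hom_lin[OF e]] base_alg_def
        HA.B.smult_add_left HA.B.smult_add_right HA.B.smult_smult mult.commute)
  have L: "tensor_lift A (\<lambda>h a. H_counit E h \<odot>\<^sub>A a) \<in> alg_hom HAT A"
    by (rule tensor_lift_alg_hom[OF HA.A.kalgebra HA.B.kalgebra HA.B.kalgebra b])
      (auto simp: alg_hom_mult[OF e] alg_hom_one[OF e] base_alg_def HA.B.mult_smult_left HA.B.mult_smult_right HA.B.smult_smult mult.commute)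
  note Lp = HA.tensor_lift(2)[OF HA.B.kalgebra b]
  note Ls = lin_hom_finsum_eq[OF HA.T.kalgebra HA.B.kalgebra alg_hom_lin[OF L]]
  show ?thesis
  proof (rule alg_hom_H_eq[OF E F alg_hom_comp[OF coact_hom L] alg_hom_id _ _ assms])
    fix i j assume ij: "i < m" "j < n"
    have "(\<Oplus>\<^sub>A l\<in>{..<m}. H_counit E (Hu i l) \<odot>\<^sub>A u l j) = H_counit E (Hu i i) \<odot>\<^sub>A u i j"
      using ij by (intro HA.B.finsum_delta) (auto simp: counit)
    moreover have "tensor_lift A (\<lambda>h a. H_counit E h \<odot>\<^sub>A a) (H_coact E F (u i j)) = (\<Oplus>\<^sub>A l\<in>{..<m}. H_counit E (Hu i l) \<odot>\<^sub>A u l j)"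
      unfolding coact_u[OF ij] using ij by (intro Ls) (simp_all add: Lp)
    ultimately show "tensor_lift A (\<lambda>h a. H_counit E h \<odot>\<^sub>A a) (H_coact E F (u i j)) = u i j"
      using ij by (simp add: counit)
    have "(\<Oplus>\<^sub>A l\<in>{..<m}. H_counit E (Hv i l) \<odot>\<^sub>A v l j) = H_counit E (Hv i i) \<odot>\<^sub>A v i j"
      using ij by (intro HA.B.finsum_delta) (auto simp: counit)
    moreover have "tensor_lift A (\<lambda>h a. H_counit E h \<odot>\<^sub>A a) (H_coact E F (v i j)) = (\<Oplus>\<^sub>A l\<in>{..<m}. H_counit E (Hv i l) \<odot>\<^sub>A v l j)"
      unfolding coact_v[OF ij] using ij by (intro Ls) (simp_all add: Lp)
    ultimately show "tensor_lift A (\<lambda>h a. H_counit E h \<odot>\<^sub>A a) (H_coact E F (v i j)) = v i j"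
      using ij by (simp add: counit)
  qed
qed

end

text \<open>Coassociativity: both composites are algebra maps, and on generators both give
  \<open>\<Sum> u\<^sub>i\<^sub>k \<otimes> u\<^sub>k\<^sub>l \<otimes> u\<^sub>l\<^sub>j\<close>.\<close>

lemma (in h_pair) coact_assoc:
  assumes "x \<in> carrier A"
  shows "tensor_assoc H H A (tensor_map (tensor H H) A (H_coact E E) id (H_coact E F x)) =
    tensor_map H HAT id (H_coact E F) (H_coact E F x)"
proof -
  interpret P: h_pair E E m m by unfold_locales (rule E)+
  interpret X: two_algs "tensor H H" A by (rule two_algsI[OF HH.T.kalgebra HA.B.kalgebra])
  interpret Y: two_algs H HAT by (rule two_algsI[OF HA.A.kalgebra HA.T.kalgebra])
  have idh: "id \<in> alg_hom A A" "id \<in> alg_hom H H" using alg_hom_id by (simp_all add: id_def)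
  note kH = HA.A.kalgebra and kA = HA.B.kalgebra
  note m1 = tensor_map_alg_hom[OF kH kA HH.T.kalgebra kA P.coact_hom idh(1)]
  note m1p = tensor_map(2)[OF kH kA HH.T.kalgebra kA alg_hom_lin[OF P.coact_hom] alg_hom_lin[OF idh(1)]]
  note as = tensor_assoc[OF kH kH kA]
  note m2 = tensor_map_alg_hom[OF kH kA kH HA.T.kalgebra idh(2) coact_hom]
  note m2p = tensor_map(2)[OF kH kA kH HA.T.kalgebra alg_hom_lin[OF idh(2)] alg_hom_lin[OF coact_hom]]
  note s1 = lin_hom_finsum_eq[OF HA.T.kalgebra X.T.kalgebra alg_hom_lin[OF m1]]
  note s2 = lin_hom_finsum_eq[OF X.T.kalgebra Y.T.kalgebra alg_hom_lin[OF as(1)]]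
  note s3 = lin_hom_finsum_eq[OF HA.T.kalgebra Y.T.kalgebra alg_hom_lin[OF m2]]
  have gen: "tensor_assoc H H A (tensor_map (tensor H H) A (H_coact E E) id (H_coact E F (g i j))) =
      tensor_map H HAT id (H_coact E F) (H_coact E F (g i j))"
    if g: "\<And>i j. i < m \<Longrightarrow> j < n \<Longrightarrow> g i j \<in> carrier A" "\<And>i j. i < m \<Longrightarrow> j < m \<Longrightarrow> Hg i j \<in> carrier H"
      "\<And>i j. i < m \<Longrightarrow> j < n \<Longrightarrow> H_coact E F (g i j) = (\<Oplus>\<^bsub>HAT\<^esub>l\<in>{..<m}. HA.pt (Hg i l) (g l j))"
      "\<And>i j. i < m \<Longrightarrow> j < m \<Longrightarrow> H_coact E E (Hg i j) = (\<Oplus>\<^bsub>tensor H H\<^esub>l\<in>{..<m}. HH.pt (Hg i l) (Hg l j))"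
      and ij: "i < m" "j < n" for g Hg i j
  proof -
    note [simp] = g(1,2)
    have "tensor_map (tensor H H) A (H_coact E E) id (H_coact E F (g i j)) =
        (\<Oplus>\<^bsub>X.T\<^esub>l\<in>{..<m}. \<Oplus>\<^bsub>X.T\<^esub>k\<in>{..<m}. X.pt (HH.pt (Hg i k) (Hg k l)) (g l j))"
      unfolding g(3)[OF ij] using ij by (intro s1; simp add: m1p[unfolded id_def] id_def g(4)) (rule X.pt_finsum_left; simp)
    then have "tensor_assoc H H A (tensor_map (tensor H H) A (H_coact E E) id (H_coact E F (g i j))) =
        tensor_assoc H H A (\<Oplus>\<^bsub>X.T\<^esub>l\<in>{..<m}. \<Oplus>\<^bsub>X.T\<^esub>k\<in>{..<m}. X.pt (HH.pt (Hg i k) (Hg k l)) (g l j))"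
      by (rule arg_cong)
    also have "\<dots> = (\<Oplus>\<^bsub>Y.T\<^esub>l\<in>{..<m}. \<Oplus>\<^bsub>Y.T\<^esub>k\<in>{..<m}. Y.pt (Hg i k) (HA.pt (Hg k l) (g l j)))"
      using ij by (intro s2) (simp_all add: as(2))
    also have "\<dots> = (\<Oplus>\<^bsub>Y.T\<^esub>k\<in>{..<m}. \<Oplus>\<^bsub>Y.T\<^esub>l\<in>{..<m}. Y.pt (Hg i k) (HA.pt (Hg k l) (g l j)))"
      using ij by (intro Y.T.finsum_swap) simp_all
    also have "\<dots> = (\<Oplus>\<^bsub>Y.T\<^esub>k\<in>{..<m}. Y.pt (Hg i k) (H_coact E F (g k j)))"
      using ij by (intro Y.T.finsum_eqI; simp add: g(3)) (rule Y.pt_finsum_right[symmetric]; simp)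
    also have "\<dots> = tensor_map H HAT id (H_coact E F) (H_coact E F (g i j))"
      unfolding g(3)[OF ij] using ij
      by (intro s3[symmetric]) (simp_all add: m2p[unfolded id_def] id_def)
    finally show ?thesis .
  qed
  show ?thesis
    by (rule alg_hom_H_eq[OF E F alg_hom_comp[OF alg_hom_comp[OF coact_hom m1] as(1)] alg_hom_comp[OF coact_hom m2] _ _ assms])
      (rule gen[of u Hu] gen[of v Hv]; simp add: coact_u coact_v P.coact_u P.coact_v)+
qed

lemma bij_betw_inverse_maps:
  assumes "\<And>x. x \<in> S \<Longrightarrow> f x \<in> T" "\<And>y. y \<in> T \<Longrightarrow> g y \<in> S"
    "\<And>x. x \<in> S \<Longrightarrow> g (f x) = x" "\<And>y. y \<in> T \<Longrightarrow> f (g y) = y"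
  shows "bij_betw f S T"
  by (rule bij_betw_byWitness[where f' = g]) (use assms in auto)

context h_pair
begin

lemmas A_induct = H_induct[OF E F, consumes 1, case_names one u v add scale]
  and H_induct' = H_induct[OF E E, consumes 1, case_names one u v add scale]

lemma right_counit:
  assumes FE: "F = E" "n = m" and x: "x \<in> carrier A"
  shows "tensor_lift A (\<lambda>h a. H_counit E a \<odot>\<^sub>A h) (H_coact E F x) = x"
proof -
  note e = counit(1)
  note [simp] = FE
  have b: "bilin A A A (\<lambda>h a. H_counit E a \<odot>\<^sub>A h)"
    using e by (intro bilinI lin_homI)
      (auto simp: lin_hom_add[OF alg_hom_lin[OF e]] lin_hom_smult[OF alg_hom_lin[OF e]] base_alg_def
        HA.A.smult_add_left HA.A.smult_add_right HA.A.smult_smult mult.commute)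
  have L: "tensor_lift A (\<lambda>h a. H_counit E a \<odot>\<^sub>A h) \<in> alg_hom AAT A"
    by (rule tensor_lift_alg_hom[OF HA.B.kalgebra HA.B.kalgebra HA.B.kalgebra b])
      (auto simp: alg_hom_mult[OF e] alg_hom_one[OF e] base_alg_def HA.A.mult_smult_left HA.A.mult_smult_right HA.A.smult_smult mult.commute)
  note Lp = AA.tensor_lift(2)[OF HA.B.kalgebra b]
  note Ls = lin_hom_finsum_eq[OF AA.T.kalgebra HA.B.kalgebra alg_hom_lin[OF L]]
  have ch: "H_coact E F \<in> alg_hom A AAT" using coact_hom by simp
  have gen: "tensor_lift A (\<lambda>h a. H_counit E a \<odot>\<^sub>A h) (H_coact E F (g i j)) = g i j"
    if "i < m" "j < n" "\<And>i j. i < m \<Longrightarrow> j < n \<Longrightarrow> g i j \<in> carrier A"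
      "H_coact E F (g i j) = (\<Oplus>\<^bsub>AAT\<^esub>l\<in>{..<m}. AA.pt (g i l) (g l j))"
      "\<And>i j. i < m \<Longrightarrow> j < m \<Longrightarrow> H_counit E (g i j) = (if i = j then 1 else 0)" for g i j
  proof -
    have "tensor_lift A (\<lambda>h a. H_counit E a \<odot>\<^sub>A h) (H_coact E F (g i j)) = (\<Oplus>\<^sub>A l\<in>{..<m}. H_counit E (g l j) \<odot>\<^sub>A g i l)"
      unfolding that(4) using that(1-3) Lp by (intro Ls) simp_all
    also have "\<dots> = H_counit E (g j j) \<odot>\<^sub>A g i j"
      using that(1,2,3,5) by (intro HA.B.finsum_delta) auto
    finally show ?thesis using that(1,2,3,5) by simp
  qed
  show ?thesis
    by (rule alg_hom_H_eq[OF E F alg_hom_comp[OF ch L] alg_hom_id _ _ x])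
      (rule gen[of _ _ u] gen[of _ _ v]; use coact_u coact_v counit in simp)+
qed

text \<open>The antipode axioms propagate from the generators: if \<open>S(x\<^sub>1) x\<^sub>2\<close> is scalar for one factor,
  it can be cancelled in the middle of the product.\<close>

lemma antipode:
  assumes FE: "F = E" "n = m"
  shows "H_antipode E \<in> alg_hom A (op_alg A)"
    and "\<And>i j. i < m \<Longrightarrow> j < m \<Longrightarrow> H_antipode E (u i j) = v j i"
    and "\<And>i j. i < m \<Longrightarrow> j < m \<Longrightarrow> H_antipode E (v i j) = w i j"
proof -
  note [simp] = FE
  let ?g = "\<lambda>x. case x of U i j \<Rightarrow> amat_transpose (H_v E E) i j
     | V i j \<Rightarrow> amat_mult A m (amat_mult A m (amat_scalar A E) (amat_transpose (H_u E E))) (amat_scalar A (mat_inv E)) i j"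
  have dE: "dim_row E = m" using GL_dims[OF E] by simp
  have c: "H_antipode E = pres_lift (op_alg A) ?g" by (simp only: H_antipode_def Let_def dE FE(1))
  let ?u = "mat m m (\<lambda>(i, j). u i j)" and ?v = "mat m m (\<lambda>(i, j). v i j)"
  let ?w = "scal A E \<star>\<^sub>A ?u\<^sup>T \<star>\<^sub>A scal A (mat_inv E)"
  have ent: "entries A ?u" using rep.uv_entries(1) by simp
  have ww: "w i j = ?w $$ (i, j)" for i j unfolding w_def by (simp only: FE)
  have wv: "?g (V i j) = w i j" if "i < m" "j < m" for i j
  proof -
    have "amat_mult A m (amat_mult A m (amat_scalar A E) (amat_transpose (H_u E E))) (amat_scalar A (mat_inv E)) i j = ?w $$ (i, j)"
      using that ent by (intro HA.B.amat_mult_index)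
        (simp_all add: amat_scalar_def amat_transpose_def)
    then show ?thesis by (simp only: hgen.case ww)
  qed
  have eq: "Um m m ?g = ?v\<^sup>T" "Vm m m ?g = ?w"
    by (rule eq_matI; simp add: amat_transpose_def) (rule eq_matI; use wv ww in simp)
  have h: "hmats E E (op_alg A) (Um m m ?g) (Vm m m ?g)"
    unfolding eq using hmats_op[OF HA.B.kalgebra E F hmats_H[OF E F]] by simp
  note l = H_lift[OF E E kalgebra_op_alg[OF HA.B.kalgebra] h, folded c]
  show "H_antipode E \<in> alg_hom A (op_alg A)"
    "\<And>i j. i < m \<Longrightarrow> j < m \<Longrightarrow> H_antipode E (u i j) = v j i"
    "\<And>i j. i < m \<Longrightarrow> j < m \<Longrightarrow> H_antipode E (v i j) = w i j"
    using l wv by (simp_all add: amat_transpose_def)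
qed

lemma antipode_axioms:
  assumes FE: "F = E" "n = m" and x: "x \<in> carrier A"
  shows "tensor_lift A (\<lambda>y z. H_antipode E y \<otimes>\<^sub>A z) (H_coact E F x) = H_counit E x \<odot>\<^sub>A \<one>\<^sub>A"
    and "tensor_lift A (\<lambda>y z. y \<otimes>\<^sub>A H_antipode E z) (H_coact E F x) = H_counit E x \<odot>\<^sub>A \<one>\<^sub>A"
proof -
  define S where "S = H_antipode E"
  note S = antipode[OF FE, folded S_def]
  note e = counit(1)
  have Sl: "S \<in> lin_hom A A" using alg_hom_lin[OF S(1)] same_alg_hom(1)[of A A] by (simp add: lin_hom_def)
  have Sc [simp]: "S y \<in> carrier A" if "y \<in> carrier A" for y using lin_hom_closed[OF Sl that] .
  have Sm: "S (y \<otimes>\<^sub>A z) = S z \<otimes>\<^sub>A S y" if "y \<in> carrier A" "z \<in> carrier A" for y z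
    using alg_hom_mult[OF S(1) that] by simp
  have S1: "S \<one>\<^sub>A = \<one>\<^sub>A" using alg_hom_one[OF S(1)] by simp
  have ch: "H_coact E F \<in> alg_hom A AAT" using coact_hom FE by simp
  have em: "H_counit E (y \<otimes>\<^sub>A z) = H_counit E y * H_counit E z" if "y \<in> carrier A" "z \<in> carrier A" for y z
    using alg_hom_mult[OF e] that FE by (simp add: base_alg_def)
  have e1: "H_counit E \<one>\<^sub>A = 1" using alg_hom_one[OF e] FE by (simp add: base_alg_def)
  have ea: "H_counit E (y \<oplus>\<^sub>A z) = H_counit E y + H_counit E z" if "y \<in> carrier A" "z \<in> carrier A" for y z
    using lin_hom_add[OF alg_hom_lin[OF e]] that FE by (simp add: base_alg_def)
  have es: "H_counit E (c \<odot>\<^sub>A y) = c * H_counit E y" if "y \<in> carrier A" for c y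
    using lin_hom_smult[OF alg_hom_lin[OF e]] that FE by (simp add: base_alg_def)
  have eg: "H_counit E (u i j) = (if i = j then 1 else 0)" "H_counit E (v i j) = (if i = j then 1 else 0)"
    if "i < m" "j < m" for i j using counit(2,3) that FE by simp_all
  have bl: "bilin A A A (\<lambda>y z. S y \<otimes>\<^sub>A z)"
    by (intro bilinI lin_hom_comp[OF Sl lin_hom_mult_right] lin_hom_mult_left HA.B.kalgebra Sc)
  have br: "bilin A A A (\<lambda>y z. y \<otimes>\<^sub>A S z)"
    by (intro bilinI lin_hom_comp[OF Sl lin_hom_mult_left] lin_hom_mult_right HA.B.kalgebra Sc)
  define fl fr where "fl = tensor_lift A (\<lambda>y z. S y \<otimes>\<^sub>A z)" and "fr = tensor_lift A (\<lambda>y z. y \<otimes>\<^sub>A S z)"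
  note Fl = AA.tensor_lift[OF HA.B.kalgebra bl, folded fl_def]
  note Fr = AA.tensor_lift[OF HA.B.kalgebra br, folded fr_def]
  have cl: "fl X \<in> carrier A" "fr X \<in> carrier A" if "X \<in> carrier AAT" for X
    using lin_hom_closed[OF Fl(1) that] lin_hom_closed[OF Fr(1) that] by auto
  have l1: "fl (W \<otimes>\<^bsub>AAT\<^esub> AA.pt a b) = S a \<otimes>\<^sub>A fl W \<otimes>\<^sub>A b"
    if "W \<in> carrier AAT" "a \<in> carrier A" "b \<in> carrier A" for W a b
    using that(1)
    by (induction rule: AA.tensor_induct)
      (use that(2,3) in \<open>simp_all add: Fl(2) AA.pt_mult Sm HA.B.m_assoc AA.T.l_distr lin_hom_add[OF Fl(1)]
        HA.B.l_distr HA.B.r_distr cl\<close>)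
  have r1: "fr (AA.pt a b \<otimes>\<^bsub>AAT\<^esub> W) = a \<otimes>\<^sub>A fr W \<otimes>\<^sub>A S b"
    if "W \<in> carrier AAT" "a \<in> carrier A" "b \<in> carrier A" for W a b
    using that(1)
    by (induction rule: AA.tensor_induct)
      (use that(2,3) in \<open>simp_all add: Fr(2) AA.pt_mult Sm HA.B.m_assoc AA.T.r_distr lin_hom_add[OF Fr(1)]
        HA.B.l_distr HA.B.r_distr cl\<close>)
  have l2: "fl (W \<otimes>\<^bsub>AAT\<^esub> Z) = c \<odot>\<^sub>A fl Z" if "W \<in> carrier AAT" "fl W = c \<odot>\<^sub>A \<one>\<^sub>A" "Z \<in> carrier AAT" for W Z c
    using that(3)
    by (induction rule: AA.tensor_induct)
      (use that(1,2) in \<open>simp_all add: l1 Fl(2) HA.B.mult_smult_left HA.B.mult_smult_right AA.T.r_distr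
        lin_hom_add[OF Fl(1)] HA.B.smult_add_right cl\<close>)
  have r2: "fr (Z \<otimes>\<^bsub>AAT\<^esub> W) = c \<odot>\<^sub>A fr Z" if "W \<in> carrier AAT" "fr W = c \<odot>\<^sub>A \<one>\<^sub>A" "Z \<in> carrier AAT" for W Z c
    using that(3)
    by (induction rule: AA.tensor_induct)
      (use that(1,2) in \<open>simp_all add: r1 Fr(2) HA.B.mult_smult_left HA.B.mult_smult_right AA.T.l_distr
        lin_hom_add[OF Fr(1)] HA.B.smult_add_right cl\<close>)
  have gen: "fl (H_coact E F (g i j)) = H_counit E (g i j) \<odot>\<^sub>A \<one>\<^sub>A"
    "fr (H_coact E F (g i j)) = H_counit E (g i j) \<odot>\<^sub>A \<one>\<^sub>A"
    if ij: "i < m" "j < m" and g: "\<And>i j. i < m \<Longrightarrow> j < m \<Longrightarrow> g i j \<in> carrier A"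
      "\<And>i j. i < m \<Longrightarrow> j < m \<Longrightarrow> H_coact E F (g i j) = (\<Oplus>\<^bsub>AAT\<^esub>l\<in>{..<m}. AA.pt (g i l) (g l j))"
      "\<And>i j. i < m \<Longrightarrow> j < m \<Longrightarrow> H_counit E (g i j) = (if i = j then 1 else 0)"
      "\<And>i j. i < m \<Longrightarrow> j < m \<Longrightarrow> (\<Oplus>\<^sub>A l\<in>{..<m}. S (g i l) \<otimes>\<^sub>A g l j) = (if i = j then \<one>\<^sub>A else \<zero>\<^sub>A)"
      "\<And>i j. i < m \<Longrightarrow> j < m \<Longrightarrow> (\<Oplus>\<^sub>A l\<in>{..<m}. g i l \<otimes>\<^sub>A S (g l j)) = (if i = j then \<one>\<^sub>A else \<zero>\<^sub>A)" for g i j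
  proof -
    have "fl (H_coact E F (g i j)) = (\<Oplus>\<^sub>A l\<in>{..<m}. S (g i l) \<otimes>\<^sub>A g l j)"
      unfolding g(2)[OF ij] using ij g(1)
      by (intro lin_hom_finsum_eq[OF AA.T.kalgebra HA.B.kalgebra Fl(1)]) (simp_all add: Fl(2))
    then show "fl (H_coact E F (g i j)) = H_counit E (g i j) \<odot>\<^sub>A \<one>\<^sub>A" using g(3,4) ij by simp
    have "fr (H_coact E F (g i j)) = (\<Oplus>\<^sub>A l\<in>{..<m}. g i l \<otimes>\<^sub>A S (g l j))"
      unfolding g(2)[OF ij] using ij g(1)
      by (intro lin_hom_finsum_eq[OF AA.T.kalgebra HA.B.kalgebra Fr(1)]) (simp_all add: Fr(2))
    then show "fr (H_coact E F (g i j)) = H_counit E (g i j) \<odot>\<^sub>A \<one>\<^sub>A" using g(3,5) ij by simp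
  qed
  have closed: "u i j \<in> carrier A" "v i j \<in> carrier A" "w i j \<in> carrier A" if "i < m" "j < m" for i j
    by (rule gens_closed w_closed; use that FE(2) in simp)+
  have sums: "(\<Oplus>\<^sub>A l\<in>{..<m}. S (u i l) \<otimes>\<^sub>A u l j) = (\<Oplus>\<^sub>A l\<in>{..<m}. v l i \<otimes>\<^sub>A u l j)"
    "(\<Oplus>\<^sub>A l\<in>{..<m}. u i l \<otimes>\<^sub>A S (u l j)) = (\<Oplus>\<^sub>A l\<in>{..<m}. u i l \<otimes>\<^sub>A v j l)"
    "(\<Oplus>\<^sub>A l\<in>{..<m}. S (v i l) \<otimes>\<^sub>A v l j) = (\<Oplus>\<^sub>A l\<in>{..<m}. w i l \<otimes>\<^sub>A v l j)"
    "(\<Oplus>\<^sub>A l\<in>{..<m}. v i l \<otimes>\<^sub>A S (v l j)) = (\<Oplus>\<^sub>A l\<in>{..<m}. v i l \<otimes>\<^sub>A w l j)"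
    if "i < m" "j < m" for i j
    using that by (intro HA.B.finsum_eqI; simp add: S closed)+
  have gu: "fl (H_coact E F (u i j)) = H_counit E (u i j) \<odot>\<^sub>A \<one>\<^sub>A \<and> fr (H_coact E F (u i j)) = H_counit E (u i j) \<odot>\<^sub>A \<one>\<^sub>A"
    if "i < m" "j < m" for i j
    using gen[of i j u] that coact_u eg sums rels FE by simp
  have gv: "fl (H_coact E F (v i j)) = H_counit E (v i j) \<odot>\<^sub>A \<one>\<^sub>A \<and> fr (H_coact E F (v i j)) = H_counit E (v i j) \<odot>\<^sub>A \<one>\<^sub>A"
    if "i < m" "j < m" for i j
    using gen[of i j v] that coact_v eg sums rels FE by simp
  note cm = alg_hom_mult[OF ch] and cc = alg_hom_closed[OF ch]
  have step: "fl (H_coact E F (z \<otimes>\<^sub>A y)) = H_counit E (z \<otimes>\<^sub>A y) \<odot>\<^sub>A \<one>\<^sub>A \<and> fr (H_coact E F (z \<otimes>\<^sub>A y)) = H_counit E (z \<otimes>\<^sub>A y) \<odot>\<^sub>A \<one>\<^sub>A"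
    if "z \<in> carrier A" "y \<in> carrier A"
      "fl (H_coact E F z) = H_counit E z \<odot>\<^sub>A \<one>\<^sub>A \<and> fr (H_coact E F z) = H_counit E z \<odot>\<^sub>A \<one>\<^sub>A"
      "fl (H_coact E F y) = H_counit E y \<odot>\<^sub>A \<one>\<^sub>A \<and> fr (H_coact E F y) = H_counit E y \<odot>\<^sub>A \<one>\<^sub>A" for z y
    using that l2[OF cc[OF that(1)] _ cc[OF that(2)]] r2[OF cc[OF that(2)] _ cc[OF that(1)]]
    by (simp add: cm em HA.B.smult_smult mult.commute)
  have "fl (H_coact E F x) = H_counit E x \<odot>\<^sub>A \<one>\<^sub>A \<and> fr (H_coact E F x) = H_counit E x \<odot>\<^sub>A \<one>\<^sub>A"
    using x
  proof (induction rule: A_induct)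
    case one
    show ?case by (simp add: alg_hom_one[OF ch] AA.T_one Fl(2) Fr(2) S1 e1)
  next
    case (u i j Y)
    then show ?case using step gu FE by simp
  next
    case (v i j Y)
    then show ?case using step gv FE by simp
  next
    case (add X Y)
    then show ?case
      by (simp add: lin_hom_add[OF alg_hom_lin[OF ch]] lin_hom_add[OF Fl(1)] lin_hom_add[OF Fr(1)] cc ea HA.B.smult_add_left)
  next
    case (scale c X)
    then show ?case
      by (simp add: lin_hom_smult[OF alg_hom_lin[OF ch]] lin_hom_smult[OF Fl(1)] lin_hom_smult[OF Fr(1)] cc es HA.B.smult_smult)
  qed
  then show "tensor_lift A (\<lambda>y z. H_antipode E y \<otimes>\<^sub>A z) (H_coact E F x) = H_counit E x \<odot>\<^sub>A \<one>\<^sub>A"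
    "tensor_lift A (\<lambda>y z. y \<otimes>\<^sub>A H_antipode E z) (H_coact E F x) = H_counit E x \<odot>\<^sub>A \<one>\<^sub>A"
    by (simp_all add: fl_def fr_def S_def)
qed

end

lemma hopf_algebra_H:
  assumes E: "E \<in> GL m"
  shows "hopf_algebra (H_hopf E)"
proof -
  interpret P: h_pair E E m m by unfold_locales (rule E)+
  note sa = same_alg_H(1)[of E]
  have t: "tensor (H_hopf E) (H_hopf E) = tensor (H_alg E E) (H_alg E E)"
    by (rule same_alg_tensor(1)[OF sa sa])
  have m1: "tensor_map (tensor (H_alg E E) (H_alg E E)) (H_hopf E) = tensor_map (tensor (H_alg E E) (H_alg E E)) (H_alg E E)"
    by (rule same_alg_maps(1)[OF same_alg_refl sa sa])
  have m2: "tensor_map (H_hopf E) (tensor (H_alg E E) (H_alg E E)) = tensor_map (H_alg E E) (tensor (H_alg E E) (H_alg E E))"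
    by (rule same_alg_maps(1)[OF sa same_alg_refl sa])
  have as: "tensor_assoc (H_hopf E) (H_hopf E) (H_hopf E) = tensor_assoc (H_alg E E) (H_alg E E) (H_alg E E)"
    by (rule same_alg_maps(2)[OF sa sa sa])
  have S: "H_antipode E \<in> lin_hom (H_alg E E) (H_alg E E)"
    using alg_hom_lin[OF P.antipode(1)] by (simp add: lin_hom_def)
  show ?thesis
    unfolding hopf_algebra_def t m1 m2 as same_alg_lift[OF sa]
    using same_alg_kalgebra[OF sa P.HA.A.kalgebra] P.coact_hom P.counit(1) S P.coact_assoc P.comodule_counit
      P.right_counit P.antipode_axioms
    by (simp add: same_alg_hom[OF sa same_alg_refl] same_alg_hom[OF sa sa] same_alg_hom[OF same_alg_refl sa])
qed

context h_pair
begin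

lemma left_comodule_algebra_H: "left_comodule_algebra (H_hopf E) (H_comod_alg E F)"
proof -
  note sh = same_alg_H(1)[of E] and sa = same_alg_H(2)[of E F]
  have t: "tensor (H_hopf E) (H_comod_alg E F) = HAT" "tensor (H_hopf E) (H_hopf E) = tensor H H"
    by (rule same_alg_tensor(1)[OF sh sa], rule same_alg_tensor(1)[OF sh sh])
  have m1: "tensor_map (tensor H H) (H_comod_alg E F) = tensor_map (tensor H H) A"
    by (rule same_alg_maps(1)[OF same_alg_refl sa sa])
  have m2: "tensor_map (H_hopf E) HAT = tensor_map H HAT"
    by (rule same_alg_maps(1)[OF sh same_alg_refl sa])
  have as: "tensor_assoc (H_hopf E) (H_hopf E) (H_comod_alg E F) = tensor_assoc H H A"
    by (rule same_alg_maps(2)[OF sh sh sa])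
  show ?thesis
    unfolding left_comodule_algebra_def t m1 m2 as same_alg_lift[OF sa]
    using same_alg_kalgebra[OF sa HA.B.kalgebra] coact_hom coact_assoc comodule_counit
    by (simp add: same_alg_hom[OF sa same_alg_refl])
qed

abbreviation "can \<equiv> galois_map (H_hopf E) (H_comod_alg E F)"

lemma can: "can \<in> lin_hom AAT HAT"
  "\<And>x y. x \<in> carrier A \<Longrightarrow> y \<in> carrier A \<Longrightarrow> can (AA.pt x y) = H_coact E F x \<otimes>\<^bsub>HAT\<^esub> HA.pt \<one>\<^sub>H y"
proof -
  note sh = same_alg_H(1)[of E] and sa = same_alg_H(2)[of E F]
  note t = same_alg_tensor[OF sh sa] same_alg_tensor[OF sa sa]
  have c: "coaction (H_comod_alg E F) \<in> lin_hom (H_comod_alg E F) (tensor (H_hopf E) (H_comod_alg E F))"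
    using alg_hom_lin[OF coact_hom] by (simp add: t same_alg_hom[OF sa same_alg_refl])
  note g = galois_map[OF same_alg_kalgebra[OF sh HA.A.kalgebra] same_alg_kalgebra[OF sa HA.B.kalgebra] c]
  show "can \<in> lin_hom AAT HAT" using g(1) by (simp add: t)
  show "\<And>x y. x \<in> carrier A \<Longrightarrow> y \<in> carrier A \<Longrightarrow> can (AA.pt x y) = H_coact E F x \<otimes>\<^bsub>HAT\<^esub> HA.pt \<one>\<^sub>H y"
    using g(2) by (simp add: t)
qed

text \<open>The inverse of the Galois map is \<open>h \<otimes> b \<mapsto> \<kappa>(h) (1 \<otimes> b)\<close>, where \<open>\<kappa> : H(E) \<rightarrow> A \<otimes> A\<^sup>o\<^sup>p\<close> is the
  composite of \<open>H(E) \<rightarrow> H(E,F) \<otimes> H(F,E)\<close> with the inversion \<open>H(F,E) \<rightarrow> H(E,F)\<^sup>o\<^sup>p\<close>. Both identities hold on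
  generators and are stable under products.\<close>

lemma can_bij: "bij_betw can (carrier AAT) (carrier HAT)"
proof -
  obtain \<kappa> where k: "\<kappa> \<in> alg_hom H AOT"
    and ku: "\<And>i j. i < m \<Longrightarrow> j < m \<Longrightarrow> \<kappa> (Hu i j) = (\<Oplus>\<^bsub>AOT\<^esub>a\<in>{..<n}. AO.pt (u i a) (v j a))"
    and kv: "\<And>i j. i < m \<Longrightarrow> j < m \<Longrightarrow> \<kappa> (Hv i j) = (\<Oplus>\<^bsub>AOT\<^esub>a\<in>{..<n}. AO.pt (v i a) (w a j))"
    using kappa_exists by blast
  define \<alpha> where "\<alpha> = H_coact E F"
  note al = coact_hom[folded \<alpha>_def]
  have ac [simp]: "\<alpha> x \<in> carrier HAT" if "x \<in> carrier A" for x using alg_hom_closed[OF al that] .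
  have kc [simp]: "\<kappa> h \<in> carrier AOT" if "h \<in> carrier H" for h using alg_hom_closed[OF k that] .
  note can' = can[folded \<alpha>_def]
  have opc: "carrier (op_alg A) = carrier A" by simp
  define R where "R b = tensor_lift AAT (\<lambda>x y. AA.pt x (y \<otimes>\<^sub>A b))" for b
  have Rb: "bilin A (op_alg A) AAT (\<lambda>x y. AA.pt x (y \<otimes>\<^sub>A b))" if "b \<in> carrier A" for b
  proof (rule bilinI)
    fix y assume "y \<in> carrier (op_alg A)"
    then show "(\<lambda>x. AA.pt x (y \<otimes>\<^sub>A b)) \<in> lin_hom A AAT" using that by (intro AA.pt_left) simp
  next
    fix x assume "x \<in> carrier A"
    then have "(\<lambda>y. AA.pt x (y \<otimes>\<^sub>A b)) \<in> lin_hom A AAT"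
      using that by (intro lin_hom_comp[OF lin_hom_mult_right AA.pt_right] HA.B.kalgebra)
    then show "(\<lambda>y. AA.pt x (y \<otimes>\<^sub>A b)) \<in> lin_hom (op_alg A) AAT" by (simp add: lin_hom_def)
  qed
  have Rl: "R b \<in> lin_hom AOT AAT" if "b \<in> carrier A" for b
    unfolding R_def by (rule AO.tensor_lift(1)[OF AA.T.kalgebra Rb[OF that]])
  have Rp: "R b (AO.pt x y) = AA.pt x (y \<otimes>\<^sub>A b)" if "b \<in> carrier A" "x \<in> carrier A" "y \<in> carrier A" for b x y
    unfolding R_def using AO.tensor_lift(2)[OF AA.T.kalgebra Rb[OF that(1)], of x y] that by simp
  have Rc [simp]: "R b X \<in> carrier AAT" if "b \<in> carrier A" "X \<in> carrier AOT" for b X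
    using lin_hom_closed[OF Rl[OF that(1)] that(2)] .
  have R2: "(\<lambda>b. R b X) \<in> lin_hom A AAT" if X: "X \<in> carrier AOT" for X
  proof (rule lin_homI)
    fix b d c assume b: "b \<in> carrier A"
    show "R b X \<in> carrier AAT" using b X by simp
    show "R (c \<odot>\<^sub>A b) X = c \<odot>\<^bsub>AAT\<^esub> R b X"
      by (rule AO.lin_hom_tensor_eq[OF Rl lin_hom_scale[OF AA.T.kalgebra Rl] _ X])
        (use b in \<open>simp_all add: Rp HA.B.mult_smult_right AA.pt_smult_right\<close>)
    assume d: "d \<in> carrier A"
    show "R (b \<oplus>\<^sub>A d) X = R b X \<oplus>\<^bsub>AAT\<^esub> R d X"
      by (rule AO.lin_hom_tensor_eq[OF Rl lin_hom_sum[OF AA.T.kalgebra Rl Rl] _ X])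
        (use b d in \<open>simp_all add: Rp HA.B.r_distr AA.pt_add_right\<close>)
  qed
  have AOm: "AO.pt x y \<otimes>\<^bsub>AOT\<^esub> AO.pt x' y' = AO.pt (x \<otimes>\<^sub>A x') (y' \<otimes>\<^sub>A y)"
    if "x \<in> carrier A" "y \<in> carrier A" "x' \<in> carrier A" "y' \<in> carrier A" for x y x' y'
    using AO.pt_mult[of x x' y y'] that by simp
  have AOc [simp]: "AO.pt x y \<in> carrier AOT" if "x \<in> carrier A" "y \<in> carrier A" for x y
    using AO.pt_closed[of x y] that by simp
  have cc [simp]: "can X \<in> carrier HAT" if "X \<in> carrier AAT" for X using lin_hom_closed[OF can'(1) that] .
  \<comment> \<open>first identity: the Galois map undoes \<open>\<kappa>(h) (1 \<otimes> b)\<close>\<close>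
  have c1: "can (R b (AO.pt x y \<otimes>\<^bsub>AOT\<^esub> W)) = \<alpha> x \<otimes>\<^bsub>HAT\<^esub> can (R (y \<otimes>\<^sub>A b) W)"
    if W: "W \<in> carrier AOT" and xyb: "x \<in> carrier A" "y \<in> carrier A" "b \<in> carrier A" for W x y b
    using W
  proof (induction rule: AO.tensor_induct)
    case (pure x' y')
    then show ?case using xyb by (simp add: AOm Rp can'(2) alg_hom_mult[OF al] HA.B.m_assoc HA.T.m_assoc)
  next
    case (add X Y)
    then show ?case using xyb
      by (simp add: AO.T.r_distr lin_hom_add[OF Rl] lin_hom_add[OF can'(1)] HA.T.r_distr)
  qed
  have c2: "can (R b (Z \<otimes>\<^bsub>AOT\<^esub> \<kappa> h)) = can (R b Z) \<otimes>\<^bsub>HAT\<^esub> HA.pt h \<one>\<^sub>A"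
    if h: "h \<in> carrier H" "\<And>b. b \<in> carrier A \<Longrightarrow> can (R b (\<kappa> h)) = HA.pt h b"
      and b: "b \<in> carrier A" and Z: "Z \<in> carrier AOT" for Z h b
    using Z
  proof (induction rule: AO.tensor_induct)
    case (pure x y)
    then show ?case using h b by (simp add: c1 Rp can'(2) HA.T.m_assoc HA.pt_mult)
  next
    case (add X Y)
    then show ?case using h b
      by (simp add: AO.T.l_distr lin_hom_add[OF Rl] lin_hom_add[OF can'(1)] HA.T.l_distr)
  qed
  have base1: "can (R b (\<Oplus>\<^bsub>AOT\<^esub>a\<in>{..<n}. AO.pt (g i a) (y a j))) = HA.pt (Hg i j) b"
    if ij: "i < m" "j < m" and b: "b \<in> carrier A"
      and g: "\<And>i a. i < m \<Longrightarrow> a < n \<Longrightarrow> g i a \<in> carrier A" "\<And>i j. i < m \<Longrightarrow> j < m \<Longrightarrow> Hg i j \<in> carrier H"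
        "\<And>i a. i < m \<Longrightarrow> a < n \<Longrightarrow> y a i \<in> carrier A"
        "\<And>i a. i < m \<Longrightarrow> a < n \<Longrightarrow> \<alpha> (g i a) = (\<Oplus>\<^bsub>HAT\<^esub>l\<in>{..<m}. HA.pt (Hg i l) (g l a))"
        "\<And>i j. i < m \<Longrightarrow> j < m \<Longrightarrow> (\<Oplus>\<^sub>A a\<in>{..<n}. g i a \<otimes>\<^sub>A y a j) = (if i = j then \<one>\<^sub>A else \<zero>\<^sub>A)"
    for g Hg y i j b
  proof -
    note [simp] = g(1-3) b
    have t1: "can (R b (AO.pt (g i a) (y a j))) = (\<Oplus>\<^bsub>HAT\<^esub>l\<in>{..<m}. HA.pt (Hg i l) (g l a \<otimes>\<^sub>A (y a j \<otimes>\<^sub>A b)))"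
      if a: "a < n" for a
    proof -
      have "can (R b (AO.pt (g i a) (y a j))) = (\<Oplus>\<^bsub>HAT\<^esub>l\<in>{..<m}. HA.pt (Hg i l) (g l a)) \<otimes>\<^bsub>HAT\<^esub> HA.pt \<one>\<^sub>H (y a j \<otimes>\<^sub>A b)"
        using ij a by (simp add: Rp can'(2) g(4))
      also have "\<dots> = (\<Oplus>\<^bsub>HAT\<^esub>l\<in>{..<m}. HA.pt (Hg i l) (g l a) \<otimes>\<^bsub>HAT\<^esub> HA.pt \<one>\<^sub>H (y a j \<otimes>\<^sub>A b))"
        using ij a by (intro HA.T.finsum_ldistr) (simp_all add: Pi_iff)
      also have "\<dots> = (\<Oplus>\<^bsub>HAT\<^esub>l\<in>{..<m}. HA.pt (Hg i l) (g l a \<otimes>\<^sub>A (y a j \<otimes>\<^sub>A b)))"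
        using ij a by (intro HA.T.finsum_eqI) (simp_all add: HA.pt_mult)
      finally show ?thesis .
    qed
    have "can (R b (\<Oplus>\<^bsub>AOT\<^esub>a\<in>{..<n}. AO.pt (g i a) (y a j))) =
        (\<Oplus>\<^bsub>HAT\<^esub>a\<in>{..<n}. \<Oplus>\<^bsub>HAT\<^esub>l\<in>{..<m}. HA.pt (Hg i l) (g l a \<otimes>\<^sub>A (y a j \<otimes>\<^sub>A b)))"
      using ij t1 by (intro lin_hom_finsum_eq[OF AO.T.kalgebra HA.T.kalgebra lin_hom_comp[OF Rl can'(1)]]) simp_all
    also have "\<dots> = (\<Oplus>\<^bsub>HAT\<^esub>l\<in>{..<m}. \<Oplus>\<^bsub>HAT\<^esub>a\<in>{..<n}. HA.pt (Hg i l) (g l a \<otimes>\<^sub>A (y a j \<otimes>\<^sub>A b)))"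
      using ij by (intro HA.T.finsum_swap) simp_all
    also have "\<dots> = (\<Oplus>\<^bsub>HAT\<^esub>l\<in>{..<m}. HA.pt (Hg i l) ((if l = j then \<one>\<^sub>A else \<zero>\<^sub>A) \<otimes>\<^sub>A b))"
    proof (intro HA.T.finsum_eqI)
      fix l assume "l \<in> {..<m}"
      then have l: "l < m" by simp
      have "(\<Oplus>\<^bsub>HAT\<^esub>a\<in>{..<n}. HA.pt (Hg i l) (g l a \<otimes>\<^sub>A (y a j \<otimes>\<^sub>A b))) = HA.pt (Hg i l) (\<Oplus>\<^sub>A a\<in>{..<n}. g l a \<otimes>\<^sub>A (y a j \<otimes>\<^sub>A b))"
        using ij l by (intro HA.pt_finsum_right[symmetric]) simp_all
      also have "(\<Oplus>\<^sub>A a\<in>{..<n}. g l a \<otimes>\<^sub>A (y a j \<otimes>\<^sub>A b)) = (\<Oplus>\<^sub>A a\<in>{..<n}. g l a \<otimes>\<^sub>A y a j \<otimes>\<^sub>A b)"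
        using ij l by (intro HA.B.finsum_eqI) (simp_all add: HA.B.m_assoc)
      also have "\<dots> = (\<Oplus>\<^sub>A a\<in>{..<n}. g l a \<otimes>\<^sub>A y a j) \<otimes>\<^sub>A b"
        using ij l by (intro HA.B.finsum_ldistr[symmetric]) (simp_all add: Pi_iff)
      finally show "(\<Oplus>\<^bsub>HAT\<^esub>a\<in>{..<n}. HA.pt (Hg i l) (g l a \<otimes>\<^sub>A (y a j \<otimes>\<^sub>A b))) = HA.pt (Hg i l) ((if l = j then \<one>\<^sub>A else \<zero>\<^sub>A) \<otimes>\<^sub>A b)"
        using g(5)[OF l ij(2)] by simp
    qed (use ij in simp)
    also have "\<dots> = HA.pt (Hg i j) ((if j = j then \<one>\<^sub>A else \<zero>\<^sub>A) \<otimes>\<^sub>A b)"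
      using ij by (intro HA.T.finsum_delta) (simp_all add: HA.pt_zero_right)
    finally show ?thesis by simp
  qed
  have bu: "can (R b (\<kappa> (Hu i j))) = HA.pt (Hu i j) b" if "i < m" "j < m" "b \<in> carrier A" for i j b
    unfolding ku[OF that(1,2)]
    by (rule base1[of i j b u Hu "\<lambda>a j. v j a"]) (use that coact_u rels(1) in \<open>simp_all add: \<alpha>_def\<close>)
  have bv: "can (R b (\<kappa> (Hv i j))) = HA.pt (Hv i j) b" if "i < m" "j < m" "b \<in> carrier A" for i j b
    unfolding kv[OF that(1,2)]
    by (rule base1[of i j b v Hv w]) (use that coact_v rels(3) in \<open>simp_all add: \<alpha>_def\<close>)
  have P: "\<forall>b\<in>carrier A. can (R b (\<kappa> h)) = HA.pt h b" if "h \<in> carrier H" for h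
    using that
  proof (induction rule: H_induct')
    case one
    then show ?case using alg_hom_one[OF k] alg_hom_one[OF al] AO.T_one by (simp add: Rp can'(2))
  next
    case (u i j Y)
    then show ?case using c2[of Y _ "\<kappa> (Hu i j)"] by (simp add: alg_hom_mult[OF k] bu HA.pt_mult)
  next
    case (v i j Y)
    then show ?case using c2[of Y _ "\<kappa> (Hv i j)"] by (simp add: alg_hom_mult[OF k] bv HA.pt_mult)
  next
    case (add X Y)
    then show ?case
      by (simp add: lin_hom_add[OF alg_hom_lin[OF k]] lin_hom_add[OF Rl] lin_hom_add[OF can'(1)] HA.pt_add_left)
  next
    case (scale c X)
    then show ?case
      by (simp add: lin_hom_smult[OF alg_hom_lin[OF k]] lin_hom_smult[OF Rl] lin_hom_smult[OF can'(1)] HA.pt_smult_left)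
  qed
  \<comment> \<open>second identity\<close>
  have bG: "bilin H A AAT (\<lambda>h c. R (c \<otimes>\<^sub>A d) (\<kappa> h \<otimes>\<^bsub>AOT\<^esub> V))" if "d \<in> carrier A" "V \<in> carrier AOT" for d V
  proof (rule bilinI)
    fix c assume "c \<in> carrier A"
    then show "(\<lambda>h. R (c \<otimes>\<^sub>A d) (\<kappa> h \<otimes>\<^bsub>AOT\<^esub> V)) \<in> lin_hom H AAT"
      using that by (intro lin_hom_comp[OF lin_hom_comp[OF alg_hom_lin[OF k] lin_hom_mult_right] Rl] AO.T.kalgebra) simp_all
  next
    fix h assume "h \<in> carrier H"
    then show "(\<lambda>c. R (c \<otimes>\<^sub>A d) (\<kappa> h \<otimes>\<^bsub>AOT\<^esub> V)) \<in> lin_hom A AAT"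
      using that by (intro lin_hom_comp[OF lin_hom_mult_right R2] HA.B.kalgebra) simp_all
  qed
  define GV where "GV d V = tensor_lift AAT (\<lambda>h c. R (c \<otimes>\<^sub>A d) (\<kappa> h \<otimes>\<^bsub>AOT\<^esub> V))" for d V
  have GVl: "GV d V \<in> lin_hom HAT AAT" if "d \<in> carrier A" "V \<in> carrier AOT" for d V
    unfolding GV_def by (rule HA.tensor_lift(1)[OF AA.T.kalgebra bG[OF that]])
  have GVp: "GV d V (HA.pt h c) = R (c \<otimes>\<^sub>A d) (\<kappa> h \<otimes>\<^bsub>AOT\<^esub> V)"
    if "d \<in> carrier A" "V \<in> carrier AOT" "h \<in> carrier H" "c \<in> carrier A" for d V h c
    unfolding GV_def by (rule HA.tensor_lift(2)[OF AA.T.kalgebra bG[OF that(1,2)] that(3,4)])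
  define G where "G = GV \<one>\<^sub>A \<one>\<^bsub>AOT\<^esub>"
  have Gl: "G \<in> lin_hom HAT AAT" unfolding G_def by (rule GVl) simp_all
  have Gp: "G (HA.pt h c) = R c (\<kappa> h)" if "h \<in> carrier H" "c \<in> carrier A" for h c
    using that by (simp add: G_def GVp)
  have Gc [simp]: "G X \<in> carrier AAT" if "X \<in> carrier HAT" for X using lin_hom_closed[OF Gl that] .
  define La where "La a = tensor_map A A (\<lambda>t. a \<otimes>\<^sub>A t) (\<lambda>t. t)" for a
  note Lam = tensor_map[OF HA.B.kalgebra HA.B.kalgebra HA.B.kalgebra HA.B.kalgebra lin_hom_mult_left[OF HA.B.kalgebra] lin_hom_id(1), folded La_def]
  have g1: "GV d V (\<alpha> a) = La a (R d V)"
    if a: "a \<in> carrier A" "\<And>b. b \<in> carrier A \<Longrightarrow> G (\<alpha> a \<otimes>\<^bsub>HAT\<^esub> HA.pt \<one>\<^sub>H b) = AA.pt a b"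
      and d: "d \<in> carrier A" and V: "V \<in> carrier AOT" for a d V
    using V
  proof (induction rule: AO.tensor_induct)
    case (pure x y')
    then have y': "y' \<in> carrier A" and x: "x \<in> carrier A" by simp_all
    let ?M = "tensor_map A A (\<lambda>s. s \<otimes>\<^sub>A x) (\<lambda>t. y' \<otimes>\<^sub>A t)"
    note M = tensor_map[OF HA.B.kalgebra HA.B.kalgebra HA.B.kalgebra HA.B.kalgebra
        lin_hom_mult_right[OF HA.B.kalgebra x] lin_hom_mult_left[OF HA.B.kalgebra y']]
    have RM: "R c (W \<otimes>\<^bsub>AOT\<^esub> AO.pt x y') = ?M (R c W)" if c: "c \<in> carrier A" and W: "W \<in> carrier AOT" for c W
      using W
      by (induction rule: AO.tensor_induct)
        (use x y' c in \<open>simp_all add: AOm Rp M(2) HA.B.m_assoc AO.T.l_distr lin_hom_add[OF Rl] lin_hom_add[OF M(1)]\<close>)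
    have "GV d (AO.pt x y') Z = ?M (G (Z \<otimes>\<^bsub>HAT\<^esub> HA.pt \<one>\<^sub>H d))" if Z: "Z \<in> carrier HAT" for Z
      using Z
      by (induction rule: HA.tensor_induct)
        (use x y' d in \<open>simp_all add: GVp RM HA.pt_mult Gp lin_hom_add[OF GVl] HA.T.l_distr lin_hom_add[OF Gl] lin_hom_add[OF M(1)]\<close>)
    then have "GV d (AO.pt x y') (\<alpha> a) = ?M (AA.pt a d)" using a d by simp
    also have "\<dots> = La a (R d (AO.pt x y'))" using a d x y' by (simp add: M(2) Rp Lam(2))
    finally show ?case .
  next
    case (add V V')
    have "GV d (V \<oplus>\<^bsub>AOT\<^esub> V') Z = GV d V Z \<oplus>\<^bsub>AAT\<^esub> GV d V' Z" if Z: "Z \<in> carrier HAT" for Z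
      by (rule HA.lin_hom_tensor_eq[OF GVl lin_hom_sum[OF AA.T.kalgebra GVl GVl] _ Z])
        (use add d in \<open>simp_all add: GVp AO.T.r_distr lin_hom_add[OF Rl]\<close>)
    then show ?case using add a d by (simp add: lin_hom_add[OF Rl] lin_hom_add[OF Lam(1)])
  qed
  have g2: "G (\<alpha> a \<otimes>\<^bsub>HAT\<^esub> Z) = La a (G Z)"
    if a: "a \<in> carrier A" "\<And>b. b \<in> carrier A \<Longrightarrow> G (\<alpha> a \<otimes>\<^bsub>HAT\<^esub> HA.pt \<one>\<^sub>H b) = AA.pt a b"
      and Z: "Z \<in> carrier HAT" for a Z
    using Z
  proof (induction rule: HA.tensor_induct)
    case (pure h d)
    have "G (X \<otimes>\<^bsub>HAT\<^esub> HA.pt h d) = GV d (\<kappa> h) X" if X: "X \<in> carrier HAT" for X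
      using X
      by (induction rule: HA.tensor_induct)
        (use pure in \<open>simp_all add: HA.pt_mult Gp GVp alg_hom_mult[OF k] HA.T.l_distr lin_hom_add[OF Gl] lin_hom_add[OF GVl]\<close>)
    then show ?case using g1[OF a, of d "\<kappa> h"] pure a by (simp add: Gp)
  next
    case (add X Y)
    then show ?case using a by (simp add: HA.T.r_distr lin_hom_add[OF Gl] lin_hom_add[OF Lam(1)])
  qed
  have base2: "G (\<alpha> (g i j) \<otimes>\<^bsub>HAT\<^esub> HA.pt \<one>\<^sub>H b) = AA.pt (g i j) b"
    if ij: "i < m" "j < n" and b: "b \<in> carrier A"
      and g: "\<And>i a. i < m \<Longrightarrow> a < n \<Longrightarrow> g i a \<in> carrier A" "\<And>i j. i < m \<Longrightarrow> j < m \<Longrightarrow> Hg i j \<in> carrier H"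
        "\<And>i a. i < m \<Longrightarrow> a < n \<Longrightarrow> y a i \<in> carrier A"
        "\<And>i a. i < m \<Longrightarrow> a < n \<Longrightarrow> \<alpha> (g i a) = (\<Oplus>\<^bsub>HAT\<^esub>l\<in>{..<m}. HA.pt (Hg i l) (g l a))"
        "\<And>i j. i < m \<Longrightarrow> j < m \<Longrightarrow> \<kappa> (Hg i j) = (\<Oplus>\<^bsub>AOT\<^esub>a\<in>{..<n}. AO.pt (g i a) (y a j))"
        "\<And>a c. a < n \<Longrightarrow> c < n \<Longrightarrow> (\<Oplus>\<^sub>A i\<in>{..<m}. y a i \<otimes>\<^sub>A g i c) = (if a = c then \<one>\<^sub>A else \<zero>\<^sub>A)"
    for g Hg y i j b
  proof -
    note [simp] = g(1-3) b
    have "\<alpha> (g i j) \<otimes>\<^bsub>HAT\<^esub> HA.pt \<one>\<^sub>H b = (\<Oplus>\<^bsub>HAT\<^esub>l\<in>{..<m}. HA.pt (Hg i l) (g l j) \<otimes>\<^bsub>HAT\<^esub> HA.pt \<one>\<^sub>H b)"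
      unfolding g(4)[OF ij] using ij by (intro HA.T.finsum_ldistr) (simp_all add: Pi_iff)
    also have "\<dots> = (\<Oplus>\<^bsub>HAT\<^esub>l\<in>{..<m}. HA.pt (Hg i l) (g l j \<otimes>\<^sub>A b))"
      using ij by (intro HA.T.finsum_eqI) (simp_all add: HA.pt_mult)
    finally have "G (\<alpha> (g i j) \<otimes>\<^bsub>HAT\<^esub> HA.pt \<one>\<^sub>H b) = G (\<Oplus>\<^bsub>HAT\<^esub>l\<in>{..<m}. HA.pt (Hg i l) (g l j \<otimes>\<^sub>A b))" by (rule arg_cong)
    also have "\<dots> = (\<Oplus>\<^bsub>AAT\<^esub>l\<in>{..<m}. \<Oplus>\<^bsub>AAT\<^esub>a\<in>{..<n}. AA.pt (g i a) (y a l \<otimes>\<^sub>A (g l j \<otimes>\<^sub>A b)))"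
    proof (rule lin_hom_finsum_eq[OF HA.T.kalgebra AA.T.kalgebra Gl])
      fix l assume "l \<in> {..<m}"
      then have l: "l < m" by simp
      show "HA.pt (Hg i l) (g l j \<otimes>\<^sub>A b) \<in> carrier HAT" using l ij by simp
      have "G (HA.pt (Hg i l) (g l j \<otimes>\<^sub>A b)) = R (g l j \<otimes>\<^sub>A b) (\<Oplus>\<^bsub>AOT\<^esub>a\<in>{..<n}. AO.pt (g i a) (y a l))"
        using l ij by (simp add: Gp g(5))
      also have "\<dots> = (\<Oplus>\<^bsub>AAT\<^esub>a\<in>{..<n}. AA.pt (g i a) (y a l \<otimes>\<^sub>A (g l j \<otimes>\<^sub>A b)))"
        using l ij by (intro lin_hom_finsum_eq[OF AO.T.kalgebra AA.T.kalgebra Rl]) (simp_all add: Rp)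
      finally show "G (HA.pt (Hg i l) (g l j \<otimes>\<^sub>A b)) = (\<Oplus>\<^bsub>AAT\<^esub>a\<in>{..<n}. AA.pt (g i a) (y a l \<otimes>\<^sub>A (g l j \<otimes>\<^sub>A b)))" .
    qed
    also have "\<dots> = (\<Oplus>\<^bsub>AAT\<^esub>a\<in>{..<n}. \<Oplus>\<^bsub>AAT\<^esub>l\<in>{..<m}. AA.pt (g i a) (y a l \<otimes>\<^sub>A (g l j \<otimes>\<^sub>A b)))"
      using ij by (intro AA.T.finsum_swap) simp_all
    also have "\<dots> = (\<Oplus>\<^bsub>AAT\<^esub>a\<in>{..<n}. AA.pt (g i a) ((if a = j then \<one>\<^sub>A else \<zero>\<^sub>A) \<otimes>\<^sub>A b))"
    proof (intro AA.T.finsum_eqI)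
      fix a assume "a \<in> {..<n}"
      then have a: "a < n" by simp
      have "(\<Oplus>\<^bsub>AAT\<^esub>l\<in>{..<m}. AA.pt (g i a) (y a l \<otimes>\<^sub>A (g l j \<otimes>\<^sub>A b))) = AA.pt (g i a) (\<Oplus>\<^sub>A l\<in>{..<m}. y a l \<otimes>\<^sub>A (g l j \<otimes>\<^sub>A b))"
        using ij a by (intro AA.pt_finsum_right[symmetric]) simp_all
      also have "(\<Oplus>\<^sub>A l\<in>{..<m}. y a l \<otimes>\<^sub>A (g l j \<otimes>\<^sub>A b)) = (\<Oplus>\<^sub>A l\<in>{..<m}. y a l \<otimes>\<^sub>A g l j \<otimes>\<^sub>A b)"
        using ij a by (intro HA.B.finsum_eqI) (simp_all add: HA.B.m_assoc)
      also have "\<dots> = (\<Oplus>\<^sub>A l\<in>{..<m}. y a l \<otimes>\<^sub>A g l j) \<otimes>\<^sub>A b"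
        using ij a by (intro HA.B.finsum_ldistr[symmetric]) (simp_all add: Pi_iff)
      finally show "(\<Oplus>\<^bsub>AAT\<^esub>l\<in>{..<m}. AA.pt (g i a) (y a l \<otimes>\<^sub>A (g l j \<otimes>\<^sub>A b))) = AA.pt (g i a) ((if a = j then \<one>\<^sub>A else \<zero>\<^sub>A) \<otimes>\<^sub>A b)"
        using g(6)[OF a ij(2)] by simp
    qed (use ij in simp)
    also have "\<dots> = AA.pt (g i j) ((if j = j then \<one>\<^sub>A else \<zero>\<^sub>A) \<otimes>\<^sub>A b)"
      using ij by (intro AA.T.finsum_delta) (simp_all add: AA.pt_zero_right)
    finally show ?thesis by simp
  qed
  have bu2: "G (\<alpha> (u i j) \<otimes>\<^bsub>HAT\<^esub> HA.pt \<one>\<^sub>H b) = AA.pt (u i j) b" if "i < m" "j < n" "b \<in> carrier A" for i j b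
    by (rule base2[of i j b u Hu "\<lambda>a j. v j a"]) (use that coact_u rels(2) ku in \<open>simp_all add: \<alpha>_def\<close>)
  have bv2: "G (\<alpha> (v i j) \<otimes>\<^bsub>HAT\<^esub> HA.pt \<one>\<^sub>H b) = AA.pt (v i j) b" if "i < m" "j < n" "b \<in> carrier A" for i j b
    by (rule base2[of i j b v Hv w]) (use that coact_v rels(4) kv in \<open>simp_all add: \<alpha>_def\<close>)
  have Q: "\<forall>b\<in>carrier A. G (\<alpha> a \<otimes>\<^bsub>HAT\<^esub> HA.pt \<one>\<^sub>H b) = AA.pt a b" if "a \<in> carrier A" for a
    using that
  proof (induction rule: A_induct)
    case one
    then show ?case using alg_hom_one[OF k] alg_hom_one[OF al] AO.T_one by (simp add: Gp Rp)
  next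
    case (u i j Y)
    then show ?case using g2[OF _ bu2] by (simp add: alg_hom_mult[OF al] HA.T.m_assoc Lam(2))
  next
    case (v i j Y)
    then show ?case using g2[OF _ bv2] by (simp add: alg_hom_mult[OF al] HA.T.m_assoc Lam(2))
  next
    case (add X Y)
    then show ?case
      by (simp add: lin_hom_add[OF alg_hom_lin[OF al]] HA.T.l_distr lin_hom_add[OF Gl] AA.pt_add_left)
  next
    case (scale c X)
    then show ?case
      by (simp add: lin_hom_smult[OF alg_hom_lin[OF al]] HA.T.mult_smult_left lin_hom_smult[OF Gl] AA.pt_smult_left)
  qed
  show ?thesis
  proof (rule bij_betw_inverse_maps[where g = G])
    show "G (can X) = X" if "X \<in> carrier AAT" for X
      by (rule AA.lin_hom_tensor_eq[OF lin_hom_comp[OF can'(1) Gl] lin_hom_id(1) _ that]) (simp add: can'(2) Q)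
    show "can (G X) = X" if "X \<in> carrier HAT" for X
      by (rule HA.lin_hom_tensor_eq[OF lin_hom_comp[OF Gl can'(1)] lin_hom_id(1) _ that]) (simp add: Gp P)
  qed simp_all
qed

theorem galois_object_H:
  assumes "\<one>\<^sub>A \<noteq> \<zero>\<^sub>A"
  shows "galois_object (H_hopf E) (H_comod_alg E F)"
proof -
  note sh = same_alg_H(1)[of E] and sa = same_alg_H(2)[of E F]
  have "carrier A \<noteq> {\<zero>\<^sub>A }" using assms HA.B.one_closed by auto
  then show ?thesis
    using hopf_algebra_H[OF E] left_comodule_algebra_H can_bij
    by (simp add: galois_object_def same_alg_tensor(1)[OF sh sa] same_alg_tensor(1)[OF sa sa])
qed

end

section \<open>Linear functionals and slices of tensors\<close>

text \<open>Choice enters here: on the free vector space on \<open>A\<close>, the kernel of evaluation does not contain the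
  basis vector of \<open>x\<close>, so a functional can be prescribed to vanish on the kernel and to be \<open>1\<close> there.\<close>

lemma ex_functional:
  fixes A :: "('k::field, 'a, 'z) module_scheme"
  assumes A: "kalgebra A" and x: "x \<in> carrier A" "x \<noteq> \<zero>\<^sub>A"
  shows "\<exists>\<xi>\<in>lin_hom A base_alg. \<xi> x = 1"
proof -
  interpret A: kalg A by (simp add: kalg_def A)
  interpret P: kalg "monoid_alg A :: ('k, 'a \<Rightarrow> 'k) module"
    by (simp add: kalg_def kalgebra_monoid_alg A.monoid_axioms)
  interpret V: vector_space "\<lambda>(c :: 'k) (f :: 'a \<Rightarrow> 'k) t. c * f t"
    by unfold_locales (auto simp: fun_eq_iff algebra_simps)
  interpret K: vector_space "(*) :: 'k \<Rightarrow> 'k \<Rightarrow> 'k" by unfold_locales (auto simp: algebra_simps)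
  interpret VK: vector_space_pair "\<lambda>(c :: 'k) (f :: 'a \<Rightarrow> 'k) t. c * f t" "(*) :: 'k \<Rightarrow> 'k \<Rightarrow> 'k" ..
  define L where "L = (lin_ext A (\<lambda>a. a) :: ('a \<Rightarrow> 'k) \<Rightarrow> 'a)"
  let ?P = "monoid_alg A :: ('k, 'a \<Rightarrow> 'k) module"
  have L: "L \<in> lin_hom ?P A" unfolding L_def by (rule lin_ext_lin_hom[OF A])
  have Ld: "L (delta a) = a" if "a \<in> carrier A" for a unfolding L_def using lin_ext_delta[where b = "\<lambda>a. a", OF A, of a] that by simp
  define W where "W = {f \<in> carrier ?P. L f = \<zero>\<^sub>A }"
  have ops: "f \<oplus>\<^bsub>?P\<^esub> g = f + g" "c \<odot>\<^bsub>?P\<^esub> f = (\<lambda>t. c * f t)" "\<zero>\<^bsub>?P\<^esub> = 0" for f g c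
    by (auto simp: monoid_alg_simps plus_fun_def zero_fun_def)
  have W: "V.subspace W"
  proof (rule V.subspaceI)
    show "0 \<in> W" using lin_hom_zero[OF P.kalgebra A L] P.zero_closed by (simp add: W_def ops(3)[symmetric])
    fix f g c assume f: "f \<in> W"
    show "(\<lambda>t. c * f t) \<in> W"
      using f lin_hom_smult[OF L, of f c] P.smult_closed[of f c] by (simp add: W_def ops(2))
    assume g: "g \<in> W"
    show "f + g \<in> W"
      using f g lin_hom_add[OF L, of f g] P.add.m_closed[of f g] by (simp add: W_def ops(1))
  qed
  obtain B where B: "B \<subseteq> W" "V.independent B" "W \<subseteq> V.span B" by (rule V.maximal_independent_subset)
  have sB: "V.span B \<subseteq> W" using V.span_minimal[OF B(1) W] .
  have "delta x \<notin> V.span B" using sB x Ld by (auto simp: W_def)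
  then have "V.independent (insert (delta x) B)" using B(2) by (rule V.independent_insertI)
  then obtain g where g: "Vector_Spaces.linear (\<lambda>(c :: 'k) (f :: 'a \<Rightarrow> 'k) t. c * f t) ((*) :: 'k \<Rightarrow> 'k \<Rightarrow> 'k) g" "\<forall>b\<in>insert (delta x) B. g b = (if b = delta x then 1 else 0)"
    using VK.linear_independent_extend[of "insert (delta x) B" "\<lambda>b. if b = delta x then 1 else 0"] by blast
  have nB: "delta x \<notin> B" using \<open>delta x \<notin> V.span B\<close> V.span_base by blast
  have "g f = 0" if "f \<in> V.span B" for f
    by (rule VK.linear_eq_0_on_span[OF g(1) _ that]) (use g(2) nB in auto)
  then have gW: "g f = 0" if "f \<in> W" for f using B(3) that by blast
  have gm: "g (f - h) = g f - g h" "g (f + h) = g f + g h" "g (\<lambda>t. c * f t) = c * g f" for f h c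
    using VK.linear_diff[OF g(1)] VK.linear_add[OF g(1)] VK.linear_scale[OF g(1)] by auto
  have eqI: "g f = g h" if "f \<in> carrier ?P" "h \<in> carrier ?P" "L f = L h" for f h
  proof -
    have e: "f \<ominus>\<^bsub>?P\<^esub> h = f - h"
    proof -
      have "\<ominus>\<^bsub>?P\<^esub> h = (\<lambda>t. - 1 * h t)" using P.smult_uminus[OF that(2)] by (simp add: ops(2))
      then show ?thesis by (simp add: a_minus_def ops(1)) (simp add: fun_eq_iff)
    qed
    have "f \<ominus>\<^bsub>?P\<^esub> h \<in> W"
      using that lin_hom_minus[OF P.kalgebra A L that(1,2)] lin_hom_closed[OF L that(2)] A.minus_eq_zero_iff P.minus_closed[OF that(1,2)]
      by (simp add: W_def)
    then have "g (f - h) = 0" using gW e by simp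
    then show ?thesis by (simp add: gm)
  qed
  have "(\<lambda>a. g (delta a)) \<in> lin_hom A base_alg"
  proof (rule lin_homI)
    fix a b c assume a: "a \<in> carrier A"
    show "g (delta a) \<in> carrier base_alg" by (simp add: base_alg_def)
    have "g (delta (c \<odot>\<^sub>A a)) = g (c \<odot>\<^bsub>?P\<^esub> delta a)"
      using a by (intro eqI P.smult_closed delta_closed) (simp_all add: Ld lin_hom_smult[OF L])
    then show "g (delta (c \<odot>\<^sub>A a)) = c \<odot>\<^bsub>base_alg\<^esub> g (delta a)" by (simp add: ops gm base_alg_def)
    assume b: "b \<in> carrier A"
    have "g (delta (a \<oplus>\<^sub>A b)) = g (delta a \<oplus>\<^bsub>?P\<^esub> delta b)"
      using a b by (intro eqI P.add.m_closed delta_closed) (simp_all add: Ld lin_hom_add[OF L])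
    then show "g (delta (a \<oplus>\<^sub>A b)) = g (delta a) \<oplus>\<^bsub>base_alg\<^esub> g (delta b)" by (simp add: ops gm base_alg_def)
  qed
  moreover have "g (delta x) = 1" using g(2) by simp
  ultimately show ?thesis by (intro bexI[of _ "\<lambda>a. g (delta a)"])
qed

lemma base_alg_simps [simp]: "x \<in> carrier base_alg" "x \<oplus>\<^bsub>base_alg\<^esub> y = x + y" "c \<odot>\<^bsub>base_alg\<^esub> y = c * y"
  "x \<otimes>\<^bsub>base_alg\<^esub> y = x * y" "\<one>\<^bsub>base_alg\<^esub> = 1" "\<zero>\<^bsub>base_alg\<^esub> = 0"
  by (simp_all add: base_alg_def)

text \<open>A finite set lies in the span of a finite basis, with dual functionals defined on all of \<open>A\<close>. A new
  vector outside the span is corrected by its projection, and a functional that is \<open>1\<close> there by the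
  functionals already present.\<close>

lemma finite_dual_system:
  fixes A :: "('k::field, 'a, 'z) module_scheme"
  assumes A: "kalgebra A" and Y: "finite Y" "Y \<subseteq> carrier A"
  shows "\<exists>N e \<xi>. (\<forall>s<N. e s \<in> carrier A \<and> \<xi> s \<in> lin_hom A base_alg) \<and>
    (\<forall>s<N. \<forall>t<N. \<xi> s (e t) = (if s = t then 1 else 0)) \<and>
    (\<forall>y\<in>Y. y = (\<Oplus>\<^sub>A s\<in>{..<N::nat}. \<xi> s y \<odot>\<^sub>A e s))"
  using Y
proof (induction Y rule: finite_induct)
  case empty
  show ?case by (rule exI[of _ 0]) simp
next
  case (insert y Y)
  interpret A: kalg A by (simp add: kalg_def A)
  have b: "kalgebra (base_alg :: ('k, 'k) module)" by (rule kalgebra_base_alg)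
  have "Y \<subseteq> carrier A" using insert.prems by simp
  from insert.IH[OF this] obtain N :: nat and e :: "nat \<Rightarrow> 'a" and \<xi> :: "nat \<Rightarrow> 'a \<Rightarrow> 'k"
    where IH: "\<forall>s<N. e s \<in> carrier A \<and> \<xi> s \<in> lin_hom A base_alg"
      "\<forall>s<N. \<forall>t<N. \<xi> s (e t) = (if s = t then 1 else 0)"
      "\<forall>y\<in>Y. y = (\<Oplus>\<^sub>A s\<in>{..<N}. \<xi> s y \<odot>\<^sub>A e s)" by (elim exE conjE)
  then have h: "\<And>s. s < N \<Longrightarrow> e s \<in> carrier A" "\<And>s. s < N \<Longrightarrow> \<xi> s \<in> lin_hom A base_alg"
      "\<And>s t. s < N \<Longrightarrow> t < N \<Longrightarrow> \<xi> s (e t) = (if s = t then 1 else 0)"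
      "\<And>y. y \<in> Y \<Longrightarrow> y = (\<Oplus>\<^sub>A s\<in>{..<N}. \<xi> s y \<odot>\<^sub>A e s)" by blast+
  have y: "y \<in> carrier A" using insert by simp
  define p where "p = (\<Oplus>\<^sub>A s\<in>{..<N}. \<xi> s y \<odot>\<^sub>A e s)"
  have p: "p \<in> carrier A" unfolding p_def using h(1) by simp
  have lsum: "f (\<Oplus>\<^sub>A s\<in>{..<N}. c s \<odot>\<^sub>A e s) = (\<Sum>s<N. c s * f (e s))" if f: "f \<in> lin_hom A base_alg" for f c
    using lin_hom_finsum_eq[OF A b f, of "{..<N}" "\<lambda>s. c s \<odot>\<^sub>A e s" "\<lambda>s. c s * f (e s)"] h(1)
    by (simp add: lin_hom_smult[OF f] finsum_base_alg)
  have lp: "\<xi> t p = \<xi> t y" if "t < N" for t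
    using lsum[OF h(2)[OF that], of "\<lambda>s. \<xi> s y"] that h(3)
    by (simp add: p_def if_distrib[of "\<lambda>x. _ * x"] cong: if_cong)
  show ?case
  proof (cases "y = p")
    case True
    then have "y = (\<Oplus>\<^sub>A s\<in>{..<N}. \<xi> s y \<odot>\<^sub>A e s)" unfolding p_def .
    then have "\<forall>y\<in>insert y Y. y = (\<Oplus>\<^sub>A s\<in>{..<N}. \<xi> s y \<odot>\<^sub>A e s)" using IH(3) by blast
    then show ?thesis using IH(1,2) by (intro exI[of _ N] exI[of _ e] exI[of _ \<xi>] conjI)
  next
    case False
    define z where "z = y \<ominus>\<^sub>A p"
    have z: "z \<in> carrier A" "z \<noteq> \<zero>\<^sub>A" using y p False A.minus_eq_zero_iff by (auto simp: z_def)
    obtain \<mu> where mu: "\<mu> \<in> lin_hom A base_alg" "\<mu> z = 1" using ex_functional[OF A z] by blast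
    interpret K: kalg "base_alg :: ('k, 'k) module" by (simp add: kalg_def b)
    have lz: "\<xi> t z = 0" if "t < N" for t
      using lin_hom_minus[OF A b h(2)[OF that] y p] lp[OF that]
        K.minus_eq_zero_iff[of "\<xi> t y" "\<xi> t p"] by (simp add: z_def)
    define \<nu> where "\<nu> x = \<mu> x - (\<Sum>s<N. \<mu> (e s) * \<xi> s x)" for x
    have nu: "\<nu> \<in> lin_hom A base_alg"
    proof (rule lin_homI)
      fix x x' c assume x: "x \<in> carrier A"
      show "\<nu> (c \<odot>\<^sub>A x) = c \<odot>\<^bsub>base_alg\<^esub> \<nu> x"
        using x by (simp add: \<nu>_def lin_hom_smult[OF mu(1)] lin_hom_smult[OF h(2)] right_diff_distrib sum_distrib_left mult_ac)
      assume "x' \<in> carrier A"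
      then show "\<nu> (x \<oplus>\<^sub>A x') = \<nu> x \<oplus>\<^bsub>base_alg\<^esub> \<nu> x'"
        using x by (simp add: \<nu>_def lin_hom_add[OF mu(1)] lin_hom_add[OF h(2)] distrib_left sum.distrib)
    qed simp
    have nue: "\<nu> (e t) = 0" if "t < N" for t
      using that h(3) by (simp add: \<nu>_def if_distrib[of "\<lambda>x. _ * x"] cong: if_cong)
    have nuz: "\<nu> z = 1" using lz by (simp add: \<nu>_def mu)
    have nuY: "\<nu> (\<Oplus>\<^sub>A s\<in>{..<N}. c s \<odot>\<^sub>A e s) = 0" for c using lsum[OF nu] nue by simp
    have yz: "y = z \<oplus>\<^sub>A p" using y p by (simp add: z_def a_minus_def A.a_assoc A.l_neg)
    have "\<nu> y = \<nu> (z \<oplus>\<^sub>A p)" using yz by simp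
    also have "\<dots> = \<nu> z + \<nu> p" using z(1) p by (simp add: lin_hom_add[OF nu])
    finally have nuy: "\<nu> y = 1" using nuz nuY[of "\<lambda>s. \<xi> s y"] unfolding p_def by simp
    define e' where "e' = e(N := z)"
    define \<xi>' where "\<xi>' = \<xi>(N := \<nu>)"
    have sum': "(\<Oplus>\<^sub>A s\<in>{..<Suc N}. \<xi>' s x \<odot>\<^sub>A e' s) = \<nu> x \<odot>\<^sub>A z \<oplus>\<^sub>A (\<Oplus>\<^sub>A s\<in>{..<N}. \<xi> s x \<odot>\<^sub>A e s)" for x
    proof -
      have "(\<Oplus>\<^sub>A s\<in>{..<N}. \<xi>' s x \<odot>\<^sub>A e' s) = (\<Oplus>\<^sub>A s\<in>{..<N}. \<xi> s x \<odot>\<^sub>A e s)"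
        using h(1) by (intro A.finsum_eqI) (auto simp: e'_def \<xi>'_def)
      then show ?thesis using h(1) z unfolding lessThan_Suc
        by (subst A.finsum_insert) (auto simp: e'_def \<xi>'_def)
    qed
    show ?thesis
    proof (intro exI conjI)
      show "\<forall>s<Suc N. e' s \<in> carrier A \<and> \<xi>' s \<in> lin_hom A base_alg"
        using h(1,2) z nu by (auto simp: e'_def \<xi>'_def less_Suc_eq)
      show "\<forall>s<Suc N. \<forall>t<Suc N. \<xi>' s (e' t) = (if s = t then 1 else 0)"
        using h(3) nue nuz lz by (auto simp: e'_def \<xi>'_def less_Suc_eq)
      show "\<forall>x\<in>insert y Y. x = (\<Oplus>\<^sub>A s\<in>{..<Suc N}. \<xi>' s x \<odot>\<^sub>A e' s)"
      proof
        fix x assume "x \<in> insert y Y"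
        then consider "x = y" | "x \<in> Y" by auto
        then show "x = (\<Oplus>\<^sub>A s\<in>{..<Suc N}. \<xi>' s x \<odot>\<^sub>A e' s)"
        proof cases
          case 1
          have "1 \<odot>\<^sub>A z = z" using z(1) by simp
          then show ?thesis unfolding 1 sum' nuy by (simp only:) (rule yz[unfolded p_def])
        next
          case 2
          have x: "(\<Oplus>\<^sub>A s\<in>{..<N}. \<xi> s x \<odot>\<^sub>A e s) = x" using h(4)[OF 2] by (rule sym)
          have n: "\<nu> x = 0" using nuY[of "\<lambda>s. \<xi> s x"] unfolding x .
          have "x \<in> carrier A" using 2 insert.prems by blast
          then show ?thesis unfolding sum' n x using z(1) by simp
        qed
      qed
    qed
  qed
qed

context two_algs
begin

definition slice :: "('b \<Rightarrow> 'k) \<Rightarrow> ('a, 'b, 'k) tens \<Rightarrow> 'a" where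
  "slice \<xi> = tensor_lift A (\<lambda>x y. \<xi> y \<odot>\<^sub>A x)"

lemma slice:
  assumes l: "\<xi> \<in> lin_hom B base_alg"
  shows "slice \<xi> \<in> lin_hom T A" "\<And>x y. x \<in> carrier A \<Longrightarrow> y \<in> carrier B \<Longrightarrow> slice \<xi> (pt x y) = \<xi> y \<odot>\<^sub>A x"
proof -
  have b: "bilin A B A (\<lambda>x y. \<xi> y \<odot>\<^sub>A x)"
    by (intro bilinI lin_homI)
      (auto simp: lin_hom_add[OF l] lin_hom_smult[OF l] A.smult_add_left A.smult_add_right A.smult_smult mult.commute)
  show "slice \<xi> \<in> lin_hom T A" "\<And>x y. x \<in> carrier A \<Longrightarrow> y \<in> carrier B \<Longrightarrow> slice \<xi> (pt x y) = \<xi> y \<odot>\<^sub>A x"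
    unfolding slice_def by (rule tensor_lift(1)[OF A.kalgebra b], rule tensor_lift(2)[OF A.kalgebra b])
qed

lemma pt_one_inj:
  assumes "\<one>\<^sub>B \<noteq> \<zero>\<^sub>B" "x \<in> carrier A" "y \<in> carrier A" "pt x \<one>\<^sub>B = pt y \<one>\<^sub>B"
  shows "x = y"
proof -
  obtain \<xi> where l: "\<xi> \<in> lin_hom B base_alg" "\<xi> \<one>\<^sub>B = 1" using ex_functional[OF B.kalgebra B.one_closed assms(1)] by blast
  have "slice \<xi> (pt z \<one>\<^sub>B) = z" if "z \<in> carrier A" for z using that l(2) by (simp add: slice(2)[OF l(1)])
  then show ?thesis using assms by metis
qed

text \<open>Expanding the second legs in a common finite basis: each tensor is recovered from its slices by the
  dual functionals.\<close>

lemma tensor_expansion: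
  assumes "finite I" "\<And>i. i \<in> I \<Longrightarrow> Z i \<in> carrier T"
  shows "\<exists>N e \<xi>. (\<forall>s<N. e s \<in> carrier B \<and> \<xi> s \<in> lin_hom B base_alg) \<and>
    (\<forall>i\<in>I. Z i = (\<Oplus>\<^sub>T s\<in>{..<N::nat}. pt (slice (\<xi> s) (Z i)) (e s)))"
proof -
  define good where "good N e \<xi> y \<longleftrightarrow> y = (\<Oplus>\<^sub>B s\<in>{..<N::nat}. \<xi> s y \<odot>\<^sub>B e s)" for N e y and \<xi> :: "nat \<Rightarrow> 'b \<Rightarrow> 'k"
  have *: "\<exists>Y. finite Y \<and> Y \<subseteq> carrier B \<and> (\<forall>N e \<xi>. (\<forall>s<N. e s \<in> carrier B \<and> \<xi> s \<in> lin_hom B base_alg) \<longrightarrow>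
      (\<forall>y\<in>Y. good N e \<xi> y) \<longrightarrow> X = (\<Oplus>\<^sub>T s\<in>{..<N}. pt (slice (\<xi> s) X) (e s)))" if "X \<in> carrier T" for X
    using that
  proof (induction rule: tensor_induct)
    case (pure a b)
    show ?case
    proof (intro exI[of _ "{b}"] conjI allI impI)
      fix N e and \<xi> :: "nat \<Rightarrow> 'b \<Rightarrow> 'k" assume h: "\<forall>s<N. e s \<in> carrier B \<and> \<xi> s \<in> lin_hom B base_alg" and "\<forall>y\<in>{b}. good N e \<xi> y"
      then have "pt a b = pt a (\<Oplus>\<^sub>B s\<in>{..<N}. \<xi> s b \<odot>\<^sub>B e s)" by (simp add: good_def)
      also have "\<dots> = (\<Oplus>\<^sub>T s\<in>{..<N}. pt a (\<xi> s b \<odot>\<^sub>B e s))" using pure h by (intro pt_finsum_right) auto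
      also have "\<dots> = (\<Oplus>\<^sub>T s\<in>{..<N}. pt (slice (\<xi> s) (pt a b)) (e s))"
        using pure h by (intro T.finsum_eqI) (simp_all add: slice pt_smult_left pt_smult_right)
      finally show "pt a b = (\<Oplus>\<^sub>T s\<in>{..<N}. pt (slice (\<xi> s) (pt a b)) (e s))" .
    qed (use pure in auto)
  next
    case (add X X')
    from add obtain Y Y' where Y: "finite Y" "Y \<subseteq> carrier B" "finite Y'" "Y' \<subseteq> carrier B"
      and e: "\<And>N e \<xi>. (\<forall>s<N. e s \<in> carrier B \<and> \<xi> s \<in> lin_hom B base_alg) \<Longrightarrow>
        (\<forall>y\<in>Y. good N e \<xi> y) \<Longrightarrow> X = (\<Oplus>\<^sub>T s\<in>{..<N}. pt (slice (\<xi> s) X) (e s))"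
      and e': "\<And>N e \<xi>. (\<forall>s<N. e s \<in> carrier B \<and> \<xi> s \<in> lin_hom B base_alg) \<Longrightarrow>
        (\<forall>y\<in>Y'. good N e \<xi> y) \<Longrightarrow> X' = (\<Oplus>\<^sub>T s\<in>{..<N}. pt (slice (\<xi> s) X') (e s))" by blast
    show ?case
    proof (intro exI[of _ "Y \<union> Y'"] conjI allI impI)
      fix N e and \<xi> :: "nat \<Rightarrow> 'b \<Rightarrow> 'k" assume h: "\<forall>s<N. e s \<in> carrier B \<and> \<xi> s \<in> lin_hom B base_alg" and g: "\<forall>y\<in>Y \<union> Y'. good N e \<xi> y"
      have "X \<oplus>\<^sub>T X' = (\<Oplus>\<^sub>T s\<in>{..<N}. pt (slice (\<xi> s) X) (e s)) \<oplus>\<^sub>T (\<Oplus>\<^sub>T s\<in>{..<N}. pt (slice (\<xi> s) X') (e s))"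
        using e[OF h] e'[OF h] g by auto
      also have "\<dots> = (\<Oplus>\<^sub>T s\<in>{..<N}. pt (slice (\<xi> s) X) (e s) \<oplus>\<^sub>T pt (slice (\<xi> s) X') (e s))"
        using h add by (intro T.finsum_addf[symmetric]) (auto intro!: pt_closed lin_hom_closed[OF slice(1)])
      also have "\<dots> = (\<Oplus>\<^sub>T s\<in>{..<N}. pt (slice (\<xi> s) (X \<oplus>\<^sub>T X')) (e s))"
        using h add by (intro T.finsum_eqI) (simp_all add: lin_hom_add[OF slice(1)] pt_add_left lin_hom_closed[OF slice(1)])
      finally show "X \<oplus>\<^sub>T X' = (\<Oplus>\<^sub>T s\<in>{..<N}. pt (slice (\<xi> s) (X \<oplus>\<^sub>T X')) (e s))" .
    qed (use Y in auto)
  qed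
  define Q where "Q i Y \<longleftrightarrow> finite Y \<and> Y \<subseteq> carrier B \<and> (\<forall>N e \<xi>. (\<forall>s<N. e s \<in> carrier B \<and> \<xi> s \<in> lin_hom B base_alg) \<longrightarrow>
      (\<forall>y\<in>Y. good N e \<xi> y) \<longrightarrow> Z i = (\<Oplus>\<^sub>T s\<in>{..<N}. pt (slice (\<xi> s) (Z i)) (e s)))" for i Y
  have "\<forall>i\<in>I. \<exists>Y. Q i Y" using *[OF assms(2)] by (simp add: Q_def)
  then obtain Y where Q: "\<forall>i\<in>I. Q i (Y i)" by (rule bchoice[THEN exE])
  have "finite (\<Union>i\<in>I. Y i)" "(\<Union>i\<in>I. Y i) \<subseteq> carrier B" using assms(1) Q by (auto simp: Q_def)
  from finite_dual_system[OF B.kalgebra this] obtain N e \<xi> where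
    1: "\<forall>s<N. e s \<in> carrier B \<and> \<xi> s \<in> lin_hom B base_alg" and 2: "\<forall>y\<in>(\<Union>i\<in>I. Y i). good N e \<xi> y"
    unfolding good_def by auto
  have "Z i = (\<Oplus>\<^sub>T s\<in>{..<N}. pt (slice (\<xi> s) (Z i)) (e s))" if "i \<in> I" for i
  proof -
    have "\<forall>y\<in>Y i. good N e \<xi> y" using 2 that by blast
    then show ?thesis using Q that 1 unfolding Q_def by blast
  qed
  then show ?thesis using 1 by blast
qed

end

section \<open>Galois objects\<close>

locale galois =
  fixes H :: "('k::field, 'h, 'y) hopf_scheme" and A :: "('k, 'a, 'h, 'z) comod_alg_scheme"
  assumes gal: "galois_object H A"
begin

lemma kH: "kalgebra H" and kA: "kalgebra A"
  and comult_hom: "comult H \<in> alg_hom H (tensor H H)"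
  and counit_hom: "counit H \<in> alg_hom H base_alg"
  and coaction_hom: "coaction A \<in> alg_hom A (tensor H A)"
  using gal by (simp_all add: galois_object_def hopf_algebra_def left_comodule_algebra_def)

sublocale HA: two_algs H A by (rule two_algsI[OF kH kA])
sublocale AA: two_algs A A by (rule two_algsI[OF kA kA])
sublocale HH: two_algs H H by (rule two_algsI[OF kH kH])

abbreviation "HAT \<equiv> tensor H A"
abbreviation "AAT \<equiv> tensor A A"
abbreviation "\<alpha> \<equiv> coaction A"
abbreviation "can \<equiv> galois_map H A"

lemma coassoc: "x \<in> carrier A \<Longrightarrow>
    tensor_assoc H H A (tensor_map (tensor H H) A (comult H) id (\<alpha> x)) = tensor_map H HAT id \<alpha> (\<alpha> x)"
  and counit_law: "x \<in> carrier A \<Longrightarrow> tensor_lift A (\<lambda>h a. counit H h \<odot>\<^sub>A a) (\<alpha> x) = x"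
  and nontrivial: "carrier A \<noteq> {\<zero>\<^sub>A }"
  and can_bij: "bij_betw can (carrier AAT) (carrier HAT)"
  using gal by (simp_all add: galois_object_def left_comodule_algebra_def)

lemma one_not_zero: "\<one>\<^sub>A \<noteq> \<zero>\<^sub>A"
  using nontrivial HA.B.one_zeroD by auto

lemma scalar_inj: "c \<odot>\<^sub>A \<one>\<^sub>A = d \<odot>\<^sub>A \<one>\<^sub>A \<Longrightarrow> c = d"
proof -
  obtain \<xi> where "\<xi> \<in> lin_hom A base_alg" "\<xi> \<one>\<^sub>A = 1" using ex_functional[OF kA HA.B.one_closed one_not_zero] by blast
  then show "c \<odot>\<^sub>A \<one>\<^sub>A = d \<odot>\<^sub>A \<one>\<^sub>A \<Longrightarrow> c = d" using lin_hom_smult[of \<xi> A base_alg "\<one>\<^sub>A"] by (metis HA.B.one_closed base_alg_simps(3) mult.right_neutral)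
qed

lemma coaction_closed [simp]: "x \<in> carrier A \<Longrightarrow> \<alpha> x \<in> carrier HAT"
  by (rule alg_hom_closed[OF coaction_hom])

lemmas can = galois_map[OF kH kA alg_hom_lin[OF coaction_hom]]

lemma can_closed [simp]: "X \<in> carrier AAT \<Longrightarrow> can X \<in> carrier HAT" by (rule lin_hom_closed[OF can(1)])

definition caninv where "caninv = inv_into (carrier AAT) can"

lemma caninv: "caninv \<in> lin_hom HAT AAT"
  unfolding caninv_def by (rule lin_hom_inv_into[OF AA.T.kalgebra HA.T.kalgebra can(1) can_bij])

lemma caninv_closed [simp]: "X \<in> carrier HAT \<Longrightarrow> caninv X \<in> carrier AAT" by (rule lin_hom_closed[OF caninv])

lemma caninv_can [simp]: "X \<in> carrier AAT \<Longrightarrow> caninv (can X) = X"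
  unfolding caninv_def using can_bij by (simp add: bij_betw_def inv_into_f_f)

lemma can_caninv [simp]: "X \<in> carrier HAT \<Longrightarrow> can (caninv X) = X"
  unfolding caninv_def using can_bij by (simp add: bij_betw_def f_inv_into_f)

lemma can_inj: "can X = can Y \<Longrightarrow> X \<in> carrier AAT \<Longrightarrow> Y \<in> carrier AAT \<Longrightarrow> X = Y"
  using can_bij by (auto simp: bij_betw_def dest: inj_onD)

lemma caninv_eqI: "X \<in> carrier AAT \<Longrightarrow> can X = Y \<Longrightarrow> caninv Y = X" by auto

text \<open>The translation map \<open>\<kappa>\<close>, written \<open>\<kappa>(h) = h\<^sup>[\<^sup>1\<^sup>] \<otimes> h\<^sup>[\<^sup>2\<^sup>]\<close> in the usual notation.\<close>

definition \<kappa> where "\<kappa> h = caninv (HA.pt h \<one>\<^sub>A)"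

lemma \<kappa>_closed [simp]: "h \<in> carrier H \<Longrightarrow> \<kappa> h \<in> carrier AAT" by (simp add: \<kappa>_def)

lemma can_\<kappa>: "h \<in> carrier H \<Longrightarrow> can (\<kappa> h) = HA.pt h \<one>\<^sub>A" by (simp add: \<kappa>_def)

definition \<rho> where "\<rho> b = tensor_map A A (\<lambda>x. x) (\<lambda>t. t \<otimes>\<^sub>A b)"

lemma \<rho>: "b \<in> carrier A \<Longrightarrow> \<rho> b \<in> lin_hom AAT AAT"
  "b \<in> carrier A \<Longrightarrow> x \<in> carrier A \<Longrightarrow> y \<in> carrier A \<Longrightarrow> \<rho> b (AA.pt x y) = AA.pt x (y \<otimes>\<^sub>A b)"
  unfolding \<rho>_def using tensor_map[OF kA kA kA kA lin_hom_id(1) lin_hom_mult_right[OF kA]] by auto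

lemma can_\<rho>: "b \<in> carrier A \<Longrightarrow> Z \<in> carrier AAT \<Longrightarrow> can (\<rho> b Z) = can Z \<otimes>\<^bsub>HAT\<^esub> HA.pt \<one>\<^sub>H b"
proof -
  assume b: "b \<in> carrier A" and Z: "Z \<in> carrier AAT"
  show ?thesis using Z
    by (induction rule: AA.tensor_induct)
      (use b in \<open>simp_all add: \<rho>(2) can(2) HA.T.m_assoc HA.pt_mult lin_hom_add[OF \<rho>(1)] lin_hom_add[OF can(1)]
        HA.T.l_distr lin_hom_closed[OF \<rho>(1)]\<close>)
qed

lemma caninv_pt: "h \<in> carrier H \<Longrightarrow> b \<in> carrier A \<Longrightarrow> caninv (HA.pt h b) = \<rho> b (\<kappa> h)"
  by (rule caninv_eqI) (simp_all add: can_\<rho> can_\<kappa> HA.pt_mult lin_hom_closed[OF \<rho>(1)])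

lemma caninv_coaction: "x \<in> carrier A \<Longrightarrow> caninv (\<alpha> x) = AA.pt x \<one>\<^sub>A"
  by (rule caninv_eqI) (simp_all add: can(2) HA.T_one[symmetric])

text \<open>For coinvariant \<open>a\<close> the tensors \<open>a \<otimes> 1\<close> and \<open>1 \<otimes> a\<close> have the same image under the Galois map.\<close>

lemma coinvariant_scalar:
  assumes a: "a \<in> carrier A" "\<alpha> a = HA.pt \<one>\<^sub>H a"
  shows "\<exists>c. a = c \<odot>\<^sub>A \<one>\<^sub>A"
proof -
  have "can (AA.pt a \<one>\<^sub>A) = can (AA.pt \<one>\<^sub>A a)"
    using a by (simp add: can(2) alg_hom_one[OF coaction_hom] HA.T_one HA.pt_mult)
  then have e: "AA.pt a \<one>\<^sub>A = AA.pt \<one>\<^sub>A a"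
    by (rule can_inj) (use a(1) in simp_all)
  obtain \<xi> where l: "\<xi> \<in> lin_hom A base_alg" "\<xi> \<one>\<^sub>A = 1" using ex_functional[OF kA HA.B.one_closed one_not_zero] by blast
  have "a = AA.slice \<xi> (AA.pt a \<one>\<^sub>A)" using a l(2) by (simp add: AA.slice(2)[OF l(1)])
  also have "\<dots> = \<xi> a \<odot>\<^sub>A \<one>\<^sub>A" unfolding e using a(1) by (simp add: AA.slice(2)[OF l(1)])
  finally have "a = \<xi> a \<odot>\<^sub>A \<one>\<^sub>A" .
  then show ?thesis by blast
qed

lemma counit_lift:
  shows "tensor_lift A (\<lambda>h a. counit H h \<odot>\<^sub>A a) \<in> alg_hom HAT A"
    and "\<And>h a. h \<in> carrier H \<Longrightarrow> a \<in> carrier A \<Longrightarrow> tensor_lift A (\<lambda>h a. counit H h \<odot>\<^sub>A a) (HA.pt h a) = counit H h \<odot>\<^sub>A a"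
proof -
  note e = counit_hom
  have b: "bilin H A A (\<lambda>h a. counit H h \<odot>\<^sub>A a)"
    by (intro bilinI lin_homI)
      (auto simp: lin_hom_add[OF alg_hom_lin[OF e]] lin_hom_smult[OF alg_hom_lin[OF e]]
        HA.B.smult_add_left HA.B.smult_add_right HA.B.smult_smult mult.commute)
  show "tensor_lift A (\<lambda>h a. counit H h \<odot>\<^sub>A a) \<in> alg_hom HAT A"
    by (rule tensor_lift_alg_hom[OF kH kA kA b])
      (auto simp: alg_hom_mult[OF e] alg_hom_one[OF e] HA.B.mult_smult_left HA.B.mult_smult_right HA.B.smult_smult mult.commute)
  show "\<And>h a. h \<in> carrier H \<Longrightarrow> a \<in> carrier A \<Longrightarrow> tensor_lift A (\<lambda>h a. counit H h \<odot>\<^sub>A a) (HA.pt h a) = counit H h \<odot>\<^sub>A a"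
    by (rule HA.tensor_lift(2)[OF kA b])
qed

definition \<mu> where "\<mu> = tensor_lift A (\<lambda>x y. x \<otimes>\<^sub>A y)"

lemma \<mu>: "\<mu> \<in> lin_hom AAT A" "\<And>x y. x \<in> carrier A \<Longrightarrow> y \<in> carrier A \<Longrightarrow> \<mu> (AA.pt x y) = x \<otimes>\<^sub>A y"
proof -
  have b: "bilin A A A (\<lambda>x y. x \<otimes>\<^sub>A y)"
    using lin_hom_mult_left[OF kA] lin_hom_mult_right[OF kA] by (intro bilinI) auto
  show "\<mu> \<in> lin_hom AAT A" "\<And>x y. x \<in> carrier A \<Longrightarrow> y \<in> carrier A \<Longrightarrow> \<mu> (AA.pt x y) = x \<otimes>\<^sub>A y"
    unfolding \<mu>_def by (rule AA.tensor_lift(1)[OF kA b], rule AA.tensor_lift(2)[OF kA b])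
qed

lemma \<mu>_\<kappa>: "h \<in> carrier H \<Longrightarrow> \<mu> (\<kappa> h) = counit H h \<odot>\<^sub>A \<one>\<^sub>A"
proof -
  assume h: "h \<in> carrier H"
  let ?e = "tensor_lift A (\<lambda>h a. counit H h \<odot>\<^sub>A a)"
  have "\<mu> Z = ?e (can Z)" if "Z \<in> carrier AAT" for Z
    by (rule AA.lin_hom_tensor_eq[OF \<mu>(1) lin_hom_comp[OF can(1) alg_hom_lin[OF counit_lift(1)]] _ that])
      (simp add: \<mu>(2) can(2) alg_hom_mult[OF counit_lift(1)] counit_law counit_lift(2) alg_hom_one[OF counit_hom])
  then show ?thesis using h by (simp add: can_\<kappa> counit_lift(2))
qed

text \<open>The first leg of \<open>\<kappa>\<close> is colinear: \<open>\<alpha>(h\<^sup>[\<^sup>1\<^sup>]) \<otimes> h\<^sup>[\<^sup>2\<^sup>] = h\<^sub>1 \<otimes> \<kappa>(h\<^sub>2)\<close>. Here a functional is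
  applied to the second leg.\<close>

lemma coaction_slice_\<kappa>:
  assumes l: "\<xi> \<in> lin_hom A base_alg" and h: "h \<in> carrier H"
    and S: "\<And>i. i \<in> S \<Longrightarrow> p i \<in> carrier H" "\<And>i. i \<in> S \<Longrightarrow> q i \<in> carrier H"
    and d: "comult H h = (\<Oplus>\<^bsub>tensor H H\<^esub>i\<in>S. HH.pt (p i) (q i))"
  shows "\<alpha> (AA.slice \<xi> (\<kappa> h)) = (\<Oplus>\<^bsub>HAT\<^esub>i\<in>S. HA.pt (p i) (AA.slice \<xi> (\<kappa> (q i))))"
proof -
  interpret HHA: two_algs H "tensor H A" by (rule two_algsI[OF kH HA.T.kalgebra])
  interpret HHA': two_algs "tensor H H" A by (rule two_algsI[OF HH.T.kalgebra kA])
  note sl = AA.slice[OF l]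
  have idh: "(\<lambda>x. x) \<in> alg_hom X X" for X :: "('k, 'x, 'w) module_scheme" by (rule alg_hom_id)
  define D where "D = tensor_map (tensor H H) A (comult H) (\<lambda>x. x)"
  note D = tensor_map_alg_hom[OF kH kA HH.T.kalgebra kA comult_hom idh, folded D_def]
  note Dp = tensor_map(2)[OF kH kA HH.T.kalgebra kA alg_hom_lin[OF comult_hom] alg_hom_lin[OF idh], folded D_def]
  note as = tensor_assoc[OF kH kH kA]
  define C where "C = tensor_map H HAT (\<lambda>x. x) \<alpha>"
  note C = tensor_map[OF kH kA kH HA.T.kalgebra lin_hom_id(1) alg_hom_lin[OF coaction_hom], folded C_def]
  define \<Lambda> where "\<Lambda> = tensor_map H A (\<lambda>x. x) (\<lambda>X. AA.slice \<xi> (caninv X))"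
  note L = tensor_map[OF kH HA.T.kalgebra kH kA lin_hom_id(1) lin_hom_comp[OF caninv sl(1)], folded \<Lambda>_def]
  have N: "\<Lambda> (C X \<otimes>\<^bsub>HHA.T\<^esub> HHA.pt \<one>\<^sub>H (HA.pt \<one>\<^sub>H y)) = \<xi> y \<odot>\<^bsub>HAT\<^esub> X"
    if X: "X \<in> carrier HAT" and y: "y \<in> carrier A" for X y
    using X
  proof (induction rule: HA.tensor_induct)
    case (pure g a)
    have "\<alpha> a \<otimes>\<^bsub>HAT\<^esub> HA.pt \<one>\<^sub>H y = can (AA.pt a y)" using pure y by (simp add: can(2))
    then show ?case using pure y by (simp add: C(2) HHA.pt_mult L(2) sl(2) HA.pt_smult_right)
  next
    case (add X Y)
    then show ?case using y
      by (simp add: lin_hom_add[OF C(1)] HHA.T.l_distr lin_hom_add[OF L(1)] lin_hom_closed[OF C(1)] HA.T.smult_add_right)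
  qed
  have "\<alpha> (AA.slice \<xi> Z) = \<Lambda> (tensor_assoc H H A (D (can Z)))" if "Z \<in> carrier AAT" for Z
  proof (rule AA.lin_hom_tensor_eq[OF lin_hom_comp[OF sl(1) alg_hom_lin[OF coaction_hom]]
        lin_hom_comp[OF lin_hom_comp[OF lin_hom_comp[OF can(1) alg_hom_lin[OF D]] alg_hom_lin[OF as(1)]] L(1)] _ that])
    fix x y assume x: "x \<in> carrier A" and y: "y \<in> carrier A"
    have "tensor_assoc H H A (D (can (AA.pt x y))) = tensor_assoc H H A (D (\<alpha> x)) \<otimes>\<^bsub>HHA.T\<^esub> HHA.pt \<one>\<^sub>H (HA.pt \<one>\<^sub>H y)"
      using x y by (simp add: can(2) alg_hom_mult[OF D] alg_hom_mult[OF as(1)] alg_hom_closed[OF D] Dp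
          alg_hom_one[OF comult_hom] HH.T_one as(2))
    also have "tensor_assoc H H A (D (\<alpha> x)) = C (\<alpha> x)" using coassoc[OF x] by (simp add: D_def C_def id_def)
    finally show "\<alpha> (AA.slice \<xi> (AA.pt x y)) = \<Lambda> (tensor_assoc H H A (D (can (AA.pt x y))))"
      using x y by (simp add: N sl(2) lin_hom_smult[OF alg_hom_lin[OF coaction_hom]])
  qed
  then have "\<alpha> (AA.slice \<xi> (\<kappa> h)) = \<Lambda> (tensor_assoc H H A (D (HA.pt h \<one>\<^sub>A)))" using h by (simp add: can_\<kappa>)
  also have "D (HA.pt h \<one>\<^sub>A) = (\<Oplus>\<^bsub>HHA'.T\<^esub>i\<in>S. HHA'.pt (HH.pt (p i) (q i)) \<one>\<^sub>A)"
    using h S by (simp add: Dp d) (rule HHA'.pt_finsum_left; simp)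
  also have "\<Lambda> (tensor_assoc H H A (\<Oplus>\<^bsub>HHA'.T\<^esub>i\<in>S. HHA'.pt (HH.pt (p i) (q i)) \<one>\<^sub>A)) = (\<Oplus>\<^bsub>HAT\<^esub>i\<in>S. HA.pt (p i) (AA.slice \<xi> (\<kappa> (q i))))"
    using S by (intro lin_hom_finsum_eq[OF HHA'.T.kalgebra HA.T.kalgebra lin_hom_comp[OF alg_hom_lin[OF as(1)] L(1)]])
      (simp_all add: as(2) L(2) \<kappa>_def)
  finally show ?thesis .
qed

end

text \<open>The map
  \<open>a \<otimes> b \<mapsto> a\<^sub>0 \<otimes> f(a\<^sub>1) b\<close> has the inverse \<open>h \<otimes> b \<mapsto> h\<^sup>[\<^sup>1\<^sup>] \<otimes> f(h\<^sup>[\<^sup>2\<^sup>]) b\<close> and equals the Galois map of \<open>B\<close> after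
  \<open>f \<otimes> 1\<close>. Hence \<open>f \<otimes> 1\<close> is bijective, and so is \<open>f\<close>.\<close>

theorem colinear_bij:
  fixes H :: "('k::field, 'h, 'y) hopf_scheme" and A :: "('k, 'a, 'h, 'z) comod_alg_scheme"
    and B :: "('k, 'b, 'h, 'w) comod_alg_scheme"
  assumes A: "galois_object H A" and B: "galois_object H B" and f: "f \<in> alg_hom A B"
    and colin: "\<And>x. x \<in> carrier A \<Longrightarrow> coaction B (f x) = tensor_map H B id f (coaction A x)"
  shows "bij_betw f (carrier A) (carrier B)"
proof -
  interpret A: galois H A by (rule galois.intro[OF A])
  interpret B: galois H B by (rule galois.intro[OF B])
  interpret AB: two_algs A B by (rule two_algsI[OF A.kA B.kA])
  note fl = alg_hom_lin[OF f] and fc [simp] = alg_hom_closed[OF f]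
  define hf where "hf = tensor_map H B (\<lambda>x. x) f"
  note hf = tensor_map_alg_hom[OF A.kH A.kA A.kH B.kA alg_hom_id f, folded hf_def]
  note hfp = tensor_map(2)[OF A.kH A.kA A.kH B.kA lin_hom_id(1) fl, folded hf_def]
  have col: "coaction B (f x) = hf (coaction A x)" if "x \<in> carrier A" for x using colin[OF that] by (simp add: hf_def id_def)
  define \<phi> where "\<phi> = tensor_map B B f (\<lambda>x. x)"
  note \<phi> = tensor_map[OF A.kA B.kA B.kA B.kA fl lin_hom_id(1), folded \<phi>_def]
  define af where "af = tensor_map A B (\<lambda>x. x) f"
  note af = tensor_map[OF A.kA A.kA A.kA B.kA lin_hom_id(1) fl, folded af_def]
  define r where "r b = tensor_map A B (\<lambda>x. x) (\<lambda>t. t \<otimes>\<^sub>B b)" for b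
  note r = tensor_map[OF A.kA B.kA A.kA B.kA lin_hom_id(1) lin_hom_mult_right[OF B.kA], folded r_def]
  have rc [simp]: "r b X \<in> carrier AB.T" if "b \<in> carrier B" "X \<in> carrier AB.T" for b X
    using lin_hom_closed[OF r(1)[OF that(1)] that(2)] .
  have afc [simp]: "af X \<in> carrier AB.T" if "X \<in> carrier A.AAT" for X using lin_hom_closed[OF af(1) that] .
  have r2: "(\<lambda>b. r b X) \<in> lin_hom B AB.T" if X: "X \<in> carrier AB.T" for X
  proof (rule lin_homI)
    fix b d c assume b: "b \<in> carrier B"
    show "r b X \<in> carrier AB.T" using b X by simp
    show "r (c \<odot>\<^sub>B b) X = c \<odot>\<^bsub>AB.T\<^esub> r b X"
      by (rule AB.lin_hom_tensor_eq[OF r(1) lin_hom_scale[OF AB.T.kalgebra r(1)] _ X])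
        (use b in \<open>simp_all add: r(2) B.HA.B.mult_smult_right AB.pt_smult_right\<close>)
    assume d: "d \<in> carrier B"
    show "r (b \<oplus>\<^sub>B d) X = r b X \<oplus>\<^bsub>AB.T\<^esub> r d X"
      by (rule AB.lin_hom_tensor_eq[OF r(1) lin_hom_sum[OF AB.T.kalgebra r(1) r(1)] _ X])
        (use b d in \<open>simp_all add: r(2) B.HA.B.r_distr AB.pt_add_right\<close>)
  qed
  have kl: "A.\<kappa> \<in> lin_hom H A.AAT"
  proof -
    have "A.\<kappa> = (\<lambda>h. A.caninv (A.HA.pt h \<one>\<^sub>A))" by (simp add: fun_eq_iff A.\<kappa>_def)
    then show ?thesis using lin_hom_comp[OF A.HA.pt_left[OF A.HA.B.one_closed] A.caninv] by simp
  qed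
  have bK: "bilin H B AB.T (\<lambda>h b. r b (af (A.\<kappa> h)))"
    by (intro bilinI r2 lin_hom_comp[OF lin_hom_comp[OF kl af(1)] r(1)]) simp_all
  define K where "K = tensor_lift AB.T (\<lambda>h b. r b (af (A.\<kappa> h)))"
  note K = B.HA.tensor_lift[OF AB.T.kalgebra bK, folded K_def]
  have afr: "af (A.\<rho> a Z) = r (f a) (af Z)" if "a \<in> carrier A" "Z \<in> carrier A.AAT" for a Z
    using that(2)
    by (induction rule: A.AA.tensor_induct)
      (use that(1) in \<open>simp_all add: A.\<rho>(2) af(2) r(2) alg_hom_mult[OF f] lin_hom_add[OF A.\<rho>(1)] lin_hom_add[OF af(1)]
        lin_hom_add[OF r(1)] lin_hom_closed[OF A.\<rho>(1)]\<close>)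
  have rr: "r b (r b' X) = r (b' \<otimes>\<^sub>B b) X" if "b \<in> carrier B" "b' \<in> carrier B" "X \<in> carrier AB.T" for b b' X
    using that(3)
    by (induction rule: AB.tensor_induct)
      (use that(1,2) in \<open>simp_all add: r(2) B.HA.B.m_assoc lin_hom_add[OF r(1)]\<close>)
  have K1: "K (hf X \<otimes>\<^bsub>B.HAT\<^esub> B.HA.pt \<one>\<^sub>H b) = r b (af (A.caninv X))" if X: "X \<in> carrier A.HAT" and b: "b \<in> carrier B" for X b
    using X
  proof (induction rule: A.HA.tensor_induct)
    case (pure h a)
    then show ?case using b by (simp add: hfp B.HA.pt_mult K(2) A.caninv_pt afr rr)
  next
    case (add X Y)
    then show ?case using b
      by (simp add: lin_hom_add[OF alg_hom_lin[OF hf]] B.HA.T.l_distr lin_hom_add[OF K(1)] lin_hom_add[OF A.caninv]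
          lin_hom_add[OF af(1)] lin_hom_add[OF r(1)] alg_hom_closed[OF hf])
  qed
  have K2: "B.can (\<phi> (r b (af Z))) = hf (A.can Z) \<otimes>\<^bsub>B.HAT\<^esub> B.HA.pt \<one>\<^sub>H b" if Z: "Z \<in> carrier A.AAT" and b: "b \<in> carrier B" for Z b
    using Z
  proof (induction rule: A.AA.tensor_induct)
    case (pure x y)
    then show ?case using b
      by (simp add: af(2) r(2) \<phi>(2) B.can(2) col A.can(2) alg_hom_mult[OF hf] hfp B.HA.T.m_assoc B.HA.pt_mult alg_hom_closed[OF hf])
  next
    case (add X Y)
    then show ?case using b
      by (simp add: lin_hom_add[OF af(1)] lin_hom_add[OF r(1)] lin_hom_add[OF \<phi>(1)] lin_hom_add[OF B.can(1)] lin_hom_add[OF A.can(1)]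
          lin_hom_add[OF alg_hom_lin[OF hf]] B.HA.T.l_distr lin_hom_closed[OF \<phi>(1)] alg_hom_closed[OF hf])
  qed
  have inv1: "K (B.can (\<phi> X)) = X" if "X \<in> carrier AB.T" for X
    by (rule AB.lin_hom_tensor_eq[OF lin_hom_comp[OF lin_hom_comp[OF \<phi>(1) B.can(1)] K(1)] lin_hom_id(1) _ that])
      (simp add: \<phi>(2) B.can(2) col K1 A.caninv_coaction af(2) alg_hom_one[OF f] r(2))
  have inv2: "B.can (\<phi> (K X)) = X" if "X \<in> carrier B.HAT" for X
    by (rule B.HA.lin_hom_tensor_eq[OF lin_hom_comp[OF lin_hom_comp[OF K(1) \<phi>(1)] B.can(1)] lin_hom_id(1) _ that])
      (simp add: K(2) K2 A.can_\<kappa> hfp alg_hom_one[OF f] B.HA.pt_mult)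
  have "inj_on f (carrier A)"
  proof (rule inj_onI)
    fix x y assume xy: "x \<in> carrier A" "y \<in> carrier A" "f x = f y"
    then have e: "\<phi> (AB.pt x \<one>\<^sub>B) = \<phi> (AB.pt y \<one>\<^sub>B)" by (simp add: \<phi>(2))
    have "AB.pt x \<one>\<^sub>B = K (B.can (\<phi> (AB.pt x \<one>\<^sub>B)))" using xy by (simp only: inv1 AB.pt_closed B.HA.B.one_closed)
    also have "\<dots> = AB.pt y \<one>\<^sub>B" using xy by (simp only: e inv1 AB.pt_closed B.HA.B.one_closed)
    finally have "AB.pt x \<one>\<^sub>B = AB.pt y \<one>\<^sub>B" .
    then show "x = y" using AB.pt_one_inj[OF B.one_not_zero] xy by blast
  qed
  moreover have "b \<in> f ` carrier A" if b: "b \<in> carrier B" for b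
  proof -
    obtain \<xi> where l: "\<xi> \<in> lin_hom B base_alg" "\<xi> \<one>\<^sub>B = 1" using ex_functional[OF B.kA B.HA.B.one_closed B.one_not_zero] by blast
    define X where "X = K (B.can (B.AA.pt b \<one>\<^sub>B))"
    have X: "X \<in> carrier AB.T" unfolding X_def using b lin_hom_closed[OF K(1)] by simp
    have "B.can (\<phi> X) = B.can (B.AA.pt b \<one>\<^sub>B)" unfolding X_def by (rule inv2) (use b in simp)
    then have \<phi>X: "\<phi> X = B.AA.pt b \<one>\<^sub>B"
      by (rule B.can_inj) (use b lin_hom_closed[OF \<phi>(1) X] in simp_all)
    have "B.AA.slice \<xi> (\<phi> Z) = f (AB.slice \<xi> Z)" if "Z \<in> carrier AB.T" for Z
      by (rule AB.lin_hom_tensor_eq[OF lin_hom_comp[OF \<phi>(1) B.AA.slice(1)[OF l(1)]] lin_hom_comp[OF AB.slice(1)[OF l(1)] fl] _ that])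
        (simp add: \<phi>(2) B.AA.slice(2)[OF l(1)] AB.slice(2)[OF l(1)] lin_hom_smult[OF fl])
    then have "f (AB.slice \<xi> X) = B.AA.slice \<xi> (\<phi> X)" using X by simp
    also have "\<dots> = b" unfolding \<phi>X using b l(2) by (simp add: B.AA.slice(2)[OF l(1)])
    finally have "f (AB.slice \<xi> X) = b" .
    moreover have "AB.slice \<xi> X \<in> carrier A" using lin_hom_closed[OF AB.slice(1)[OF l(1)] X] .
    ultimately show ?thesis by blast
  qed
  ultimately show ?thesis by (auto simp: bij_betw_def)
qed

section \<open>Scalar matrices with trivial left kernel\<close>

text \<open>More rows than columns: Gaussian elimination of the last column with pivot row \<open>t\<close>.\<close>

lemma wide_kernel:
  fixes M :: "nat \<Rightarrow> nat \<Rightarrow> 'k::field"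
  assumes "finite S" "q < card S"
  shows "\<exists>a. (\<exists>s\<in>S. a s \<noteq> 0) \<and> (\<forall>r<q. (\<Sum>s\<in>S. a s * M s r) = 0)"
  using assms
proof (induction q arbitrary: S M)
  case 0
  then obtain s where "s \<in> S" by (metis card.empty ex_in_conv less_nat_zero_code)
  then show ?case by (intro exI[of _ "\<lambda>_. 1"]) auto
next
  case (Suc q)
  show ?case
  proof (cases "\<exists>t\<in>S. M t q \<noteq> 0")
    case False
    obtain a where a: "\<exists>s\<in>S. a s \<noteq> 0" "\<forall>r<q. (\<Sum>s\<in>S. a s * M s r) = 0" using Suc.IH[of S M] Suc.prems by auto
    then show ?thesis using False by (intro exI[of _ a]) (auto simp: less_Suc_eq)
  next
    case True
    then obtain t where t: "t \<in> S" "M t q \<noteq> 0" by blast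
    define M' where "M' s r = M s r - M s q / M t q * M t r" for s r
    have "q < card (S - {t})" using Suc.prems t(1) by simp
    then obtain a where a: "\<exists>s\<in>S - {t}. a s \<noteq> 0" "\<forall>r<q. (\<Sum>s\<in>S - {t}. a s * M' s r) = 0"
      using Suc.IH[of "S - {t}" M'] Suc.prems(1) by auto
    (* the coefficient at the pivot row that cancels column q *)
    define e where "e = - (\<Sum>s\<in>S - {t}. a s * (M s q / M t q))"
    define b where "b = a(t := e)"
    have b: "(\<Sum>s\<in>S. b s * M s r) = (\<Sum>s\<in>S - {t}. a s * M' s r)" for r
    proof -
      have "(\<Sum>s\<in>S. b s * M s r) = b t * M t r + (\<Sum>s\<in>S - {t}. b s * M s r)" by (rule sum.remove) (use Suc.prems t in auto)
      also have "(\<Sum>s\<in>S - {t}. b s * M s r) = (\<Sum>s\<in>S - {t}. a s * M s r)" by (rule sum.cong) (auto simp: b_def)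
      also have "b t * M t r = - (\<Sum>s\<in>S - {t}. a s * (M s q / M t q) * M t r)" by (simp add: b_def e_def sum_distrib_right)
      finally show ?thesis by (simp add: M'_def right_diff_distrib sum_subtractf mult.assoc)
    qed
    have "(\<Sum>s\<in>S. b s * M s r) = 0" if "r < Suc q" for r
    proof (cases "r = q")
      case True
      then show ?thesis unfolding b using t(2) by (simp add: M'_def)
    next
      case False
      then show ?thesis unfolding b using a(2) that by simp
    qed
    moreover have "\<exists>s\<in>S. b s \<noteq> 0" using a(1) by (auto simp: b_def)
    ultimately show ?thesis by blast
  qed
qed

text \<open>Both conclusions are needed below for Gram matrices, whose kernels are controlled on one side only and
  whose two sizes are not known to agree beforehand.\<close>

lemma trivial_left_kernel:
  fixes M :: "'k::field mat"
  assumes M: "M \<in> carrier_mat p q" and k: "\<And>a. (\<And>r. r < q \<Longrightarrow> (\<Sum>s<p. a s * M $$ (s, r)) = 0) \<Longrightarrow> \<forall>s<p. a s = 0"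
  shows "p \<le> q" "p = q \<Longrightarrow> M \<in> GL p"
proof -
  show "p \<le> q"
  proof (rule ccontr)
    assume "\<not> p \<le> q"
    then obtain a where "\<exists>s\<in>{..<p}. a s \<noteq> 0" "\<forall>r<q. (\<Sum>s<p. a s * M $$ (s, r)) = 0"
      using wide_kernel[of "{..<p}" q "\<lambda>s r. M $$ (s, r)"] by auto
    then show False using k[of a] by auto
  qed
  assume pq: "p = q"
  have Mt: "M\<^sup>T \<in> carrier_mat p p" and M': "M \<in> carrier_mat p p" using M pq by auto
  have "det M \<noteq> 0"
  proof
    assume "det M = 0"
    then have "det M\<^sup>T = 0" using det_transpose[OF M'] by simp
    then obtain v where v: "v \<in> carrier_vec p" "v \<noteq> 0\<^sub>v p" "M\<^sup>T *\<^sub>v v = 0\<^sub>v p"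
      using det_0_iff_vec_prod_zero[OF Mt] by auto
    have "(\<Sum>s<p. v $ s * M $$ (s, r)) = 0" if r: "r < q" for r
    proof -
      have "(M\<^sup>T *\<^sub>v v) $ r = (\<Sum>s<p. v $ s * M $$ (s, r))"
        using r v(1) M' pq by (auto simp: scalar_prod_def lessThan_atLeast0 mult.commute intro!: sum.cong)
      then show ?thesis using v(3) r pq by simp
    qed
    then have "\<forall>s<p. v $ s = 0" by (rule k)
    then have "v = 0\<^sub>v p" using v(1) by (intro eq_vecI) auto
    then show False using v(2) by simp
  qed
  from det_non_zero_imp_unit[OF M' this, of "()"] obtain N where "N \<in> carrier_mat p p" "M * N = 1\<^sub>m p" "N * M = 1\<^sub>m p"
    by (auto simp: Units_def ring_mat_def)
  then show "M \<in> GL p" using GL_I(1)[OF M'] by blast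
qed

lemma right_inverse_dims:
  fixes M :: "'k::field mat"
  assumes "M \<in> carrier_mat p q" "N \<in> carrier_mat q p" "M * N = 1\<^sub>m p"
  shows "p \<le> q"
proof (rule trivial_left_kernel(1)[OF assms(1)])
  fix a :: "nat \<Rightarrow> 'k" assume a: "\<And>r. r < q \<Longrightarrow> (\<Sum>s<p. a s * M $$ (s, r)) = 0"
  show "\<forall>s<p. a s = 0"
  proof (intro allI impI)
    fix t assume t: "t < p"
    have "(\<Sum>s<p. a s * (1\<^sub>m p :: 'k mat) $$ (s, t)) = (\<Sum>s<p. \<Sum>r<q. a s * M $$ (s, r) * N $$ (r, t))"
      unfolding assms(3)[symmetric] using assms(1,2) t
      by (intro sum.cong) (auto simp: scalar_prod_def lessThan_atLeast0 sum_distrib_left mult.assoc)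
    also have "\<dots> = (\<Sum>r<q. \<Sum>s<p. a s * M $$ (s, r) * N $$ (r, t))" by (rule sum.swap)
    also have "\<dots> = (\<Sum>r<q. (\<Sum>s<p. a s * M $$ (s, r)) * N $$ (r, t))" by (simp add: sum_distrib_right)
    also have "\<dots> = 0" using a by simp
    also have "(\<Sum>s<p. a s * (1\<^sub>m p :: 'k mat) $$ (s, t)) = (\<Sum>s<p. if s = t then a s else 0)"
      using t by (intro sum.cong) auto
    finally show "a t = 0" using t by simp
  qed
qed

lemma (in kalg) finsum_blocks:
  fixes m N :: nat
  assumes "\<And>r. r < m * N \<Longrightarrow> f r \<in> carrier A"
  shows "(\<Oplus>r\<in>{..<m * N}. f r) = (\<Oplus>j\<in>{..<m}. \<Oplus>s\<in>{..<N}. f (j * N + s))"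
  using assms
proof (induction m)
  case (Suc m)
  have S: "{..<Suc m * N} = {..<m * N} \<union> (\<lambda>s. m * N + s) ` {..<N}"
    by (auto simp: image_iff) (metis add_diff_inverse_nat add.commute less_diff_conv2 lessThan_iff not_less)
  have c: "f (j * N + s) \<in> carrier A" if "j < Suc m" "s < N" for j s
  proof (rule Suc.prems)
    have "j * N \<le> m * N" using that(1) by (intro mult_right_mono) auto
    then show "j * N + s < Suc m * N" using that(2) by (simp only: mult_Suc)
  qed
  have "(\<Oplus>r\<in>{..<Suc m * N}. f r) = (\<Oplus>r\<in>{..<m * N}. f r) \<oplus> (\<Oplus>r\<in>(\<lambda>s. m * N + s) ` {..<N}. f r)"
    unfolding S using Suc.prems by (intro finsum_Un_disjoint) (auto simp: c)
  also have "(\<Oplus>r\<in>(\<lambda>s. m * N + s) ` {..<N}. f r) = (\<Oplus>s\<in>{..<N}. f (m * N + s))"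
    by (rule finsum_reindex) (auto simp: c inj_on_def)
  also have "(\<Oplus>r\<in>{..<m * N}. f r) = (\<Oplus>j\<in>{..<m}. \<Oplus>s\<in>{..<N}. f (j * N + s))"
    by (rule Suc.IH) (use Suc.prems in auto)
  finally show ?case unfolding lessThan_Suc using c by (subst finsum_insert) (auto simp: a_comm)
qed simp

text \<open>Over a noncommutative algebra the trace of \<open>X M Y\<^sup>t\<close> is no longer cyclic, but with scalar \<open>M\<close> the
  factors stay in order: it equals the sum of the entries of \<open>M\<close> weighted by those of \<open>X\<^sup>t Y\<close>.\<close>

lemma (in kalg) trace_swap:
  assumes "dim_row X = m" "dim_col X = n" "dim_row Y = m" "dim_col Y = n" "M \<in> carrier_mat n n" "entries A X" "entries A Y"
  shows "(\<Oplus>i\<in>{..<m}. (X \<star> (scal A M \<star> Y\<^sup>T)) $$ (i, i)) =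
    (\<Oplus>a\<in>{..<n}. \<Oplus>b\<in>{..<n}. M $$ (a, b) \<odot> (X\<^sup>T \<star> Y) $$ (a, b))"
proof -
  have M: "dim_row M = n" "dim_col M = n" using assms(5) by auto
  note [simp] = assms(1-4) M entriesD[OF assms(6)] entriesD[OF assms(7)]
  let ?t = "\<lambda>i a b. M $$ (a, b) \<odot> (X $$ (i, a) \<otimes> Y $$ (i, b))"
  have "(\<Oplus>i\<in>{..<m}. (X \<star> (scal A M \<star> Y\<^sup>T)) $$ (i, i)) = (\<Oplus>i\<in>{..<m}. \<Oplus>a\<in>{..<n}. \<Oplus>b\<in>{..<n}. ?t i a b)"
  proof (rule finsum_eqI)
    fix i assume i: "i \<in> {..<m}"
    have "(X \<star> (scal A M \<star> Y\<^sup>T)) $$ (i, i) = (\<Oplus>a\<in>{..<n}. X $$ (i, a) \<otimes> (scal A M \<star> Y\<^sup>T) $$ (a, i))"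
      using i by (subst amul_index) simp_all
    also have "\<dots> = (\<Oplus>a\<in>{..<n}. \<Oplus>b\<in>{..<n}. ?t i a b)"
    proof (rule finsum_eqI)
      fix a assume a: "a \<in> {..<n}"
      have "(scal A M \<star> Y\<^sup>T) $$ (a, i) = (\<Oplus>b\<in>{..<n}. M $$ (a, b) \<odot> Y $$ (i, b))"
        using i a by (subst scal_amul_index) (simp_all add: assms(7), intro finsum_eqI, simp_all)
      then have "X $$ (i, a) \<otimes> (scal A M \<star> Y\<^sup>T) $$ (a, i) = (\<Oplus>b\<in>{..<n}. X $$ (i, a) \<otimes> (M $$ (a, b) \<odot> Y $$ (i, b)))"
        using i a by (simp add: finsum_rdistr Pi_iff)
      also have "\<dots> = (\<Oplus>b\<in>{..<n}. ?t i a b)" using i a by (intro finsum_eqI) (simp_all add: mult_smult_right)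
      finally show "X $$ (i, a) \<otimes> (scal A M \<star> Y\<^sup>T) $$ (a, i) = (\<Oplus>b\<in>{..<n}. ?t i a b)" .
    qed (use i in simp)
    finally show "(X \<star> (scal A M \<star> Y\<^sup>T)) $$ (i, i) = (\<Oplus>a\<in>{..<n}. \<Oplus>b\<in>{..<n}. ?t i a b)" .
  qed simp
  also have "\<dots> = (\<Oplus>a\<in>{..<n}. \<Oplus>i\<in>{..<m}. \<Oplus>b\<in>{..<n}. ?t i a b)" by (rule finsum_swap) simp_all
  also have "\<dots> = (\<Oplus>a\<in>{..<n}. \<Oplus>b\<in>{..<n}. \<Oplus>i\<in>{..<m}. ?t i a b)"
    by (rule finsum_eqI, rule finsum_swap) simp_all
  also have "\<dots> = (\<Oplus>a\<in>{..<n}. \<Oplus>b\<in>{..<n}. M $$ (a, b) \<odot> (X\<^sup>T \<star> Y) $$ (a, b))"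
  proof (intro finsum_eqI)
    fix a b assume ab: "a \<in> {..<n}" "b \<in> {..<n}"
    have "(X\<^sup>T \<star> Y) $$ (a, b) = (\<Oplus>i\<in>{..<m}. X $$ (i, a) \<otimes> Y $$ (i, b))"
      using ab by (subst amul_index) (simp_all, intro finsum_eqI, simp_all)
    then show "(\<Oplus>i\<in>{..<m}. ?t i a b) = M $$ (a, b) \<odot> (X\<^sup>T \<star> Y) $$ (a, b)"
      using ab by (simp add: finsum_smult Pi_iff)
  qed (use assms(6,7) in \<open>auto intro!: finsum_in_carrier smult_closed entriesD\<close>)
  finally show ?thesis .
qed

lemma (in kalg) trace_scal:
  assumes M: "M \<in> carrier_mat n n"
  shows "(\<Oplus>a\<in>{..<n}. \<Oplus>b\<in>{..<n}. M $$ (a, b) \<odot> scal A (1\<^sub>m n) $$ (a, b)) = mat_trace M \<odot> \<one>"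
proof -
  have "(\<Oplus>a\<in>{..<n}. \<Oplus>b\<in>{..<n}. M $$ (a, b) \<odot> scal A (1\<^sub>m n) $$ (a, b)) = (\<Oplus>a\<in>{..<n}. M $$ (a, a) \<odot> \<one>)"
  proof (rule finsum_eqI)
    fix a assume a: "a \<in> {..<n}"
    have "(\<Oplus>b\<in>{..<n}. M $$ (a, b) \<odot> scal A (1\<^sub>m n) $$ (a, b)) = M $$ (a, a) \<odot> scal A (1\<^sub>m n) $$ (a, a)"
      by (rule finsum_delta) (use a in auto)
    then show "(\<Oplus>b\<in>{..<n}. M $$ (a, b) \<odot> scal A (1\<^sub>m n) $$ (a, b)) = M $$ (a, a) \<odot> \<one>" using a by simp
  qed simp
  then show ?thesis using M by (simp add: mat_trace_def smult_sum_left)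
qed

text \<open>Taking traces in \<open>v F u\<^sup>t = E\<close> and using \<open>v\<^sup>t u = 1\<close> gives \<open>tr F = tr E\<close>; in the same way
  \<open>u\<^sup>t E\<^sup>-\<^sup>1 v = F\<^sup>-\<^sup>1\<close> and \<open>u v\<^sup>t = 1\<close> give the equality for the inverses.\<close>

lemma (in hrep) traces:
  assumes inj: "\<And>c d. c \<odot> \<one> = d \<odot> \<one> \<Longrightarrow> c = d"
  shows "mat_trace E = mat_trace F" "mat_trace (mat_inv E) = mat_trace (mat_inv F)"
proof -
  have tr: "(\<Oplus>i\<in>{..<p}. scal A M $$ (i, i)) = mat_trace M \<odot> \<one>" if "M \<in> carrier_mat p p" for M p
  proof -
    have "(\<Oplus>i\<in>{..<p}. scal A M $$ (i, i)) = (\<Oplus>i\<in>{..<p}. M $$ (i, i) \<odot> \<one>)" using that by (intro finsum_eqI) auto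
    then show ?thesis using that by (simp add: mat_trace_def smult_sum_left)
  qed
  have "mat_trace E \<odot> \<one> = (\<Oplus>i\<in>{..<m}. (v \<star> (scal A F \<star> u\<^sup>T)) $$ (i, i))"
    unfolding rel2' by (rule tr[symmetric]) (rule GL_inv(1)[OF E])
  also have "\<dots> = mat_trace F \<odot> \<one>"
    using trace_swap[of v m n u F] GL_inv(1)[OF F] trace_scal[OF GL_inv(1)[OF F]] by (simp add: rel3 del: scal_index)
  finally show "mat_trace E = mat_trace F" by (rule inj)
  have "mat_trace (mat_inv F) \<odot> \<one> = (\<Oplus>i\<in>{..<n}. (u\<^sup>T \<star> (scal A (mat_inv E) \<star> v)) $$ (i, i))"
    unfolding rel4' by (rule tr[symmetric]) (rule GL_inv(2)[OF F])
  also have "\<dots> = mat_trace (mat_inv E) \<odot> \<one>"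
    using trace_swap[of "u\<^sup>T" n m "v\<^sup>T" "mat_inv E"] GL_inv(2)[OF E] trace_scal[OF GL_inv(2)[OF E]]
    by (simp add: rel1 del: scal_index)
  finally show "mat_trace (mat_inv E) = mat_trace (mat_inv F)" using inj by metis
qed

lemma transpose_map_mat: "(map_mat f X)\<^sup>T = map_mat f X\<^sup>T"
  by (rule eq_matI) auto

section \<open>Isomorphisms of comodule algebras\<close>

lemma alg_hom_cong:
  assumes f: "f \<in> alg_hom A B" and A: "kalgebra A" and e: "\<And>x. x \<in> carrier A \<Longrightarrow> g x = f x"
  shows "g \<in> alg_hom A B"
proof -
  interpret A: kalg A by (simp add: kalg_def A)
  show ?thesis
    by (intro alg_homI lin_homI)
      (simp_all add: e alg_hom_closed[OF f] alg_hom_mult[OF f] alg_hom_one[OF f] lin_hom_add[OF alg_hom_lin[OF f]] lin_hom_smult[OF alg_hom_lin[OF f]])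
qed

lemma colinear_inverse:
  assumes H: "kalgebra H" and A: "kalgebra A" and B: "kalgebra B" and f: "f \<in> lin_hom A B" and g: "g \<in> lin_hom B A"
    and gf: "\<And>x. x \<in> carrier A \<Longrightarrow> g (f x) = x" and X: "X \<in> carrier (tensor H A)"
  shows "tensor_map H A id g (tensor_map H B id f X) = X"
proof -
  interpret T: two_algs H A by (rule two_algsI[OF H A])
  note tf = tensor_map[OF H A H B lin_hom_id(2) f] and tg = tensor_map[OF H B H A lin_hom_id(2) g]
  show ?thesis
    by (rule T.lin_hom_tensor_eq[OF lin_hom_comp[OF tf(1) tg(1)] lin_hom_id(1) _ X])
      (simp add: tf(2) tg(2) lin_hom_closed[OF f] gf)
qed

lemma comod_alg_iso_sym:
  assumes A: "galois_object H A" and B: "galois_object H B" and i: "comod_alg_iso H A B"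
  shows "comod_alg_iso H B A"
proof -
  note gA = galois.intro[OF A] and kB = galois.kA[OF galois.intro[OF B]]
  note kH = galois.kH[OF gA] and kA = galois.kA[OF gA]
  obtain f where f: "f \<in> alg_hom A B" "bij_betw f (carrier A) (carrier B)"
    "\<And>x. x \<in> carrier A \<Longrightarrow> coaction B (f x) = tensor_map H B id f (coaction A x)"
    using i by (auto simp: comod_alg_iso_def)
  define g where "g = inv_into (carrier A) f"
  have g: "g \<in> alg_hom B A" unfolding g_def by (rule alg_hom_inv_into[OF kA kB f(1,2)])
  have gf: "g (f x) = x" if "x \<in> carrier A" for x using f(2) that by (simp add: g_def bij_betw_def inv_into_f_f)
  have fg: "f (g y) = y" if "y \<in> carrier B" for y using f(2) that by (simp add: g_def bij_betw_def f_inv_into_f)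
  have "coaction A (g y) = tensor_map H A id g (coaction B y)" if y: "y \<in> carrier B" for y
  proof -
    have gy: "g y \<in> carrier A" by (rule alg_hom_closed[OF g y])
    have "tensor_map H A id g (coaction B (f (g y))) = coaction A (g y)"
      unfolding f(3)[OF gy] by (rule colinear_inverse[OF kH kA kB alg_hom_lin[OF f(1)] alg_hom_lin[OF g] gf galois.coaction_closed[OF gA gy]])
    then show ?thesis using fg[OF y] by simp
  qed
  moreover have "bij_betw g (carrier B) (carrier A)" unfolding g_def by (rule bij_betw_inv_into[OF f(2)])
  ultimately show ?thesis using g unfolding comod_alg_iso_def by blast
qed

lemma comod_alg_iso_trans:
  assumes A: "galois_object H A" and B: "galois_object H B" and C: "galois_object H C"
    and i: "comod_alg_iso H A B" "comod_alg_iso H B C"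
  shows "comod_alg_iso H A C"
proof -
  note gA = galois.intro[OF A]
  note kH = galois.kH[OF gA] and kA = galois.kA[OF gA] and kB = galois.kA[OF galois.intro[OF B]]
    and kC = galois.kA[OF galois.intro[OF C]]
  obtain f where f: "f \<in> alg_hom A B" "bij_betw f (carrier A) (carrier B)"
    "\<And>x. x \<in> carrier A \<Longrightarrow> coaction B (f x) = tensor_map H B id f (coaction A x)"
    using i by (auto simp: comod_alg_iso_def)
  obtain g where g: "g \<in> alg_hom B C" "bij_betw g (carrier B) (carrier C)"
    "\<And>x. x \<in> carrier B \<Longrightarrow> coaction C (g x) = tensor_map H C id g (coaction B x)"
    using i by (auto simp: comod_alg_iso_def)
  note gf = alg_hom_comp[OF f(1) g(1)]
  note tf = tensor_map[OF kH kA kH kB lin_hom_id(2) alg_hom_lin[OF f(1)]]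
    and tg = tensor_map[OF kH kB kH kC lin_hom_id(2) alg_hom_lin[OF g(1)]]
    and th = tensor_map[OF kH kA kH kC lin_hom_id(2) alg_hom_lin[OF gf]]
  have "tensor_map H C id g (tensor_map H B id f X) = tensor_map H C id (\<lambda>x. g (f x)) X" if "X \<in> carrier (tensor H A)" for X
    by (rule two_algs.lin_hom_tensor_eq[OF two_algsI[OF kH kA] lin_hom_comp[OF tf(1) tg(1)] th(1) _ that])
      (simp add: tf(2) tg(2) th(2) alg_hom_closed[OF f(1)])
  then have "coaction C (g (f x)) = tensor_map H C id (\<lambda>x. g (f x)) (coaction A x)" if "x \<in> carrier A" for x
    using that by (simp add: f(3) g(3) alg_hom_closed[OF f(1)] galois.coaction_closed[OF gA])
  moreover have "bij_betw (\<lambda>x. g (f x)) (carrier A) (carrier C)" using bij_betw_trans[OF f(2) g(2)] by (simp add: comp_def)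
  ultimately show ?thesis unfolding comod_alg_iso_def using gf by (intro bexI[of _ "\<lambda>x. g (f x)"]) simp_all
qed

text \<open>The structure maps of \<open>A\<close> and \<open>B\<close> are intertwined by \<open>f\<close>, \<open>f \<otimes> f\<close> and \<open>1 \<otimes> f\<close>, so each axiom for \<open>B\<close> is
  the image of the corresponding one for \<open>A\<close>.\<close>

lemma galois_transport:
  assumes A: "galois_object H A" and B: "kalgebra B" and f: "f \<in> alg_hom A B" and bij: "bij_betw f (carrier A) (carrier B)"
    and colin: "\<And>x. x \<in> carrier A \<Longrightarrow> coaction B (f x) = tensor_map H B id f (coaction A x)"
  shows "galois_object H B"
proof -
  interpret A: galois H A by (rule galois.intro[OF A])
  interpret HB: two_algs H B by (rule two_algsI[OF A.kH B])
  interpret BB: two_algs B B by (rule two_algsI[OF B B])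
  define g where "g = inv_into (carrier A) f"
  have g: "g \<in> alg_hom B A" unfolding g_def by (rule alg_hom_inv_into[OF A.kA B f bij])
  have gf [simp]: "g (f x) = x" if "x \<in> carrier A" for x using bij that by (simp add: g_def bij_betw_def inv_into_f_f)
  have fg [simp]: "f (g y) = y" if "y \<in> carrier B" for y using bij that by (simp add: g_def bij_betw_def f_inv_into_f)
  note fl = alg_hom_lin[OF f] and gl = alg_hom_lin[OF g]
  note [simp] = alg_hom_closed[OF f] alg_hom_closed[OF g]
  let ?\<beta> = "coaction B"
  define hf where "hf = tensor_map H B id f"
  have idh: "id \<in> alg_hom H H" using alg_hom_id[of H] by (simp add: id_def)
  note hf = tensor_map_alg_hom[OF A.kH A.kA A.kH B idh f, folded hf_def]
  note hfp = tensor_map(2)[OF A.kH A.kA A.kH B lin_hom_id(2) fl, folded hf_def]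
  define hg where "hg = tensor_map H A id g"
  note hg = tensor_map[OF A.kH B A.kH A.kA lin_hom_id(2) gl, folded hg_def]
  have hgf: "hg (hf X) = X" if "X \<in> carrier A.HAT" for X
    unfolding hg_def hf_def by (rule colinear_inverse[OF A.kH A.kA B fl gl gf that])
  have hfg: "hf (hg X) = X" if "X \<in> carrier HB.T" for X
    unfolding hg_def hf_def by (rule colinear_inverse[OF A.kH B A.kA gl fl fg that])
  have \<beta>f: "?\<beta> (f x) = hf (A.\<alpha> x)" if "x \<in> carrier A" for x using colin[OF that] by (simp add: hf_def)
  have \<beta>g: "?\<beta> y = hf (A.\<alpha> (g y))" if "y \<in> carrier B" for y using \<beta>f[of "g y"] that by simp
  have \<beta>: "?\<beta> \<in> alg_hom B HB.T"
    by (rule alg_hom_cong[OF alg_hom_comp[OF alg_hom_comp[OF g A.coaction_hom] hf] B \<beta>g])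
  note \<beta>l = alg_hom_lin[OF \<beta>]
  define K where "K = tensor_map H HB.T id hf"
  note K = tensor_map[OF A.kH A.HA.T.kalgebra A.kH HB.T.kalgebra lin_hom_id(2) alg_hom_lin[OF hf], folded K_def]
  note asA = tensor_assoc[OF A.kH A.kH A.kA] and asB = tensor_assoc[OF A.kH A.kH B]
  note DA = tensor_map[OF A.kH A.kA A.HH.T.kalgebra A.kA alg_hom_lin[OF A.comult_hom] lin_hom_id(2)]
  note DB = tensor_map[OF A.kH B A.HH.T.kalgebra B alg_hom_lin[OF A.comult_hom] lin_hom_id(2)]
  note CA = tensor_map[OF A.kH A.kA A.kH A.HA.T.kalgebra lin_hom_id(2) alg_hom_lin[OF A.coaction_hom]]
  note CB = tensor_map[OF A.kH B A.kH HB.T.kalgebra lin_hom_id(2) \<beta>l]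
  interpret HHA': two_algs "tensor H H" A by (rule two_algsI[OF A.HH.T.kalgebra A.kA])
  interpret HHB': two_algs "tensor H H" B by (rule two_algsI[OF A.HH.T.kalgebra B])
  have as: "tensor_assoc H H B (HHB'.pt Z (f a)) = K (tensor_assoc H H A (HHA'.pt Z a))"
    if Z: "Z \<in> carrier (tensor H H)" and a: "a \<in> carrier A" for Z a
    by (rule A.HH.lin_hom_tensor_eq[OF lin_hom_comp[OF HHB'.pt_left alg_hom_lin[OF asB(1)]]
          lin_hom_comp[OF lin_hom_comp[OF HHA'.pt_left alg_hom_lin[OF asA(1)]] K(1)] _ Z])
      (use a in \<open>simp_all add: asA(2) asB(2) K(2) hfp\<close>)
  have l1: "tensor_assoc H H B (tensor_map (tensor H H) B (comult H) id (hf X)) =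
      K (tensor_assoc H H A (tensor_map (tensor H H) A (comult H) id X))" if "X \<in> carrier A.HAT" for X
    by (rule A.HA.lin_hom_tensor_eq[OF lin_hom_comp[OF lin_hom_comp[OF alg_hom_lin[OF hf] DB(1)] alg_hom_lin[OF asB(1)]]
          lin_hom_comp[OF lin_hom_comp[OF DA(1) alg_hom_lin[OF asA(1)]] K(1)] _ that])
      (simp add: hfp DA(2) DB(2) as alg_hom_closed[OF A.comult_hom])
  have l2: "tensor_map H HB.T id ?\<beta> (hf X) = K (tensor_map H A.HAT id A.\<alpha> X)" if "X \<in> carrier A.HAT" for X
    by (rule A.HA.lin_hom_tensor_eq[OF lin_hom_comp[OF alg_hom_lin[OF hf] CB(1)] lin_hom_comp[OF CA(1) K(1)] _ that])
      (simp add: hfp CA(2) CB(2) K(2) \<beta>f)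
  have bc: "bilin H B B (\<lambda>h b. counit H h \<odot>\<^sub>B b)"
    by (intro bilinI lin_homI)
      (auto simp: lin_hom_add[OF alg_hom_lin[OF A.counit_hom]] lin_hom_smult[OF alg_hom_lin[OF A.counit_hom]]
        HB.B.smult_add_left HB.B.smult_add_right HB.B.smult_smult mult.commute)
  note LB = HB.tensor_lift[OF B bc]
  have l3: "tensor_lift B (\<lambda>h b. counit H h \<odot>\<^sub>B b) (hf X) = f (tensor_lift A (\<lambda>h a. counit H h \<odot>\<^sub>A a) X)" if "X \<in> carrier A.HAT" for X
    by (rule A.HA.lin_hom_tensor_eq[OF lin_hom_comp[OF alg_hom_lin[OF hf] LB(1)] lin_hom_comp[OF alg_hom_lin[OF A.counit_lift(1)] fl] _ that])
      (simp add: hfp LB(2) A.counit_lift(2) lin_hom_smult[OF fl])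
  have com: "left_comodule_algebra H B"
    unfolding left_comodule_algebra_def
  proof (intro conjI ballI B \<beta>)
    fix y assume y: "y \<in> carrier B"
    then have x: "g y \<in> carrier A" by simp
    show "tensor_assoc H H B (tensor_map (tensor H H) B (comult H) id (?\<beta> y)) = tensor_map H HB.T id ?\<beta> (?\<beta> y)"
      unfolding \<beta>g[OF y] l1[OF A.coaction_closed[OF x]] l2[OF A.coaction_closed[OF x]] A.coassoc[OF x] ..
    show "tensor_lift B (\<lambda>h a. counit H h \<odot>\<^sub>B a) (?\<beta> y) = y"
      unfolding \<beta>g[OF y] l3[OF A.coaction_closed[OF x]] A.counit_law[OF x] by (rule fg[OF y])
  qed
  have "\<one>\<^sub>B \<noteq> \<zero>\<^sub>B"
  proof
    assume "\<one>\<^sub>B = \<zero>\<^sub>B"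
    then have "g \<one>\<^sub>B = g \<zero>\<^sub>B" by simp
    then show False using A.one_not_zero alg_hom_one[OF g] lin_hom_zero[OF B A.kA gl] by simp
  qed
  then have nt: "carrier B \<noteq> {\<zero>\<^sub>B }" using HB.B.one_closed by auto
  define ff where "ff = tensor_map B B f f"
  note ff = tensor_map[OF A.kA A.kA B B fl fl, folded ff_def]
  define gg where "gg = tensor_map A A g g"
  note gg = tensor_map[OF B B A.kA A.kA gl gl, folded gg_def]
  have fgg: "ff (gg Y) = Y" if "Y \<in> carrier BB.T" for Y
    by (rule BB.lin_hom_tensor_eq[OF lin_hom_comp[OF gg(1) ff(1)] lin_hom_id(1) _ that]) (simp add: ff(2) gg(2))
  have gff: "gg (ff Y) = Y" if "Y \<in> carrier A.AAT" for Y
    by (rule A.AA.lin_hom_tensor_eq[OF lin_hom_comp[OF ff(1) gg(1)] lin_hom_id(1) _ that]) (simp add: ff(2) gg(2))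
  note canB = galois_map[OF A.kH B \<beta>l]
  have cB: "galois_map H B (ff Z) = hf (A.can Z)" if "Z \<in> carrier A.AAT" for Z
    by (rule A.AA.lin_hom_tensor_eq[OF lin_hom_comp[OF ff(1) canB(1)] lin_hom_comp[OF A.can(1) alg_hom_lin[OF hf]] _ that])
      (simp add: ff(2) canB(2) A.can(2) \<beta>f alg_hom_mult[OF hf] hfp)
  have "bij_betw (galois_map H B) (carrier BB.T) (carrier HB.T)"
  proof (rule bij_betw_inverse_maps[where g = "\<lambda>W. ff (A.caninv (hg W))"])
    fix Y assume Y: "Y \<in> carrier BB.T"
    show "galois_map H B Y \<in> carrier HB.T" by (rule lin_hom_closed[OF canB(1) Y])
    have gY: "gg Y \<in> carrier A.AAT" by (rule lin_hom_closed[OF gg(1) Y])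
    have "galois_map H B Y = hf (A.can (gg Y))" using cB[OF gY] unfolding fgg[OF Y] .
    then show "ff (A.caninv (hg (galois_map H B Y))) = Y"
      by (simp only: hgf[OF A.can_closed[OF gY]] A.caninv_can[OF gY] fgg[OF Y])
  next
    fix W assume W: "W \<in> carrier HB.T"
    have gW: "hg W \<in> carrier A.HAT" by (rule lin_hom_closed[OF hg(1) W])
    show "ff (A.caninv (hg W)) \<in> carrier BB.T" by (rule lin_hom_closed[OF ff(1) A.caninv_closed[OF gW]])
    show "galois_map H B (ff (A.caninv (hg W))) = W"
      by (simp only: cB[OF A.caninv_closed[OF gW]] A.can_caninv[OF gW] hfg[OF W])
  qed
  then show ?thesis using com nt A unfolding galois_object_def by blast
qed

text \<open>Transport of structure along an injection into another type. It puts a copy of every \<open>H(E,F)\<close> into the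
  universe, so that the classes of these algebras are not empty.\<close>

lemma galois_copy:
  fixes H :: "('k::field, 'h, 'y) hopf_scheme" and A :: "('k, 'a, 'h, 'z) comod_alg_scheme" and emb :: "'a \<Rightarrow> 'u"
  assumes A: "galois_object H A" and emb: "inj emb"
  shows "\<exists>B :: ('k, 'u, 'h) comod_alg. galois_object H B \<and> comod_alg_iso H A B"
proof -
  interpret A: galois H A by (rule galois.intro[OF A])
  define g where "g = inv_into UNIV emb"
  have [simp]: "g (emb x) = x" for x using emb by (simp add: g_def)
  define B0 :: "('k, 'u) module" where "B0 = \<lparr>carrier = emb ` carrier A, mult = (\<lambda>x y. emb (g x \<otimes>\<^sub>A g y)),
    one = emb \<one>\<^sub>A, zero = emb \<zero>\<^sub>A, add = (\<lambda>x y. emb (g x \<oplus>\<^sub>A g y)), smult = (\<lambda>c x. emb (c \<odot>\<^sub>A g x))\<rparr>"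
  have B0s [simp]: "carrier B0 = emb ` carrier A" "mult B0 = (\<lambda>x y. emb (g x \<otimes>\<^sub>A g y))" "one B0 = emb \<one>\<^sub>A"
    "zero B0 = emb \<zero>\<^sub>A" "add B0 = (\<lambda>x y. emb (g x \<oplus>\<^sub>A g y))" "module.smult B0 = (\<lambda>c x. emb (c \<odot>\<^sub>A g x))"
    by (simp_all add: B0_def)
  have "ring B0"
  proof (rule ringI)
    show "abelian_group B0"
    proof (rule abelian_groupI)
      fix x assume "x \<in> carrier B0"
      then obtain a where a: "a \<in> carrier A" "x = emb a" by auto
      then show "\<exists>y\<in>carrier B0. y \<oplus>\<^bsub>B0\<^esub> x = \<zero>\<^bsub>B0\<^esub>"
        by (intro bexI[of _ "emb (\<ominus>\<^sub>A a)"]) (simp_all add: A.HA.B.l_neg)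
    qed (auto simp: A.HA.B.a_ac)
    show "Group.monoid B0" by (rule monoidI) (auto simp: A.HA.B.m_assoc)
  qed (auto simp: A.HA.B.l_distr A.HA.B.r_distr)
  then have B0: "kalgebra B0"
    by (rule kalgebraI) (auto simp: A.HA.B.smult_add_left A.HA.B.smult_add_right A.HA.B.smult_smult A.HA.B.mult_smult_left A.HA.B.mult_smult_right)
  define B :: "('k, 'u, 'h) comod_alg" where "B = \<lparr>carrier = carrier B0, mult = mult B0, one = one B0, zero = zero B0, add = add B0,
    smult = module.smult B0, coaction = (\<lambda>x. tensor_map H B0 id emb (coaction A (g x)))\<rparr>"
  have s: "same_alg B B0" by (simp add: same_alg_def B_def)
  have B: "kalgebra B" by (rule same_alg_kalgebra[OF s B0])
  have f: "emb \<in> alg_hom A B" by (intro alg_homI lin_homI) (simp_all add: B_def)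
  have bij: "bij_betw emb (carrier A) (carrier B)" using emb by (auto simp: bij_betw_def B_def inj_on_def)
  have c: "coaction B (emb x) = tensor_map H B id emb (coaction A x)" for x
    unfolding same_alg_maps(1)[OF same_alg_refl s same_alg_refl] by (simp add: B_def)
  have "galois_object H B" by (rule galois_transport[OF A B f bij c])
  moreover have "comod_alg_iso H A B" unfolding comod_alg_iso_def using f bij c by blast
  ultimately show ?thesis by blast
qed

text \<open>Colinearity is an equality of two algebra maps, hence can be tested on generators.\<close>

lemma colinear_H:
  fixes A :: "('k::field, 'a, 'k hel, 'z) comod_alg_scheme"
  assumes E: "E \<in> GL m" and F: "F \<in> GL n" and A: "kalgebra A" and \<alpha>: "coaction A \<in> alg_hom A (tensor (H_hopf E) A)"
    and f: "f \<in> alg_hom (H_alg E F) A"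
    and u: "\<And>i j. i < m \<Longrightarrow> j < n \<Longrightarrow> coaction A (f (H_u E F i j)) =
      (\<Oplus>\<^bsub>tensor (H_hopf E) A\<^esub>l\<in>{..<m}. pure_tensor (H_hopf E) A (H_u E E i l) (f (H_u E F l j)))"
    and v: "\<And>i j. i < m \<Longrightarrow> j < n \<Longrightarrow> coaction A (f (H_v E F i j)) =
      (\<Oplus>\<^bsub>tensor (H_hopf E) A\<^esub>l\<in>{..<m}. pure_tensor (H_hopf E) A (H_v E E i l) (f (H_v E F l j)))"
    and x: "x \<in> carrier (H_alg E F)"
  shows "coaction A (f x) = tensor_map (H_hopf E) A id f (coaction (H_comod_alg E F) x)"
proof -
  interpret P: h_pair E F m n by (rule h_pair.intro[OF E F])
  note sh = same_alg_H(1)[of E]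
  have kH: "kalgebra (H_hopf E)" by (rule same_alg_kalgebra[OF sh kalgebra_H[OF E E]])
  interpret T: two_algs "H_hopf E" A by (rule two_algsI[OF kH A])
  have idh: "id \<in> alg_hom (H_alg E E) (H_hopf E)"
    using alg_hom_id[of "H_hopf E"] unfolding same_alg_hom(2)[OF sh same_alg_refl] by (simp add: id_def)
  let ?t = "tensor_map (H_hopf E) A id f"
  note tm = tensor_map[OF P.HA.A.kalgebra P.HA.B.kalgebra kH A alg_hom_lin[OF idh] alg_hom_lin[OF f]]
  note tma = tensor_map_alg_hom[OF P.HA.A.kalgebra P.HA.B.kalgebra kH A idh f]
  note ts = lin_hom_finsum_eq[OF P.HA.T.kalgebra T.T.kalgebra tm(1), symmetric]
  have "coaction A (f x) = ?t (H_coact E F x)"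
  proof (rule alg_hom_H_eq[OF E F alg_hom_comp[OF f \<alpha>] alg_hom_comp[OF P.coact_hom tma] _ _ x])
    fix i j assume ij: "i < m" "j < n"
    show "coaction A (f (H_u E F i j)) = ?t (H_coact E F (H_u E F i j))"
      unfolding u[OF ij] P.coact_u[OF ij] by (rule ts) (use ij in \<open>simp_all add: tm(2)\<close>)
    show "coaction A (f (H_v E F i j)) = ?t (H_coact E F (H_v E F i j))"
      unfolding v[OF ij] P.coact_v[OF ij] by (rule ts) (use ij in \<open>simp_all add: tm(2)\<close>)
  qed
  then show ?thesis by simp
qed

section \<open>Galois objects of \<open>H(E)\<close>\<close>

declare H_hopf_simps [simp del]

locale hgalois = galois "H_hopf E" A
  for E :: "'k::field mat" and A :: "('k, 'a, 'k hel, 'z) comod_alg_scheme" +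
  fixes m :: nat
  assumes E: "E \<in> GL m"
begin

abbreviation "H \<equiv> H_hopf E"
abbreviation "Hu \<equiv> H_u E E"
abbreviation "Hv \<equiv> H_v E E"

lemma E_pair: "h_pair E E m m" by (rule h_pair.intro[OF E E])

lemmas dimE [simp] = GL_dims[OF E]

text \<open>The matrices \<open>u\<close> and \<open>v\<close> of \<open>H(E)\<close> have the same comultiplication, so both types of vectors can be
  treated at once.\<close>

definition comatrix :: "(nat \<Rightarrow> nat \<Rightarrow> 'k hel) \<Rightarrow> bool" where
  "comatrix g \<longleftrightarrow> (\<forall>i<m. \<forall>j<m. g i j \<in> carrier H \<and>
     comult H (g i j) = (\<Oplus>\<^bsub>tensor H H\<^esub>l\<in>{..<m}. HH.pt (g i l) (g l j)) \<and>
     counit H (g i j) = (if i = j then 1 else 0))"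

lemma comatrixD: assumes "comatrix g" "i < m" "j < m"
  shows "g i j \<in> carrier H" "comult H (g i j) = (\<Oplus>\<^bsub>tensor H H\<^esub>l\<in>{..<m}. HH.pt (g i l) (g l j))"
    "counit H (g i j) = (if i = j then 1 else 0)"
  using assms by (auto simp: comatrix_def)

lemma comatrix_gens: "comatrix Hu" "comatrix Hv"
proof -
  interpret P: h_pair E E m m by (rule E_pair)
  note sh = same_alg_H(1)[of E]
  show "comatrix Hu" "comatrix Hv"
    by (simp_all add: H_hopf_simps comatrix_def same_alg_tensor[OF sh sh] P.coact_u P.coact_v P.counit)
qed

text \<open>With \<open>left_leg g\<close> for \<open>g \<otimes> 1\<close> and \<open>right_leg c\<close> for \<open>1 \<otimes> c\<close>, covariance becomes the matrix equation
  \<open>\<alpha>(c) = (g \<otimes> 1)(1 \<otimes> c)\<close>, and invariance of a pairing a computation with the relations of \<open>u \<otimes> 1\<close>, \<open>v \<otimes> 1\<close>.\<close>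

definition left_leg :: "(nat \<Rightarrow> nat \<Rightarrow> 'k hel) \<Rightarrow> ('k hel, 'a, 'k) tens mat" where
  "left_leg g = mat m m (\<lambda>(i, j). HA.pt (g i j) \<one>\<^sub>A)"

definition right_leg :: "'a mat \<Rightarrow> ('k hel, 'a, 'k) tens mat" where
  "right_leg c = map_mat (HA.pt \<one>\<^sub>H) c"

lemma leg_dims [simp]: "dim_row (left_leg g) = m" "dim_col (left_leg g) = m"
  "dim_row (right_leg c) = dim_row c" "dim_col (right_leg c) = dim_col c"
  by (simp_all add: left_leg_def right_leg_def)

lemma leg_entries [simp]: "comatrix g \<Longrightarrow> entries HAT (left_leg g)" "entries A c \<Longrightarrow> entries HAT (right_leg c)"
  by (simp_all add: entries_def left_leg_def right_leg_def comatrixD)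

lemma right_leg_amul: "dim_col X = dim_row Y \<Longrightarrow> entries A X \<Longrightarrow> entries A Y \<Longrightarrow>
    right_leg (X \<star>\<^sub>A Y) = right_leg X \<star>\<^bsub>HAT\<^esub> right_leg Y"
  unfolding right_leg_def by (rule map_mat_amul[OF kA HA.T.kalgebra HA.incl_right])

lemma right_leg_scal: "right_leg (scal A M) = scal HAT M"
  unfolding right_leg_def by (rule map_mat_scal[OF kA HA.incl_right])

lemma transpose_right_leg: "(right_leg X)\<^sup>T = right_leg X\<^sup>T"
  by (simp add: right_leg_def transpose_map_mat)

lemma coact_amul: "dim_col X = dim_row Y \<Longrightarrow> entries A X \<Longrightarrow> entries A Y \<Longrightarrow>
    map_mat \<alpha> (X \<star>\<^sub>A Y) = map_mat \<alpha> X \<star>\<^bsub>HAT\<^esub> map_mat \<alpha> Y"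
  by (rule map_mat_amul[OF kA HA.T.kalgebra coaction_hom])

lemma coact_scal: "map_mat \<alpha> (scal A M) = scal HAT M"
  by (rule map_mat_scal[OF kA coaction_hom])

lemma legs_index:
  assumes "comatrix g" "entries A c" "dim_row c = m" "i < m" "j < dim_col c"
  shows "(left_leg g \<star>\<^bsub>HAT\<^esub> right_leg c) $$ (i, j) = (\<Oplus>\<^bsub>HAT\<^esub>l\<in>{..<m}. HA.pt (g i l) (c $$ (l, j)))"
proof -
  have "(left_leg g \<star>\<^bsub>HAT\<^esub> right_leg c) $$ (i, j) = (\<Oplus>\<^bsub>HAT\<^esub>l\<in>{..<m}. left_leg g $$ (i, l) \<otimes>\<^bsub>HAT\<^esub> right_leg c $$ (l, j))"
    using assms by (subst HA.T.amul_index) simp_all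
  also have "\<dots> = (\<Oplus>\<^bsub>HAT\<^esub>l\<in>{..<m}. HA.pt (g i l) (c $$ (l, j)))"
    using assms comatrixD(1)[OF assms(1)] entriesD[OF assms(2)]
    by (intro HA.T.finsum_eqI) (simp_all add: left_leg_def right_leg_def HA.pt_mult)
  finally show ?thesis .
qed

text \<open>Matrices whose columns \<open>w\<close> satisfy \<open>\<alpha>(w\<^sub>i) = \<Sum>\<^sub>k g\<^sub>i\<^sub>k \<otimes> w\<^sub>k\<close>.\<close>

definition cov :: "(nat \<Rightarrow> nat \<Rightarrow> 'k hel) \<Rightarrow> 'a mat \<Rightarrow> bool" where
  "cov g c \<longleftrightarrow> dim_row c = m \<and> entries A c \<and> map_mat \<alpha> c = left_leg g \<star>\<^bsub>HAT\<^esub> right_leg c"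

lemma covD: "cov g c \<Longrightarrow> dim_row c = m" "cov g c \<Longrightarrow> entries A c" by (simp_all add: cov_def)

lemma cov_coact: "cov g c \<Longrightarrow> map_mat \<alpha> c = left_leg g \<star>\<^bsub>HAT\<^esub> right_leg c" by (simp add: cov_def)

lemma cov_iff:
  assumes "comatrix g" "entries A c" "dim_row c = m"
  shows "cov g c \<longleftrightarrow> (\<forall>i<m. \<forall>j<dim_col c. \<alpha> (c $$ (i, j)) = (\<Oplus>\<^bsub>HAT\<^esub>l\<in>{..<m}. HA.pt (g i l) (c $$ (l, j))))"
proof (intro iffI allI impI)
  fix i j assume c: "cov g c" and ij: "i < m" "j < dim_col c"
  have "\<alpha> (c $$ (i, j)) = map_mat \<alpha> c $$ (i, j)" using ij assms(3) by simp
  then show "\<alpha> (c $$ (i, j)) = (\<Oplus>\<^bsub>HAT\<^esub>l\<in>{..<m}. HA.pt (g i l) (c $$ (l, j)))"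
    unfolding cov_coact[OF c] legs_index[OF assms ij] .
next
  assume e: "\<forall>i<m. \<forall>j<dim_col c. \<alpha> (c $$ (i, j)) = (\<Oplus>\<^bsub>HAT\<^esub>l\<in>{..<m}. HA.pt (g i l) (c $$ (l, j)))"
  have "map_mat \<alpha> c = left_leg g \<star>\<^bsub>HAT\<^esub> right_leg c"
  proof (rule eq_matI)
    fix i j assume "i < dim_row (left_leg g \<star>\<^bsub>HAT\<^esub> right_leg c)" "j < dim_col (left_leg g \<star>\<^bsub>HAT\<^esub> right_leg c)"
    then have ij: "i < m" "j < dim_col c" by simp_all
    show "map_mat \<alpha> c $$ (i, j) = (left_leg g \<star>\<^bsub>HAT\<^esub> right_leg c) $$ (i, j)"
      unfolding legs_index[OF assms ij] using e ij assms(3) by simp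
  qed (simp_all add: assms(3))
  then show "cov g c" using assms by (simp add: cov_def)
qed

lemma cov_scal:
  assumes g: "comatrix g" and c: "cov g c" and M: "dim_col c = dim_row M"
  shows "cov g (c \<star>\<^sub>A scal A M)"
proof -
  note [simp] = covD[OF c] M leg_entries(1)[OF g]
  have "map_mat \<alpha> (c \<star>\<^sub>A scal A M) = left_leg g \<star>\<^bsub>HAT\<^esub> right_leg c \<star>\<^bsub>HAT\<^esub> scal HAT M"
    by (simp add: coact_amul coact_scal cov_coact[OF c])
  also have "\<dots> = left_leg g \<star>\<^bsub>HAT\<^esub> right_leg (c \<star>\<^sub>A scal A M)"
    by (simp add: HA.T.amul_assoc right_leg_amul right_leg_scal)
  finally show ?thesis unfolding cov_def by simp
qed

lemma scal_inj_mat: "scal A M = scal A N \<Longrightarrow> M = N"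
proof (rule eq_matI)
  assume e: "scal A M = scal A N"
  show d: "dim_row M = dim_row N" "dim_col M = dim_col N"
    using arg_cong[OF e, of dim_row] arg_cong[OF e, of dim_col] by simp_all
  fix i j assume "i < dim_row N" "j < dim_col N"
  then show "M $$ (i, j) = N $$ (i, j)"
    using arg_cong[OF e, of "\<lambda>X. X $$ (i, j)"] d by (simp add: scalar_inj)
qed

lemma coinvariant_matrix:
  assumes G: "entries A G" "map_mat \<alpha> G = right_leg G"
  shows "\<exists>M\<in>carrier_mat (dim_row G) (dim_col G). G = scal A M"
proof -
  have "\<exists>c. G $$ (i, j) = c \<odot>\<^sub>A \<one>\<^sub>A" if ij: "i < dim_row G" "j < dim_col G" for i j
  proof (rule coinvariant_scalar)
    show "G $$ (i, j) \<in> carrier A" using ij by (rule entriesD[OF G(1)])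
    show "\<alpha> (G $$ (i, j)) = HA.pt \<one>\<^sub>H (G $$ (i, j))"
      using arg_cong[OF G(2), of "\<lambda>X. X $$ (i, j)"] ij by (simp add: right_leg_def)
  qed
  then obtain f where f: "\<And>i j. i < dim_row G \<Longrightarrow> j < dim_col G \<Longrightarrow> G $$ (i, j) = f i j \<odot>\<^sub>A \<one>\<^sub>A" by metis
  show ?thesis
    by (rule bexI[of _ "mat (dim_row G) (dim_col G) (\<lambda>(i, j). f i j)"]) (rule eq_matI, use f in auto)
qed

lemma hmats_left_leg: "hmats E E HAT (left_leg Hu) (left_leg Hv)"
proof -
  have e: "(\<lambda>h. HA.pt h \<one>\<^sub>A) \<in> alg_hom (H_alg E E) HAT"
    using HA.incl_left by (simp add: same_alg_hom(2)[OF same_alg_H(1) same_alg_refl])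
  have "left_leg g = map_mat (\<lambda>h. HA.pt h \<one>\<^sub>A) (mat m m (\<lambda>(i, j). g i j))" for g
    by (rule eq_matI) (simp_all add: left_leg_def)
  then show ?thesis using hmats_map[OF kalgebra_H[OF E E] HA.T.kalgebra e E E hmats_H[OF E E]] by simp
qed

lemma transpose_legs:
  assumes g: "comatrix g" and c: "entries A c" "dim_row c = m"
  shows "(left_leg g \<star>\<^bsub>HAT\<^esub> right_leg c)\<^sup>T = right_leg c\<^sup>T \<star>\<^bsub>HAT\<^esub> (left_leg g)\<^sup>T"
  unfolding transpose_right_leg[symmetric]
proof (rule HA.T.transpose_amul_commuting)
  fix i j k l assume "i < dim_row (left_leg g)" "j < dim_col (left_leg g)" "k < dim_row (right_leg c)" "l < dim_col (right_leg c)"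
  then show "left_leg g $$ (i, j) \<otimes>\<^bsub>HAT\<^esub> right_leg c $$ (k, l) = right_leg c $$ (k, l) \<otimes>\<^bsub>HAT\<^esub> left_leg g $$ (i, j)"
    using assms by (simp add: left_leg_def right_leg_def HA.pt_mult comatrixD entriesD)
qed (use assms in simp_all)

text \<open>The two pairings of covariant vectors take scalar values, because their values are
  coinvariant.\<close>

lemma pairing_vu:
  assumes d: "cov Hv d" and c: "cov Hu c"
  shows "\<exists>M\<in>carrier_mat (dim_col d) (dim_col c). d\<^sup>T \<star>\<^sub>A c = scal A M"
proof -
  interpret L: hrep HAT E E "left_leg Hu" "left_leg Hv" m m by (rule hrepI[OF HA.T.kalgebra E E hmats_left_leg])
  note cm = comatrix_gens
  note [simp] = covD[OF c] covD[OF d] leg_entries(1)[OF cm(1)] leg_entries(1)[OF cm(2)]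
  have "map_mat \<alpha> (d\<^sup>T \<star>\<^sub>A c) = (map_mat \<alpha> d)\<^sup>T \<star>\<^bsub>HAT\<^esub> map_mat \<alpha> c"
    by (simp add: coact_amul transpose_map_mat)
  also have "\<dots> = right_leg d\<^sup>T \<star>\<^bsub>HAT\<^esub> (left_leg Hv)\<^sup>T \<star>\<^bsub>HAT\<^esub> (left_leg Hu \<star>\<^bsub>HAT\<^esub> right_leg c)"
    by (simp add: cov_coact[OF c] cov_coact[OF d] transpose_legs cm)
  also have "\<dots> = right_leg d\<^sup>T \<star>\<^bsub>HAT\<^esub> (((left_leg Hv)\<^sup>T \<star>\<^bsub>HAT\<^esub> left_leg Hu) \<star>\<^bsub>HAT\<^esub> right_leg c)"
    by (simp add: HA.T.amul_assoc)
  also have "\<dots> = right_leg (d\<^sup>T \<star>\<^sub>A c)" by (simp add: L.rel3 right_leg_amul)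
  finally show ?thesis using coinvariant_matrix[of "d\<^sup>T \<star>\<^sub>A c"] by simp
qed

lemma pairing_uv:
  assumes d: "cov Hv d" and c: "cov Hu c"
  shows "\<exists>M\<in>carrier_mat (dim_col c) (dim_col d). c\<^sup>T \<star>\<^sub>A (scal A (mat_inv E) \<star>\<^sub>A d) = scal A M"
proof -
  interpret L: hrep HAT E E "left_leg Hu" "left_leg Hv" m m by (rule hrepI[OF HA.T.kalgebra E E hmats_left_leg])
  note cm = comatrix_gens
  note [simp] = covD[OF c] covD[OF d] leg_entries(1)[OF cm(1)] leg_entries(1)[OF cm(2)]
  let ?E = "scal HAT (mat_inv E)" and ?G = "c\<^sup>T \<star>\<^sub>A (scal A (mat_inv E) \<star>\<^sub>A d)"
  have "map_mat \<alpha> ?G = (map_mat \<alpha> c)\<^sup>T \<star>\<^bsub>HAT\<^esub> (?E \<star>\<^bsub>HAT\<^esub> map_mat \<alpha> d)"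
    by (simp add: coact_amul coact_scal transpose_map_mat)
  also have "\<dots> = right_leg c\<^sup>T \<star>\<^bsub>HAT\<^esub> (left_leg Hu)\<^sup>T \<star>\<^bsub>HAT\<^esub> (?E \<star>\<^bsub>HAT\<^esub> (left_leg Hv \<star>\<^bsub>HAT\<^esub> right_leg d))"
    by (simp add: cov_coact[OF c] cov_coact[OF d] transpose_legs cm)
  also have "\<dots> = right_leg c\<^sup>T \<star>\<^bsub>HAT\<^esub> (((left_leg Hu)\<^sup>T \<star>\<^bsub>HAT\<^esub> (?E \<star>\<^bsub>HAT\<^esub> left_leg Hv)) \<star>\<^bsub>HAT\<^esub> right_leg d)"
    by (simp add: HA.T.amul_assoc)
  also have "\<dots> = right_leg ?G" by (simp add: L.rel4' right_leg_amul right_leg_scal)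
  finally show ?thesis using coinvariant_matrix[of ?G] by simp
qed

text \<open>A right inverse \<open>y\<close> of a matrix \<open>c\<close> of covariant columns. It shows that the columns are many enough:
  a row vector orthogonal to all of them is zero.\<close>

definition resolves where
  "resolves g N c y \<longleftrightarrow> cov g c \<and> dim_col c = N \<and> y \<in> carrier_mat N m \<and> entries A y \<and> c \<star>\<^sub>A y = scal A (1\<^sub>m m)"

lemma resolvesD: "resolves g N c y \<Longrightarrow> cov g c" "resolves g N c y \<Longrightarrow> dim_col c = N" "resolves g N c y \<Longrightarrow> dim_row y = N"
  "resolves g N c y \<Longrightarrow> dim_col y = m" "resolves g N c y \<Longrightarrow> entries A y" "resolves g N c y \<Longrightarrow> c \<star>\<^sub>A y = scal A (1\<^sub>m m)"
  by (auto simp: resolves_def)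

text \<open>Write \<open>\<kappa>(g\<^sub>i\<^sub>j) = \<Sum>\<^sub>s b\<^sub>i\<^sub>j\<^sub>s \<otimes> e\<^sub>s\<close>. For fixed \<open>j\<close> and \<open>s\<close> the vector \<open>(b\<^sub>i\<^sub>j\<^sub>s)\<^sub>i\<close> is covariant, and
  multiplying the two legs gives \<open>\<Sum>\<^sub>s b\<^sub>i\<^sub>j\<^sub>s e\<^sub>s = \<epsilon>(g\<^sub>i\<^sub>j) = \<delta>\<^sub>i\<^sub>j\<close>. The pairs \<open>(j, s)\<close> index the columns of \<open>c\<close>, as
  \<open>r = j N + s\<close>.\<close>

lemma resolution_exists:
  assumes g: "comatrix g"
  shows "\<exists>N c y. resolves g N c y"
proof -
  note gD = comatrixD[OF g]
  obtain N e \<xi> where e: "\<And>s. s < N \<Longrightarrow> e s \<in> carrier A" and l: "\<And>s. s < N \<Longrightarrow> \<xi> s \<in> lin_hom A base_alg"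
    and Z: "\<And>i j. i < m \<Longrightarrow> j < m \<Longrightarrow> \<kappa> (g i j) = (\<Oplus>\<^bsub>AAT\<^esub>s\<in>{..<N::nat}. AA.pt (AA.slice (\<xi> s) (\<kappa> (g i j))) (e s))"
  proof -
    from AA.tensor_expansion[of "{..<m} \<times> {..<m}" "\<lambda>(i, j). \<kappa> (g i j)"] obtain N e \<xi> where
      1: "\<forall>s<N. e s \<in> carrier A \<and> \<xi> s \<in> lin_hom A base_alg"
      and 2: "\<forall>x\<in>{..<m} \<times> {..<m}. (case x of (i, j) \<Rightarrow> \<kappa> (g i j)) =
        (\<Oplus>\<^bsub>AAT\<^esub>s\<in>{..<N::nat}. AA.pt (AA.slice (\<xi> s) (case x of (i, j) \<Rightarrow> \<kappa> (g i j))) (e s))"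
      using gD(1) by auto
    show ?thesis
    proof (rule that[of N e \<xi>])
      fix i j assume ij: "i < m" "j < m"
      from bspec[OF 2, of "(i, j)"] ij
      show "\<kappa> (g i j) = (\<Oplus>\<^bsub>AAT\<^esub>s\<in>{..<N::nat}. AA.pt (AA.slice (\<xi> s) (\<kappa> (g i j))) (e s))" by (simp only: prod.case) simp
    qed (use 1 in blast)+
  qed
  define b where "b i j s = AA.slice (\<xi> s) (\<kappa> (g i j))" for i j s
  have b: "b i j s \<in> carrier A" if "i < m" "j < m" "s < N" for i j s
    unfolding b_def using that gD(1) by (intro lin_hom_closed[OF AA.slice(1)[OF l]] \<kappa>_closed)
  have \<alpha>b: "\<alpha> (b i j s) = (\<Oplus>\<^bsub>HAT\<^esub>l\<in>{..<m}. HA.pt (g i l) (b l j s))" if "i < m" "j < m" "s < N" for i j s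
    unfolding b_def using that gD by (intro coaction_slice_\<kappa>[OF l]) auto
  have sum: "(\<Oplus>\<^sub>A s\<in>{..<N}. b i j s \<otimes>\<^sub>A e s) = (if i = j then 1 else 0) \<odot>\<^sub>A \<one>\<^sub>A" if ij: "i < m" "j < m" for i j
  proof -
    have "\<mu> (\<kappa> (g i j)) = (\<Oplus>\<^sub>A s\<in>{..<N}. b i j s \<otimes>\<^sub>A e s)"
      by (subst Z[OF ij], rule lin_hom_finsum_eq[OF AA.T.kalgebra kA \<mu>(1)]) (use b[OF ij] e in \<open>simp_all add: b_def \<mu>(2)\<close>)
    then show ?thesis using \<mu>_\<kappa>[OF gD(1)[OF ij]] gD(3)[OF ij] by simp
  qed
  define c where "c = mat m (m * N) (\<lambda>(i, r). b i (r div N) (r mod N))"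
  define y where "y = mat (m * N) m (\<lambda>(r, j). if r div N = j then e (r mod N) else \<zero>\<^sub>A)"
  have r: "r div N < m" "r mod N < N" if "r < m * N" for r
  proof -
    have "N > 0" using that by (cases N) auto
    then show "r div N < m" "r mod N < N" using that by (auto simp: less_mult_imp_div_less)
  qed
  have ec: "entries A c" unfolding entries_def c_def using b r by simp
  have ey: "entries A y" unfolding entries_def y_def using e r by simp
  have cov: "cov g c"
  proof (rule iffD2[OF cov_iff[OF g ec]], simp add: c_def, intro allI impI)
    fix i j assume ij: "i < m" "j < dim_col c"
    then have j: "j < m * N" by (simp add: c_def)
    have "\<alpha> (c $$ (i, j)) = (\<Oplus>\<^bsub>HAT\<^esub>l\<in>{..<m}. HA.pt (g i l) (b l (j div N) (j mod N)))"
      using \<alpha>b[OF ij(1) r[OF j]] ij(1) j by (simp add: c_def)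
    also have "\<dots> = (\<Oplus>\<^bsub>HAT\<^esub>l\<in>{..<m}. HA.pt (g i l) (c $$ (l, j)))"
      using ij(1) j gD(1) b r[OF j] by (intro HA.T.finsum_eqI) (simp_all add: c_def)
    finally show "\<alpha> (c $$ (i, j)) = (\<Oplus>\<^bsub>HAT\<^esub>l\<in>{..<m}. HA.pt (g i l) (c $$ (l, j)))" .
  qed
  have "c \<star>\<^sub>A y = scal A (1\<^sub>m m)"
  proof (rule eq_matI)
    fix i j assume "i < dim_row (scal A (1\<^sub>m m))" "j < dim_col (scal A (1\<^sub>m m))"
    then have ij: "i < m" "j < m" by simp_all
    have "(c \<star>\<^sub>A y) $$ (i, j) = (\<Oplus>\<^sub>A r\<in>{..<m * N}. c $$ (i, r) \<otimes>\<^sub>A y $$ (r, j))"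
      using ij by (subst HA.B.amul_index) (simp_all add: c_def y_def)
    also have "\<dots> = (\<Oplus>\<^sub>A k\<in>{..<m}. \<Oplus>\<^sub>A s\<in>{..<N}. c $$ (i, k * N + s) \<otimes>\<^sub>A y $$ (k * N + s, j))"
      using ij entriesD[OF ec] entriesD[OF ey] by (intro HA.B.finsum_blocks) (simp add: c_def y_def)
    also have "\<dots> = (\<Oplus>\<^sub>A k\<in>{..<m}. if k = j then (\<Oplus>\<^sub>A s\<in>{..<N}. b i j s \<otimes>\<^sub>A e s) else \<zero>\<^sub>A)"
    proof (rule HA.B.finsum_eqI)
      fix k assume k: "k \<in> {..<m}"
      have lt: "k * N + s < m * N" if "s < N" for s
      proof -
        have "Suc k * N \<le> m * N" using k by (intro mult_right_mono) auto
        then show ?thesis using that by simp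
      qed
      have dm: "(k * N + s) div N = k" "(k * N + s) mod N = s" if "s < N" for s using that by simp_all
      show "(\<Oplus>\<^sub>A s\<in>{..<N}. c $$ (i, k * N + s) \<otimes>\<^sub>A y $$ (k * N + s, j)) =
          (if k = j then (\<Oplus>\<^sub>A s\<in>{..<N}. b i j s \<otimes>\<^sub>A e s) else \<zero>\<^sub>A)"
      proof (cases "k = j")
        case True
        then show ?thesis unfolding if_P[OF True]
          by (intro HA.B.finsum_eqI) (use ij b e lt dm in \<open>simp_all add: c_def y_def\<close>)
      next
        case False
        show ?thesis unfolding if_not_P[OF False]
          by (rule HA.B.finsum_zero') (use False ij k b lt dm in \<open>simp add: c_def y_def\<close>)
      qed
    qed (use ij b e in simp)
    also have "\<dots> = (\<Oplus>\<^sub>A s\<in>{..<N}. b i j s \<otimes>\<^sub>A e s)"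
      using ij b e HA.B.finsum_delta[of "{..<m}" j "\<lambda>k. if k = j then (\<Oplus>\<^sub>A s\<in>{..<N}. b i j s \<otimes>\<^sub>A e s) else \<zero>\<^sub>A"] by simp
    finally show "(c \<star>\<^sub>A y) $$ (i, j) = scal A (1\<^sub>m m) $$ (i, j)" using sum[OF ij] ij by simp
  qed (simp_all add: c_def y_def)
  then have "resolves g (m * N) c y" using cov ey by (simp add: resolves_def c_def y_def)
  then show ?thesis by blast
qed

text \<open>In a resolution with the least number of columns, the columns are linearly independent: a
  linear relation would allow one of them to be dropped.\<close>

lemma minimal_resolution:
  assumes g: "comatrix g" and r: "resolves g N c y" and min: "\<And>N' c' y'. resolves g N' c' y' \<Longrightarrow> N \<le> N'"
    and M: "M \<in> carrier_mat N q" and Y: "dim_row Y = q" "dim_col Y = m" "entries A Y"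
    and c: "c\<^sup>T = scal A M \<star>\<^sub>A Y"
  shows "N \<le> q" "N = q \<Longrightarrow> M \<in> GL N"
proof -
  note [simp] = resolvesD(2-5)[OF r] covD[OF resolvesD(1)[OF r]] Y
  have Md [simp]: "dim_row M = N" "dim_col M = q" using M by auto
  have cc: "c $$ (i, l) \<in> carrier A" if "i < m" "l < N" for i l using that entriesD[of A c i l] by simp
  have k: "\<forall>s<N. a s = 0" if a: "\<And>r. r < q \<Longrightarrow> (\<Sum>s<N. a s * M $$ (s, r)) = 0" for a
  proof (rule ccontr)
    assume "\<not> (\<forall>s<N. a s = 0)"
    then obtain t where t: "t < N" "a t \<noteq> 0" by blast
    then obtain N0 where N: "N = Suc N0" by (cases N) auto
    have z: "(\<Oplus>\<^sub>A s\<in>{..<N}. a s \<odot>\<^sub>A c $$ (i, s)) = \<zero>\<^sub>A" if i: "i < m" for i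
    proof -
      have ci: "c $$ (i, s) = (\<Oplus>\<^sub>A r\<in>{..<q}. M $$ (s, r) \<odot>\<^sub>A Y $$ (r, i))" if s: "s < N" for s
        using arg_cong[OF c, of "\<lambda>X. X $$ (s, i)"] i s by (simp add: HA.B.scal_amul_index)
      have Yc: "Y $$ (r, i) \<in> carrier A" if "r < q" for r using that i entriesD[OF Y(3)] by simp
      have "(\<Oplus>\<^sub>A s\<in>{..<N}. a s \<odot>\<^sub>A c $$ (i, s)) = (\<Oplus>\<^sub>A s\<in>{..<N}. \<Oplus>\<^sub>A r\<in>{..<q}. (a s * M $$ (s, r)) \<odot>\<^sub>A Y $$ (r, i))"
        using Yc by (intro HA.B.finsum_eqI) (simp_all add: ci HA.B.finsum_smult HA.B.smult_smult Pi_iff cong: HA.B.finsum_cong)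
      also have "\<dots> = (\<Oplus>\<^sub>A r\<in>{..<q}. \<Oplus>\<^sub>A s\<in>{..<N}. (a s * M $$ (s, r)) \<odot>\<^sub>A Y $$ (r, i))"
        using Yc by (intro HA.B.finsum_swap) simp_all
      also have "\<dots> = \<zero>\<^sub>A" using Yc a by - (rule HA.B.finsum_zero', simp add: HA.B.smult_sum_left[symmetric])
      finally show ?thesis .
    qed
    (* sigma enumerates the indices other than t, and b is such that Q R = 1 + a b projects along the
       relation a, with row t equal to zero; so column t of c can be dropped *)
    define \<sigma> where "\<sigma> i = (if i < t then i else Suc i)" for i
    define b where "b j = (if j = t then - 1 / a t else 0)" for j
    define Q where "Q = mat N N0 (\<lambda>(s, i). if s = \<sigma> i then 1 else 0 :: 'k)"
    define R where "R = mat N0 N (\<lambda>(i, s). (if s = \<sigma> i then 1 else 0) + a (\<sigma> i) * b s)"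
    have Rd [simp]: "dim_row Q = N" "dim_col Q = N0" "dim_row R = N0" "dim_col R = N" by (simp_all add: Q_def R_def)
    have QR: "(Q * R) $$ (l, j) = (if l = j then 1 else 0) + b j * a l" if l: "l < N" "j < N" for l j
    proof -
      have "(Q * R) $$ (l, j) = (\<Sum>i<N0. (if l = \<sigma> i then 1 else 0) * ((if j = \<sigma> i then 1 else 0) + a (\<sigma> i) * b j))"
        using l by (simp add: Q_def R_def scalar_prod_def lessThan_atLeast0)
      also have "\<dots> = (\<Sum>i<N0. if l = \<sigma> i then (if j = l then 1 else 0) + a l * b j else 0)" by (rule sum.cong) auto
      also have "\<dots> = (if l = j then 1 else 0) + b j * a l"
      proof (cases "l = t")
        case True
        then have "l \<noteq> \<sigma> i" for i by (simp add: \<sigma>_def)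
        then show ?thesis using True t(2) by (auto simp: b_def)
      next
        case False
        define i0 where "i0 = (if l < t then l else l - 1)"
        have i0: "i0 < N0" "\<And>i. l = \<sigma> i \<longleftrightarrow> i = i0" using False l t N by (auto simp: i0_def \<sigma>_def)
        show ?thesis unfolding i0(2) using i0(1) by (auto simp: mult.commute)
      qed
      finally show ?thesis .
    qed
    have cQR: "c \<star>\<^sub>A scal A (Q * R) = c"
    proof (rule eq_matI)
      fix i j assume "i < dim_row c" "j < dim_col c"
      then have ij: "i < m" "j < N" by simp_all
      have "(c \<star>\<^sub>A scal A (Q * R)) $$ (i, j) = (\<Oplus>\<^sub>A l\<in>{..<N}. (Q * R) $$ (l, j) \<odot>\<^sub>A c $$ (i, l))"
        using ij by (subst HA.B.amul_scal_index) simp_all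
      also have "\<dots> = (\<Oplus>\<^sub>A l\<in>{..<N}. (if l = j then 1 else 0) \<odot>\<^sub>A c $$ (i, l) \<oplus>\<^sub>A b j \<odot>\<^sub>A (a l \<odot>\<^sub>A c $$ (i, l)))"
        using ij cc by (intro HA.B.finsum_eqI) (simp_all add: QR HA.B.smult_add_left HA.B.smult_smult del: index_mult_mat)
      also have "\<dots> = (\<Oplus>\<^sub>A l\<in>{..<N}. (if l = j then 1 else 0) \<odot>\<^sub>A c $$ (i, l)) \<oplus>\<^sub>A (\<Oplus>\<^sub>A l\<in>{..<N}. b j \<odot>\<^sub>A (a l \<odot>\<^sub>A c $$ (i, l)))"
        using ij cc by (intro HA.B.finsum_addf) auto
      also have "(\<Oplus>\<^sub>A l\<in>{..<N}. b j \<odot>\<^sub>A (a l \<odot>\<^sub>A c $$ (i, l))) = b j \<odot>\<^sub>A (\<Oplus>\<^sub>A l\<in>{..<N}. a l \<odot>\<^sub>A c $$ (i, l))"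
        using ij cc by (intro HA.B.finsum_smult[symmetric]) auto
      also have "(\<Oplus>\<^sub>A l\<in>{..<N}. (if l = j then 1 else 0) \<odot>\<^sub>A c $$ (i, l)) = c $$ (i, j)"
        using ij cc HA.B.finsum_delta[of "{..<N}" j "\<lambda>l. (if l = j then 1 else 0) \<odot>\<^sub>A c $$ (i, l)"] by simp
      finally show "(c \<star>\<^sub>A scal A (Q * R)) $$ (i, j) = c $$ (i, j)" using z[OF ij(1)] ij cc by simp
    qed simp_all
    have "c \<star>\<^sub>A scal A Q \<star>\<^sub>A (scal A R \<star>\<^sub>A y) = c \<star>\<^sub>A scal A (Q * R) \<star>\<^sub>A y"
      by (simp add: HA.B.scal_mult HA.B.amul_assoc)
    also have "\<dots> = scal A (1\<^sub>m m)" unfolding cQR by (rule resolvesD(6)[OF r])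
    finally have "resolves g N0 (c \<star>\<^sub>A scal A Q) (scal A R \<star>\<^sub>A y)"
      unfolding resolves_def by (intro conjI carrier_matI cov_scal[OF g resolvesD(1)[OF r]]) simp_all
    from min[OF this] show False using N by simp
  qed
  show "N \<le> q" "N = q \<Longrightarrow> M \<in> GL N" by (rule trivial_left_kernel[OF M k]; assumption)+
qed

lemma minimal_resolution_exists:
  assumes "comatrix g"
  shows "\<exists>N c y. resolves g N c y \<and> (\<forall>N' c' y'. resolves g N' c' y' \<longrightarrow> N \<le> N')"
proof -
  define N where "N = (LEAST N. \<exists>c y. resolves g N c y)"
  have "\<exists>c y. resolves g N c y" unfolding N_def by (rule LeastI_ex) (rule resolution_exists[OF assms])
  moreover have "N \<le> N'" if "resolves g N' c' y'" for N' c' y' unfolding N_def by (rule Least_le) (use that in blast)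
  ultimately show ?thesis by blast
qed

text \<open>Let \<open>c\<close> and \<open>d\<close> be minimal resolutions of the two types, with right inverses \<open>y\<close> and \<open>z\<close>, and let
  \<open>M\<^sub>1 = d\<^sup>t c\<close> and \<open>M\<^sub>2 = c\<^sup>t E\<^sup>-\<^sup>1 d\<close> be the Gram matrices. From \<open>d\<^sup>t = M\<^sub>1 y\<close> and \<open>c\<^sup>t = M\<^sub>2 z E\<close> and minimality,
  both are square and invertible. Then \<open>u = c\<close>, the dual basis \<open>v = d (M\<^sub>1\<^sup>-\<^sup>1)\<^sup>t\<close> and
  \<open>F\<^sup>-\<^sup>1 = u\<^sup>t E\<^sup>-\<^sup>1 v\<close> satisfy the relations; a one-sided inverse in them becomes two-sided through \<open>y\<close> and \<open>z\<close>.\<close>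

theorem covariant_representation:
  "\<exists>n F u v. F \<in> GL n \<and> hmats E F A u v \<and> cov Hu u \<and> cov Hv v"
proof -
  obtain n c y where c: "resolves Hu n c y" "\<And>N' c' y'. resolves Hu N' c' y' \<Longrightarrow> n \<le> N'"
    using minimal_resolution_exists[OF comatrix_gens(1)] by blast
  obtain p d z where d: "resolves Hv p d z" "\<And>N' c' y'. resolves Hv N' c' y' \<Longrightarrow> p \<le> N'"
    using minimal_resolution_exists[OF comatrix_gens(2)] by blast
  note cD = resolvesD[OF c(1)] and dD = resolvesD[OF d(1)]
  note [simp] = cD(2-6) covD[OF cD(1)] dD(2-6) covD[OF dD(1)]
  obtain M1 where M1: "M1 \<in> carrier_mat p n" "d\<^sup>T \<star>\<^sub>A c = scal A M1" using pairing_vu[OF dD(1) cD(1)] by auto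
  obtain M2 where M2: "M2 \<in> carrier_mat n p" "c\<^sup>T \<star>\<^sub>A (scal A (mat_inv E) \<star>\<^sub>A d) = scal A M2"
    using pairing_uv[OF dD(1) cD(1)] by auto
  have [simp]: "dim_row M1 = p" "dim_col M1 = n" "dim_row M2 = n" "dim_col M2 = p" using M1(1) M2(1) by auto
  have EE: "scal A (mat_inv E) \<star>\<^sub>A scal A E = scal A (1\<^sub>m m)" using GL_inv[OF E] by (simp add: HA.B.scal_mult[symmetric])
  have "d\<^sup>T = d\<^sup>T \<star>\<^sub>A (c \<star>\<^sub>A y)" by simp
  also have "\<dots> = (d\<^sup>T \<star>\<^sub>A c) \<star>\<^sub>A y" by (simp add: HA.B.amul_assoc del: cD(6))
  finally have dt: "d\<^sup>T = scal A M1 \<star>\<^sub>A y" unfolding M1(2) .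
  have "c\<^sup>T = c\<^sup>T \<star>\<^sub>A (scal A (mat_inv E) \<star>\<^sub>A ((d \<star>\<^sub>A z) \<star>\<^sub>A scal A E))" by (simp add: EE)
  also have "\<dots> = (c\<^sup>T \<star>\<^sub>A (scal A (mat_inv E) \<star>\<^sub>A d)) \<star>\<^sub>A (z \<star>\<^sub>A scal A E)"
    by (simp add: HA.B.amul_assoc del: dD(6))
  finally have ct: "c\<^sup>T = scal A M2 \<star>\<^sub>A (z \<star>\<^sub>A scal A E)" unfolding M2(2) .
  have "p \<le> n" and G1: "p = n \<Longrightarrow> M1 \<in> GL p" by (rule minimal_resolution[OF comatrix_gens(2) d M1(1) _ _ _ dt]; simp)+
  moreover have "n \<le> p" and G2: "n = p \<Longrightarrow> M2 \<in> GL n" by (rule minimal_resolution[OF comatrix_gens(1) c M2(1) _ _ _ ct]; simp)+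
  ultimately have pn: "p = n" by simp
  note G1 = G1[OF pn, unfolded pn] and G2 = G2[OF pn[symmetric]]
  define D where "D = (mat_inv M1)\<^sup>T"
  note iM = GL_inv[OF G1]
  have D: "D \<in> carrier_mat n n" "D * M1\<^sup>T = 1\<^sub>m n" "M1\<^sup>T * D = 1\<^sub>m n"
    using iM by (simp_all add: D_def transpose_mult[symmetric, where nr = n and n = n and nc = n])
  have DG: "D \<in> GL n" by (rule GL_I(1)[OF D(1) _ D(2,3)]) (use iM in simp)
  have [simp]: "dim_row D = n" "dim_col D = n" using D(1) by auto
  define v where "v = d \<star>\<^sub>A scal A D"
  define F' where "F' = M2 * D"
  define F where "F = mat_inv F'"
  have F': "F' \<in> GL n" unfolding F'_def using GL_mult[OF G2 DG] by simp
  have F: "F \<in> GL n" "mat_inv F = F'" using GL_mat_inv[OF F'] by (simp_all add: F_def)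
  note [simp] = GL_dims[OF F(1)] pn
  have v [simp]: "dim_row v = m" "dim_col v = n" "entries A v" by (simp_all add: v_def)
  have FF: "scal A F \<star>\<^sub>A scal A F' = scal A (1\<^sub>m n)" using GL_inv[OF F(1)] F(2) by (simp add: HA.B.scal_mult[symmetric])
  have vt: "v\<^sup>T = scal A (mat_inv M1) \<star>\<^sub>A d\<^sup>T"
    by (simp add: v_def D_def HA.B.transpose_amul_scal GL_dims[OF G1])
  have "v\<^sup>T \<star>\<^sub>A c = scal A (mat_inv M1) \<star>\<^sub>A (d\<^sup>T \<star>\<^sub>A c)"
    unfolding vt by (simp add: HA.B.amul_assoc GL_dims[OF G1])
  then have r3: "v\<^sup>T \<star>\<^sub>A c = scal A (1\<^sub>m n)"
    unfolding M1(2) using iM by (simp add: HA.B.scal_mult[symmetric] GL_dims[OF G1])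
  have "v\<^sup>T = v\<^sup>T \<star>\<^sub>A (c \<star>\<^sub>A y)" by simp
  also have "\<dots> = (v\<^sup>T \<star>\<^sub>A c) \<star>\<^sub>A y" by (simp add: HA.B.amul_assoc del: cD(6))
  finally have "v\<^sup>T = y" unfolding r3 by simp
  then have r1: "c \<star>\<^sub>A v\<^sup>T = scal A (1\<^sub>m m)" by simp
  have r4: "c\<^sup>T \<star>\<^sub>A (scal A (mat_inv E) \<star>\<^sub>A v) = scal A F'"
  proof -
    have "c\<^sup>T \<star>\<^sub>A (scal A (mat_inv E) \<star>\<^sub>A v) = (c\<^sup>T \<star>\<^sub>A (scal A (mat_inv E) \<star>\<^sub>A d)) \<star>\<^sub>A scal A D"
      unfolding v_def by (simp add: HA.B.amul_assoc)
    then show ?thesis unfolding M2(2) F'_def by (simp add: HA.B.scal_mult)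
  qed
  (* a right inverse of v, which turns F u^t E^-1 v = 1 into v F u^t E^-1 = 1 *)
  define z' where "z' = scal A M1\<^sup>T \<star>\<^sub>A z"
  have z' [simp]: "dim_row z' = n" "dim_col z' = m" "entries A z'" by (simp_all add: z'_def)
  have "v \<star>\<^sub>A z' = d \<star>\<^sub>A ((scal A D \<star>\<^sub>A scal A M1\<^sup>T) \<star>\<^sub>A z)"
    unfolding v_def z'_def by (simp add: HA.B.amul_assoc)
  then have vz: "v \<star>\<^sub>A z' = scal A (1\<^sub>m m)" using D(2) by (simp add: HA.B.scal_mult[symmetric])
  let ?t = "scal A F \<star>\<^sub>A (c\<^sup>T \<star>\<^sub>A scal A (mat_inv E))"
  have "?t = ?t \<star>\<^sub>A (v \<star>\<^sub>A z')" unfolding vz by simp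
  also have "\<dots> = (scal A F \<star>\<^sub>A (c\<^sup>T \<star>\<^sub>A (scal A (mat_inv E) \<star>\<^sub>A v))) \<star>\<^sub>A z'" by (simp add: HA.B.amul_assoc)
  finally have t: "?t = z'" unfolding r4 FF by simp
  have "v \<star>\<^sub>A (scal A F \<star>\<^sub>A c\<^sup>T) = v \<star>\<^sub>A (scal A F \<star>\<^sub>A (c\<^sup>T \<star>\<^sub>A (scal A (mat_inv E) \<star>\<^sub>A scal A E)))"
    by (simp add: EE)
  also have "\<dots> = (v \<star>\<^sub>A ?t) \<star>\<^sub>A scal A E" by (simp add: HA.B.amul_assoc)
  finally have r2: "v \<star>\<^sub>A (scal A F \<star>\<^sub>A c\<^sup>T) = scal A E" unfolding t vz by simp
  have "hmats E F A c v"
    by (rule hmatsI[OF kA E F(1) _ _ _ _ r1 r3 r2]) (simp_all add: r4 F(2) carrier_matI)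
  moreover have "cov Hv v" unfolding v_def by (rule cov_scal[OF comatrix_gens(2) dD(1)]) simp
  ultimately show ?thesis using F(1) cD(1) by blast
qed

text \<open>For \<open>n = 0\<close> the relation \<open>u v\<^sup>t = 1\<close> says \<open>0 = 1\<close>. For \<open>n = 1\<close> it gives \<open>u\<^sub>0 v\<^sub>0 = 1\<close> and \<open>u\<^sub>0 v\<^sub>1 = 0\<close>,
  while \<open>v\<^sub>1\<close> has a right inverse; so \<open>u\<^sub>0 = 0\<close>.\<close>

lemma hmats_size:
  assumes m: "2 \<le> m" and F: "F \<in> GL n" and h: "hmats E F A u v"
  shows "2 \<le> n"
proof (rule ccontr)
  assume "\<not> 2 \<le> n"
  then consider "n = 0" | "n = 1" by linarith
  then show False
  proof cases
    interpret hr: hrep A E F u v m n by (rule hrepI[OF kA E F h])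
    have r1: "(\<Oplus>\<^sub>A l\<in>{..<n}. u $$ (i, l) \<otimes>\<^sub>A v $$ (j, l)) = (if i = j then \<one>\<^sub>A else \<zero>\<^sub>A)" if ij: "i < m" "j < m" for i j
    proof -
      have "(u \<star>\<^sub>A v\<^sup>T) $$ (i, j) = (\<Oplus>\<^sub>A l\<in>{..<n}. u $$ (i, l) \<otimes>\<^sub>A v $$ (j, l))"
        using ij entriesD[OF hr.uv_entries(1)] entriesD[OF hr.uv_entries(2)]
        by (subst HA.B.amul_index) (simp_all, intro HA.B.finsum_eqI, simp_all)
      then show ?thesis unfolding hr.rel1 using ij by (cases "i = j") simp_all
    qed
    {
      case 1
      then show False using r1[of 0 0] m one_not_zero by simp
    next
      case 2
      have c [simp]: "u $$ (i, 0) \<in> carrier A" "v $$ (i, 0) \<in> carrier A" if "i < m" for i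
        using that 2 entriesD[OF hr.uv_entries(1), of i 0] entriesD[OF hr.uv_entries(2), of i 0] by simp_all
      have s: "(\<Oplus>\<^sub>A l\<in>{..<Suc 0}. f l) = f 0" if "f 0 \<in> carrier A" for f
        using that by (simp add: lessThan_Suc)
      have r: "u $$ (0, 0) \<otimes>\<^sub>A v $$ (0, 0) = \<one>\<^sub>A" "u $$ (0, 0) \<otimes>\<^sub>A v $$ (1, 0) = \<zero>\<^sub>A"
        using r1[of 0 0] r1[of 0 1] m 2 s[of "\<lambda>l. u $$ (0, l) \<otimes>\<^sub>A v $$ (0, l)"]
          s[of "\<lambda>l. u $$ (0, l) \<otimes>\<^sub>A v $$ (1, l)"] by simp_all
      define t where "t = scal A F \<star>\<^sub>A (u\<^sup>T \<star>\<^sub>A scal A (mat_inv E))"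
      have t: "t $$ (0, 1) \<in> carrier A" by (rule entriesD) (use m 2 in \<open>simp_all add: t_def\<close>)
      have "(v \<star>\<^sub>A t) $$ (1, 1) = v $$ (1, 0) \<otimes>\<^sub>A t $$ (0, 1)"
        using m 2 t by (subst HA.B.amul_index) (simp_all add: t_def s)
      then have vt: "v $$ (1, 0) \<otimes>\<^sub>A t $$ (0, 1) = \<one>\<^sub>A" using hr.rel2 m by (simp add: t_def)
      have "u $$ (0, 0) = u $$ (0, 0) \<otimes>\<^sub>A (v $$ (1, 0) \<otimes>\<^sub>A t $$ (0, 1))" unfolding vt using m by simp
      also have "\<dots> = (u $$ (0, 0) \<otimes>\<^sub>A v $$ (1, 0)) \<otimes>\<^sub>A t $$ (0, 1)" using m t by (simp add: HA.B.m_assoc)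
      finally have "u $$ (0, 0) = \<zero>\<^sub>A" unfolding r(2) using t by simp
      then show False using r(1) m one_not_zero by simp
    }
  qed
qed

lemma iso_from_representation:
  assumes F: "F \<in> GL n" and G: "galois_object H (H_comod_alg E F)" and h: "hmats E F A u v" and u: "cov Hu u" and v: "cov Hv v"
  shows "comod_alg_iso H (H_comod_alg E F) A"
proof -
  interpret hr: hrep A E F u v m n by (rule hrepI[OF kA E F h])
  define g where "g x = (case x of U i j \<Rightarrow> u $$ (i, j) | V i j \<Rightarrow> v $$ (i, j))" for x
  have UV: "Um m n g = u" "Vm m n g = v" by (rule eq_matI; simp add: g_def)+
  note f = H_lift[OF E F kA, of g, unfolded UV, OF h]
  let ?f = "pres_lift A g"
  have c: "coaction A (?f x) = tensor_map H A id ?f (coaction (H_comod_alg E F) x)" if "x \<in> carrier (H_comod_alg E F)" for x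
  proof (rule colinear_H[OF E F kA coaction_hom f(1)])
    fix i j assume ij: "i < m" "j < n"
    have "\<alpha> (u $$ (i, j)) = (\<Oplus>\<^bsub>HAT\<^esub>l\<in>{..<m}. HA.pt (Hu i l) (u $$ (l, j)))"
      using iffD1[OF cov_iff[OF comatrix_gens(1) hr.uv_entries(1) hr.uv_dims(1)] u] ij by simp
    then show "\<alpha> (?f (H_u E F i j)) = (\<Oplus>\<^bsub>HAT\<^esub>l\<in>{..<m}. HA.pt (Hu i l) (?f (H_u E F l j)))"
      using ij comatrixD(1)[OF comatrix_gens(1)] entriesD[OF hr.uv_entries(1)] f(2)
      by (simp add: g_def, intro HA.T.finsum_eqI) simp_all
    have "\<alpha> (v $$ (i, j)) = (\<Oplus>\<^bsub>HAT\<^esub>l\<in>{..<m}. HA.pt (Hv i l) (v $$ (l, j)))"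
      using iffD1[OF cov_iff[OF comatrix_gens(2) hr.uv_entries(2) hr.uv_dims(3)] v] ij by simp
    then show "\<alpha> (?f (H_v E F i j)) = (\<Oplus>\<^bsub>HAT\<^esub>l\<in>{..<m}. HA.pt (Hv i l) (?f (H_v E F l j)))"
      using ij comatrixD(1)[OF comatrix_gens(2)] entriesD[OF hr.uv_entries(2)] f(3)
      by (simp add: g_def, intro HA.T.finsum_eqI) simp_all
  qed (use that in simp)
  have fh: "?f \<in> alg_hom (H_comod_alg E F) A" using f(1) by (simp add: same_alg_hom(2)[OF same_alg_H(2) same_alg_refl])
  have "bij_betw ?f (carrier (H_comod_alg E F)) (carrier A)" by (rule colinear_bij[OF G gal fh c])
  then show ?thesis unfolding comod_alg_iso_def using fh c by blast
qed

lemma cov_of_colinear: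
  assumes F: "F \<in> GL n" and f: "f \<in> alg_hom (H_comod_alg E F) A"
    and c: "\<And>x. x \<in> carrier (H_comod_alg E F) \<Longrightarrow> coaction A (f x) = tensor_map H A id f (coaction (H_comod_alg E F) x)"
  shows "cov Hu (map_mat f (mat m n (\<lambda>(i, j). H_u E F i j)))" (is ?u)
    and "cov Hv (map_mat f (mat m n (\<lambda>(i, j). H_v E F i j)))" (is ?v)
    and "hmats E F A (map_mat f (mat m n (\<lambda>(i, j). H_u E F i j))) (map_mat f (mat m n (\<lambda>(i, j). H_v E F i j)))"
proof -
  note pr = h_pair.intro[OF E F]
  note kE = kalgebra_H[OF E E] and kF = kalgebra_H[OF E F]
  note gens = h_pair.gens_closed[OF pr]
  note tp = two_algs.pt_closed[OF two_algsI[OF kE kF]]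
  have f': "f \<in> alg_hom (H_alg E F) A" using f by (simp add: same_alg_hom(2)[OF same_alg_H(2) same_alg_refl])
  show "hmats E F A (map_mat f (mat m n (\<lambda>(i, j). H_u E F i j))) (map_mat f (mat m n (\<lambda>(i, j). H_v E F i j)))"
    by (rule hmats_map[OF kF kA f' E F hmats_H[OF E F]])
  note sh = same_alg_H(1)[of E]
  have idh: "id \<in> alg_hom (H_alg E E) H"
    using alg_hom_id[of H] unfolding same_alg_hom(2)[OF sh same_alg_refl] by (simp add: id_def)
  note tm = tensor_map[OF kE kF kH kA alg_hom_lin[OF idh] alg_hom_lin[OF f']]
  note ts = lin_hom_finsum_eq[OF kalgebra_tensor[OF kE kF] HA.T.kalgebra tm(1)]
  have "\<alpha> (f (H_u E F i j)) = (\<Oplus>\<^bsub>HAT\<^esub>l\<in>{..<m}. HA.pt (Hu i l) (f (H_u E F l j)))"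
    "\<alpha> (f (H_v E F i j)) = (\<Oplus>\<^bsub>HAT\<^esub>l\<in>{..<m}. HA.pt (Hv i l) (f (H_v E F l j)))" if ij: "i < m" "j < n" for i j
  proof -
    show "\<alpha> (f (H_u E F i j)) = (\<Oplus>\<^bsub>HAT\<^esub>l\<in>{..<m}. HA.pt (Hu i l) (f (H_u E F l j)))"
      using ij by (simp add: gens c h_pair.coact_u[OF pr], intro ts) (simp_all add: tm(2) gens tp)
    show "\<alpha> (f (H_v E F i j)) = (\<Oplus>\<^bsub>HAT\<^esub>l\<in>{..<m}. HA.pt (Hv i l) (f (H_v E F l j)))"
      using ij by (simp add: gens c h_pair.coact_v[OF pr], intro ts) (simp_all add: tm(2) gens tp)
  qed note a = this
  have en: "entries A (map_mat f (mat m n (\<lambda>(i, j). H_u E F i j)))" "entries A (map_mat f (mat m n (\<lambda>(i, j). H_v E F i j)))"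
    by (simp_all add: entries_def alg_hom_closed[OF f'] gens)
  show ?u
  proof (rule iffD2[OF cov_iff[OF comatrix_gens(1) en(1)]], simp, intro allI impI)
    fix i j assume "i < m" "j < dim_col (map_mat f (mat m n (\<lambda>(i, j). H_u E F i j)))"
    then have ij: "i < m" "j < n" by simp_all
    then show "\<alpha> (map_mat f (mat m n (\<lambda>(i, j). H_u E F i j)) $$ (i, j)) =
        (\<Oplus>\<^bsub>HAT\<^esub>l\<in>{..<m}. HA.pt (Hu i l) (map_mat f (mat m n (\<lambda>(i, j). H_u E F i j)) $$ (l, j)))"
      using comatrixD(1)[OF comatrix_gens(1)]
      by (simp add: a(1)[OF ij], intro HA.T.finsum_eqI) (simp_all add: alg_hom_closed[OF f'] gens)
  qed
  show ?v
  proof (rule iffD2[OF cov_iff[OF comatrix_gens(2) en(2)]], simp, intro allI impI)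
    fix i j assume "i < m" "j < dim_col (map_mat f (mat m n (\<lambda>(i, j). H_v E F i j)))"
    then have ij: "i < m" "j < n" by simp_all
    then show "\<alpha> (map_mat f (mat m n (\<lambda>(i, j). H_v E F i j)) $$ (i, j)) =
        (\<Oplus>\<^bsub>HAT\<^esub>l\<in>{..<m}. HA.pt (Hv i l) (map_mat f (mat m n (\<lambda>(i, j). H_v E F i j)) $$ (l, j)))"
      using comatrixD(1)[OF comatrix_gens(2)]
      by (simp add: a(2)[OF ij], intro HA.T.finsum_eqI) (simp_all add: alg_hom_closed[OF f'] gens)
  qed
qed

text \<open>Covariant representations for \<open>F\<close> and \<open>G\<close> in the same Galois object differ by a scalar base
  change, which conjugates \<open>G\<close> to \<open>F\<close>; every base change occurs.\<close>

lemma representation_base_change: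
  assumes G: "G \<in> GL p" and P: "P \<in> GL p" and F: "F = P * G * mat_inv P"
    and h: "hmats E G A u v" "cov Hu u" "cov Hv v"
  shows "\<exists>u v. hmats E F A u v \<and> cov Hu u \<and> cov Hv v"
proof -
  interpret P: hrep A E G u v m p by (rule hrepI[OF kA E G h(1)])
  note iP = GL_inv[OF P] and iG = GL_inv(1)[OF G]
  have n: "F \<in> GL p" unfolding F by (rule GL_conj(1)[OF P G])
  have GP: "mat_inv P * F * P = G"
    unfolding F using iP iG by (simp add: assoc_mult_mat[of _ p p _ p _ p] mat_cancel[of _ p])
  have h': "hmats G F A (scal A P\<^sup>T) (scal A (mat_inv P))"
    using hmats_scalar[OF kA conjunct1[OF GL_mat_inv[OF P]] n] GL_mat_inv[OF P] GP by simp
  have Pd: "dim_row P = p" "dim_col P = p" "dim_row (mat_inv P) = p" "dim_col (mat_inv P) = p" using iP by auto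
  have "hmats E F A (u \<star>\<^sub>A scal A P\<^sup>T) (v \<star>\<^sub>A scal A (mat_inv P))"
  proof (rule hmats_comp[OF kA E G n h(1) h'])
    fix x y i j a b assume *: "x \<in> {u, v}" "y \<in> {scal A P\<^sup>T, scal A (mat_inv P)}" "i < m" "j < p" "a < p" "b < p"
    then have "\<exists>c. y $$ (a, b) = c \<odot>\<^sub>A \<one>\<^sub>A" using Pd by auto
    then obtain c where c: "y $$ (a, b) = c \<odot>\<^sub>A \<one>\<^sub>A" by blast
    have x: "x $$ (i, j) \<in> carrier A" using *(1,3,4) entriesD[OF P.uv_entries(1), of i j] entriesD[OF P.uv_entries(2), of i j] by auto
    show "x $$ (i, j) \<otimes>\<^sub>A y $$ (a, b) = y $$ (a, b) \<otimes>\<^sub>A x $$ (i, j)"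
      unfolding c using x by (simp add: HA.B.mult_smult_left HA.B.mult_smult_right)
  qed
  moreover have "cov Hu (u \<star>\<^sub>A scal A P\<^sup>T)" by (rule cov_scal[OF comatrix_gens(1) h(2)]) (simp add: Pd)
  moreover have "cov Hv (v \<star>\<^sub>A scal A (mat_inv P))" by (rule cov_scal[OF comatrix_gens(2) h(3)]) (simp add: Pd)
  ultimately show ?thesis by blast
qed

lemma representations_conjugate:
  assumes p: "G \<in> GL p" and uv: "cov Hu u" "cov Hv v" "hmats E G A u v"
    and n: "F \<in> GL n" and uv': "cov Hu u'" "cov Hv v'" "hmats E F A u' v'"
  shows "n = p \<and> (\<exists>P\<in>GL p. F = P * G * mat_inv P)"
proof -
  interpret P: hrep A E G u v m p by (rule hrepI[OF kA E p uv(3)])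
  interpret Q: hrep A E F u' v' m n by (rule hrepI[OF kA E n uv'(3)])
  obtain M where M: "M \<in> carrier_mat p n" "v\<^sup>T \<star>\<^sub>A u' = scal A M" using pairing_vu[OF uv(2) uv'(1)] by auto
  obtain N where N: "N \<in> carrier_mat n p" "v'\<^sup>T \<star>\<^sub>A u = scal A N" using pairing_vu[OF uv'(2) uv(1)] by auto
  have d [simp]: "dim_row M = p" "dim_col M = n" "dim_row N = n" "dim_col N = p" using M(1) N(1) by auto
  have u'M: "u' = u \<star>\<^sub>A scal A M"
  proof -
    have "u \<star>\<^sub>A scal A M = (u \<star>\<^sub>A v\<^sup>T) \<star>\<^sub>A u'" unfolding M(2)[symmetric] by (simp add: HA.B.amul_assoc)
    then show ?thesis unfolding P.rel1 by simp
  qed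
  have v'N: "v'\<^sup>T = scal A N \<star>\<^sub>A v\<^sup>T"
  proof -
    have "scal A N \<star>\<^sub>A v\<^sup>T = v'\<^sup>T \<star>\<^sub>A (u \<star>\<^sub>A v\<^sup>T)" unfolding N(2)[symmetric] by (simp add: HA.B.amul_assoc)
    then show ?thesis unfolding P.rel1 by simp
  qed
  have "scal A (M * N) = v\<^sup>T \<star>\<^sub>A ((u' \<star>\<^sub>A v'\<^sup>T) \<star>\<^sub>A u)"
    by (simp add: HA.B.scal_mult M(2)[symmetric] N(2)[symmetric] HA.B.amul_assoc)
  also have "\<dots> = scal A (1\<^sub>m p)" unfolding Q.rel1 by (simp add: P.rel3)
  finally have MN: "M * N = 1\<^sub>m p" by (rule scal_inj_mat)
  have "scal A (N * M) = v'\<^sup>T \<star>\<^sub>A ((u \<star>\<^sub>A v\<^sup>T) \<star>\<^sub>A u')"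
    by (simp add: HA.B.scal_mult M(2)[symmetric] N(2)[symmetric] HA.B.amul_assoc)
  also have "\<dots> = scal A (1\<^sub>m n)" unfolding P.rel1 by (simp add: Q.rel3)
  finally have NM: "N * M = 1\<^sub>m n" by (rule scal_inj_mat)
  have np: "n = p" using right_inverse_dims[OF M(1) N(1) MN] right_inverse_dims[OF N(1) M(1) NM] by simp
  note n = n[unfolded np] and M1 = M(1)[unfolded np] and N1 = N(1)[unfolded np] and NM = NM[unfolded np]
  define R where "R = M\<^sup>T"
  have R: "R \<in> GL p" "mat_inv R = N\<^sup>T"
    using GL_I[of R p "N\<^sup>T"] M1 N1 MN NM
    by (simp_all add: R_def transpose_mult[symmetric, where nr = p and n = p and nc = p])
  have v't: "v' = v \<star>\<^sub>A scal A N\<^sup>T"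
    using arg_cong[OF v'N, of transpose_mat] by (simp add: HA.B.transpose_scal_amul)
  have "scal A (mat_inv F) = scal A R \<star>\<^sub>A ((u\<^sup>T \<star>\<^sub>A (scal A (mat_inv E) \<star>\<^sub>A v)) \<star>\<^sub>A scal A N\<^sup>T)"
    unfolding Q.rel4'[symmetric] v't u'M R_def by (simp add: HA.B.transpose_amul_scal HA.B.amul_assoc)
  also have "\<dots> = scal A (R * mat_inv G * mat_inv R)"
    unfolding P.rel4' R(2) using GL_dims[OF p] M1 N1 by (simp add: HA.B.scal_mult HA.B.amul_assoc R_def)
  finally have "mat_inv F = R * mat_inv G * mat_inv R" by (rule scal_inj_mat)
  then have "mat_inv (mat_inv F) = R * mat_inv (mat_inv G) * mat_inv R"
    using GL_conj(2)[OF R(1) conjunct1[OF GL_mat_inv[OF p]]] by simp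
  then have "F = R * G * mat_inv R" using GL_mat_inv[OF n] GL_mat_inv[OF p] by simp
  then show ?thesis using np R(1) by blast
qed

end

section \<open>The classification\<close>

lemma galois_object_X0:
  assumes "2 \<le> m" "E \<in> GL m" "F \<in> X0 E"
  shows "galois_object (H_hopf E) (H_comod_alg E F)"
proof -
  obtain n where n: "2 \<le> n" "F \<in> GL n" "mat_trace E = mat_trace F" "mat_trace (mat_inv E) = mat_trace (mat_inv F)"
    using assms(3) by (auto simp: X0_def)
  show ?thesis by (rule h_pair.galois_object_H[OF h_pair.intro[OF assms(2) n(2)] H_nonzero[OF assms(1) n(1) assms(2) n(2-4)]])
qed

text \<open>The representation found in \<open>A\<close> defines a colinear algebra map from \<open>H(E,F)\<close>, which is bijective once
  the source is known to be a Galois object; the traces of \<open>F\<close> are right because \<open>A\<close> is not zero.\<close>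

theorem galois_object_classification:
  assumes m: "2 \<le> m" and E: "E \<in> GL m" and A: "galois_object (H_hopf E) A"
  shows "\<exists>F\<in>X0 E. comod_alg_iso (H_hopf E) (H_comod_alg E F) A"
proof -
  note hg = hgalois.intro[OF galois.intro[OF A] hgalois_axioms.intro[OF E]]
  note kA = galois.kA[OF galois.intro[OF A]]
  obtain n F u v where F: "F \<in> GL n" "hmats E F A u v" "hgalois.cov E A m (H_u E E) u" "hgalois.cov E A m (H_v E E) v"
    using hgalois.covariant_representation[OF hg] by blast
  have "F \<in> X0 E"
    using hgalois.hmats_size[OF hg m F(1,2)] F(1) hrep.traces[OF hrepI[OF kA E F(1,2)] galois.scalar_inj[OF galois.intro[OF A]]]
    by (auto simp: X0_def)
  then show ?thesis using hgalois.iso_from_representation[OF hg F(1) galois_object_X0[OF m E] F(2-4)] by blast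
qed

lemma id_colinear:
  assumes A: "galois_object H A" and x: "x \<in> carrier A"
  shows "coaction A x = tensor_map H A id (\<lambda>x. x) (coaction A x)"
proof -
  note gA = galois.intro[OF A]
  note kH = galois.kH[OF gA] and kA = galois.kA[OF gA]
  note t = tensor_map[OF kH kA kH kA lin_hom_id(2) lin_hom_id(1)]
  show ?thesis
    by (rule two_algs.lin_hom_tensor_eq[OF two_algsI[OF kH kA] lin_hom_id(1) t(1) _ galois.coaction_closed[OF gA x]]) (simp add: t(2))
qed

lemma map_mat_ident: "map_mat (\<lambda>x. x) X = X" by (rule eq_matI) simp_all

text \<open>Isomorphisms from \<open>H(E,F)\<close> to \<open>H(E,G)\<close> are the same as covariant representations for \<open>(E,F)\<close> in
  \<open>H(E,G)\<close>, and these are compared with the generic one. Since isomorphism is an equivalence relation on Galois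
  objects, so is the conjugacy relation on the parameters.\<close>

lemma iso_iff_conjugate:
  assumes m: "2 \<le> m" and E: "E \<in> GL m" and F: "F \<in> X0 E" and G: "G \<in> X0 E"
  shows "comod_alg_iso (H_hopf E) (H_comod_alg E F) (H_comod_alg E G) \<longleftrightarrow> (F, G) \<in> X0_rel E"
proof -
  obtain n where n: "F \<in> GL n" using F by (auto simp: X0_def)
  obtain p where p: "G \<in> GL p" using G by (auto simp: X0_def)
  let ?A = "H_comod_alg E G"
  note gF = galois_object_X0[OF m E F] and gG = galois_object_X0[OF m E G]
  note hg = hgalois.intro[OF galois.intro[OF gG] hgalois_axioms.intro[OF E]]
  note uv = hgalois.cov_of_colinear[OF hg p alg_hom_id id_colinear[OF gG], unfolded map_mat_ident]
  show ?thesis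
  proof
    assume "(F, G) \<in> X0_rel E"
    then obtain k P where k: "G \<in> GL k" and P: "P \<in> GL k" "F = P * G * mat_inv P" by (auto simp: X0_rel_def)
    have kp: "k = p" using GL_dims(1)[OF k] GL_dims(1)[OF p] by simp
    show "comod_alg_iso (H_hopf E) (H_comod_alg E F) ?A"
      using hgalois.representation_base_change[OF hg p P[unfolded kp] uv(3,1,2)] hgalois.iso_from_representation[OF hg n gF] by blast
  next
    assume "comod_alg_iso (H_hopf E) (H_comod_alg E F) ?A"
    then obtain f where f: "f \<in> alg_hom (H_comod_alg E F) ?A"
      "\<And>x. x \<in> carrier (H_comod_alg E F) \<Longrightarrow> coaction ?A (f x) = tensor_map (H_hopf E) ?A id f (coaction (H_comod_alg E F) x)"
      unfolding comod_alg_iso_def by blast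
    have "n = p \<and> (\<exists>P\<in>GL p. F = P * G * mat_inv P)"
      by (rule hgalois.representations_conjugate[OF hg p uv n hgalois.cov_of_colinear[OF hg n f]])
    then show "(F, G) \<in> X0_rel E" unfolding X0_rel_def using F G n p by blast
  qed
qed

lemma gal_class_eq:
  assumes "galois_object H A" "galois_object H B" "comod_alg_iso H A B"
  shows "gal_class H A = gal_class H B"
  using comod_alg_iso_trans[OF assms(1,2) _ assms(3)] comod_alg_iso_trans[OF assms(2,1) _ comod_alg_iso_sym[OF assms]]
  by (auto simp: gal_class_def)

theorem theorem4p5:
  fixes E :: "'k::field mat" and m :: nat
    and emb :: "'k hel \<Rightarrow> 'u"
  assumes "m \<ge> 2" and "E \<in> GL m"
    and "inj emb"
  shows "equiv (X0 E) (X0_rel E) \<and>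
    (\<forall>F\<in>X0 E. galois_object (H_hopf E) (H_comod_alg E F)) \<and>
    (\<exists>\<phi>. bij_betw \<phi> (X_quot E) (Gal (H_hopf E) :: ('k, 'u, 'k hel) comod_alg set set) \<and>
         (\<forall>F\<in>X0 E. \<phi> (X0_rel E `` {F}) = gal_class (H_hopf E) (H_comod_alg E F)))"
proof (intro conjI ballI)
  note gal = galois_object_X0[OF assms(1,2)] and iff = iso_iff_conjugate[OF assms(1,2)]
  let ?c = "\<lambda>F. gal_class (H_hopf E) (H_comod_alg E F) :: ('k, 'u, 'k hel) comod_alg set"
  show eq: "equiv (X0 E) (X0_rel E)"
  proof (rule equivI)
    show sub: "X0_rel E \<subseteq> X0 E \<times> X0 E" by (auto simp: X0_rel_def)
    show "refl_on (X0 E) (X0_rel E)"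
    proof (rule refl_onI)
      fix F assume F: "F \<in> X0 E"
      have "comod_alg_iso (H_hopf E) (H_comod_alg E F) (H_comod_alg E F)"
        unfolding comod_alg_iso_def using id_colinear[OF gal[OF F]] bij_betw_id[unfolded id_def]
        by (intro bexI[OF _ alg_hom_id] conjI ballI)
      then show "(F, F) \<in> X0_rel E" using iff[OF F F] by simp
    qed
    show "sym (X0_rel E)"
    proof (rule symI)
      fix F G assume h: "(F, G) \<in> X0_rel E"
      then have X: "F \<in> X0 E" "G \<in> X0 E" using sub by auto
      show "(G, F) \<in> X0_rel E"
        using comod_alg_iso_sym[OF gal[OF X(1)] gal[OF X(2)]] h iff[OF X(1,2)] iff[OF X(2,1)] by simp
    qed
    show "trans (X0_rel E)"
    proof (rule transI)
      fix F G K assume h: "(F, G) \<in> X0_rel E" "(G, K) \<in> X0_rel E"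
      then have X: "F \<in> X0 E" "G \<in> X0 E" "K \<in> X0 E" using sub by auto
      show "(F, K) \<in> X0_rel E"
        using comod_alg_iso_trans[OF gal[OF X(1)] gal[OF X(2)] gal[OF X(3)]] h iff[OF X(1,2)] iff[OF X(2,3)] iff[OF X(1,3)] by simp
    qed
  qed
  show "galois_object (H_hopf E) (H_comod_alg E F)" if "F \<in> X0 E" for F by (rule gal[OF that])
  have class_iff: "?c F = ?c G \<longleftrightarrow> (F, G) \<in> X0_rel E" if F: "F \<in> X0 E" and G: "G \<in> X0 E" for F G
  proof
    assume "(F, G) \<in> X0_rel E"
    then show "?c F = ?c G" using gal_class_eq[OF gal[OF F] gal[OF G]] iff[OF F G] by simp
  next
    assume e: "?c F = ?c G"
    obtain B :: "('k, 'u, 'k hel) comod_alg" where B: "galois_object (H_hopf E) B" "comod_alg_iso (H_hopf E) (H_comod_alg E F) B"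
      using galois_copy[OF gal[OF F] assms(3)] by blast
    then have "B \<in> ?c G" unfolding e[symmetric] by (simp add: gal_class_def)
    then have "comod_alg_iso (H_hopf E) (H_comod_alg E G) B" by (simp add: gal_class_def)
    then have "comod_alg_iso (H_hopf E) (H_comod_alg E F) (H_comod_alg E G)"
      using comod_alg_iso_trans[OF gal[OF F] B(1) gal[OF G] B(2)] comod_alg_iso_sym[OF gal[OF G] B(1)] by blast
    then show "(F, G) \<in> X0_rel E" using iff[OF F G] by simp
  qed
  define \<phi> where "\<phi> C = ?c (SOME F. F \<in> C)" for C
  have \<phi>: "\<phi> (X0_rel E `` {F}) = ?c F" if F: "F \<in> X0 E" for F
  proof -
    have "F \<in> X0_rel E `` {F}" by (rule equiv_class_self[OF eq F])
    then have "(SOME F'. F' \<in> X0_rel E `` {F}) \<in> X0_rel E `` {F}" by (rule someI)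
    then have r: "(F, SOME F'. F' \<in> X0_rel E `` {F}) \<in> X0_rel E" by blast
    then have "(SOME F'. F' \<in> X0_rel E `` {F}) \<in> X0 E" by (auto simp: X0_rel_def)
    from class_iff[OF F this] r show ?thesis unfolding \<phi>_def by simp
  qed
  have "bij_betw \<phi> (X_quot E) (Gal (H_hopf E) :: ('k, 'u, 'k hel) comod_alg set set)"
  proof (rule bij_betw_imageI)
    show "inj_on \<phi> (X_quot E)"
    proof (rule inj_onI)
      fix C D assume C: "C \<in> X_quot E" and D: "D \<in> X_quot E" and e: "\<phi> C = \<phi> D"
      obtain F where F: "F \<in> X0 E" "C = X0_rel E `` {F}" using C unfolding X_quot_def by (rule quotientE)
      obtain G where G: "G \<in> X0 E" "D = X0_rel E `` {G}" using D unfolding X_quot_def by (rule quotientE)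
      have "(F, G) \<in> X0_rel E" using e class_iff[OF F(1) G(1)] by (simp add: F(2) G(2) \<phi> F(1) G(1))
      then show "C = D" unfolding F(2) G(2) by (rule equiv_class_eq[OF eq])
    qed
    show "\<phi> ` X_quot E = Gal (H_hopf E)"
    proof (intro equalityI subsetI)
      fix c assume "c \<in> \<phi> ` X_quot E"
      then obtain C where C: "C \<in> X_quot E" "c = \<phi> C" by blast
      obtain F where F: "F \<in> X0 E" "C = X0_rel E `` {F}" using C(1) unfolding X_quot_def by (rule quotientE)
      obtain B :: "('k, 'u, 'k hel) comod_alg" where B: "galois_object (H_hopf E) B" "comod_alg_iso (H_hopf E) (H_comod_alg E F) B"
        using galois_copy[OF gal[OF F(1)] assms(3)] by blast
      have "c = gal_class (H_hopf E) B" unfolding C(2) F(2) \<phi>[OF F(1)] by (rule gal_class_eq[OF gal[OF F(1)] B])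
      then show "c \<in> Gal (H_hopf E)" using B(1) unfolding Gal_def by blast
    next
      fix c :: "('k, 'u, 'k hel) comod_alg set" assume "c \<in> Gal (H_hopf E)"
      then obtain A :: "('k, 'u, 'k hel) comod_alg" where A: "galois_object (H_hopf E) A" "c = gal_class (H_hopf E) A" unfolding Gal_def by blast
      obtain F where F: "F \<in> X0 E" "comod_alg_iso (H_hopf E) (H_comod_alg E F) A"
        using galois_object_classification[OF assms(1,2) A(1)] by blast
      have "c = \<phi> (X0_rel E `` {F})" unfolding A(2) \<phi>[OF F(1)] by (rule gal_class_eq[OF gal[OF F(1)] A(1) F(2), symmetric])
      then show "c \<in> \<phi> ` X_quot E" using F(1) unfolding X_quot_def by (blast intro: quotientI)
    qed
  qed
  then show "\<exists>\<phi>. bij_betw \<phi> (X_quot E) (Gal (H_hopf E) :: ('k, 'u, 'k hel) comod_alg set set) \<and>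
      (\<forall>F\<in>X0 E. \<phi> (X0_rel E `` {F}) = ?c F)"
    using \<phi> by blast
qed

end
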